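(* Let $q$, $L$, $S$, $\mathcal{D}$, $\mathcal{P}$ and the boundary triplet $(\mathbb{C}^2,\Gamma_0,\Gamma_1)$ of $L=S^*$ be as described in the context. The collection of all $\mathcal{P}$-self-adjoint extensions $A$ of $S$ (i.e. $A\supset S$ with $\mathcal{P}A^*=A\mathcal{P}$) with empty resolvent set coincides with the collection of restrictions of $L$ onto the sets of functions $f\in\mathcal{D}$ satisfying the condition $$\begin{pmatrix} i\sin\theta & 1-\cos\theta\\ 1+\cos\theta & -i\sin\theta\end{pmatrix}\Gamma_1f=i\begin{pmatrix}1+\cos\theta & -i\sin\theta\\ i\sin\theta & 1-\cos\theta\end{pmatrix}\Gamma_0f,$$ where $\theta$ runs over $[0,2\pi)$.
   Context: Consider $l(\phi)(x)=-\phi''(x)+q(x)\phi(x)$, $x\in\mathbb{R}$, where $q$ is an even real-valued measurable function that has a non-integrable singularity at zero and is integrable on every finite (compact) subinterval of $\mathbb{R}\setminus\{0\}$. Assume that $q$ is in the limit-point case at $x\to\pm\infty$ and in the limit-circle case at $x=0$. $\mathcal{D}$ is the set of all $\phi\in L_2(\mathbb{R})$ such that $\phi,\phi'$ are absolutely continuous on every finite subinterval of $\mathbb{R}\setminus\{0\}$ and $l(\phi)\in L_2(\mathbb{R})$; $L\phi=l(\phi)$ for $\phi\in\mathcal{D}$. $\mathcal{P}\phi(x)=\phi(-x)$. With respect to $L_2(\mathbb{R})=L_2(\mathbb{R}_+)\oplus L_2(\mathbb{R}_-)$ one has $L=L_+\oplus\mathcal{P}L_+\mathcal{P}$, where $L_+=L\upharpoonright_{L_2(\mathbb{R}_+)}$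 is the maximal operator of $l$ on $\mathbb{R}_+=(0,\infty)$. Let $S_+$ be the minimal operator generated by $l$ in $L_2(\mathbb{R}_+)$ (deficiency indices $\langle1,1\rangle$, $S_+^*=L_+$), and $S=S_+\oplus\mathcal{P}S_+\mathcal{P}$, a closed symmetric operator in $L_2(\mathbb{R})$ with deficiency indices $\langle 2,2\rangle$ and $S^*=L$. A boundary triplet of $T^*$ ($T$ closed densely defined symmetric) is $(\mathcal{H},\Gamma_0,\Gamma_1)$ with $\mathcal{H}$ a Hilbert space and $\Gamma_0,\Gamma_1:\mathcal{D}(T^* )\to\mathcal{H}$ linear, such that $(T^*x,y)-(x,T^*y)=(\Gamma_1x,\Gamma_0y)_{\mathcal{H}}-(\Gamma_0x,\Gamma_1y)_{\mathcal{H}}$ for all $x,y\in\mathcal{D}(T^* )$ and $(\Gamma_0,\Gamma_1):\mathcal{D}(T^* )\to\mathcal{H}\oplus\mathcal{H}$ is surjective. Let $(\mathbb{C},\Gamma_0^+,\Gamma_1^+)$ be an arbitrary boundary triplet of $L_+=S_+^*$, and define the boundary triplet $(\mathbb{C}^2,\Gamma_0,\Gamma_1)$ of $L=S^*$ by $$\Gamma_jf=\begin{pmatrix}\Gamma_j^+f_+\\ \Gamma_j^+\mathcal{P}f_-\end{pmatrix},\qquad j=0,1,$$ where $f=f_++f_-\in\mathcal{D}$, $f_\pm=f\upharpoonright_{\mathbb{R}_\pm}$ (extended by zero). *)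

theory Defs
  imports "HOL-Analysis.Analysis"
begin

section \<open>Complex inner product spaces\<close>

text \<open>The norm and the topology are those of the underlying real inner product space; the complex
  inner product is linear in its first argument.\<close>

class complex_inner = real_inner +
  fixes scaleC :: "complex \<Rightarrow> 'a \<Rightarrow> 'a"  (infixr \<open>*\<^sub>C\<close> 75)
    and cinner :: "'a \<Rightarrow> 'a \<Rightarrow> complex"
  assumes scaleC_add_right: "a *\<^sub>C (x + y) = a *\<^sub>C x + a *\<^sub>C y"
    and scaleC_add_left: "(a + b) *\<^sub>C x = a *\<^sub>C x + b *\<^sub>C x"
    and scaleC_scaleC: "a *\<^sub>C b *\<^sub>C x = (a * b) *\<^sub>C x"
    and scaleR_scaleC: "r *\<^sub>R x = complex_of_real r *\<^sub>C x"
    and cinner_commute: "cinner x y = cnj (cinner y x)"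
    and cinner_add_left: "cinner (x + y) z = cinner x z + cinner y z"
    and cinner_scaleC_left: "cinner (a *\<^sub>C x) y = a * cinner x y"
    and inner_Re_cinner: "inner x y = Re (cinner x y)"

class complex_hilbert = complex_inner + complete_space

instantiation complex :: complex_hilbert
begin

definition "scaleC_complex (a::complex) (x::complex) = a * x"

definition "cinner_complex (x::complex) (y::complex) = x * cnj y"

instance
  by standard
    (auto simp: scaleC_complex_def cinner_complex_def algebra_simps scaleR_conv_of_real
       inner_complex_def)

end

section \<open>Unbounded operators as graphs\<close>

definition csubspace :: "'h::complex_inner set \<Rightarrow> bool" where
  "csubspace V \<longleftrightarrow> 0 \<in> V \<and> (\<forall>x\<in>V. \<forall>y\<in>V. x + y \<in> V) \<and> (\<forall>a. \<forall>x\<in>V. a *\<^sub>C x \<in> V)"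

definition clinear_on :: "'h::complex_inner set \<Rightarrow> ('h \<Rightarrow> 'k::complex_inner) \<Rightarrow> bool" where
  "clinear_on V f \<longleftrightarrow> csubspace V \<and> (\<forall>x\<in>V. \<forall>y\<in>V. f (x + y) = f x + f y) \<and>
     (\<forall>a. \<forall>x\<in>V. f (a *\<^sub>C x) = a *\<^sub>C f x)"

definition linear_operator :: "('h::complex_inner \<times> 'h) set \<Rightarrow> bool" where
  "linear_operator T \<longleftrightarrow> single_valued T \<and> (0, 0) \<in> T \<and>
     (\<forall>(x, x')\<in>T. \<forall>(y, y')\<in>T. (x + y, x' + y') \<in> T) \<and>
     (\<forall>a. \<forall>(x, x')\<in>T. (a *\<^sub>C x, a *\<^sub>C x') \<in> T)"

definition graph_of :: "('h \<Rightarrow> 'h) \<Rightarrow> ('h \<times> 'h) set" where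
  "graph_of F = {(x, F x) | x. True}"

text \<open>The adjoint is formed in the Hilbert space \<open>H\<close>, a closed subspace of the ambient space; it is
  the graph of an operator when the domain of \<open>T\<close> is dense in \<open>H\<close>.\<close>

definition adjoint_in :: "'h::complex_inner set \<Rightarrow> ('h \<times> 'h) set \<Rightarrow> ('h \<times> 'h) set" where
  "adjoint_in H T = {(y, z). y \<in> H \<and> z \<in> H \<and> (\<forall>(x, x')\<in>T. cinner x' y = cinner x z)}"

text \<open>\<open>z\<close> belongs to the resolvent set iff \<open>T - z\<close> maps the domain of \<open>T\<close> bijectively onto the whole
  space and has a bounded inverse.\<close>

definition resolvent_set :: "('h::complex_inner \<times> 'h) set \<Rightarrow> complex set" where
  "resolvent_set T = {z. (\<forall>w. \<exists>!x. (x, w + z *\<^sub>C x) \<in> T) \<and>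
     (\<exists>C. \<forall>(x, x')\<in>T. norm x \<le> C * norm (x' - z *\<^sub>C x))}"

text \<open>A boundary triplet of the adjoint of \<open>T\<close>, where \<open>T\<close> acts in \<open>H\<close>. The auxiliary Hilbert space is
  the type \<open>'k\<close>; the boundary maps matter only on the domain of the adjoint.\<close>

definition boundary_triplet ::
  "'h::complex_inner set \<Rightarrow> ('h \<times> 'h) set \<Rightarrow> ('h \<Rightarrow> 'k::complex_hilbert) \<Rightarrow> ('h \<Rightarrow> 'k) \<Rightarrow> bool" where
  "boundary_triplet H T G0 G1 \<longleftrightarrow>
     clinear_on (Domain (adjoint_in H T)) G0 \<and> clinear_on (Domain (adjoint_in H T)) G1 \<and>
     (\<forall>(x, x')\<in>adjoint_in H T. \<forall>(y, y')\<in>adjoint_in H T.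
        cinner x' y - cinner x y' = cinner (G1 x) (G0 y) - cinner (G0 x) (G1 y)) \<and>
     (\<lambda>x. (G0 x, G1 x)) ` Domain (adjoint_in H T) = UNIV"

definition self_adjoint_wrt :: "('h::complex_inner \<Rightarrow> 'h) \<Rightarrow> ('h \<times> 'h) set \<Rightarrow> bool" where
  "self_adjoint_wrt J A \<longleftrightarrow> adjoint_in UNIV A O graph_of J = graph_of J O A"

section \<open>The space of square-integrable functions on the line\<close>

definition square_integrable :: "(real \<Rightarrow> complex) \<Rightarrow> bool" where
  "square_integrable f \<longleftrightarrow>
     f \<in> borel_measurable lebesgue \<and> integrable lebesgue (\<lambda>x. (cmod (f x))\<^sup>2)"

lemma square_integrable_measurable: "square_integrable f \<Longrightarrow> f \<in> borel_measurable lebesgue"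
  unfolding square_integrable_def by (rule conjunct1)

lemma square_integrable_integrable:
  "square_integrable f \<Longrightarrow> integrable lebesgue (\<lambda>x. (cmod (f x))\<^sup>2)"
  unfolding square_integrable_def by (rule conjunct2)

lemma square_integrable_zero: "square_integrable (\<lambda>x. 0)"
  by (simp add: square_integrable_def)

lemma square_integrable_bound:
  assumes f: "f \<in> borel_measurable lebesgue" and h: "integrable lebesgue h"
    and le: "\<And>x. (cmod (f x))\<^sup>2 \<le> h x"
  shows "square_integrable f"
  unfolding square_integrable_def
proof (rule conjI[OF f])
  show "integrable lebesgue (\<lambda>x. (cmod (f x))\<^sup>2)"
  proof (rule Bochner_Integration.integrable_bound[OF h])
    show "(\<lambda>x. (cmod (f x))\<^sup>2) \<in> borel_measurable lebesgue"
      by (rule borel_measurable_power[OF measurable_compose[OF f borel_measurable_norm]])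
    show "AE x in lebesgue. norm ((cmod (f x))\<^sup>2) \<le> norm (h x)"
    proof (rule AE_I2)
      fix x
      show "norm ((cmod (f x))\<^sup>2) \<le> norm (h x)"
        using le[of x] order_trans[OF zero_le_power2 le[of x]]
        unfolding real_norm_def by simp
    qed
  qed
qed

lemma square_integrable_add:
  assumes f: "square_integrable f" and g: "square_integrable g"
  shows "square_integrable (\<lambda>x. f x + g x)"
proof (rule square_integrable_bound)
  show "(\<lambda>x. f x + g x) \<in> borel_measurable lebesgue"
    by (intro borel_measurable_add square_integrable_measurable f g)
  show "integrable lebesgue (\<lambda>x. 2 * (cmod (f x))\<^sup>2 + 2 * (cmod (g x))\<^sup>2)"
    by (intro Bochner_Integration.integrable_add integrable_mult_right
        square_integrable_integrable f g)
  show "(cmod (f x + g x))\<^sup>2 \<le> 2 * (cmod (f x))\<^sup>2 + 2 * (cmod (g x))\<^sup>2" for x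
  proof -
    have "(cmod (f x + g x))\<^sup>2 \<le> (cmod (f x) + cmod (g x))\<^sup>2"
      by (rule power_mono[OF norm_triangle_ineq norm_ge_zero])
    also have "\<dots> \<le> 2 * (cmod (f x))\<^sup>2 + 2 * (cmod (g x))\<^sup>2"
      using sum_squares_bound[of "cmod (f x)" "cmod (g x)"] unfolding power2_sum by linarith
    finally show ?thesis .
  qed
qed

lemma square_integrable_cmult:
  assumes f: "square_integrable f"
  shows "square_integrable (\<lambda>x. a * f x)"
proof (rule square_integrable_bound)
  show "(\<lambda>x. a * f x) \<in> borel_measurable lebesgue"
    by (intro borel_measurable_times borel_measurable_const square_integrable_measurable f)
  show "integrable lebesgue (\<lambda>x. (cmod a)\<^sup>2 * (cmod (f x))\<^sup>2)"
    by (intro integrable_mult_right square_integrable_integrable f)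
qed (simp add: norm_mult power_mult_distrib)

lemma square_integrable_indicator:
  assumes f: "square_integrable f" and S: "S \<in> sets lebesgue"
  shows "square_integrable (\<lambda>x. if x \<in> S then f x else 0)"
proof (rule square_integrable_bound)
  show "(\<lambda>x. if x \<in> S then f x else 0) \<in> borel_measurable lebesgue"
    using S by (intro measurable_If_set square_integrable_measurable[OF f]) simp_all
  show "integrable lebesgue (\<lambda>x. (cmod (f x))\<^sup>2)"
    by (rule square_integrable_integrable[OF f])
qed simp

lemma reflect_measurable_lebesgue: "uminus \<in> lebesgue \<rightarrow>\<^sub>M (lebesgue :: real measure)"
proof -
  have "(*\<^sub>R) (-1) = (uminus :: real \<Rightarrow> real)"
    by (simp add: fun_eq_iff)
  with lebesgue_measurable_scaling[of "-1", where 'a = real] show ?thesis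
    by (simp only:)
qed

lemma AE_lebesgue_reflect:
  fixes P :: "real \<Rightarrow> bool"
  assumes "AE x in lebesgue. P x"
  shows "AE x in lebesgue. P (- x)"
proof -
  obtain N where N: "{x \<in> space lebesgue. \<not> P x} \<subseteq> N" "N \<in> null_sets lebesgue"
    using assms by (auto simp: eventually_ae_filter)
  have img: "uminus -` N = (\<lambda>x. (-1) *\<^sub>R x + 0) ` N"
    by (auto simp: image_iff) (metis add.inverse_inverse)
  have "emeasure lebesgue (uminus -` N) = 0"
    unfolding img emeasure_lebesgue_affine using N(2) by auto
  moreover have "uminus -` N \<in> sets lebesgue"
    using measurable_sets[OF reflect_measurable_lebesgue, of N] N(2) by auto
  ultimately have "uminus -` N \<in> null_sets lebesgue"
    by auto
  then show ?thesis
    by (rule AE_I') (use N(1) in auto)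
qed

lemma square_integrable_reflect:
  assumes "square_integrable f"
  shows "square_integrable (\<lambda>x. f (- x))"
proof -
  have "(\<lambda>x. f (- x)) \<in> borel_measurable lebesgue"
    using assms unfolding square_integrable_def
    by (intro measurable_compose[OF reflect_measurable_lebesgue]) auto
  moreover have "integrable lebesgue (\<lambda>x. (cmod (f (- x)))\<^sup>2)"
  proof -
    obtain i where "has_bochner_integral lebesgue (\<lambda>x. (cmod (f x))\<^sup>2) i"
      using assms by (auto simp: square_integrable_def integrable.simps)
    then have "has_bochner_integral lebesgue (\<lambda>x. (cmod (f (0 + (-1) * x)))\<^sup>2) (i /\<^sub>R \<bar>-1\<bar>)"
      by (subst has_bochner_integral_lebesgue_real_affine_iff[of "-1" _ _ 0, symmetric]) auto
    then show ?thesis by (auto simp: integrable.simps)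
  qed
  ultimately show ?thesis by (simp add: square_integrable_def)
qed

lemma integrable_mult_cnj:
  assumes "square_integrable f" "square_integrable g"
  shows "integrable lebesgue (\<lambda>x. f x * cnj (g x))"
proof (rule Bochner_Integration.integrable_bound)
  show "integrable lebesgue (\<lambda>x. (cmod (f x))\<^sup>2 + (cmod (g x))\<^sup>2)"
    by (intro Bochner_Integration.integrable_add square_integrable_integrable assms)
  have "(\<lambda>x. cnj (g x)) \<in> borel_measurable lebesgue"
    by (rule measurable_compose[OF square_integrable_measurable[OF assms(2)]])
       (intro borel_measurable_continuous_onI continuous_intros)
  then show "(\<lambda>x. f x * cnj (g x)) \<in> borel_measurable lebesgue"
    by (rule borel_measurable_times[OF square_integrable_measurable[OF assms(1)]])
  show "AE x in lebesgue. norm (f x * cnj (g x)) \<le> norm ((cmod (f x))\<^sup>2 + (cmod (g x))\<^sup>2)"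
  proof (rule AE_I2)
    fix x
    have "0 \<le> cmod (f x) * cmod (g x)"
      by simp
    then show "norm (f x * cnj (g x)) \<le> norm ((cmod (f x))\<^sup>2 + (cmod (g x))\<^sup>2)"
      using sum_squares_bound[of "cmod (f x)" "cmod (g x)"]
      unfolding norm_mult complex_mod_cnj real_norm_def by linarith
  qed
qed

quotient_type l2 = "real \<Rightarrow> complex" / partial:
  "\<lambda>f g. square_integrable f \<and> square_integrable g \<and> (AE x in lebesgue. f x = g x)"
  morphisms rep_l2 abs_l2
proof (rule part_equivpI)
  show "\<exists>f. square_integrable f \<and> square_integrable f \<and> (AE x in lebesgue. f x = f x)"
    using square_integrable_zero by auto
  show "symp (\<lambda>f g. square_integrable f \<and> square_integrable g \<and> (AE x in lebesgue. f x = g x))"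
    by (auto simp: symp_def)
  show "transp (\<lambda>f g. square_integrable f \<and> square_integrable g \<and> (AE x in lebesgue. f x = g x))"
  proof (rule transpI)
    fix f g h :: "real \<Rightarrow> complex"
    assume fg: "square_integrable f \<and> square_integrable g \<and> (AE x in lebesgue. f x = g x)"
      and gh: "square_integrable g \<and> square_integrable h \<and> (AE x in lebesgue. g x = h x)"
    from conjunct2[OF conjunct2[OF fg]] conjunct2[OF conjunct2[OF gh]]
    have "AE x in lebesgue. f x = h x"
      by eventually_elim simp
    with fg gh show "square_integrable f \<and> square_integrable h \<and> (AE x in lebesgue. f x = h x)"
      by blast
  qed
qed

instantiation l2 :: complex_inner
begin

lift_definition zero_l2 :: l2 is "\<lambda>x. 0"
  by (simp add: square_integrable_zero)

lift_definition plus_l2 :: "l2 \<Rightarrow> l2 \<Rightarrow> l2" is "\<lambda>f g x. f x + g x"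
proof (elim conjE, intro conjI)
  fix f f' g g' :: "real \<Rightarrow> complex"
  assume "square_integrable f" "square_integrable f'" "square_integrable g" "square_integrable g'"
    and ae: "AE x in lebesgue. f x = f' x" "AE x in lebesgue. g x = g' x"
  then show "square_integrable (\<lambda>x. f x + g x)" "square_integrable (\<lambda>x. f' x + g' x)"
    by (simp_all add: square_integrable_add)
  from ae show "AE x in lebesgue. f x + g x = f' x + g' x"
    by eventually_elim simp
qed

lift_definition scaleC_l2 :: "complex \<Rightarrow> l2 \<Rightarrow> l2" is "\<lambda>a f x. a * f x"
proof (elim conjE, intro conjI)
  fix a and f g :: "real \<Rightarrow> complex"
  assume "square_integrable f" "square_integrable g" and ae: "AE x in lebesgue. f x = g x"
  then show "square_integrable (\<lambda>x. a * f x)" "square_integrable (\<lambda>x. a * g x)"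
    by (simp_all add: square_integrable_cmult)
  from ae show "AE x in lebesgue. a * f x = a * g x"
    by eventually_elim simp
qed

definition uminus_l2 :: "l2 \<Rightarrow> l2" where "uminus_l2 u = scaleC (-1) u"

definition minus_l2 :: "l2 \<Rightarrow> l2 \<Rightarrow> l2" where "minus_l2 u v = u + (- v)"

definition scaleR_l2 :: "real \<Rightarrow> l2 \<Rightarrow> l2" where "scaleR_l2 r u = scaleC (complex_of_real r) u"

lift_definition cinner_l2 :: "l2 \<Rightarrow> l2 \<Rightarrow> complex" is "\<lambda>f g. \<integral>x. f x * cnj (g x) \<partial>lebesgue"
proof (elim conjE)
  fix f f' g g' :: "real \<Rightarrow> complex"
  assume si: "square_integrable f" "square_integrable f'" "square_integrable g" "square_integrable g'"
    and ae: "AE x in lebesgue. f x = f' x" "AE x in lebesgue. g x = g' x"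
  show "(\<integral>x. f x * cnj (g x) \<partial>lebesgue) = (\<integral>x. f' x * cnj (g' x) \<partial>lebesgue)"
  proof (rule integral_cong_AE)
    show "AE x in lebesgue. f x * cnj (g x) = f' x * cnj (g' x)"
      using ae by eventually_elim simp
  qed (use si in \<open>simp_all add: integrable_mult_cnj borel_measurable_integrable\<close>)
qed

definition inner_l2 :: "l2 \<Rightarrow> l2 \<Rightarrow> real" where "inner_l2 u v = Re (cinner u v)"

definition norm_l2 :: "l2 \<Rightarrow> real" where "norm_l2 u = sqrt (inner u u)"

definition sgn_l2 :: "l2 \<Rightarrow> l2" where "sgn_l2 u = inverse (norm u) *\<^sub>R u"

definition dist_l2 :: "l2 \<Rightarrow> l2 \<Rightarrow> real" where "dist_l2 u v = norm (u - v)"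

definition uniformity_l2 :: "(l2 \<times> l2) filter" where
  "uniformity_l2 = (INF e\<in>{0<..}. principal {(x, y). dist x y < e})"

definition open_l2 :: "l2 set \<Rightarrow> bool" where
  "open_l2 U \<longleftrightarrow> (\<forall>x\<in>U. eventually (\<lambda>(x', y). x' = x \<longrightarrow> y \<in> U) uniformity)"

instance
proof (intro_classes)
  note si = square_integrable_zero square_integrable_add square_integrable_cmult
  fix u v w :: l2 and r s :: real
  show "u + v + w = u + (v + w)"
    by transfer (simp add: si add.assoc)
  show "u + v = v + u"
    by transfer (simp add: si add.commute)
  show "0 + u = u"
    by transfer simp
  show "- u + u = 0"
    unfolding uminus_l2_def
  proof transfer
    fix f :: "real \<Rightarrow> complex"
    assume f: "square_integrable f \<and> square_integrable f \<and> (AE x in lebesgue. f x = f x)"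
    then have "square_integrable (\<lambda>x. - 1 * f x + f x)"
      by (intro si) auto
    then show "square_integrable (\<lambda>x. - 1 * f x + f x) \<and> square_integrable (\<lambda>x. 0) \<and>
        (AE x in lebesgue. - 1 * f x + f x = 0)"
      by (simp add: square_integrable_zero)
  qed
  show "u - v = u + - v"
    by (simp add: minus_l2_def)
  show addR: "c *\<^sub>C (x + y) = c *\<^sub>C x + c *\<^sub>C y" for c and x y :: l2
    by transfer (simp add: si distrib_left)
  show addL: "(c + d) *\<^sub>C x = c *\<^sub>C x + d *\<^sub>C x" for c d and x :: l2
    by transfer (simp add: si distrib_right)
  show assoc: "c *\<^sub>C d *\<^sub>C x = (c * d) *\<^sub>C x" for c d and x :: l2
    by transfer (simp add: si mult.assoc)
  have one: "1 *\<^sub>C x = x" for x :: l2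
    by transfer simp
  show "r *\<^sub>R u = complex_of_real r *\<^sub>C u"
    by (simp add: scaleR_l2_def)
  show "r *\<^sub>R (u + v) = r *\<^sub>R u + r *\<^sub>R v" "(r + s) *\<^sub>R u = r *\<^sub>R u + s *\<^sub>R u"
    "r *\<^sub>R s *\<^sub>R u = (r * s) *\<^sub>R u" "1 *\<^sub>R u = u"
    by (simp_all add: scaleR_l2_def addR addL assoc one)
  show comm: "cinner x y = cnj (cinner y x)" for x y :: l2
    by transfer (subst Bochner_Integration.integral_cnj[symmetric], simp add: mult.commute)
  show add: "cinner (x + y) z = cinner x z + cinner y z" for x y z :: l2
    by transfer (simp add: distrib_right integrable_mult_cnj Bochner_Integration.integral_add)
  show scale: "cinner (c *\<^sub>C x) y = c * cinner x y" for c and x y :: l2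
    by transfer (simp add: mult.assoc)
  show "inner u v = Re (cinner u v)"
    by (simp add: inner_l2_def)
  show "inner u v = inner v u"
    unfolding inner_l2_def by (subst comm) simp
  show "inner (u + v) w = inner u w + inner v w"
    by (simp add: inner_l2_def add)
  show "inner (r *\<^sub>R u) v = r * inner u v"
    by (simp add: inner_l2_def scaleR_l2_def scale)
  have pos: "(\<integral>x. f x * cnj (f x) \<partial>lebesgue) = complex_of_real (\<integral>x. (cmod (f x))\<^sup>2 \<partial>lebesgue)"
    for f :: "real \<Rightarrow> complex"
    by (simp only: complex_norm_square[symmetric] integral_complex_of_real)
  show "0 \<le> inner u u"
    unfolding inner_l2_def by transfer (simp add: pos)
  show "inner u u = 0 \<longleftrightarrow> u = 0"
    unfolding inner_l2_def
  proof transfer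
    fix f :: "real \<Rightarrow> complex"
    assume f: "square_integrable f \<and> square_integrable f \<and> (AE x in lebesgue. f x = f x)"
    have "(\<integral>x. (cmod (f x))\<^sup>2 \<partial>lebesgue) = 0 \<longleftrightarrow> (AE x in lebesgue. (cmod (f x))\<^sup>2 = 0)"
      using f by (intro integral_nonneg_eq_0_iff_AE) (auto simp: square_integrable_def)
    then show "(Re (\<integral>x. f x * cnj (f x) \<partial>lebesgue) = 0) =
        (square_integrable f \<and> square_integrable (\<lambda>x. 0) \<and> (AE x in lebesgue. f x = 0))"
      using f by (simp add: pos square_integrable_zero)
  qed
  show "norm u = sqrt (inner u u)"
    by (simp add: norm_l2_def)
  show "sgn u = inverse (norm u) *\<^sub>R u"
    by (simp add: sgn_l2_def)
  show "dist u v = norm (u - v)"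
    by (simp add: dist_l2_def)
  show "uniformity = (INF e\<in>{0<..}. principal {(x::l2, y). dist x y < e})"
    by (simp add: uniformity_l2_def)
  show "open U \<longleftrightarrow> (\<forall>x\<in>U. eventually (\<lambda>(x', y). x' = x \<longrightarrow> y \<in> U) uniformity)" for U :: "l2 set"
    by (simp add: open_l2_def)
qed

end

lift_definition parity :: "l2 \<Rightarrow> l2" is "\<lambda>f x. f (- x)"
proof (elim conjE, intro conjI)
  fix f g :: "real \<Rightarrow> complex"
  assume "square_integrable f" "square_integrable g" "AE x in lebesgue. f x = g x"
  then show "square_integrable (\<lambda>x. f (- x))" "square_integrable (\<lambda>x. g (- x))"
    "AE x in lebesgue. f (- x) = g (- x)"
    by (simp_all add: square_integrable_reflect AE_lebesgue_reflect[of "\<lambda>x. f x = g x"])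
qed

text \<open>\<open>f_+\<close> and \<open>f_-\<close>: restriction to a half-line, extended by zero. The space \<open>L_2(0,\<infinity>)\<close> is identified
  with the subspace \<open>l2_pos\<close> of classes vanishing on the negative half-line.\<close>

lift_definition pos_part :: "l2 \<Rightarrow> l2" is "\<lambda>f x. if x \<in> {0<..} then f x else 0"
proof (elim conjE, intro conjI)
  fix f g :: "real \<Rightarrow> complex"
  assume fg: "square_integrable f" "square_integrable g" and ae: "AE x in lebesgue. f x = g x"
  show "square_integrable (\<lambda>x. if x \<in> {0<..} then f x else 0)"
    "square_integrable (\<lambda>x. if x \<in> {0<..} then g x else 0)"
    using fg by (auto intro!: square_integrable_indicator simp del: greaterThan_iff)
  from ae show "AE x in lebesgue. (if x \<in> {0<..} then f x else 0) = (if x \<in> {0<..} then g x else 0)"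
    by eventually_elim simp
qed

lift_definition neg_part :: "l2 \<Rightarrow> l2" is "\<lambda>f x. if x \<in> {..<0} then f x else 0"
proof (elim conjE, intro conjI)
  fix f g :: "real \<Rightarrow> complex"
  assume fg: "square_integrable f" "square_integrable g" and ae: "AE x in lebesgue. f x = g x"
  show "square_integrable (\<lambda>x. if x \<in> {..<0} then f x else 0)"
    "square_integrable (\<lambda>x. if x \<in> {..<0} then g x else 0)"
    using fg by (auto intro!: square_integrable_indicator simp del: lessThan_iff)
  from ae show "AE x in lebesgue. (if x \<in> {..<0} then f x else 0) = (if x \<in> {..<0} then g x else 0)"
    by eventually_elim simp
qed

definition l2_pos :: "l2 set" where
  "l2_pos = range pos_part"

section \<open>The differential expression and its solutions\<close>

definition absolutely_continuous_on :: "real \<Rightarrow> real \<Rightarrow> (real \<Rightarrow> 'a::real_normed_vector) \<Rightarrow> bool" where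
  "absolutely_continuous_on a b f \<longleftrightarrow>
     (\<forall>\<epsilon>>0. \<exists>\<delta>>0. \<forall>n (u :: nat \<Rightarrow> real) v.
        (\<forall>i<n. a \<le> u i \<and> u i \<le> v i \<and> v i \<le> b) \<and>
        (\<forall>i<n. \<forall>j<n. i \<noteq> j \<longrightarrow> {u i<..<v i} \<inter> {u j<..<v j} = {}) \<and>
        (\<Sum>i<n. v i - u i) < \<delta>
        \<longrightarrow> (\<Sum>i<n. norm (f (v i) - f (u i))) < \<epsilon>)"

definition deriv1 :: "(real \<Rightarrow> complex) \<Rightarrow> real \<Rightarrow> complex" where
  "deriv1 f x = vector_derivative f (at x)"

definition locally_AC1 :: "real set \<Rightarrow> (real \<Rightarrow> complex) \<Rightarrow> bool" where
  "locally_AC1 I f \<longleftrightarrow> (\<forall>x\<in>I. f differentiable at x) \<and>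
     (\<forall>a b. a \<le> b \<and> {a..b} \<subseteq> I \<longrightarrow>
        absolutely_continuous_on a b f \<and> absolutely_continuous_on a b (deriv1 f))"

text \<open>For locally absolutely continuous \<open>f'\<close> the second derivative exists almost everywhere, so
  \<open>schroedinger q f\<close> is determined up to a null set.\<close>

definition schroedinger :: "(real \<Rightarrow> real) \<Rightarrow> (real \<Rightarrow> complex) \<Rightarrow> real \<Rightarrow> complex" where
  "schroedinger q f x = - deriv1 (deriv1 f) x + complex_of_real (q x) * f x"

definition solution_on ::
  "(real \<Rightarrow> real) \<Rightarrow> real set \<Rightarrow> complex \<Rightarrow> (real \<Rightarrow> complex) \<Rightarrow> bool" where
  "solution_on q I z y \<longleftrightarrow> locally_AC1 I y \<and>
     (AE x in lebesgue. x \<in> I \<longrightarrow> schroedinger q y x = z * y x)"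

text \<open>Endpoints are given by filters (\<open>at_right 0\<close>, \<open>at_left 0\<close>, \<open>at_top\<close>, \<open>at_bot\<close>).\<close>

definition square_integrable_near :: "real filter \<Rightarrow> (real \<Rightarrow> complex) \<Rightarrow> bool" where
  "square_integrable_near F y \<longleftrightarrow>
     (\<exists>N\<in>sets lebesgue. (\<forall>\<^sub>F x in F. x \<in> N) \<and> square_integrable (\<lambda>x. if x \<in> N then y x else 0))"

text \<open>Weyl's alternative: at an endpoint, either for every spectral parameter all solutions are
  square-integrable near it (limit-circle case), or for every spectral parameter some solution is
  not (limit-point case).\<close>

definition limit_circle :: "(real \<Rightarrow> real) \<Rightarrow> real set \<Rightarrow> real filter \<Rightarrow> bool" where
  "limit_circle q I F \<longleftrightarrow> (\<forall>z y. solution_on q I z y \<longrightarrow> square_integrable_near F y)"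

definition limit_point :: "(real \<Rightarrow> real) \<Rightarrow> real set \<Rightarrow> real filter \<Rightarrow> bool" where
  "limit_point q I F \<longleftrightarrow> (\<forall>z. \<exists>y. solution_on q I z y \<and> \<not> square_integrable_near F y)"

definition singular_even_potential :: "(real \<Rightarrow> real) \<Rightarrow> bool" where
  "singular_even_potential q \<longleftrightarrow>
     q \<in> borel_measurable lebesgue \<and> (\<forall>x. q (- x) = q x) \<and>
     (\<forall>a b. a \<le> b \<and> 0 \<notin> {a..b} \<longrightarrow> set_integrable lebesgue {a..b} q) \<and>
     (\<forall>\<epsilon>>0. \<not> set_integrable lebesgue {-\<epsilon>..\<epsilon>} q)"

section \<open>The operators generated by the differential expression\<close>

definition max_domain :: "(real \<Rightarrow> real) \<Rightarrow> (real \<Rightarrow> complex) set" where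
  "max_domain q =
     {f. square_integrable f \<and> locally_AC1 (- {0}) f \<and> square_integrable (schroedinger q f)}"

definition max_op :: "(real \<Rightarrow> real) \<Rightarrow> (l2 \<times> l2) set" where
  "max_op q = {(abs_l2 f, abs_l2 (schroedinger q f)) | f. f \<in> max_domain q}"

text \<open>The minimal operator on the half-line: the closure of the restriction of the maximal one to
  functions with compact support in the open half-line.\<close>

definition min_op_pos :: "(real \<Rightarrow> real) \<Rightarrow> (l2 \<times> l2) set" where
  "min_op_pos q = closure {(abs_l2 f, abs_l2 (schroedinger q f)) | f.
     f \<in> max_domain q \<and> (\<exists>a b. 0 < a \<and> a \<le> b \<and> (\<forall>x. x \<notin> {a..b} \<longrightarrow> f x = 0))}"

definition min_op :: "(real \<Rightarrow> real) \<Rightarrow> (l2 \<times> l2) set" where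
  "min_op q = {(u + parity v, u' + parity v') | u u' v v'.
     (u, u') \<in> min_op_pos q \<and> (v, v') \<in> min_op_pos q}"

text \<open>This is \<open>\<Gamma>\<^sub>j\<close> when \<open>G\<close> is the half-line boundary map \<open>\<Gamma>\<^sub>j\<^sup>+\<close>.\<close>

definition double_boundary_map :: "(l2 \<Rightarrow> complex) \<Rightarrow> l2 \<Rightarrow> complex ^ 2" where
  "double_boundary_map G f = vector [G (pos_part f), G (parity (neg_part f))]"

end

theory Submission
  imports Defs "HOL-Complex_Analysis.Complex_Analysis" "HOL-Real_Asymp.Real_Asymp"
begin

text \<open>Restrictions of \<open>L\<close> are described by the boundary values
  \<open>(\<Gamma>\<^sub>0 f\<^sub>+, \<Gamma>\<^sub>0 P f\<^sub>-, \<Gamma>\<^sub>1 f\<^sub>+, \<Gamma>\<^sub>1 P f\<^sub>-)\<close>. The \<open>P\<close>-self-adjoint extensions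
  are those whose boundary space is Lagrangian for the form that Green's identity induces after
  twisting by \<open>P\<close>, and a non-real \<open>z\<close> belongs to the resolvent set if this space is transversal to
  the graph of multiplication by \<open>m(z)\<close>, where \<open>m\<close> is the Weyl function of the half-line triplet.
  A Lagrangian space that fails to be transversal for two different values of \<open>m\<close> must be a product
  of the same complex line with itself, and the lines that occur are exactly those of the theorem.

  It remains to see that \<open>m\<close> is not constant on the upper half-plane. Suppose that \<open>m = \<mu>\<close> there. In the
  limit-circle case the Weyl solution \<open>\<psi>\<^sub>z\<close> then has Wronskians with two solutions \<open>s\<^sub>1, s\<^sub>2\<close> for
  \<open>z = 0\<close> whose values at the endpoint \<open>0\<close> do not depend on \<open>z\<close>. So \<open>\<psi>\<^sub>z\<close> solves a Volterra equation
  from \<open>0\<close>, and \<open>I\<^sub>j(z) = \<integral> s\<^sub>j \<psi>\<^sub>z\<close> over \<open>(0, x)\<close> extends to an entire function of zero exponential type.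
  Since \<open>Im z \<parallel>\<psi>\<^sub>z\<parallel>\<^sup>2 = Im \<mu>\<close>, it is \<open>O(1 / sqrt (Im z))\<close> in the upper half-plane, hence vanishes by a
  Phragmen-Lindelof argument. This holds for all \<open>x\<close> and forces \<open>\<psi>\<^sub>z = 0\<close>.\<close>

section \<open>Primitives of locally integrable functions\<close>

text \<open>Two different values of \<open>m\<close> are indispensable. If \<open>m\<close> were a
  constant \<mu> on the upper half-plane, the space of all
  \<open>(x1, x2, \<mu> * x1, cnj \<mu> * x2)\<close> would be Lagrangian and would meet the graph
  of \<open>m(z)\<close> for every non-real \<open>z\<close>, though it is not a product of one line
  with itself. Asymptotics of \<open>m\<close> at infinity would depend on the singularity of
  \<open>q\<close> and on the arbitrary triplet; hence an indirect argument that uses only the norm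
  of the Weyl solution and growth bounds. The limit-circle case enters through the Volterra
  equation: its kernel is built from two solutions, and its majorant is integrable up to 0 because
  both are square-integrable there. Second derivatives exist only almost everywhere, so all work
  with the differential expression is done on pairs related by \<open>prim_on\<close>; absolute
  integrability makes the density usable for the gauge and for the Lebesgue integral. This rests on
  the fundamental theorem of calculus for absolutely continuous functions, which is derived from the
  Radon-Nikodym theorem.\<close>

definition prim_on :: "real set \<Rightarrow> (real \<Rightarrow> 'a::euclidean_space) \<Rightarrow> (real \<Rightarrow> 'a) \<Rightarrow> bool" where
  "prim_on I F g \<longleftrightarrow> (\<forall>a\<in>I. \<forall>b\<in>I. a \<le> b \<longrightarrow>
     g absolutely_integrable_on {a..b} \<and> (g has_integral F b - F a) {a..b})"

lemma prim_onD:
  assumes "prim_on I F g" "a \<in> I" "b \<in> I" "a \<le> b"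
  shows "g absolutely_integrable_on {a..b}" "(g has_integral F b - F a) {a..b}"
    "integral {a..b} g = F b - F a"
  using assms unfolding prim_on_def by (blast, blast, blast)

lemma prim_on_subset: "prim_on I F g \<Longrightarrow> J \<subseteq> I \<Longrightarrow> prim_on J F g"
  unfolding prim_on_def by blast

section \<open>Positive variation along increasing chains\<close>

text \<open>\<open>pvl F a x s l\<close>: finitely many non-overlapping intervals in \<open>[a, x]\<close> of total length \<open>l\<close> carry the
  total increment \<open>s\<close> of \<open>F\<close>.\<close>

inductive pvl :: "(real \<Rightarrow> real) \<Rightarrow> real \<Rightarrow> real \<Rightarrow> real \<Rightarrow> real \<Rightarrow> bool" for F a where
  pvl_nil: "pvl F a a 0 0"
| pvl_skip: "pvl F a x s l \<Longrightarrow> x \<le> y \<Longrightarrow> pvl F a y s l"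
| pvl_take: "pvl F a x s l \<Longrightarrow> x \<le> y \<Longrightarrow> pvl F a y (s + (F y - F x)) (l + (y - x))"

lemma pvl_bounds: "pvl F a x s l \<Longrightarrow> a \<le> x \<and> 0 \<le> l \<and> l \<le> x - a"
  by (induction rule: pvl.induct) auto

lemma pvl_trans: "pvl F x y t m \<Longrightarrow> pvl F a x s l \<Longrightarrow> pvl F a y (s + t) (l + m)"
proof (induction rule: pvl.induct)
  case (pvl_take y t m z)
  then have "pvl F a z ((s + t) + (F z - F y)) ((l + m) + (z - y))"
    by (intro pvl.pvl_take) auto
  then show ?case by (simp add: algebra_simps)
qed (auto intro: pvl.intros)

text \<open>An interval of the chain that straddles \<open>x\<close> is cut there; increment and
  length add up exactly over the two pieces.\<close>

lemma pvl_split: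
  "pvl F a y s l \<Longrightarrow> a \<le> x \<Longrightarrow> x \<le> y \<Longrightarrow>
    \<exists>s1 l1 s2 l2. pvl F a x s1 l1 \<and> pvl F x y s2 l2 \<and> s = s1 + s2 \<and> l = l1 + l2"
proof (induction rule: pvl.induct)
  case pvl_nil
  then have "x = a" by simp
  then show ?case using pvl.pvl_nil[of F a] by (intro exI[of _ 0]) auto
next
  case (pvl_skip z s l y)
  show ?case
  proof (cases "x \<le> z")
    case True
    then obtain s1 l1 s2 l2 where "pvl F a x s1 l1" "pvl F x z s2 l2" "s = s1 + s2" "l = l1 + l2"
      using pvl_skip by blast
    then show ?thesis using pvl.pvl_skip[of F x z s2 l2 y] pvl_skip(2) by blast
  next
    case False
    then have "pvl F a x s l" using pvl.pvl_skip[of F a z s l x] pvl_skip by simp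
    moreover have "pvl F x y 0 0" using pvl.pvl_skip[OF pvl.pvl_nil] pvl_skip by blast
    ultimately show ?thesis by (intro exI[of _ s] exI[of _ l] exI[of _ 0]) auto
  qed
next
  case (pvl_take z s l y)
  show ?case
  proof (cases "x \<le> z")
    case True
    then obtain s1 l1 s2 l2 where *: "pvl F a x s1 l1" "pvl F x z s2 l2" "s = s1 + s2" "l = l1 + l2"
      using pvl_take by blast
    have "pvl F x y (s2 + (F y - F z)) (l2 + (y - z))"
      using pvl.pvl_take[OF *(2) pvl_take(2)] .
    then show ?thesis using * by (metis (no_types, lifting) add.assoc)
  next
    case False
    then have "pvl F a x (s + (F x - F z)) (l + (x - z))"
      using pvl.pvl_take[OF pvl_take(1), of x] by simp
    moreover have "pvl F x y (0 + (F y - F x)) (0 + (y - x))"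
      by (rule pvl.pvl_take[OF pvl.pvl_nil]) (use pvl_take in auto)
    ultimately show ?thesis
      by (intro exI[of _ "s + (F x - F z)"] exI[of _ "l + (x - z)"]
          exI[of _ "0 + (F y - F x)"] exI[of _ "0 + (y - x)"]) auto
  qed
qed

text \<open>Translation of the inductive chains into the indexed families of
  \<open>absolutely_continuous_on\<close>. An interval appended on the right stays disjoint from the
  earlier ones, which end at or before \<open>x\<close>.\<close>

lemma pvl_family:
  "pvl F a x s l \<Longrightarrow> \<exists>n u v. (\<forall>i<n. a \<le> u i \<and> u i \<le> v i \<and> v i \<le> x) \<and>
     (\<forall>i<n. \<forall>j<n. i \<noteq> j \<longrightarrow> {u i<..<v i} \<inter> {u j<..<v j} = {}) \<and>
     (\<Sum>i<n. v i - u i) = l \<and> (\<Sum>i<(n::nat). F (v i) - F (u i)) = s"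
proof (induction rule: pvl.induct)
  case pvl_nil
  show ?case by (intro exI[of _ 0]) auto
next
  case (pvl_skip x s l y)
  then obtain n u v where "(\<forall>i<n. a \<le> u i \<and> u i \<le> v i \<and> v i \<le> x)"
     "(\<forall>i<n. \<forall>j<n. i \<noteq> j \<longrightarrow> {u i<..<v i} \<inter> {u j<..<v j} = {})"
     "(\<Sum>i<n. v i - u i) = l" "(\<Sum>i<(n::nat). F (v i) - F (u i)) = s" by blast
  moreover from this(1) have "\<forall>i<n. a \<le> u i \<and> u i \<le> v i \<and> v i \<le> y"
    using pvl_skip(2) by (meson order_trans)
  ultimately show ?case by (intro exI[of _ n] exI[of _ u] exI[of _ v] conjI)
next
  case (pvl_take x s l y)
  then obtain n u v where *: "(\<forall>i<n. a \<le> u i \<and> u i \<le> v i \<and> v i \<le> x)"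
     "(\<forall>i<n. \<forall>j<n. i \<noteq> j \<longrightarrow> {u i<..<v i} \<inter> {u j<..<v j} = {})"
     "(\<Sum>i<n. v i - u i) = l" "(\<Sum>i<(n::nat). F (v i) - F (u i)) = s" by blast
  have ax: "a \<le> x" using pvl_bounds[OF pvl_take(1)] by simp
  let ?u = "u(n := x)" and ?v = "v(n := y)"
  have "(\<forall>i<Suc n. a \<le> ?u i \<and> ?u i \<le> ?v i \<and> ?v i \<le> y)"
    using *(1) pvl_take(2) ax by (auto simp: less_Suc_eq intro: order_trans)
  moreover have "{?u i<..<?v i} \<inter> {?u j<..<?v j} = {}" if ij: "i < Suc n" "j < Suc n" "i \<noteq> j" for i j
  proof -
    have "{u i<..<v i} \<inter> {x<..<y} = {}" if "i < n" for i
      using *(1) that by (fastforce dest: spec[of _ i])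
    then have d2: "{u i<..<v i} \<inter> {x<..<y} = {}" "{x<..<y} \<inter> {u i<..<v i} = {}" if "i < n" for i
      using that by blast+
    consider "i < n" "j < n" | "i = n" "j < n" | "i < n" "j = n" using ij unfolding less_Suc_eq by blast
    then show ?thesis
    proof cases
      case 1
      then have "?u i = u i" "?v i = v i" "?u j = u j" "?v j = v j" by auto
      then show ?thesis using *(2) 1 ij(3) by (simp only: simp_thms)
    next
      case 2
      then have "?u i = x" "?v i = y" "?u j = u j" "?v j = v j" by auto
      then show ?thesis using d2(2)[OF 2(2)] by (simp only: simp_thms)
    next
      case 3
      then have "?u i = u i" "?v i = v i" "?u j = x" "?v j = y" by auto
      then show ?thesis using d2(1)[OF 3(1)] by (simp only: simp_thms)
    qed
  qed
  moreover have "(\<Sum>i<Suc n. ?v i - ?u i) = l + (y - x)" "(\<Sum>i<Suc n. F (?v i) - F (?u i)) = s + (F y - F x)"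
    using *(3,4) by simp_all
  ultimately show ?case
    by (intro exI[of _ "Suc n"] exI[of _ ?u] exI[of _ ?v] conjI allI impI) (simp_all only:)
qed

section \<open>Jordan decomposition of absolutely continuous functions\<close>

lemma AC_pvl:
  fixes F :: "real \<Rightarrow> real"
  assumes "absolutely_continuous_on a b F" "\<epsilon> > 0"
  obtains \<delta> where "\<delta> > 0" "\<And>x y s l. a \<le> x \<Longrightarrow> y \<le> b \<Longrightarrow> pvl F x y s l \<Longrightarrow> l < \<delta> \<Longrightarrow> \<bar>s\<bar> < \<epsilon>"
proof -
  obtain \<delta> where d: "\<delta> > 0" "\<And>n (u::nat\<Rightarrow>real) v. (\<forall>i<n. a \<le> u i \<and> u i \<le> v i \<and> v i \<le> b) \<and>
        (\<forall>i<n. \<forall>j<n. i \<noteq> j \<longrightarrow> {u i<..<v i} \<inter> {u j<..<v j} = {}) \<and>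
        (\<Sum>i<n. v i - u i) < \<delta> \<Longrightarrow> (\<Sum>i<n. norm (F (v i) - F (u i))) < \<epsilon>"
    using assms unfolding absolutely_continuous_on_def by blast
  show ?thesis
  proof (rule that[OF d(1)])
    fix x y s l assume "a \<le> x" "y \<le> b" "pvl F x y s l" "l < \<delta>"
    then have A: "a \<le> x \<and> y \<le> b \<and> pvl F x y s l \<and> l < \<delta>" by blast
    then obtain n u v where *: "(\<forall>i<n. x \<le> u i \<and> u i \<le> v i \<and> v i \<le> y)"
     "(\<forall>i<n. \<forall>j<n. i \<noteq> j \<longrightarrow> {u i<..<v i} \<inter> {u j<..<v j} = {})"
     "(\<Sum>i<n. v i - u i) = l" "(\<Sum>i<(n::nat). F (v i) - F (u i)) = s"
      using pvl_family[of F x y s l] by blast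
    have "(\<Sum>i<n. norm (F (v i) - F (u i))) < \<epsilon>"
      using * A by (intro d(2)) (auto intro: order_trans)
    then show "\<bar>s\<bar> < \<epsilon>"
      using *(4) sum_abs[of "\<lambda>i. F (v i) - F (u i)" "{..<n}"] by auto
  qed
qed

text \<open>Absolute continuity tested only on selections \<open>S\<close> of cells of an increasing
  grid. The monotone parts of the Jordan decomposition need no absolute values, and the weak
  inequality survives the approximation of a supremum. The grid form is what the covering of open
  sets in \<open>cell_AC_prim\<close> consumes.\<close>

definition cell_AC :: "real \<Rightarrow> real \<Rightarrow> (real \<Rightarrow> real) \<Rightarrow> bool" where
  "cell_AC a b M \<longleftrightarrow> (\<forall>\<epsilon>>0. \<exists>\<delta>>0. \<forall>(t::nat \<Rightarrow> real) N S. mono t \<and> a \<le> t 0 \<and> t N \<le> b \<and>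
     (\<Sum>k\<in>S \<inter> {..<N}. t (Suc k) - t k) < \<delta> \<longrightarrow> (\<Sum>k\<in>S \<inter> {..<N}. M (t (Suc k)) - M (t k)) \<le> \<epsilon>)"

lemma sum_Int_Suc: "(\<Sum>k\<in>S \<inter> {..<Suc N}. f k) = (\<Sum>k\<in>S \<inter> {..<N}. f k) + (if N \<in> S then f N else (0::real))"
proof -
  have "S \<inter> {..<Suc N} = (if N \<in> S then insert N (S \<inter> {..<N}) else S \<inter> {..<N})"
    by (auto simp: less_Suc_eq)
  then show ?thesis by (simp add: add.commute)
qed

text \<open>Near-optimal chains in the selected cells are concatenated and the other cells are
  skipped. The result is a single chain no longer than the selected cells together, at the price of
  one \<open>\<eta>\<close> per cell.\<close>

lemma pvl_cells:
  fixes t :: "nat \<Rightarrow> real"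
  assumes "mono t" and
    step: "\<And>k. k < N \<Longrightarrow> \<exists>s l. pvl F (t k) (t (Suc k)) s l \<and> D k \<le> s + \<eta> \<and> l \<le> t (Suc k) - t k"
    and "\<eta> \<ge> 0"
  shows "\<exists>s l. pvl F (t 0) (t N) s l \<and> (\<Sum>k\<in>S \<inter> {..<N}. D k) \<le> s + real N * \<eta> \<and>
     l \<le> (\<Sum>k\<in>S \<inter> {..<N}. t (Suc k) - t k)"
  using step
proof (induction N)
  case 0
  show ?case using pvl_nil[of F "t 0"] by (intro exI[of _ 0]) auto
next
  case (Suc N)
  then obtain s l where sl: "pvl F (t 0) (t N) s l" "(\<Sum>k\<in>S \<inter> {..<N}. D k) \<le> s + real N * \<eta>"
     "l \<le> (\<Sum>k\<in>S \<inter> {..<N}. t (Suc k) - t k)" by auto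
  have tm: "t N \<le> t (Suc N)" using assms(1) by (simp add: monoD)
  show ?case
  proof (cases "N \<in> S")
    case True
    obtain s' l' where "pvl F (t N) (t (Suc N)) s' l'" "D N \<le> s' + \<eta>" "l' \<le> t (Suc N) - t N"
      using Suc(2)[of N] by auto
    then show ?thesis using True sl pvl_trans[OF _ sl(1), of "t (Suc N)" s' l']
      by (intro exI[of _ "s + s'"] exI[of _ "l + l'"]) (auto simp: sum_Int_Suc algebra_simps)
  next
    case False
    then show ?thesis using sl pvl_skip[OF sl(1) tm] assms(3)
      by (intro exI[of _ "s"] exI[of _ "l"]) (auto simp: sum_Int_Suc algebra_simps)
  qed
qed

text \<open>\<open>P\<close> is the positive variation and \<open>Q\<close> is \<open>P - F\<close>.
  The point is that \<open>P\<close> inherits absolute continuity: chains that nearly attain its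
  increments on short cells join to one chain of short total length, to which the absolute
  continuity of \<open>F\<close> applies.\<close>

lemma AC_decompose:
  fixes F :: "real \<Rightarrow> real"
  assumes AC: "absolutely_continuous_on a b F" and ab: "a \<le> b"
  obtains P Q where "mono_on {a..b} P" "mono_on {a..b} Q" "cell_AC a b P" "cell_AC a b Q"
    "\<And>x. F x = P x - Q x"
proof -
  define X where "X x = {s. \<exists>l. pvl F a x s l}" for x
  define P where "P x = Sup (X x)" for x
  obtain d where d: "d > 0" "\<And>x y s l. a \<le> x \<Longrightarrow> y \<le> b \<Longrightarrow> pvl F x y s l \<Longrightarrow> l < d \<Longrightarrow> \<bar>s\<bar> < 1"
    using AC_pvl[OF AC zero_less_one] by blast
  \<comment> \<open>Chains of length below \<open>d\<close> gain less than 1, so steps of size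
    \<open>d / 2\<close> bound the gain by the number of steps. For \<open>n = 0\<close> the chain
    has length 0 and hence a gain below every positive number.\<close>
  have bdn: "pvl F a x s l \<Longrightarrow> x \<le> b \<Longrightarrow> x \<le> a + real n * (d/2) \<Longrightarrow> s \<le> real n" for n x s l
  proof (induction n arbitrary: x s l)
    case 0
    then have xa: "x = a" using pvl_bounds[OF 0(1)] by auto
    have "s \<le> e" if "e > 0" for e
    proof -
      obtain d where d: "d > 0" "\<And>x y s l. a \<le> x \<Longrightarrow> y \<le> b \<Longrightarrow> pvl F x y s l \<Longrightarrow> l < d \<Longrightarrow> \<bar>s\<bar> < e"
        using AC_pvl[OF AC \<open>e > 0\<close>] by blast
      show ?thesis using d(2)[OF order_refl 0(2,1)] pvl_bounds[OF 0(1)] xa d(1) by auto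
    qed
    then show ?case by (metis field_le_epsilon add_0 of_nat_0)
  next
    case (Suc n)
    show ?case
    proof (cases "x \<le> a + real n * (d/2)")
      case True
      then show ?thesis using Suc.IH[OF Suc.prems(1,2)] by simp
    next
      case False
      define y where "y = a + real n * (d/2)"
      have "real (Suc n) * (d/2) = real n * (d/2) + d/2" by (simp add: field_simps)
      then have y: "a \<le> y" "y \<le> x" "x - y \<le> d/2" using False d(1) Suc.prems(3) by (auto simp: y_def simp del: times_divide_eq_right)
      then obtain s1 l1 s2 l2 where *: "pvl F a y s1 l1" "pvl F y x s2 l2" "s = s1 + s2"
        using pvl_split[OF Suc.prems(1)] by blast
      have "s1 \<le> real n" using Suc.IH[OF *(1)] y Suc.prems by (simp add: y_def)
      moreover have "\<bar>s2\<bar> < 1"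
        using d(2)[OF y(1) Suc.prems(2) *(2)] pvl_bounds[OF *(2)] y d(1) by auto
      ultimately show ?thesis using *(3) by simp
    qed
  qed
  obtain n :: nat where n: "b - a \<le> real n * (d/2)"
    using reals_Archimedean3[of "d/2"] d(1) by (meson half_gt_zero less_eq_real_def)
  have bdd: "bdd_above (X x)" if "x \<le> b" for x
    unfolding bdd_above_def X_def using bdn[of x _ _ n] that n by (intro exI[of _ "real n"]) auto
  have ne: "X x \<noteq> {}" if "a \<le> x" for x
    using pvl_skip[OF pvl_nil that] unfolding X_def by blast
  have up: "s \<le> P x" if "pvl F a x s l" "x \<le> b" for x s l
    unfolding P_def using cSup_upper[OF _ bdd[OF that(2)]] that(1) unfolding X_def by blast
  \<comment> \<open>A chain nearly optimal for \<open>P y\<close> is cut at \<open>x\<close>. Its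
    left part contributes at most \<open>P x\<close>, so the right part carries the remaining
    increment up to \<open>\<eta>\<close>.\<close>
  have approx: "\<exists>s l. pvl F x y s l \<and> P y - P x \<le> s + \<eta> \<and> l \<le> y - x"
    if xy: "a \<le> x" "x \<le> y" "y \<le> b" "\<eta> > 0" for x y \<eta>
  proof -
    obtain s where s: "s \<in> X y" "P y - \<eta> < s"
      using less_cSupD[OF ne, of y "P y - \<eta>"] xy unfolding P_def by auto
    then obtain l where "pvl F a y s l" unfolding X_def by blast
    then obtain s1 l1 s2 l2 where *: "pvl F a x s1 l1" "pvl F x y s2 l2" "s = s1 + s2"
      using pvl_split xy by blast
    then show ?thesis using up[OF *(1)] s xy pvl_bounds[OF *(2)] by (intro exI[of _ s2] exI[of _ l2]) auto
  qed
  have incr: "max 0 (F y - F x) \<le> P y - P x" if xy: "a \<le> x" "x \<le> y" "y \<le> b" for x y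
  proof -
    have "P x \<le> P y - max 0 (F y - F x)"
      unfolding P_def[of x]
    proof (rule cSup_least[OF ne[OF xy(1)]])
      fix s assume "s \<in> X x"
      then obtain l where l: "pvl F a x s l" unfolding X_def by blast
      show "s \<le> P y - max 0 (F y - F x)"
        using up[OF pvl_skip[OF l xy(2)] xy(3)] up[OF pvl_take[OF l xy(2)] xy(3)] by auto
    qed
    then show ?thesis by linarith
  qed
  have cP: "cell_AC a b P"
    unfolding cell_AC_def
  proof (intro allI impI)
    fix e :: real assume e: "e > 0"
    obtain d where d: "d > 0" "\<And>x y s l. a \<le> x \<Longrightarrow> y \<le> b \<Longrightarrow> pvl F x y s l \<Longrightarrow> l < d \<Longrightarrow> \<bar>s\<bar> < e"
      using AC_pvl[OF AC e] by blast
    show "\<exists>\<delta>>0. \<forall>t N S. mono t \<and> a \<le> t 0 \<and> t N \<le> b \<and> (\<Sum>k\<in>S \<inter> {..<N}. t (Suc k) - t k) < \<delta> \<longrightarrow>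
          (\<Sum>k\<in>S \<inter> {..<N}. P (t (Suc k)) - P (t k)) \<le> e"
    proof (intro exI[of _ d] conjI d(1) allI impI)
      fix t :: "nat \<Rightarrow> real" and N S
      assume A: "mono t \<and> a \<le> t 0 \<and> t N \<le> b \<and> (\<Sum>k\<in>S \<inter> {..<N}. t (Suc k) - t k) < d"
      show "(\<Sum>k\<in>S \<inter> {..<N}. P (t (Suc k)) - P (t k)) \<le> e"
      proof (rule field_le_epsilon)
        fix r :: real assume r: "r > 0"
        define \<eta> where "\<eta> = r / (real N + 1)"
        have eta: "\<eta> > 0" "real N * \<eta> \<le> r" using r by (auto simp: \<eta>_def field_simps)
        have "\<exists>s l. pvl F (t 0) (t N) s l \<and> (\<Sum>k\<in>S \<inter> {..<N}. P (t (Suc k)) - P (t k)) \<le> s + real N * \<eta> \<and>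
           l \<le> (\<Sum>k\<in>S \<inter> {..<N}. t (Suc k) - t k)"
        proof (rule pvl_cells)
          fix k assume k: "k < N"
          have "a \<le> t k" "t k \<le> t (Suc k)" "t (Suc k) \<le> b"
            using A monoD[of t 0 k] monoD[of t k "Suc k"] monoD[of t "Suc k" N] k by linarith+
          then show "\<exists>s l. pvl F (t k) (t (Suc k)) s l \<and> P (t (Suc k)) - P (t k) \<le> s + \<eta> \<and> l \<le> t (Suc k) - t k"
            by (rule approx[OF _ _ _ eta(1)])
        qed (use A eta in auto)
        then obtain s l where *: "pvl F (t 0) (t N) s l" "(\<Sum>k\<in>S \<inter> {..<N}. P (t (Suc k)) - P (t k)) \<le> s + real N * \<eta>"
           "l \<le> (\<Sum>k\<in>S \<inter> {..<N}. t (Suc k) - t k)" by blast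
        have "\<bar>s\<bar> < e" using d(2)[OF _ _ *(1)] A *(3) by auto
        then show "(\<Sum>k\<in>S \<inter> {..<N}. P (t (Suc k)) - P (t k)) \<le> e + r" using * eta by auto
      qed
    qed
  qed
  have cF: "cell_AC a b (\<lambda>x. - F x)"
    unfolding cell_AC_def
  proof (intro allI impI)
    fix e :: real assume e: "e > 0"
    obtain d where d: "d > 0" "\<And>x y s l. a \<le> x \<Longrightarrow> y \<le> b \<Longrightarrow> pvl F x y s l \<Longrightarrow> l < d \<Longrightarrow> \<bar>s\<bar> < e"
      using AC_pvl[OF AC e] by blast
    show "\<exists>\<delta>>0. \<forall>t N S. mono t \<and> a \<le> t 0 \<and> t N \<le> b \<and> (\<Sum>k\<in>S \<inter> {..<N}. t (Suc k) - t k) < \<delta> \<longrightarrow>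
          (\<Sum>k\<in>S \<inter> {..<N}. - F (t (Suc k)) - - F (t k)) \<le> e"
    proof (intro exI[of _ d] conjI d(1) allI impI)
      fix t :: "nat \<Rightarrow> real" and N S
      assume A: "mono t \<and> a \<le> t 0 \<and> t N \<le> b \<and> (\<Sum>k\<in>S \<inter> {..<N}. t (Suc k) - t k) < d"
      have "pvl F (t 0) (t n) (\<Sum>k\<in>S \<inter> {..<n}. F (t (Suc k)) - F (t k)) (\<Sum>k\<in>S \<inter> {..<n}. t (Suc k) - t k)" for n
      proof (induction n)
        case 0 then show ?case by (simp add: pvl_nil)
      next
        case (Suc n)
        then show ?case using A monoD[of t n "Suc n"] pvl_take[OF Suc, of "t (Suc n)"] pvl_skip[OF Suc, of "t (Suc n)"]
          unfolding sum_Int_Suc by (cases "n \<in> S") simp_all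
      qed
      then have "\<bar>\<Sum>k\<in>S \<inter> {..<N}. F (t (Suc k)) - F (t k)\<bar> < e" using A by (intro d(2)[of "t 0" "t N"]) auto
      then show "(\<Sum>k\<in>S \<inter> {..<N}. - F (t (Suc k)) - - F (t k)) \<le> e"
        by (simp add: sum_subtractf sum_negf)
    qed
  qed
  have cQ: "cell_AC a b (\<lambda>x. P x - F x)"
    unfolding cell_AC_def
  proof (intro allI impI)
    fix e :: real assume e: "e > 0"
    have e2: "e/2 > 0" using e by simp
    obtain d1 where d1: "d1 > 0"
      "\<And>t N S. mono t \<and> a \<le> t 0 \<and> t N \<le> b \<and>
         (\<Sum>k\<in>S \<inter> {..<N}. t (Suc k) - t k) < d1 \<Longrightarrow> (\<Sum>k\<in>S \<inter> {..<N}. P (t (Suc k)) - P (t k)) \<le> e/2"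
      using cP e2 unfolding cell_AC_def by blast
    obtain d2 where d2: "d2 > 0"
      "\<And>t N S. mono t \<and> a \<le> t 0 \<and> t N \<le> b \<and>
         (\<Sum>k\<in>S \<inter> {..<N}. t (Suc k) - t k) < d2 \<Longrightarrow> (\<Sum>k\<in>S \<inter> {..<N}. - F (t (Suc k)) - - F (t k)) \<le> e/2"
      using cF e2 unfolding cell_AC_def by blast
    show "\<exists>\<delta>>0. \<forall>t N S. mono t \<and> a \<le> t 0 \<and> t N \<le> b \<and> (\<Sum>k\<in>S \<inter> {..<N}. t (Suc k) - t k) < \<delta> \<longrightarrow>
          (\<Sum>k\<in>S \<inter> {..<N}. (P (t (Suc k)) - F (t (Suc k))) - (P (t k) - F (t k))) \<le> e"
    proof (intro exI[of _ "min d1 d2"] conjI allI impI)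
      fix t :: "nat \<Rightarrow> real" and N S
      assume A: "mono t \<and> a \<le> t 0 \<and> t N \<le> b \<and> (\<Sum>k\<in>S \<inter> {..<N}. t (Suc k) - t k) < min d1 d2"
      show "(\<Sum>k\<in>S \<inter> {..<N}. (P (t (Suc k)) - F (t (Suc k))) - (P (t k) - F (t k))) \<le> e"
        using d1(2)[of t N S] d2(2)[of t N S] A unfolding sum_subtractf sum_negf by linarith
    qed (use d1(1) d2(1) in auto)
  qed
  show ?thesis
  proof (rule that[of P "\<lambda>x. P x - F x"])
    have "P x \<le> P y \<and> P x - F x \<le> P y - F y" if "x \<in> {a..b}" "y \<in> {a..b}" "x \<le> y" for x y
      using incr[of x y] that by auto
    then show "mono_on {a..b} P" "mono_on {a..b} (\<lambda>x. P x - F x)"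
      unfolding mono_on_def by blast+
    show "F x = P x - (P x - F x)" for x by simp
    show "cell_AC a b P" by (rule cP)
    show "cell_AC a b (\<lambda>x. P x - F x)" by (rule cQ)
  qed
qed

section \<open>Densities of monotone absolutely continuous functions\<close>

lemma has_integral_nonneg_measure:
  fixes g :: "real \<Rightarrow> real"
  assumes "has_bochner_integral lborel (\<lambda>t. g t * indicator {x<..y} t) r" "x \<le> y"
  shows "(g has_integral (r::real)) {x..y}"
proof -
  have eq: "(\<lambda>t. g t * indicator {x<..y} t) = (\<lambda>t. if t \<in> {x<..y} then g t else 0)"
    by (auto simp: indicator_def)
  have "integrable lborel (\<lambda>t. g t * indicator {x<..y} t)"
    "integral\<^sup>L lborel (\<lambda>t. g t * indicator {x<..y} t) = r"
    using assms(1) by (auto simp: has_bochner_integral_iff)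
  then have "((\<lambda>t. g t * indicator {x<..y} t) has_integral r) UNIV"
    using has_integral_integral_lborel by blast
  then have "(g has_integral r) {x<..y}"
    unfolding eq has_integral_restrict_UNIV .
  moreover have "negligible {t \<in> {x<..y} - {x..y}. g t \<noteq> 0}"
  proof -
    have "{t \<in> {x<..y} - {x..y}. g t \<noteq> 0} = {}" by (auto simp: less_imp_le)
    then show ?thesis by (simp only: negligible_empty)
  qed
  moreover have "negligible {t \<in> {x..y} - {x<..y}. g t \<noteq> 0}"
    by (rule negligible_subset[of "{x}"]) auto
  ultimately show ?thesis
    using has_integral_spike_set_eq by blast
qed

lemma cell_AC_imp_small:
  assumes "cell_AC a b M" "\<epsilon> > 0"
  obtains \<delta> where "\<delta> > 0" "\<And>x y. a \<le> x \<Longrightarrow> x \<le> y \<Longrightarrow> y \<le> b \<Longrightarrow> y - x < \<delta> \<Longrightarrow> M y - M x \<le> \<epsilon>"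
proof -
  obtain d where d: "d > 0" "\<And>(t::nat \<Rightarrow> real) N S. mono t \<and> a \<le> t 0 \<and> t N \<le> b \<and>
     (\<Sum>k\<in>S \<inter> {..<N}. t (Suc k) - t k) < d \<Longrightarrow> (\<Sum>k\<in>S \<inter> {..<N}. M (t (Suc k)) - M (t k)) \<le> \<epsilon>"
    using assms unfolding cell_AC_def by blast
  show ?thesis
  proof (rule that[OF d(1)])
    fix x y assume "a \<le> x" "x \<le> y" "y \<le> b" "y - x < d"
    then show "M y - M x \<le> \<epsilon>"
      using d(2)[of "\<lambda>n. if n = 0 then x else y" 1 UNIV] by (auto simp: mono_def)
  qed
qed

text \<open>\<open>M\<close>, made constant outside \<open>[a, b]\<close>, generates a Stieltjes
  measure \<open>\<nu>\<close>. The cell condition makes \<open>\<nu>\<close> small on open sets of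
  small Lebesgue measure, hence absolutely continuous by outer regularity; the Radon-Nikodym density
  is the function sought.\<close>

lemma cell_AC_prim:
  assumes mono: "mono_on {a..b} M" and AC: "cell_AC a b M" and ab: "a < b"
  obtains g :: "real \<Rightarrow> real" where "prim_on {a..b} M g"
proof -
  define C where "C x = max a (min b x)" for x
  define M' where "M' x = M (C x)" for x
  have C: "a \<le> C x" "C x \<le> b" "x \<le> y \<Longrightarrow> C x \<le> C y" "x \<le> y \<Longrightarrow> C y - C x \<le> y - x" for x y
    using ab by (auto simp: C_def)
  have mono': "M' x \<le> M' y" if "x \<le> y" for x y
    unfolding M'_def using C that by (intro mono_onD[OF mono]) auto
  have cont: "continuous (at_right x) M'" for x
    unfolding continuous_within tendsto_iff
  proof (intro allI impI)
    fix e :: real assume e: "e > 0"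
    obtain d where d: "d > 0" "\<And>x y. a \<le> x \<Longrightarrow> x \<le> y \<Longrightarrow> y \<le> b \<Longrightarrow> y - x < d \<Longrightarrow> M y - M x \<le> e/2"
      using cell_AC_imp_small[OF AC, of "e/2"] e by (auto)
    have "dist (M' y) (M' x) < e" if "x < y" "y < x + d" for y
    proof -
      have "M' y - M' x \<le> e/2" unfolding M'_def
        using C(1,2)[of x] C(1,2)[of y] C(3,4)[of x y] that by (intro d(2)) auto
      then show ?thesis using mono'[of x y] that e by (simp add: dist_real_def)
    qed
    then show "\<forall>\<^sub>F y in at_right x. dist (M' y) (M' x) < e"
      unfolding eventually_at_right_field using d(1) by (intro exI[of _ "x + d"]) auto
  qed
  define \<nu> where "\<nu> = interval_measure M'"
  have nu: "emeasure \<nu> {x<..y} = ennreal (M' y - M' x)" if "x \<le> y" for x y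
    unfolding \<nu>_def using mono' cont that by (intro emeasure_interval_measure_Ioc) auto
  have sets_nu[measurable_cong, simp]: "sets \<nu> = sets borel" by (simp add: \<nu>_def)
  have out: "emeasure \<nu> (- {a<..b}) = 0"
  proof -
    have "{- real n + a<..a} \<union> {b<..b + real n} \<in> null_sets \<nu>" for n
    proof -
      have "emeasure \<nu> {- real n + a<..a} = 0"
        using C ab by (subst nu) (auto simp: M'_def C_def max_def min_def)
      moreover have "emeasure \<nu> {b<..b + real n} = 0"
        using ab by (subst nu) (auto simp: M'_def C_def max_def min_def)
      ultimately show ?thesis by (intro null_sets.Un null_setsI) auto
    qed
    then have "(\<Union>n. {- real n + a<..a} \<union> {b<..b + real n}) \<in> null_sets \<nu>"
      by blast
    moreover have "- {a<..b} \<subseteq> (\<Union>n. {- real n + a<..a} \<union> {b<..b + real n})"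
    proof
      fix x assume "x \<in> - {a<..b}"
      moreover obtain n where "\<bar>x - a\<bar> + \<bar>x - b\<bar> < real n" using reals_Archimedean2 by blast
      ultimately show "x \<in> (\<Union>n. {- real n + a<..a} \<union> {b<..b + real n})"
        by (intro UN_I[of n]) auto
    qed
    ultimately have "- {a<..b} \<in> null_sets \<nu>" using null_sets_subset[of _ \<nu> "- {a<..b}"] by simp
    then show ?thesis by auto
  qed
  \<comment> \<open>An open \<open>U\<close> is approximated from inside by the union
    \<open>W m\<close> of those cells of the grid with \<open>m + 1\<close> cells that lie in
    \<open>U\<close>. The cell condition bounds \<open>\<nu>\<close> on each
    \<open>W m\<close>.\<close>
  have small: "\<exists>\<delta>>0. \<forall>U. open U \<and> emeasure lborel U < ennreal \<delta> \<longrightarrow> emeasure \<nu> U \<le> ennreal \<epsilon>"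
    if e: "\<epsilon> > 0" for \<epsilon>
  proof -
    obtain d where d: "d > 0" "\<And>(t::nat \<Rightarrow> real) N S. mono t \<and> a \<le> t 0 \<and> t N \<le> b \<and>
     (\<Sum>k\<in>S \<inter> {..<N}. t (Suc k) - t k) < d \<Longrightarrow> (\<Sum>k\<in>S \<inter> {..<N}. M (t (Suc k)) - M (t k)) \<le> \<epsilon>"
      using AC e unfolding cell_AC_def by blast
    show ?thesis
    proof (intro exI[of _ d] conjI d(1) allI impI)
      fix U :: "real set" assume U: "open U \<and> emeasure lborel U < ennreal d"
      define h where "h m = (b - a) / real (Suc m)" for m
      define t where "t m k = a + real k * h m" for m k
      define S where "S m = {k. {t m k<..t m (Suc k)} \<subseteq> U}" for m
      define W where "W m = (\<Union>k\<in>S m \<inter> {..<Suc m}. {t m k<..t m (Suc k)})" for m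
      have h: "h m > 0" for m using ab by (simp add: h_def)
      have tm: "t m k \<le> t m l" if "k \<le> l" for m k l
        using that h[of m] by (simp add: t_def)
      have t0: "t m 0 = a" and tN: "t m (Suc m) = b" for m by (simp_all add: t_def h_def)
      have tin: "a \<le> t m k" "k \<le> Suc m \<Longrightarrow> t m k \<le> b" for m k
        using tm[of 0 k m] tm[of k "Suc m" m] t0 tN by auto
      have Wm: "W m \<in> sets borel" for m unfolding W_def by auto
      have nuW: "emeasure \<nu> (W m) \<le> ennreal \<epsilon>" for m
      proof -
        have disj: "disjoint_family_on (\<lambda>k. {t m k<..t m (Suc k)}) (S m \<inter> {..<Suc m})"
          unfolding disjoint_family_on_def
        proof (intro ballI impI)
          fix k l :: nat assume "k \<noteq> l"
          then consider "Suc k \<le> l" | "Suc l \<le> k" by linarith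
          then show "{t m k<..t m (Suc k)} \<inter> {t m l<..t m (Suc l)} = {}"
            by cases (use tm[of "Suc k" l m] tm[of "Suc l" k m] in auto)
        qed
        have "emeasure lborel (W m) = (\<Sum>k\<in>S m \<inter> {..<Suc m}. emeasure lborel {t m k<..t m (Suc k)})"
          unfolding W_def by (rule sum_emeasure[symmetric]) (use disj in auto)
        also have "\<dots> = (\<Sum>k\<in>S m \<inter> {..<Suc m}. ennreal (t m (Suc k) - t m k))"
          by (intro sum.cong refl) (simp add: tm)
        also have "\<dots> = ennreal (\<Sum>k\<in>S m \<inter> {..<Suc m}. t m (Suc k) - t m k)"
          by (rule sum_ennreal) (simp add: tm)
        finally have "emeasure lborel (W m) = ennreal (\<Sum>k\<in>S m \<inter> {..<Suc m}. t m (Suc k) - t m k)" .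
        moreover have WU: "W m \<subseteq> U" unfolding W_def S_def by blast
        ultimately have "ennreal (\<Sum>k\<in>S m \<inter> {..<Suc m}. t m (Suc k) - t m k) \<le> emeasure lborel U"
          using emeasure_mono[of "W m" U lborel] WU U by simp
        then have "(\<Sum>k\<in>S m \<inter> {..<Suc m}. t m (Suc k) - t m k) < d"
          using U le_less_trans by (subst ennreal_less_iff[symmetric]) (auto intro!: sum_nonneg tm)
        then have le: "(\<Sum>k\<in>S m \<inter> {..<Suc m}. M (t m (Suc k)) - M (t m k)) \<le> \<epsilon>"
          using tm t0 tN by (intro d(2)) (auto simp: mono_def)
        have "emeasure \<nu> (W m) \<le> (\<Sum>k\<in>S m \<inter> {..<Suc m}. emeasure \<nu> {t m k<..t m (Suc k)})"
          unfolding W_def by (rule emeasure_subadditive_finite) auto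
        also have "\<dots> = (\<Sum>k\<in>S m \<inter> {..<Suc m}. ennreal (M (t m (Suc k)) - M (t m k)))"
        proof (intro sum.cong refl)
          fix k assume "k \<in> S m \<inter> {..<Suc m}"
          then have "C (t m k) = t m k" "C (t m (Suc k)) = t m (Suc k)"
            using tin(1)[of m k] tin(2)[of k m] tin(1)[of m "Suc k"] tin(2)[of "Suc k" m]
            by (auto simp: C_def)
          then show "emeasure \<nu> {t m k<..t m (Suc k)} = ennreal (M (t m (Suc k)) - M (t m k))"
            using nu[OF tm[of k "Suc k" m]] by (simp add: M'_def)
        qed
        also have "\<dots> = ennreal (\<Sum>k\<in>S m \<inter> {..<Suc m}. M (t m (Suc k)) - M (t m k))"
        proof (rule sum_ennreal)
          fix k assume "k \<in> S m \<inter> {..<Suc m}"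
          then show "0 \<le> M (t m (Suc k)) - M (t m k)"
            using tin[of m k] tin[of m "Suc k"] tin(2)[of "Suc k" m] tin(2)[of k m] tm[of k "Suc k" m]
            by (simp add: mono_onD[OF mono])
        qed
        also have "\<dots> \<le> ennreal \<epsilon>" by (rule ennreal_leI[OF le])
        finally show ?thesis .
      qed
      \<comment> \<open>The grids are not nested, so \<open>W\<close> need not increase. The sets
        \<open>V n\<close> do, and they exhaust the part of \<open>U\<close> in
        \<open>{a<..b}\<close>, because a point of it lies in \<open>W m\<close> for all large
        \<open>m\<close>.\<close>
      define V where "V n = (\<Inter>m\<in>{n..}. W m)" for n
      have Vs: "V n \<in> sets \<nu>" for n unfolding V_def using Wm by (auto intro!: sets.countable_INT'')
      have incV: "incseq V" unfolding V_def incseq_def by (auto; meson order_trans)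
      have nuV: "emeasure \<nu> (V n) \<le> ennreal \<epsilon>" for n
        using emeasure_mono[of "V n" "W n" \<nu>] nuW[of n] Wm[of n] unfolding V_def
        by (auto intro: order_trans)
      have cover: "U \<inter> {a<..b} \<subseteq> (\<Union>n. V n)"
      proof
        fix x assume x: "x \<in> U \<inter> {a<..b}"
        then obtain r where r: "r > 0" "ball x r \<subseteq> U" using U open_contains_ball by blast
        obtain n :: nat where n: "(b - a) / r < real n" using reals_Archimedean2 by blast
        have "x \<in> W m" if m: "n \<le> m" for m
        proof -
          \<comment> \<open>Cells are open on the left and closed on the right, so a grid point
            belongs to the cell that ends there; hence the ceiling minus one.\<close>
          define k where "k = nat (\<lceil>(x - a) / h m\<rceil> - 1)"
          have pos: "(x - a) / h m > 0" using x h[of m] by simp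
          then have rk: "real k < (x - a) / h m" "(x - a) / h m \<le> real k + 1"
            unfolding k_def using le_of_int_ceiling[of "(x - a) / h m"] by linarith+
          have hm: "h m < r"
          proof -
            have "(b - a) / r < real (Suc m)" using n m by linarith
            then show ?thesis unfolding h_def using r(1) by (simp add: field_simps)
          qed
          have xt: "t m k < x" "x \<le> t m (Suc k)"
            using rk h[of m] by (auto simp: t_def field_simps)
          have "k < Suc m"
          proof -
            have "real k * h m < real (Suc m) * h m"
              using xt(1) x by (simp add: t_def h_def)
            then show ?thesis using h[of m] by (simp add: mult_less_cancel_right)
          qed
          moreover have "{t m k<..t m (Suc k)} \<subseteq> ball x r"
            using xt hm by (auto simp: dist_real_def t_def algebra_simps)
          ultimately show ?thesis unfolding W_def S_def using r(2) xt by auto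
        qed
        then show "x \<in> (\<Union>n. V n)" unfolding V_def by blast
      qed
      have "emeasure \<nu> U \<le> emeasure \<nu> ((\<Union>n. V n) \<union> - {a<..b})"
        using cover U Vs by (intro emeasure_mono) auto
      also have "\<dots> \<le> emeasure \<nu> (\<Union>n. V n) + emeasure \<nu> (- {a<..b})"
        using Vs by (intro emeasure_subadditive) auto
      also have "\<dots> = (SUP n. emeasure \<nu> (V n))"
        using out SUP_emeasure_incseq[OF _ incV, of \<nu>] Vs by (auto simp: image_subset_iff)
      also have "\<dots> \<le> ennreal \<epsilon>" using nuV by (intro SUP_least)
      finally show "emeasure \<nu> U \<le> ennreal \<epsilon>" .
    qed
  qed
  \<comment> \<open>A null set lies in open sets of arbitrarily small Lebesgue measure, on which
    \<open>small\<close> applies.\<close>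
  have ac: "absolutely_continuous lborel \<nu>"
    unfolding absolutely_continuous_def
  proof
    fix Z :: "real set" assume Z: "Z \<in> null_sets lborel"
    have "emeasure \<nu> Z \<le> 0 + ennreal e" if e: "e > 0" for e
    proof -
      obtain d where d: "d > 0" "\<And>U. open U \<Longrightarrow> emeasure lborel U < ennreal d \<Longrightarrow> emeasure \<nu> U \<le> ennreal e"
        using small[OF e] by blast
      have Zb: "Z \<in> sets borel" "emeasure lborel Z = 0" using Z by auto
      obtain U where U: "open U" "Z \<subseteq> U" "emeasure lborel (U - Z) < ennreal d"
        using outer_regular_lborel[OF Zb(1) d(1)] by metis
      have "emeasure lborel U \<le> emeasure lborel (U - Z) + emeasure lborel Z"
        by (metis U(1,2) Zb(1) Un_Diff_cancel2 Un_absorb2 borel_open emeasure_subadditive sets.Diff sets_lborel)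
      then have "emeasure \<nu> U \<le> ennreal e" using U Zb by (intro d(2)) auto
      then show ?thesis using emeasure_mono[OF U(2), of \<nu>] U(1) by (auto intro: order_trans)
    qed
    then have "emeasure \<nu> Z = 0" by (metis ennreal_le_epsilon le_zero_eq)
    then show "Z \<in> null_sets \<nu>" using Z by (intro null_setsI) auto
  qed
  obtain f where f: "f \<in> borel_measurable lborel" "density lborel f = \<nu>"
    using sigma_finite_measure.Radon_Nikodym[OF sigma_finite_lborel ac] by auto
  have fint: "(\<integral>\<^sup>+z. f z * indicator {x<..y} z \<partial>lborel) = ennreal (M y - M x)"
    if "a \<le> x" "x \<le> y" "y \<le> b" for x y
  proof -
    have "C x = x" "C y = y" using that by (auto simp: C_def)
    then show ?thesis using nu[OF that(2)] f emeasure_density[OF f(1), of "{x<..y}"] by (simp add: M'_def)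
  qed
  have "AE z in lborel. f z * indicator {a<..b} z \<noteq> \<infinity>"
    using f(1) fint[of a b] ab by (intro nn_integral_PInf_AE) auto
  then have fin: "AE z in lborel. z \<in> {a<..b} \<longrightarrow> f z < \<infinity>"
    by eventually_elim (auto simp: less_top)
  define g where "g z = enn2real (f z)" for z
  have [measurable]: "f \<in> borel_measurable borel" using f(1) by simp
  have g[measurable]: "g \<in> borel_measurable borel" unfolding g_def by measurable
  have gi: "(g has_integral (M y - M x)) {x..y}" if xy: "a \<le> x" "x \<le> y" "y \<le> b" for x y
  proof (rule has_integral_nonneg_measure[OF _ xy(2)], rule has_bochner_integral_nn_integral)
    show "(\<integral>\<^sup>+ z. ennreal (g z * indicator {x<..y} z) \<partial>lborel) = ennreal (M y - M x)"
      unfolding fint[OF xy, symmetric] 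
    proof (rule nn_integral_cong_AE)
      show "AE z in lborel. ennreal (g z * indicator {x<..y} z) = f z * indicator {x<..y} z"
        using fin by eventually_elim (use xy in \<open>auto simp: indicator_def g_def\<close>)
    qed
  qed (use mono_onD[OF mono, of x y] xy in \<open>auto simp: g_def\<close>)
  show ?thesis
  proof (rule that[of g])
    show "prim_on {a..b} M g"
      unfolding prim_on_def
    proof (intro ballI impI conjI)
      fix x y assume "x \<in> {a..b}" "y \<in> {a..b}" "x \<le> y"
      then have "(g has_integral (M y - M x)) {x..y}" by (intro gi) auto
      then show "(g has_integral (M y - M x)) {x..y}" "g absolutely_integrable_on {x..y}"
        by (auto intro!: nonnegative_absolutely_integrable_1 simp: g_def has_integral_iff)
    qed
  qed
qed

section \<open>Calculus of primitives\<close>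

lemma prim_on_linear:
  assumes "bounded_linear h" "prim_on I F g"
  shows "prim_on I (\<lambda>x. h (F x)) (\<lambda>x. h (g x))"
  unfolding prim_on_def
proof (intro ballI impI conjI)
  fix a b assume ab: "a \<in> I" "b \<in> I" "a \<le> b"
  note * = prim_onD[OF assms(2) ab]
  show "(\<lambda>x. h (g x)) absolutely_integrable_on {a..b}"
    using absolutely_integrable_linear[OF *(1) assms(1)] by (simp add: o_def)
  show "((\<lambda>x. h (g x)) has_integral h (F b) - h (F a)) {a..b}"
    using has_integral_linear[OF *(2) assms(1)]
    by (simp add: o_def linear_diff[OF bounded_linear.linear[OF assms(1)]])
qed

lemma prim_on_add:
  assumes "prim_on I F f" "prim_on I G g"
  shows "prim_on I (\<lambda>x. F x + G x) (\<lambda>x. f x + g x)"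
  unfolding prim_on_def
proof (intro ballI impI conjI)
  fix a b assume ab: "a \<in> I" "b \<in> I" "a \<le> b"
  show "(\<lambda>x. f x + g x) absolutely_integrable_on {a..b}"
    using prim_onD(1)[OF assms(1) ab] prim_onD(1)[OF assms(2) ab] by (rule set_integral_add(1))
  show "((\<lambda>x. f x + g x) has_integral F b + G b - (F a + G a)) {a..b}"
    using has_integral_add[OF prim_onD(2)[OF assms(1) ab] prim_onD(2)[OF assms(2) ab]]
    by (simp add: algebra_simps)
qed

lemma prim_on_diff:
  assumes "prim_on I F f" "prim_on I G g"
  shows "prim_on I (\<lambda>x. F x - G x) (\<lambda>x. f x - g x)"
  using prim_on_add[OF assms(1) prim_on_linear[OF bounded_linear_minus[OF bounded_linear_ident] assms(2)]]
  by simp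

lemma prim_on_const: "prim_on I (\<lambda>x. c) (\<lambda>x. 0)"
  unfolding prim_on_def set_integrable_def scaleR_zero_right diff_self
  by (intro ballI impI conjI integrable_zero has_integral_0)

lemma interval_sub:
  assumes I: "is_interval (I::real set)" and ab: "a \<in> I" "b \<in> I"
  shows "{a..b} \<subseteq> I"
proof
  fix x assume "x \<in> {a..b}"
  then show "x \<in> I" using I[unfolded is_interval_1, rule_format, OF ab, of x] by simp
qed

lemma prim_on_cong_AE:
  assumes "prim_on I F g" "AE x in lebesgue. x \<in> I \<longrightarrow> g x = g' x" "\<And>x. x \<in> I \<Longrightarrow> F x = F' x"
    and I: "is_interval I"
  shows "prim_on I F' g'"
  unfolding prim_on_def
proof (intro ballI impI conjI)
  fix a b assume ab: "a \<in> I" "b \<in> I" "a \<le> b"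
  have sub: "{a..b} \<subseteq> I" using interval_sub[OF I ab(1,2)] .
  obtain N where N: "N \<in> null_sets lebesgue" "{x \<in> space lebesgue. \<not> (x \<in> I \<longrightarrow> g x = g' x)} \<subseteq> N"
    using assms(2) unfolding eventually_ae_filter by auto
  have neg: "negligible N" using N(1) by (simp add: negligible_iff_null_sets)
  have eq: "g' x = g x" if x: "x \<in> {a..b} - N" for x
  proof (rule ccontr)
    assume "g' x \<noteq> g x"
    then have "x \<in> {x \<in> space lebesgue. \<not> (x \<in> I \<longrightarrow> g x = g' x)}" using x sub by auto
    then show False using N(2) x by blast
  qed
  show "g' absolutely_integrable_on {a..b}"
    using absolutely_integrable_spike[OF prim_onD(1)[OF assms(1) ab] neg eq] .
  show "(g' has_integral F' b - F' a) {a..b}"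
    using has_integral_spike[OF neg eq prim_onD(2)[OF assms(1) ab]] ab assms(3) by simp
qed

text \<open>The density is cut at height \<open>n\<close>. The excess over \<open>n\<close> has
  integral below \<open>e / 2\<close> on all of \<open>[a, b]\<close>, and the bounded rest
  contributes at most \<open>n\<close> times the total length, which the choice of \<open>d\<close>
  keeps below \<open>e / 2\<close>.\<close>

lemma prim_on_AC:
  fixes F :: "real \<Rightarrow> 'a::euclidean_space"
  assumes P: "prim_on {a..b} F g" and ab: "a \<le> b"
  shows "absolutely_continuous_on a b F"
  unfolding absolutely_continuous_on_def
proof (intro allI impI)
  fix e :: real assume e: "e > 0"
  define r where "r n x = max 0 (norm (g x) - real n)" for n x
  have gi: "g absolutely_integrable_on {a..b}" using prim_onD(1)[OF P] ab by simp
  have ngi: "set_integrable lebesgue {a..b} (\<lambda>x. norm (g x))"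
    using gi by (rule absolutely_integrable_norm[unfolded o_def])
  have ri: "set_integrable lebesgue {a..b} (r n)" for n
  proof -
    have "set_integrable lebesgue {a..b} (\<lambda>x. max 0 (norm (g x) - real n))"
      by (intro absolutely_integrable_max_1 set_integral_diff ngi) auto
    then show ?thesis by (simp add: r_def[abs_def])
  qed
  have "(\<lambda>n. LINT x|lebesgue. indicator {a..b} x *\<^sub>R r n x) \<longlonglongrightarrow> (LINT x|(lebesgue::real measure). 0)"
  proof (rule integral_dominated_convergence[where w = "\<lambda>x. indicator {a..b} x *\<^sub>R norm (g x)"])
    show "integrable lebesgue (\<lambda>x. indicat_real {a..b} x *\<^sub>R norm (g x))"
      using ngi by (simp add: set_integrable_def)
    show "(\<lambda>x. indicator {a..b} x *\<^sub>R r n x) \<in> borel_measurable lebesgue" for n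
      using ri[of n] by (simp add: set_integrable_def borel_measurable_integrable)
    show "AE x in lebesgue. (\<lambda>n. indicat_real {a..b} x *\<^sub>R r n x) \<longlonglongrightarrow> 0"
    proof (rule AE_I2)
      fix x
      obtain m :: nat where m: "norm (g x) \<le> real m" using real_arch_simple by blast
      have "\<forall>\<^sub>F n in sequentially. indicat_real {a..b} x *\<^sub>R r n x = 0"
        using eventually_ge_at_top[of m] by eventually_elim (use m in \<open>auto simp: r_def max_def\<close>)
      then show "(\<lambda>n. indicat_real {a..b} x *\<^sub>R r n x) \<longlonglongrightarrow> 0" by (rule tendsto_eventually)
    qed
    show "AE x in lebesgue. norm (indicat_real {a..b} x *\<^sub>R r n x) \<le> indicat_real {a..b} x *\<^sub>R norm (g x)" for n
      by (auto simp: r_def indicator_def)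
  qed auto
  then have "(\<lambda>n. LINT x|lebesgue. indicator {a..b} x *\<^sub>R r n x) \<longlonglongrightarrow> 0" by simp
  then have "\<forall>\<^sub>F n in sequentially. (LINT x|lebesgue. indicator {a..b} x *\<^sub>R r n x) < e/2"
    using e by (intro order_tendstoD(2)) auto
  then obtain n where "(LINT x|lebesgue. indicator {a..b} x *\<^sub>R r n x) < e/2"
    using eventually_happens'[OF sequentially_bot] by blast
  then have n: "integral {a..b} (r n) < e/2"
    using set_lebesgue_integral_eq_integral(2)[OF ri[of n]] by (simp add: set_lebesgue_integral_def)
  define d where "d = e / (2 * (real n + 1))"
  have d: "d > 0" "real n * d < e/2" using e by (auto simp: d_def field_simps)
  show "\<exists>\<delta>>0. \<forall>m (u::nat \<Rightarrow> real) v. (\<forall>i<m. a \<le> u i \<and> u i \<le> v i \<and> v i \<le> b) \<and>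
        (\<forall>i<m. \<forall>j<m. i \<noteq> j \<longrightarrow> {u i<..<v i} \<inter> {u j<..<v j} = {}) \<and>
        (\<Sum>i<m. v i - u i) < \<delta> \<longrightarrow> (\<Sum>i<m. norm (F (v i) - F (u i))) < e"
  proof (intro exI[of _ d] conjI d(1) allI impI)
    fix m :: nat and u v :: "nat \<Rightarrow> real"
    assume A: "(\<forall>i<m. a \<le> u i \<and> u i \<le> v i \<and> v i \<le> b) \<and>
        (\<forall>i<m. \<forall>j<m. i \<noteq> j \<longrightarrow> {u i<..<v i} \<inter> {u j<..<v j} = {}) \<and> (\<Sum>i<m. v i - u i) < d"
    have rint: "r n integrable_on {u i..v i}" if "i < m" for i
      using set_lebesgue_integral_eq_integral(1)[OF ri[of n]] by (rule integrable_on_subinterval) (use A that in auto)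
    have 1: "norm (F (v i) - F (u i)) \<le> real n * (v i - u i) + integral {u i..v i} (r n)" if i: "i < m" for i
    proof -
      have uv: "u i \<in> {a..b}" "v i \<in> {a..b}" "u i \<le> v i" using A i by force+
      have "norm (integral {u i..v i} g) \<le> integral {u i..v i} (\<lambda>x. real n + r n x)"
      proof (rule integral_norm_bound_integral)
        show "g integrable_on {u i..v i}" using prim_onD(2)[OF P uv] by blast
        show "(\<lambda>x. real n + r n x) integrable_on {u i..v i}" using rint[OF i] by (intro integrable_add) auto
      qed (auto simp: r_def)
      also have "\<dots> = real n * (v i - u i) + integral {u i..v i} (r n)"
        using rint[OF i] uv by (subst integral_add) auto
      finally show ?thesis using prim_onD(3)[OF P uv] by simp
    qed
    have "((r n) has_integral (\<Sum>i<m. integral {u i..v i} (r n))) (\<Union>i<m. {u i..v i})"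
    proof (rule has_integral_UN)
      show "pairwise (\<lambda>i i'. negligible ({u i..v i} \<inter> {u i'..v i'})) {..<m}"
        unfolding pairwise_def
      proof (intro ballI impI)
        fix i j assume ij: "i \<in> {..<m}" "j \<in> {..<m}" "i \<noteq> j"
        then have "{u i<..<v i} \<inter> {u j<..<v j} = {}" using A by simp
        moreover have "{u i..v i} \<inter> {u j..v j} \<subseteq> ({u i<..<v i} \<inter> {u j<..<v j}) \<union> {u i, v i, u j, v j}" by auto
        ultimately show "negligible ({u i..v i} \<inter> {u j..v j})"
          using negligible_subset[of "{u i, v i, u j, v j}"] by auto
      qed
    qed (use rint in \<open>auto simp: integrable_integral\<close>)
    then have "(\<Sum>i<m. integral {u i..v i} (r n)) \<le> integral {a..b} (r n)"
    proof (rule has_integral_subset_le[rotated])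
      show "(r n has_integral integral {a..b} (r n)) {a..b}"
        using set_lebesgue_integral_eq_integral(1)[OF ri[of n]] by (rule integrable_integral)
      show "(\<Union>i<m. {u i..v i}) \<subseteq> {a..b}"
      proof
        fix x assume "x \<in> (\<Union>i<m. {u i..v i})"
        then obtain i where "i < m" "u i \<le> x" "x \<le> v i" by auto
        then show "x \<in> {a..b}" using A by (meson atLeastAtMost_iff order_trans)
      qed
    qed (simp add: r_def)
    moreover have "(\<Sum>i<m. norm (F (v i) - F (u i))) \<le> (\<Sum>i<m. real n * (v i - u i) + integral {u i..v i} (r n))"
      using 1 by (intro sum_mono) auto
    moreover have "(\<Sum>i<m. real n * (v i - u i)) \<le> real n * d"
      using A by (simp add: sum_distrib_left[symmetric] mult_left_mono)
    ultimately show "(\<Sum>i<m. norm (F (v i) - F (u i))) < e"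
      using n d by (simp add: sum.distrib)
  qed
qed

lemma AC_continuous:
  fixes F :: "real \<Rightarrow> 'a::real_normed_vector"
  assumes "absolutely_continuous_on a b F"
  shows "continuous_on {a..b} F"
  unfolding continuous_on_iff
proof (intro ballI allI impI)
  fix x e :: real assume x: "x \<in> {a..b}" "e > 0"
  then obtain d where d: "d > 0" "\<And>n (u::nat\<Rightarrow>real) v. (\<forall>i<n. a \<le> u i \<and> u i \<le> v i \<and> v i \<le> b) \<and>
        (\<forall>i<n. \<forall>j<n. i \<noteq> j \<longrightarrow> {u i<..<v i} \<inter> {u j<..<v j} = {}) \<and>
        (\<Sum>i<n. v i - u i) < d \<Longrightarrow> (\<Sum>i<n. norm (F (v i) - F (u i))) < e"
    using assms unfolding absolutely_continuous_on_def by blast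
  have "dist (F y) (F x) < e" if y: "y \<in> {a..b}" "dist y x < d" for y
  proof (cases "x \<le> y")
    case True
    then show ?thesis using d(2)[of 1 "\<lambda>_. x" "\<lambda>_. y"] x y by (auto simp: dist_norm)
  next
    case False
    then show ?thesis using d(2)[of 1 "\<lambda>_. y" "\<lambda>_. x"] x y by (auto simp: dist_norm norm_minus_commute)
  qed
  then show "\<exists>d>0. \<forall>y\<in>{a..b}. dist y x < d \<longrightarrow> dist (F y) (F x) < e" using d(1) by blast
qed

lemma prim_on_continuous:
  assumes "prim_on I F g" "{a..b} \<subseteq> I"
  shows "continuous_on {a..b} F"
proof (cases "a \<le> b")
  case True
  then show ?thesis using AC_continuous[OF prim_on_AC[OF prim_on_subset[OF assms]]] by simp
qed simp

text \<open>Lebesgue differentiation. \<open>integrable_ccontinuous_explicit\<close> treats averages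
  over intervals to the right of a point. Applied to the reflected density it treats those to the
  left, which is why the second exceptional set is evaluated at \<open>- x\<close>.\<close>

lemma prim_on_vector_derivative_AE:
  fixes F :: "real \<Rightarrow> 'a::euclidean_space"
  assumes P: "prim_on {a..b} F g"
  shows "AE x in lebesgue. x \<in> {a<..<b} \<longrightarrow> (F has_vector_derivative g x) (at x)"
proof (cases "a < b")
  case ab: True
  define f0 where "f0 x = (if x \<in> {a..b} then g x else 0)" for x
  have gi: "g integrable_on {a..b}" using prim_onD(2)[OF P, of a b] ab by auto
  have f0U: "f0 integrable_on UNIV" using gi unfolding f0_def integrable_restrict_UNIV .
  have f0i: "f0 integrable_on cbox x y" for x y
    using integrable_on_subcbox[OF f0U] by simp
  have f1i: "(\<lambda>x. f0 (- x)) integrable_on cbox x y" for x y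
    using f0i[of "-y" "-x"] Henstock_Kurzweil_Integration.integrable_reflect_real[where f = f0 and a = "-y" and b = "-x"] by simp
  obtain N1 where N1: "negligible N1" "\<And>x e. x \<notin> N1 \<Longrightarrow> 0 < e \<Longrightarrow> \<exists>d>0. \<forall>h. 0 < h \<and> h < d \<longrightarrow>
        norm (integral (cbox x (x + h *\<^sub>R One)) f0 /\<^sub>R h ^ DIM(real) - f0 x) < e"
    using integrable_ccontinuous_explicit[OF f0i] by blast
  obtain N2 where N2: "negligible N2" "\<And>x e. x \<notin> N2 \<Longrightarrow> 0 < e \<Longrightarrow> \<exists>d>0. \<forall>h. 0 < h \<and> h < d \<longrightarrow>
        norm (integral (cbox x (x + h *\<^sub>R One)) (\<lambda>x. f0 (- x)) /\<^sub>R h ^ DIM(real) - f0 (- x)) < e"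
    using integrable_ccontinuous_explicit[OF f1i] by blast
  have *: "(F has_vector_derivative g x) (at x)" if x: "x \<in> {a<..<b}" "x \<notin> N1" "- x \<notin> N2" for x
    unfolding has_vector_derivative_def has_derivative_at_alt
  proof (intro conjI allI impI)
    show "bounded_linear (\<lambda>y. y *\<^sub>R g x)" by (rule bounded_linear_scaleR_left)
    fix e :: real assume e: "e > 0"
    obtain d1 where d1: "d1 > 0" "\<And>h. 0 < h \<Longrightarrow> h < d1 \<Longrightarrow> norm (integral {x..x + h} f0 /\<^sub>R h - f0 x) < e"
      using N1(2)[OF x(2) e] by auto
    obtain d2 where d2: "d2 > 0" "\<And>h. 0 < h \<Longrightarrow> h < d2 \<Longrightarrow> norm (integral {- x..- x + h} (\<lambda>x. f0 (- x)) /\<^sub>R h - f0 x) < e"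
      using N2(2)[OF x(3) e] by auto
    define d where "d = min (min d1 d2) (min (b - x) (x - a))"
    have int: "integral {y..z} f0 = F z - F y" if "a \<le> y" "y \<le> z" "z \<le> b" for y z
    proof -
      have "integral {y..z} f0 = integral {y..z} g"
        by (rule integral_cong) (use that in \<open>auto simp: f0_def\<close>)
      then show ?thesis using prim_onD(3)[OF P, of y z] that by simp
    qed
    have scale: "norm (w - h *\<^sub>R z) \<le> e * h" if "norm (w /\<^sub>R h - z) < e" "h > 0" for h and w z :: 'a
    proof -
      have "w - h *\<^sub>R z = h *\<^sub>R (w /\<^sub>R h - z)" using that(2) by (simp add: scaleR_diff_right)
      then have "norm (w - h *\<^sub>R z) = h * norm (w /\<^sub>R h - z)" using that(2) by simp
      then show ?thesis using that by (simp add: mult.commute)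
    qed
    show "\<exists>d>0. \<forall>y. norm (y - x) < d \<longrightarrow> norm (F y - F x - (y - x) *\<^sub>R g x) \<le> e * norm (y - x)"
    proof (intro exI[of _ d] conjI allI impI)
      show "d > 0" using d1 d2 x by (simp add: d_def)
      fix y assume y: "norm (y - x) < d"
      have f0x: "f0 x = g x" using x by (simp add: f0_def)
      consider "y = x" | "y > x" | "y < x" by linarith
      then show "norm (F y - F x - (y - x) *\<^sub>R g x) \<le> e * norm (y - x)"
      proof cases
        case 2
        then have "norm (integral {x..x + (y - x)} f0 /\<^sub>R (y - x) - f0 x) < e"
          using y by (intro d1) (auto simp: d_def)
        then show ?thesis using scale[of "y - x" "F y - F x" "g x"] int[of x y] 2 x y
          by (simp add: f0x d_def)
      next
        case 3
        then have "norm (integral {- x..- x + (x - y)} (\<lambda>x. f0 (- x)) /\<^sub>R (x - y) - f0 x) < e"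
          using y by (intro d2) (auto simp: d_def)
        moreover have "integral {- x..- y} (\<lambda>x. f0 (- x)) = integral {y..x} f0"
          by (simp add: Henstock_Kurzweil_Integration.integral_reflect_real)
        ultimately have "norm ((F x - F y) - (x - y) *\<^sub>R g x) \<le> e * (x - y)"
          using scale[of "x - y" "F x - F y" "g x"] int[of y x] 3 x y by (simp add: f0x d_def)
        moreover have "F y - F x - (y - x) *\<^sub>R g x = - ((F x - F y) - (x - y) *\<^sub>R g x)"
          by (simp add: algebra_simps)
        ultimately show ?thesis using 3 by (metis abs_of_pos diff_gt_0_iff_gt norm_minus_cancel norm_minus_commute real_norm_def)
      qed simp
    qed
  qed
  have "AE x in lebesgue. x \<notin> N1" "AE x in lebesgue. x \<notin> N2"
    using N1(1) N2(1) by (auto simp: negligible_iff_null_sets intro: AE_not_in)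
  from this(1) AE_lebesgue_reflect[OF this(2)] show ?thesis
    by eventually_elim (use * in auto)
qed auto

lemma absolutely_continuous_onE:
  assumes "absolutely_continuous_on a b F" "e > 0"
  obtains d where "d > 0" "\<And>n (u::nat\<Rightarrow>real) v. (\<forall>i<n. a \<le> u i \<and> u i \<le> v i \<and> v i \<le> b) \<and>
        (\<forall>i<n. \<forall>j<n. i \<noteq> j \<longrightarrow> {u i<..<v i} \<inter> {u j<..<v j} = {}) \<and>
        (\<Sum>i<n. v i - u i) < d \<Longrightarrow> (\<Sum>i<n. norm (F (v i) - F (u i))) < e"
  using assms unfolding absolutely_continuous_on_def by blast

lemma AC_linear:
  assumes "bounded_linear h" "absolutely_continuous_on a b F"
  shows "absolutely_continuous_on a b (\<lambda>x. h (F x))"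
  unfolding absolutely_continuous_on_def
proof (intro allI impI)
  fix e :: real assume e: "e > 0"
  obtain K where K: "K > 0" "\<And>x. norm (h x) \<le> norm x * K"
    using bounded_linear.pos_bounded[OF assms(1)] by blast
  obtain d where d: "d > 0" "\<And>n (u::nat\<Rightarrow>real) v. (\<forall>i<n. a \<le> u i \<and> u i \<le> v i \<and> v i \<le> b) \<and>
        (\<forall>i<n. \<forall>j<n. i \<noteq> j \<longrightarrow> {u i<..<v i} \<inter> {u j<..<v j} = {}) \<and>
        (\<Sum>i<n. v i - u i) < d \<Longrightarrow> (\<Sum>i<n. norm (F (v i) - F (u i))) < e / K"
    by (rule absolutely_continuous_onE[OF assms(2) divide_pos_pos[OF e K(1)]]) (rule that)
  show "\<exists>\<delta>>0. \<forall>n (u :: nat \<Rightarrow> real) v.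
        (\<forall>i<n. a \<le> u i \<and> u i \<le> v i \<and> v i \<le> b) \<and>
        (\<forall>i<n. \<forall>j<n. i \<noteq> j \<longrightarrow> {u i<..<v i} \<inter> {u j<..<v j} = {}) \<and>
        (\<Sum>i<n. v i - u i) < \<delta> \<longrightarrow> (\<Sum>i<n. norm (h (F (v i)) - h (F (u i)))) < e"
  proof (intro exI[of _ d] conjI d(1) allI impI)
    fix n and u v :: "nat \<Rightarrow> real"
    assume A: "(\<forall>i<n. a \<le> u i \<and> u i \<le> v i \<and> v i \<le> b) \<and>
        (\<forall>i<n. \<forall>j<n. i \<noteq> j \<longrightarrow> {u i<..<v i} \<inter> {u j<..<v j} = {}) \<and>
        (\<Sum>i<n. v i - u i) < d"
    have "(\<Sum>i<n. norm (h (F (v i)) - h (F (u i)))) \<le> (\<Sum>i<n. norm (F (v i) - F (u i)) * K)"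
      by (intro sum_mono) (simp only: linear_diff[OF bounded_linear.linear[OF assms(1)], symmetric] K(2))
    also have "\<dots> < (e / K) * K"
      using mult_strict_right_mono[OF d(2)[OF A] K(1)] by (simp only: sum_distrib_right)
    finally show "(\<Sum>i<n. norm (h (F (v i)) - h (F (u i)))) < e" using K(1) by simp
  qed
qed

lemma AC_prim_real:
  fixes F :: "real \<Rightarrow> real"
  assumes "absolutely_continuous_on a b F" "a < b"
  obtains g where "prim_on {a..b} F g"
proof -
  obtain P Q where *: "mono_on {a..b} P" "mono_on {a..b} Q" "cell_AC a b P" "cell_AC a b Q"
    "\<And>x. F x = P x - Q x"
    using AC_decompose[OF assms(1) less_imp_le[OF assms(2)]] by metis
  obtain p q where "prim_on {a..b} P p" "prim_on {a..b} Q q"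
    using cell_AC_prim[OF *(1,3) assms(2)] cell_AC_prim[OF *(2,4) assms(2)] by metis
  from prim_on_diff[OF this] that show ?thesis by (simp add: *(5)[symmetric])
qed

lemma AE_not_eq_lebesgue: "AE x in lebesgue. x \<noteq> (c::real)"
  using AE_not_in[of "{c}" lebesgue] by (simp add: negligible_iff_null_sets[symmetric])

text \<open>A density, found for real and imaginary part separately, agrees almost everywhere with
  \<open>deriv1 F\<close>; the arbitrary values of \<open>deriv1 F\<close> at points of
  non-differentiability therefore do no harm.\<close>

lemma AC_deriv1:
  fixes F :: "real \<Rightarrow> complex"
  assumes AC: "absolutely_continuous_on a b F"
  shows "prim_on {a..b} F (deriv1 F)"
proof (cases "a < b")
  case ab: True
  obtain g1 where g1: "prim_on {a..b} (\<lambda>x. Re (F x)) g1"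
    using AC_prim_real[OF AC_linear[OF bounded_linear_Re AC] ab] by blast
  obtain g2 where g2: "prim_on {a..b} (\<lambda>x. Im (F x)) g2"
    using AC_prim_real[OF AC_linear[OF bounded_linear_Im AC] ab] by blast
  define g where "g x = complex_of_real (g1 x) + \<i> * complex_of_real (g2 x)" for x
  have "prim_on {a..b} (\<lambda>x. complex_of_real (Re (F x)) + \<i> * complex_of_real (Im (F x))) g"
    unfolding g_def
    by (intro prim_on_add prim_on_linear[OF bounded_linear_of_real g1]
        prim_on_linear[OF bounded_linear_mult_right] prim_on_linear[OF bounded_linear_of_real g2])
  then have P: "prim_on {a..b} F g" by (simp add: complex_eq[symmetric])
  have "AE x in lebesgue. x \<in> {a..b} \<longrightarrow> g x = deriv1 F x"
    using prim_on_vector_derivative_AE[OF P] AE_not_eq_lebesgue[of a] AE_not_eq_lebesgue[of b]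
    by eventually_elim (auto simp: deriv1_def vector_derivative_at)
  then show ?thesis
    by (rule prim_on_cong_AE[OF P]) (auto simp: is_interval_cc)
next
  case False
  then have "x = y" if "x \<in> {a..b}" "y \<in> {a..b}" for x y using that by auto
  moreover have "f absolutely_integrable_on {x..x}" for f :: "real \<Rightarrow> complex" and x
    by (rule absolutely_integrable_negligible) simp
  moreover have "(f has_integral F x - F x) {x..x}" for f F :: "real \<Rightarrow> complex" and x
    using has_integral_refl(2)[of f x] by simp
  ultimately show ?thesis unfolding prim_on_def by blast
qed

lemma prim_on_norm_diff_le:
  assumes "prim_on I F g" "u \<in> I" "v \<in> I" "u \<le> v"
  shows "norm (F v - F u) \<le> integral {u..v} (\<lambda>x. norm (g x))"
  using prim_onD[OF assms]
  by (metis absolutely_integrable_on_def integral_norm_bound_integral order_refl)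

lemma AC_mult:
  fixes F G :: "real \<Rightarrow> complex"
  assumes F: "absolutely_continuous_on a b F" and G: "absolutely_continuous_on a b G"
  shows "absolutely_continuous_on a b (\<lambda>x. F x * G x)"
  unfolding absolutely_continuous_on_def
proof (intro allI impI)
  fix e :: real assume e: "e > 0"
  have "bounded (F ` {a..b})" "bounded (G ` {a..b})"
    by (intro compact_imp_bounded compact_continuous_image AC_continuous F G compact_Icc)+
  then obtain A B where AB: "A > 0" "B > 0" "\<And>x. x \<in> {a..b} \<Longrightarrow> norm (F x) \<le> A"
    "\<And>x. x \<in> {a..b} \<Longrightarrow> norm (G x) \<le> B"
    unfolding bounded_pos by auto
  have eA: "e / (2 * A) > 0" and eB: "e / (2 * B) > 0" using e AB(1,2) by auto
  obtain d1 where d1: "d1 > 0" "\<And>n (u::nat\<Rightarrow>real) v. (\<forall>i<n. a \<le> u i \<and> u i \<le> v i \<and> v i \<le> b) \<and>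
        (\<forall>i<n. \<forall>j<n. i \<noteq> j \<longrightarrow> {u i<..<v i} \<inter> {u j<..<v j} = {}) \<and>
        (\<Sum>i<n. v i - u i) < d1 \<Longrightarrow> (\<Sum>i<n. norm (F (v i) - F (u i))) < e / (2 * B)"
    by (rule absolutely_continuous_onE[OF F eB]) (rule that)
  obtain d2 where d2: "d2 > 0" "\<And>n (u::nat\<Rightarrow>real) v. (\<forall>i<n. a \<le> u i \<and> u i \<le> v i \<and> v i \<le> b) \<and>
        (\<forall>i<n. \<forall>j<n. i \<noteq> j \<longrightarrow> {u i<..<v i} \<inter> {u j<..<v j} = {}) \<and>
        (\<Sum>i<n. v i - u i) < d2 \<Longrightarrow> (\<Sum>i<n. norm (G (v i) - G (u i))) < e / (2 * A)"
    by (rule absolutely_continuous_onE[OF G eA]) (rule that)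
  show "\<exists>\<delta>>0. \<forall>n (u :: nat \<Rightarrow> real) v.
        (\<forall>i<n. a \<le> u i \<and> u i \<le> v i \<and> v i \<le> b) \<and>
        (\<forall>i<n. \<forall>j<n. i \<noteq> j \<longrightarrow> {u i<..<v i} \<inter> {u j<..<v j} = {}) \<and>
        (\<Sum>i<n. v i - u i) < \<delta> \<longrightarrow> (\<Sum>i<n. norm (F (v i) * G (v i) - F (u i) * G (u i))) < e"
  proof (intro exI[of _ "min d1 d2"] conjI allI impI)
    fix n and u v :: "nat \<Rightarrow> real"
    assume *: "(\<forall>i<n. a \<le> u i \<and> u i \<le> v i \<and> v i \<le> b) \<and>
        (\<forall>i<n. \<forall>j<n. i \<noteq> j \<longrightarrow> {u i<..<v i} \<inter> {u j<..<v j} = {}) \<and>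
        (\<Sum>i<n. v i - u i) < min d1 d2"
    have "norm (F (v i) * G (v i) - F (u i) * G (u i)) \<le> B * norm (F (v i) - F (u i)) + A * norm (G (v i) - G (u i))"
      if i: "i < n" for i
    proof -
      have in_ab: "u i \<in> {a..b}" "v i \<in> {a..b}" using * i by force+
      have "F (v i) * G (v i) - F (u i) * G (u i) = G (v i) * (F (v i) - F (u i)) + F (u i) * (G (v i) - G (u i))"
        by (simp add: algebra_simps)
      then have "norm (F (v i) * G (v i) - F (u i) * G (u i)) \<le>
          norm (G (v i)) * norm (F (v i) - F (u i)) + norm (F (u i)) * norm (G (v i) - G (u i))"
        by (metis norm_mult norm_triangle_ineq)
      also have "\<dots> \<le> B * norm (F (v i) - F (u i)) + A * norm (G (v i) - G (u i))"
        using AB(3,4) in_ab by (intro add_mono mult_right_mono) auto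
      finally show ?thesis .
    qed
    then have "(\<Sum>i<n. norm (F (v i) * G (v i) - F (u i) * G (u i)))
      \<le> (\<Sum>i<n. B * norm (F (v i) - F (u i)) + A * norm (G (v i) - G (u i)))"
      by (intro sum_mono) auto
    also have "\<dots> = B * (\<Sum>i<n. norm (F (v i) - F (u i))) + A * (\<Sum>i<n. norm (G (v i) - G (u i)))"
      by (simp add: sum.distrib sum_distrib_left)
    also have "\<dots> < B * (e / (2 * B)) + A * (e / (2 * A))"
      using d1(2)[of n u v] d2(2)[of n u v] * AB(1,2) by (intro add_strict_mono mult_strict_left_mono) auto
    also have "\<dots> = e" using AB(1,2) by simp
    finally show "(\<Sum>i<n. norm (F (v i) * G (v i) - F (u i) * G (u i))) < e" .
  qed (use d1(1) d2(1) in simp)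
qed

text \<open>The product is absolutely continuous, hence the integral of its own derivative, and that
  derivative is computed almost everywhere by the pointwise product rule.\<close>

lemma prim_on_mult:
  fixes F G :: "real \<Rightarrow> complex"
  assumes F: "prim_on I F f" and G: "prim_on I G g" and I: "is_interval I"
  shows "prim_on I (\<lambda>x. F x * G x) (\<lambda>x. f x * G x + F x * g x)"
proof -
  have *: "prim_on {a..b} (\<lambda>x. F x * G x) (\<lambda>x. f x * G x + F x * g x)"
    if ab: "a \<in> I" "b \<in> I" "a \<le> b" for a b
  proof -
    note sub = interval_sub[OF I ab(1,2)]
    note F' = prim_on_subset[OF F sub] and G' = prim_on_subset[OF G sub]
    have P: "prim_on {a..b} (\<lambda>x. F x * G x) (deriv1 (\<lambda>x. F x * G x))"
      by (intro AC_deriv1 AC_mult prim_on_AC[OF F' ab(3)] prim_on_AC[OF G' ab(3)])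
    have "AE x in lebesgue. x \<in> {a..b} \<longrightarrow> deriv1 (\<lambda>x. F x * G x) x = f x * G x + F x * g x"
      using prim_on_vector_derivative_AE[OF F'] prim_on_vector_derivative_AE[OF G']
        AE_not_eq_lebesgue[of a] AE_not_eq_lebesgue[of b]
    proof eventually_elim
      case (elim x)
      show ?case
      proof
        assume "x \<in> {a..b}"
        then have "(F has_vector_derivative f x) (at x)" "(G has_vector_derivative g x) (at x)"
          using elim by auto
        from has_vector_derivative_mult[OF this]
        show "deriv1 (\<lambda>x. F x * G x) x = f x * G x + F x * g x"
          unfolding deriv1_def by (simp add: vector_derivative_at add.commute)
      qed
    qed
    then show ?thesis by (rule prim_on_cong_AE[OF P]) (auto simp: is_interval_cc)
  qed
  show ?thesis
    unfolding prim_on_def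
  proof (intro ballI impI)
    fix a b assume ab: "a \<in> I" "b \<in> I" "a \<le> b"
    then show "(\<lambda>x. f x * G x + F x * g x) absolutely_integrable_on {a..b} \<and>
       ((\<lambda>x. f x * G x + F x * g x) has_integral F b * G b - F a * G a) {a..b}"
      using prim_onD(1,2)[OF *[OF ab], of a b] by simp
  qed
qed

lemma prim_on_mult_real:
  fixes F G :: "real \<Rightarrow> real"
  assumes F: "prim_on I F f" and G: "prim_on I G g" and I: "is_interval I"
  shows "prim_on I (\<lambda>x. F x * G x) (\<lambda>x. f x * G x + F x * g x)"
  using prim_on_linear[OF bounded_linear_Re prim_on_mult[OF
      prim_on_linear[OF bounded_linear_of_real F] prim_on_linear[OF bounded_linear_of_real G] I]]
  by simp

text \<open>The iterated integrals of \<open>\<kappa>\<close>, which serve as majorants in the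
  Volterra and Gronwall estimates.\<close>

lemma prim_on_power_fact:
  fixes K :: "real \<Rightarrow> real"
  assumes K: "prim_on I K \<kappa>" and I: "is_interval I"
  shows "prim_on I (\<lambda>x. K x ^ Suc n / fact (Suc n)) (\<lambda>x. \<kappa> x * (K x ^ n / fact n))"
proof -
  have "prim_on I (\<lambda>x. K x ^ Suc n) (\<lambda>x. real (Suc n) * (\<kappa> x * K x ^ n))"
  proof (induction n)
    case 0
    show ?case using K by simp
  next
    case (Suc n)
    show ?case using prim_on_mult_real[OF K Suc I] by (simp add: algebra_simps)
  qed
  from prim_on_linear[OF bounded_linear_divide[of "fact (Suc n)"] this]
  show ?thesis by (simp add: field_simps del: of_nat_Suc)
qed

lemma prim_on_integral:
  fixes g :: "real \<Rightarrow> 'a::euclidean_space"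
  assumes "\<And>x. x \<in> I \<Longrightarrow> g absolutely_integrable_on {c..x}" and I: "I \<subseteq> {c..}"
  shows "prim_on I (\<lambda>x. integral {c..x} g) g"
  unfolding prim_on_def
proof (intro ballI impI conjI)
  fix a b assume ab: "a \<in> I" "b \<in> I" "a \<le> b"
  have ca: "c \<le> a" using I ab by auto
  show ai: "g absolutely_integrable_on {a..b}"
    by (rule set_integrable_subset[OF assms(1)[OF ab(2)]]) (use ca in auto)
  have "g integrable_on {c..b}" using assms(1)[OF ab(2)] by (rule set_lebesgue_integral_eq_integral(1))
  from Henstock_Kurzweil_Integration.integral_combine[OF ca ab(3) this]
  have "integral {a..b} g = integral {c..b} g - integral {c..a} g" by (simp add: algebra_simps)
  then show "(g has_integral integral {c..b} g - integral {c..a} g) {a..b}"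
    using integrable_integral[OF set_lebesgue_integral_eq_integral(1)[OF ai]] by simp
qed

lemma prim_on_vector_derivative:
  fixes F :: "real \<Rightarrow> 'a::euclidean_space"
  assumes P: "prim_on {a..b} F g" and g: "continuous_on {a..b} g" and x: "x \<in> {a<..<b}"
  shows "(F has_vector_derivative g x) (at x)"
proof -
  have "((\<lambda>u. integral {a..u} g) has_vector_derivative g x) (at x within {a..b})"
    using integral_has_vector_derivative[OF g] x by auto
  then have 1: "((\<lambda>u. F a + integral {a..u} g) has_vector_derivative g x) (at x within {a..b})"
    by (auto intro!: derivative_eq_intros)
  have "(F has_vector_derivative g x) (at x within {a..b})"
    by (rule has_vector_derivative_transform[OF _ _ 1]) (use x prim_onD(3)[OF P] in auto)
  then show ?thesis using x at_within_Icc_at[of a x b] by simp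
qed

section \<open>Boundary triplets and Weyl functions\<close>

lemma cinner_add_right: "cinner x (y + z) = cinner x y + cinner x (z::'a::complex_inner)"
  by (metis cinner_add_left cinner_commute complex_cnj_add)

lemma cinner_scaleC_right: "cinner x (a *\<^sub>C y) = cnj a * cinner x (y::'a::complex_inner)"
  by (metis cinner_commute cinner_scaleC_left complex_cnj_mult)

lemma scaleC_zero_left [simp]: "0 *\<^sub>C x = (0::'a::complex_inner)"
  using scaleR_scaleC[of 0 x] by simp

lemma scaleC_minus_one: "(-1) *\<^sub>C x = - (x::'a::complex_inner)"
  using scaleR_scaleC[of "-1" x] by simp

lemma scaleC_zero_right [simp]: "a *\<^sub>C (0::'a::complex_inner) = 0"
  using scaleC_add_right[of a 0 "0::'a"] by simp

lemma scaleC_minus_right: "a *\<^sub>C (- x) = - (a *\<^sub>C (x::'a::complex_inner))"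
  by (metis add_eq_0_iff scaleC_add_right scaleC_zero_right)

lemma scaleC_minus_left: "(- a) *\<^sub>C x = - (a *\<^sub>C (x::'a::complex_inner))"
  by (metis add_eq_0_iff scaleC_add_left scaleC_zero_left)

lemma scaleC_diff_right: "a *\<^sub>C (x - y) = a *\<^sub>C x - a *\<^sub>C (y::'a::complex_inner)"
  using scaleC_add_right[of a x "- y"] by (simp add: scaleC_minus_right)

lemma scaleC_diff_left: "(a - b) *\<^sub>C x = a *\<^sub>C x - b *\<^sub>C (x::'a::complex_inner)"
  using scaleC_add_left[of a "- b" x] by (simp add: scaleC_minus_left)

lemma cinner_zero_right [simp]: "cinner (x::'a::complex_inner) 0 = 0"
  using cinner_scaleC_right[of x 0 0] by simp

lemma cinner_minus_left: "cinner (- x) y = - cinner x (y::'a::complex_inner)"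
  using cinner_scaleC_left[of "-1" x y] by (simp add: scaleC_minus_one)

lemma cinner_minus_right: "cinner x (- y) = - cinner x (y::'a::complex_inner)"
  using cinner_scaleC_right[of x "-1" y] by (simp add: scaleC_minus_one)

lemma cinner_diff_left: "cinner (x - y) z = cinner x z - cinner y (z::'a::complex_inner)"
  using cinner_add_left[of x "- y" z] by (simp add: cinner_minus_left)

lemma cinner_diff_right: "cinner x (y - z) = cinner x y - cinner x (z::'a::complex_inner)"
  using cinner_add_right[of x y "- z"] by (simp add: cinner_minus_right)

lemma cinner_self: "cinner x x = complex_of_real ((norm (x::'a::complex_inner))\<^sup>2)"
proof (rule complex_eqI)
  show "Re (cinner x x) = Re (complex_of_real ((norm x)\<^sup>2))"
    using inner_Re_cinner[of x x] by (simp add: power2_norm_eq_inner)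
  have "Im (cinner x x) = Im (cnj (cinner x x))" by (subst cinner_commute) (rule refl)
  then show "Im (cinner x x) = Im (complex_of_real ((norm x)\<^sup>2))" by simp
qed

lemma norm_scaleC: "norm (a *\<^sub>C x) = cmod a * norm (x::'a::complex_inner)"
proof -
  have "complex_of_real ((norm (a *\<^sub>C x))\<^sup>2) = (a * cnj a) * complex_of_real ((norm x)\<^sup>2)"
    unfolding cinner_self[symmetric]
    by (simp add: cinner_scaleC_left cinner_scaleC_right)
  also have "\<dots> = complex_of_real ((cmod a * norm x)\<^sup>2)"
    by (simp only: complex_norm_square[symmetric] power_mult_distrib of_real_mult)
  finally have "(norm (a *\<^sub>C x))\<^sup>2 = (cmod a * norm x)\<^sup>2" by (simp only: of_real_eq_iff)
  then show ?thesis by (rule power2_eq_imp_eq) auto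
qed

lemma cinner_norm_le: "cmod (cinner x y) \<le> norm x * norm (y::'a::complex_inner)"
proof (cases "cinner x y = 0")
  case False
  define u where "u = cnj (cinner x y) / complex_of_real (cmod (cinner x y))"
  have u: "cmod u = 1" using False by (simp add: u_def norm_divide)
  have "u * cinner x y = (cinner x y * cnj (cinner x y)) / complex_of_real (cmod (cinner x y))"
    by (simp add: u_def)
  also have "\<dots> = complex_of_real (cmod (cinner x y))"
    using False by (simp add: complex_norm_square[symmetric] power2_eq_square)
  finally have "cmod (cinner x y) = inner (u *\<^sub>C x) y"
    by (simp add: inner_Re_cinner cinner_scaleC_left)
  also have "\<dots> \<le> norm (u *\<^sub>C x) * norm y" by (rule norm_cauchy_schwarz)
  finally show ?thesis using u by (simp add: norm_scaleC)
qed simp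

lemma bounded_linear_cinner_left: "bounded_linear (\<lambda>x. cinner x (y::'a::complex_inner))"
  by (rule bounded_linear_intro[where K = "norm y"])
     (simp_all add: cinner_add_left scaleR_scaleC cinner_scaleC_left scaleC_complex_def cinner_norm_le)

lemma bounded_linear_cinner_right: "bounded_linear (\<lambda>y. cinner (x::'a::complex_inner) y)"
  by (rule bounded_linear_intro[where K = "norm x"])
     (simp_all add: cinner_add_right scaleR_scaleC cinner_scaleC_right scaleC_complex_def cinner_norm_le mult.commute[of "norm _" "norm x"])

lemma bounded_linear_scaleC: "bounded_linear (\<lambda>x::'a::complex_inner. a *\<^sub>C x)"
  by (rule bounded_linear_intro[where K = "cmod a"])
     (auto simp: scaleC_add_right scaleR_scaleC scaleC_scaleC norm_scaleC mult.commute)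

lemma csubspaceD:
  assumes "csubspace V"
  shows "0 \<in> V" "x \<in> V \<Longrightarrow> y \<in> V \<Longrightarrow> x + y \<in> V" "x \<in> V \<Longrightarrow> a *\<^sub>C x \<in> V" "x \<in> V \<Longrightarrow> y \<in> V \<Longrightarrow> x - y \<in> V"
proof -
  show 1: "0 \<in> V" "x \<in> V \<Longrightarrow> y \<in> V \<Longrightarrow> x + y \<in> V" "x \<in> V \<Longrightarrow> a *\<^sub>C x \<in> V" for a x y
    using assms unfolding csubspace_def by blast+
  show "x \<in> V \<Longrightarrow> y \<in> V \<Longrightarrow> x - y \<in> V"
    using 1(2)[of x "(-1) *\<^sub>C y"] 1(3)[of y "-1"] by (simp add: scaleC_minus_one)
qed

text \<open>Stated over the reals so that it serves complex Hilbert spaces, through real parts, as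
  well as the space of boundary values. The parallelogram identity makes a minimising sequence
  Cauchy.\<close>

lemma closed_subspace_projection:
  fixes V :: "'a::{real_inner,complete_space} set"
  assumes V: "subspace V" and cl: "closed V"
  obtains v where "v \<in> V" "\<And>w. w \<in> V \<Longrightarrow> inner (x - v) w = 0"
proof -
  define \<delta> where "\<delta> = infdist x V"
  have ne: "V \<noteq> {}" using subspace_0[OF V] by blast
  have d0: "\<delta> \<ge> 0" unfolding \<delta>_def by (rule infdist_nonneg)
  have low: "\<delta> \<le> norm (x - w)" if "w \<in> V" for w
    unfolding \<delta>_def using infdist_le[OF that, of x] by (simp add: dist_norm)
  have "\<exists>w\<in>V. norm (x - w) < \<delta> + 1 / real (Suc n)" for n
  proof (rule ccontr)
    assume "\<not> ?thesis"
    then have "\<And>w. w \<in> V \<Longrightarrow> \<delta> + 1 / real (Suc n) \<le> dist x w" by (auto simp: dist_norm not_less)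
    then have "\<delta> + 1 / real (Suc n) \<le> infdist x V"
      unfolding infdist_notempty[OF ne] by (intro cINF_greatest ne)
    then show False by (simp add: \<delta>_def)
  qed
  then obtain s where s: "\<And>n. s n \<in> V" "\<And>n. norm (x - s n) < \<delta> + 1 / real (Suc n)" by metis
  have par: "(norm (a - b))\<^sup>2 = 2 * (norm (x - a))\<^sup>2 + 2 * (norm (x - b))\<^sup>2 - 4 * (norm (x - (1/2) *\<^sub>R (a + b)))\<^sup>2" for a b
    unfolding power2_norm_eq_inner by (simp add: algebra_simps inner_commute)
  have mid: "(1/2) *\<^sub>R (a + b) \<in> V" if "a \<in> V" "b \<in> V" for a b
    using that V by (intro subspace_scale subspace_add)
  have Cau: "Cauchy s"
  proof (rule metric_CauchyI)
    fix e :: real assume e: "e > 0"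
    \<comment> \<open>Two estimates \<open>near\<close> enter the parallelogram identity with factor
      2 each, and the terms \<open>\<delta>\<^sup>2\<close> cancel; this leaves
      \<open>4 * (2 * \<delta> + 1) * h\<close>.\<close>
    define c where "c = 4 * (2 * \<delta> + 1)"
    have c: "c > 0" using d0 by (simp add: c_def)
    obtain N :: nat where N: "c / e\<^sup>2 < real N" using reals_Archimedean2 by blast
    show "\<exists>M. \<forall>m\<ge>M. \<forall>n\<ge>M. dist (s m) (s n) < e"
    proof (intro exI[of _ N] allI impI)
      fix m n assume mn: "m \<ge> N" "n \<ge> N"
      define h where "h = 1 / real (Suc N)"
      have h: "h > 0" "h \<le> 1" by (auto simp: h_def)
      have near: "(norm (x - s k))\<^sup>2 \<le> \<delta>\<^sup>2 + (2 * \<delta> + 1) * h" if "k \<ge> N" for k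
      proof -
        have "1 / real (Suc k) \<le> h" unfolding h_def using that by (simp add: frac_le)
        then have "norm (x - s k) \<le> \<delta> + h" using s(2)[of k] by linarith
        then have "(norm (x - s k))\<^sup>2 \<le> (\<delta> + h)\<^sup>2" by (rule power_mono) simp
        also have "\<dots> = \<delta>\<^sup>2 + 2 * \<delta> * h + h * h" by (simp add: power2_eq_square algebra_simps)
        also have "\<dots> \<le> \<delta>\<^sup>2 + (2 * \<delta> + 1) * h" using h mult_left_mono[of h 1 h] by (simp add: algebra_simps)
        finally show ?thesis .
      qed
      have "\<delta>\<^sup>2 \<le> (norm (x - (1/2) *\<^sub>R (s m + s n)))\<^sup>2"
        by (rule power_mono[OF low[OF mid[OF s(1) s(1)]] d0])
      then have "(norm (s m - s n))\<^sup>2 \<le> c * h"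
        using par[of "s m" "s n"] near[OF mn(1)] near[OF mn(2)] unfolding c_def by (simp add: algebra_simps)
      also have "\<dots> < e\<^sup>2"
      proof -
        have "c / e\<^sup>2 < real (Suc N)" using N by simp
        then show ?thesis using e by (simp add: h_def field_simps del: of_nat_Suc)
      qed
      finally show "dist (s m) (s n) < e" unfolding dist_norm using e by (simp add: power_less_imp_less_base)
    qed
  qed
  then obtain v where v: "s \<longlonglongrightarrow> v" using Cauchy_convergent_iff convergent_def by blast
  have vV: "v \<in> V" using cl v s(1) closed_sequentially by blast
  have vd: "norm (x - v) \<le> \<delta>"
  proof (rule LIMSEQ_le)
    show "(\<lambda>n. norm (x - s n)) \<longlonglongrightarrow> norm (x - v)" by (intro tendsto_intros v)
    show "(\<lambda>n. \<delta> + 1 / real (Suc n)) \<longlonglongrightarrow> \<delta>"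
      using tendsto_add[OF tendsto_const[of \<delta>] LIMSEQ_inverse_real_of_nat] by (simp add: inverse_eq_divide)
    show "\<exists>N. \<forall>n\<ge>N. norm (x - s n) \<le> \<delta> + 1 / real (Suc n)" using s(2) less_imp_le by blast
  qed
  show ?thesis
  proof (rule that[OF vV])
    fix w assume w: "w \<in> V"
    show "inner (x - v) w = 0"
    proof (cases "w = 0")
      case False
      \<comment> \<open>The minimiser of \<open>norm (x - v - t *\<^sub>R w)\<close> over real
        \<open>t\<close>; since \<open>v\<close> is already optimal, the gain must be zero.\<close>
      define t where "t = inner (x - v) w / inner w w"
      have ww: "inner w w > 0" using False by simp
      have "v + t *\<^sub>R w \<in> V" using vV w V by (intro subspace_add subspace_scale)
      then have "norm (x - v) \<le> norm (x - v - t *\<^sub>R w)" using low[of "v + t *\<^sub>R w"] vd by (simp add: algebra_simps)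
      then have "(norm (x - v))\<^sup>2 \<le> (norm (x - v - t *\<^sub>R w))\<^sup>2" by (rule power_mono) simp
      also have "\<dots> = (norm (x - v))\<^sup>2 - 2 * t * inner (x - v) w + t * t * inner w w"
        unfolding power2_norm_eq_inner by (simp add: inner_diff_left inner_diff_right inner_commute algebra_simps)
      also have "\<dots> = (norm (x - v))\<^sup>2 - (inner (x - v) w)\<^sup>2 / inner w w"
        using ww by (simp add: t_def power2_eq_square field_simps)
      finally have "(inner (x - v) w)\<^sup>2 / inner w w \<le> 0" by simp
      then have "(inner (x - v) w)\<^sup>2 \<le> 0" using ww by (simp add: divide_le_0_iff)
      then show ?thesis by simp
    qed simp
  qed
qed

lemma closed_csubspace_projection:
  fixes V :: "'a::complex_hilbert set"
  assumes V: "csubspace V" and cl: "closed V"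
  obtains v where "v \<in> V" "\<And>w. w \<in> V \<Longrightarrow> cinner w (x - v) = 0"
proof -
  have "subspace V" unfolding subspace_def using csubspaceD[OF V] by (simp add: scaleR_scaleC)
  then obtain v where v: "v \<in> V" "\<And>w. w \<in> V \<Longrightarrow> inner (x - v) w = 0"
    using closed_subspace_projection[OF _ cl] by metis
  show ?thesis
  proof (rule that[OF v(1)])
    fix w assume w: "w \<in> V"
    have "Re (cinner w (x - v)) = 0" using v(2)[OF w] by (simp add: inner_Re_cinner[symmetric] inner_commute)
    moreover have "Re (cinner (\<i> *\<^sub>C w) (x - v)) = 0"
      using v(2)[OF csubspaceD(3)[OF V w]] by (simp add: inner_Re_cinner[symmetric] inner_commute)
    ultimately show "cinner w (x - v) = 0" by (simp add: cinner_scaleC_left complex_eq_iff)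
  qed
qed

text \<open>Gram-Schmidt. As division by zero yields 0, the same coefficients are right for
  vanishing or dependent vectors.\<close>

lemma two_vector_projection:
  fixes v1 v2 w :: "'a::complex_inner"
  obtains a b where "cinner (w - a *\<^sub>C v1 - b *\<^sub>C v2) v1 = 0" "cinner (w - a *\<^sub>C v1 - b *\<^sub>C v2) v2 = 0"
proof -
  define g where "g = cinner v2 v1 / cinner v1 v1"
  define e where "e = v2 - g *\<^sub>C v1"
  have z: "cinner x v1 - cinner x v1 / cinner v1 v1 * cinner v1 v1 = 0" for x :: 'a
    by (cases "v1 = 0") (auto simp: cinner_self)
  have z': "cinner x e - cinner x e / cinner e e * cinner e e = 0" for x :: 'a
    by (cases "e = 0") (auto simp: cinner_self)
  have e1: "cinner e v1 = 0" unfolding e_def using z[of v2] by (simp add: cinner_diff_left cinner_scaleC_left g_def)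
  have e1': "cinner v1 e = 0" using e1 by (metis cinner_commute complex_cnj_zero)
  define c1 where "c1 = cinner w v1 / cinner v1 v1"
  define c2 where "c2 = cinner w e / cinner e e"
  define r where "r = w - c1 *\<^sub>C v1 - c2 *\<^sub>C e"
  have r1: "cinner r v1 = 0" unfolding r_def using z[of w] e1
    by (simp add: cinner_diff_left cinner_scaleC_left c1_def)
  have re: "cinner r e = 0" unfolding r_def using z'[of w] e1'
    by (simp add: cinner_diff_left cinner_scaleC_left c2_def)
  have v2: "v2 = e + g *\<^sub>C v1" by (simp add: e_def)
  have r2: "cinner r v2 = 0" unfolding v2 using r1 re by (simp add: cinner_add_right cinner_scaleC_right)
  have "r = w - (c1 - c2 * g) *\<^sub>C v1 - c2 *\<^sub>C v2"
    unfolding r_def e_def by (simp add: scaleC_diff_right scaleC_diff_left scaleC_scaleC)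
  then show ?thesis using that r1 r2 by metis
qed

text \<open>\<open>T\<close> is a symmetric operator in \<open>H\<close>; single-valuedness of the
  adjoint takes the place of density of the domain. Scalar boundary maps correspond to deficiency
  indices 1 and 1.\<close>

locale half_triplet =
  fixes H :: "'h::complex_hilbert set" and T :: "('h \<times> 'h) set" and G0 G1 :: "'h \<Rightarrow> complex"
  assumes H: "csubspace H" "closed H" and T_symmetric: "T \<subseteq> adjoint_in H T" and T0: "(0, 0) \<in> T"
    and adjoint_single_valued: "single_valued (adjoint_in H T)" and bt: "boundary_triplet H T G0 G1"
begin

definition L where "L = adjoint_in H T"

lemma sym: "T \<subseteq> L" and sv: "single_valued L"
  using T_symmetric adjoint_single_valued by (simp_all add: L_def)

lemma L_iff: "(y, z) \<in> L \<longleftrightarrow> y \<in> H \<and> z \<in> H \<and> (\<forall>x x'. (x, x') \<in> T \<longrightarrow> cinner x' y = cinner x z)"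
  unfolding L_def adjoint_in_def by auto

lemma L_add: "(x, x') \<in> L \<Longrightarrow> (y, y') \<in> L \<Longrightarrow> (x + y, x' + y') \<in> L"
  unfolding L_iff by (simp add: csubspaceD[OF H(1)] cinner_add_right)

lemma L_scale: "(x, x') \<in> L \<Longrightarrow> (a *\<^sub>C x, a *\<^sub>C x') \<in> L"
  unfolding L_iff by (simp add: csubspaceD[OF H(1)] cinner_scaleC_right)

lemma L_diff: "(x, x') \<in> L \<Longrightarrow> (y, y') \<in> L \<Longrightarrow> (x - y, x' - y') \<in> L"
  unfolding L_iff by (simp add: csubspaceD[OF H(1)] cinner_diff_right)

lemma L_zero: "(0, 0) \<in> L" using sym T0 by blast

lemma L_unique: "(x, x') \<in> L \<Longrightarrow> (x, x'') \<in> L \<Longrightarrow> x' = x''"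
  using sv unfolding single_valued_def by blast

lemma L_H: "(x, x') \<in> L \<Longrightarrow> x \<in> H \<and> x' \<in> H" unfolding L_iff by blast

lemma G_add:
  assumes "(x, x') \<in> L" "(y, y') \<in> L"
  shows "G0 (x + y) = G0 x + G0 y" "G1 (x + y) = G1 x + G1 y"
proof -
  have "x \<in> Domain L" "y \<in> Domain L" using assms by auto
  then show "G0 (x + y) = G0 x + G0 y" "G1 (x + y) = G1 x + G1 y"
    using bt unfolding boundary_triplet_def clinear_on_def L_def by blast+
qed

lemma G_scale:
  assumes "(x, x') \<in> L"
  shows "G0 (a *\<^sub>C x) = a * G0 x" "G1 (a *\<^sub>C x) = a * G1 x"
proof -
  have "x \<in> Domain L" using assms by auto
  then have "G0 (a *\<^sub>C x) = a *\<^sub>C G0 x" "G1 (a *\<^sub>C x) = a *\<^sub>C G1 x"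
    using bt unfolding boundary_triplet_def clinear_on_def L_def by blast+
  then show "G0 (a *\<^sub>C x) = a * G0 x" "G1 (a *\<^sub>C x) = a * G1 x" by (simp_all add: scaleC_complex_def)
qed

lemma G_diff:
  assumes "(x, x') \<in> L" "(y, y') \<in> L"
  shows "G0 (x - y) = G0 x - G0 y" "G1 (x - y) = G1 x - G1 y"
  using G_add[OF assms(1) L_scale[OF assms(2), of "-1"]] G_scale[OF assms(2), of "-1"]
  by (simp_all add: scaleC_minus_one)

lemma G_zero: "G0 0 = 0" "G1 0 = 0"
  using G_scale[OF L_zero, of 0] by simp_all

lemma green:
  assumes "(x, x') \<in> L" "(y, y') \<in> L"
  shows "cinner x' y - cinner x y' = G1 x * cnj (G0 y) - G0 x * cnj (G1 y)"
proof -
  have "\<forall>(x, x')\<in>L. \<forall>(y, y')\<in>L.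
        cinner x' y - cinner x y' = cinner (G1 x) (G0 y) - cinner (G0 x) (G1 y)"
    using bt unfolding boundary_triplet_def L_def by blast
  from bspec[OF this assms(1)] assms(2) show ?thesis by (auto simp: cinner_complex_def)
qed

lemma G_surj:
  obtains x x' where "(x, x') \<in> L" "G0 x = a" "G1 x = b"
proof -
  have "(\<lambda>x. (G0 x, G1 x)) ` Domain L = UNIV"
    using bt unfolding boundary_triplet_def L_def by blast
  then have "(a, b) \<in> (\<lambda>x. (G0 x, G1 x)) ` Domain L" by blast
  then show ?thesis using that by auto
qed

text \<open>Green's form of an element of \<open>T\<close> with any element of \<open>L\<close> is
  zero, and by surjectivity the boundary values of the latter are arbitrary.\<close>

lemma T_G:
  assumes "(x, x') \<in> T"
  shows "G0 x = 0" "G1 x = 0"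
proof -
  have xL: "(x, x') \<in> L" using assms sym by blast
  have *: "G1 x * cnj (G0 y) - G0 x * cnj (G1 y) = 0" if "(y, y') \<in> L" for y y'
    using green[OF xL that] that assms unfolding L_iff by simp
  obtain y y' where "(y, y') \<in> L" "G0 y = 1" "G1 y = 0" by (rule G_surj)
  then show "G1 x = 0" using *[of y y'] by simp
  obtain y y' where "(y, y') \<in> L" "G0 y = 0" "G1 y = 1" by (rule G_surj)
  then show "G0 x = 0" using *[of y y'] by simp
qed

text \<open>The self-adjoint extension that serves as reference: the resolvents of the other
  extensions are obtained from its resolvent.\<close>

definition A0 where "A0 = {(x, x'). (x, x') \<in> L \<and> G0 x = 0}"

lemma A0_iff: "(x, x') \<in> A0 \<longleftrightarrow> (x, x') \<in> L \<and> G0 x = 0"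
  by (simp add: A0_def)

text \<open>Self-adjointness of \<open>A0\<close>. A test element with \<open>G0 = 0\<close> and
  \<open>G1 = 1\<close> reads off \<open>G0 y\<close> through Green's identity.\<close>

lemma A0_adjoint: 
  "(y, z) \<in> A0 \<longleftrightarrow> y \<in> H \<and> z \<in> H \<and> (\<forall>x x'. (x, x') \<in> A0 \<longrightarrow> cinner x' y = cinner x z)" (is "_ \<longleftrightarrow> ?R")
proof
  assume a: "(y, z) \<in> A0"
  then have "cinner x' y = cinner x z" if "(x, x') \<in> A0" for x x'
    using green[of x x' y z] that unfolding A0_iff by simp
  then show ?R using a L_H unfolding A0_iff by blast
next
  assume R: ?R
  have "(x, x') \<in> A0" if "(x, x') \<in> T" for x x' using that sym T_G unfolding A0_iff by blast
  then have yz: "(y, z) \<in> L" using R unfolding L_iff by blast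
  obtain x x' where x: "(x, x') \<in> L" "G0 x = 0" "G1 x = 1" by (rule G_surj)
  then have "(x, x') \<in> A0" unfolding A0_iff by simp
  then have "cinner x' y = cinner x z" using R by blast
  then have "G0 y = 0" using green[OF x(1) yz] x by simp
  then show "(y, z) \<in> A0" using yz unfolding A0_iff by simp
qed

text \<open>By symmetry \<open>cinner x' x\<close> is real, so the imaginary part of
  \<open>cinner (x' - z *\<^sub>C x) x\<close> is \<open>- Im z * (norm x)\<^sup>2\<close>.\<close>

lemma A0_lower:
  assumes "(x, x') \<in> A0"
  shows "\<bar>Im z\<bar> * norm x \<le> norm (x' - z *\<^sub>C x)"
proof (cases "x = 0")
  case False
  have "cinner x' x = cinner x x'" using assms A0_adjoint by blast
  then have "cinner x' x = cnj (cinner x' x)" using cinner_commute[of x x'] by simp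
  then have "Im (cinner x' x) = 0" by (simp add: complex_eq_iff)
  then have "Im (cinner (x' - z *\<^sub>C x) x) = - Im z * (norm x)\<^sup>2"
    by (simp add: cinner_diff_left cinner_scaleC_left cinner_self)
  then have "\<bar>Im z\<bar> * (norm x)\<^sup>2 \<le> cmod (cinner (x' - z *\<^sub>C x) x)"
    using abs_Im_le_cmod[of "cinner (x' - z *\<^sub>C x) x"] by (simp add: abs_mult)
  also have "\<dots> \<le> norm (x' - z *\<^sub>C x) * norm x" by (rule cinner_norm_le)
  finally have "(\<bar>Im z\<bar> * norm x) * norm x \<le> norm (x' - z *\<^sub>C x) * norm x" by (simp add: power2_eq_square algebra_simps)
  then show ?thesis using False by simp
qed simp

text \<open>The lower bound makes the range of \<open>A0 - z\<close> closed. A vector of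
  \<open>H\<close> orthogonal to the range lies in the kernel of \<open>A0 - cnj z\<close>, which
  the same bound makes trivial.\<close>

lemma A0_onto:
  assumes z: "Im z \<noteq> 0" and w: "w \<in> H"
  obtains x x' where "(x, x') \<in> A0" "x' - z *\<^sub>C x = w"
proof -
  define R where "R = {x' - z *\<^sub>C x | x x'. (x, x') \<in> A0}"
  have RH: "R \<subseteq> H" 
  proof
    fix u assume "u \<in> R"
    then obtain x x' where "(x, x') \<in> A0" "u = x' - z *\<^sub>C x" unfolding R_def by blast
    then show "u \<in> H" using L_H[of x x'] csubspaceD(3,4)[OF H(1)] unfolding A0_iff by simp
  qed
  have Rs: "csubspace R"
    unfolding csubspace_def
  proof (intro conjI ballI allI)
    show "0 \<in> R" unfolding R_def A0_iff using L_zero G_zero by (intro CollectI exI[of _ 0]) simp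
  next
    fix u v assume "u \<in> R" "v \<in> R"
    then obtain x x' y y' where *: "(x, x') \<in> A0" "u = x' - z *\<^sub>C x" "(y, y') \<in> A0" "v = y' - z *\<^sub>C y"
      unfolding R_def by blast
    then have "(x + y, x' + y') \<in> A0" using L_add G_add unfolding A0_iff by (metis add_0)
    moreover have "u + v = (x' + y') - z *\<^sub>C (x + y)" using * by (simp add: scaleC_add_right)
    ultimately show "u + v \<in> R" unfolding R_def by blast
  next
    fix a u assume "u \<in> R"
    then obtain x x' where *: "(x, x') \<in> A0" "u = x' - z *\<^sub>C x" unfolding R_def by blast
    then have "(a *\<^sub>C x, a *\<^sub>C x') \<in> A0" using L_scale G_scale unfolding A0_iff by (metis mult_zero_right)
    moreover have "a *\<^sub>C u = a *\<^sub>C x' - z *\<^sub>C (a *\<^sub>C x)"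
      using * by (simp add: scaleC_diff_right scaleC_scaleC mult.commute)
    ultimately show "a *\<^sub>C u \<in> R" unfolding R_def by blast
  qed
  have Rc: "closed R"
    unfolding closed_sequential_limits
  proof (intro allI impI, elim conjE)
    fix u l assume u: "\<forall>n. u n \<in> R" and l: "u \<longlonglongrightarrow> l"
    from u have "\<forall>n. \<exists>p. p \<in> A0 \<and> u n = snd p - z *\<^sub>C fst p" unfolding R_def by force
    then obtain p where p: "\<And>n. p n \<in> A0" "\<And>n. u n = snd (p n) - z *\<^sub>C fst (p n)" by metis
    define x where "x n = fst (p n)" for n
    define x' where "x' n = snd (p n)" for n
    have xA: "(x n, x' n) \<in> A0" for n using p(1)[of n] by (simp add: x_def x'_def)
    have ux: "u n = x' n - z *\<^sub>C x n" for n using p(2)[of n] by (simp add: x_def x'_def)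
    have "Cauchy x"
    proof (rule metric_CauchyI)
      fix e :: real assume e: "e > 0"
      have "Cauchy u" using l by (rule LIMSEQ_imp_Cauchy)
      then obtain M where M: "\<And>m n. m \<ge> M \<Longrightarrow> n \<ge> M \<Longrightarrow> dist (u m) (u n) < e * \<bar>Im z\<bar>"
        using e z metric_CauchyD[of u "e * \<bar>Im z\<bar>"] by auto
      show "\<exists>M. \<forall>m\<ge>M. \<forall>n\<ge>M. dist (x m) (x n) < e"
      proof (intro exI[of _ M] allI impI)
        fix m n assume mn: "m \<ge> M" "n \<ge> M"
        have "(x m - x n, x' m - x' n) \<in> A0"
          using L_diff[of "x m" "x' m" "x n" "x' n"] G_diff[of "x m" "x' m" "x n" "x' n"] xA[of m] xA[of n]
          unfolding A0_iff by simp
        from A0_lower[OF this, of z]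
        have "\<bar>Im z\<bar> * norm (x m - x n) \<le> norm (u m - u n)"
          by (simp add: ux scaleC_diff_right algebra_simps)
        also have "\<dots> < e * \<bar>Im z\<bar>" using M[OF mn] by (simp add: dist_norm)
        finally show "dist (x m) (x n) < e" using z by (simp add: dist_norm mult.commute)
      qed
    qed
    then obtain y where y: "x \<longlonglongrightarrow> y" using Cauchy_convergent_iff convergent_def by blast
    have "(\<lambda>n. u n + z *\<^sub>C x n) \<longlonglongrightarrow> l + z *\<^sub>C y"
      by (intro tendsto_add l bounded_linear.tendsto[OF bounded_linear_scaleC] y)
    then have y': "x' \<longlonglongrightarrow> l + z *\<^sub>C y" by (simp add: ux)
    have "(y, l + z *\<^sub>C y) \<in> A0"
    proof (rule A0_adjoint[THEN iffD2], intro conjI allI impI)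
      have xH: "x n \<in> H" "x' n \<in> H" for n using xA[of n] L_H[of "x n" "x' n"] unfolding A0_iff by simp_all
      show "y \<in> H" by (rule closed_sequentially[OF H(2) xH(1) y])
      show "l + z *\<^sub>C y \<in> H" by (rule closed_sequentially[OF H(2) xH(2) y'])
      fix t t' assume t: "(t, t') \<in> A0"
      have "cinner t' (x n) = cinner t (x' n)" for n using xA[of n] t A0_adjoint by blast
      moreover have "(\<lambda>n. cinner t' (x n)) \<longlonglongrightarrow> cinner t' y"
        by (intro bounded_linear.tendsto[OF bounded_linear_cinner_right] y)
      moreover have "(\<lambda>n. cinner t (x' n)) \<longlonglongrightarrow> cinner t (l + z *\<^sub>C y)"
        by (intro bounded_linear.tendsto[OF bounded_linear_cinner_right] y')
      ultimately show "cinner t' y = cinner t (l + z *\<^sub>C y)" using LIMSEQ_unique by simp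
    qed
    moreover have "l = (l + z *\<^sub>C y) - z *\<^sub>C y" by simp
    ultimately show "l \<in> R" unfolding R_def by blast
  qed
  obtain v where v: "v \<in> R" "\<And>u. u \<in> R \<Longrightarrow> cinner u (w - v) = 0"
    using closed_csubspace_projection[OF Rs Rc] by blast
  define d where "d = w - v"
  have dH: "d \<in> H" unfolding d_def using v(1) RH w csubspaceD(4)[OF H(1)] by blast
  have "(d, cnj z *\<^sub>C d) \<in> A0"
  proof (rule A0_adjoint[THEN iffD2], intro conjI allI impI dH csubspaceD(3)[OF H(1) dH])
    fix x x' assume "(x, x') \<in> A0"
    then have "cinner (x' - z *\<^sub>C x) d = 0" using v(2)[of "x' - z *\<^sub>C x"] unfolding R_def d_def by blast
    then show "cinner x' d = cinner x (cnj z *\<^sub>C d)"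
      by (simp add: cinner_diff_left cinner_scaleC_left cinner_scaleC_right)
  qed
  from A0_lower[OF this, of "cnj z"] have "d = 0" using z by (simp add: mult_le_0_iff)
  then have "w \<in> R" using v(1) by (simp add: d_def)
  then show ?thesis using that unfolding R_def by blast
qed

text \<open>An element with boundary values 1 and 0 is corrected by an element of \<open>A0\<close>
  that removes its defect \<open>h' - z *\<^sub>C h\<close> and leaves \<open>G0\<close>
  unchanged.\<close>

lemma psi_exists:
  assumes z: "Im z \<noteq> 0"
  shows "\<exists>x. (x, z *\<^sub>C x) \<in> L \<and> G0 x = 1"
proof -
  obtain h h' where h: "(h, h') \<in> L" "G0 h = 1" "G1 h = 0" by (rule G_surj)
  have "h' - z *\<^sub>C h \<in> H" using L_H[OF h(1)] csubspaceD[OF H(1)] by blast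
  then obtain x x' where x: "(x, x') \<in> A0" "x' - z *\<^sub>C x = h' - z *\<^sub>C h" using A0_onto[OF z] by blast
  have "(h - x, h' - x') \<in> L" "G0 (h - x) = 1" using L_diff[OF h(1)] G_diff[OF h(1)] x(1) h unfolding A0_iff by auto
  moreover have "h' - x' = z *\<^sub>C (h - x)" using x(2) by (simp add: scaleC_diff_right algebra_simps)
  ultimately show ?thesis by metis
qed

text \<open>The Weyl solution, i.e. the defect element normalised by \<open>G0 = 1\<close>. For
  non-real \<open>z\<close> the choice is forced, by \<open>eigen_psi\<close>.\<close>

definition psi where "psi z = (SOME x. (x, z *\<^sub>C x) \<in> L \<and> G0 x = 1)"

definition weyl where "weyl z = G1 (psi z)"

lemma psi:
  assumes "Im z \<noteq> 0"
  shows "(psi z, z *\<^sub>C psi z) \<in> L" "G0 (psi z) = 1"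
  using someI_ex[OF psi_exists[OF assms]] unfolding psi_def by blast+

text \<open>The difference of the two sides lies in the kernel of \<open>A0 - z\<close>, which is
  trivial; so the defect space is one-dimensional.\<close>

lemma eigen_psi:
  assumes z: "Im z \<noteq> 0" and x: "(x, z *\<^sub>C x) \<in> L"
  shows "x = G0 x *\<^sub>C psi z"
proof -
  note p = L_scale[OF psi(1)[OF z], of "G0 x"]
  have "(x - G0 x *\<^sub>C psi z, z *\<^sub>C x - G0 x *\<^sub>C z *\<^sub>C psi z) \<in> A0"
    using L_diff[OF x p] G_diff[OF x p] G_scale[OF psi(1)[OF z]] psi(2)[OF z] unfolding A0_iff by simp
  from A0_lower[OF this, of z] have "\<bar>Im z\<bar> * norm (x - G0 x *\<^sub>C psi z) \<le> 0"
    by (simp add: scaleC_diff_right scaleC_scaleC mult.commute)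
  then show ?thesis using z by (simp add: mult_le_0_iff)
qed

lemma weyl_identity:
  assumes "Im z \<noteq> 0" "Im w \<noteq> 0"
  shows "(z - cnj w) * cinner (psi z) (psi w) = weyl z - cnj (weyl w)"
  using green[OF psi(1)[OF assms(1)] psi(1)[OF assms(2)]] psi(2)[OF assms(1)] psi(2)[OF assms(2)]
  by (simp add: weyl_def cinner_scaleC_left cinner_scaleC_right algebra_simps)

text \<open>The case \<open>w = z\<close> of \<open>weyl_identity\<close>. If \<open>weyl\<close>
  were constant on the upper half-plane, the norm of \<open>psi z\<close> would have to decay like
  \<open>1 / sqrt (Im z)\<close>.\<close>

lemma Im_weyl:
  assumes "Im z \<noteq> 0"
  shows "Im (weyl z) = Im z * (norm (psi z))\<^sup>2" "psi z \<noteq> 0"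
proof -
  show "psi z \<noteq> 0" using psi(2)[OF assms] G_zero by force
  have "(z - cnj z) * complex_of_real ((norm (psi z))\<^sup>2) = weyl z - cnj (weyl z)"
    using weyl_identity[OF assms assms] by (simp add: cinner_self)
  from arg_cong[OF this, of Im] show "Im (weyl z) = Im z * (norm (psi z))\<^sup>2" by simp
qed

text \<open>Green's identity against the defect element for \<open>cnj z\<close>. It bounds
  \<open>G1 x\<close> by the norm of \<open>x' - z *\<^sub>C x\<close>, which the resolvent estimate
  needs.\<close>

lemma A0_G1:
  assumes "(x, x') \<in> A0" "Im z \<noteq> 0"
  shows "G1 x = cinner (x' - z *\<^sub>C x) (psi (cnj z))"
proof -
  have z': "Im (cnj z) \<noteq> 0" using assms(2) by simp
  show ?thesis
    using green[OF _ psi(1)[OF z'], of x x'] assms(1) psi(2)[OF z'] unfolding A0_iff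
    by (simp add: cinner_diff_left cinner_scaleC_left cinner_scaleC_right)
qed

end

section \<open>Square-integrable functions on the line\<close>

lemma si_rep: "square_integrable (rep_l2 u)"
  using Quotient3_rep_reflp[OF Quotient3_l2, of u] by simp

lemma abs_rep_l2: "abs_l2 (rep_l2 u) = u"
  using Quotient3_abs_rep[OF Quotient3_l2, of u] .

lemma abs_l2_eq_iff:
  "square_integrable f \<Longrightarrow> square_integrable g \<Longrightarrow> abs_l2 f = abs_l2 g \<longleftrightarrow> (AE x in lebesgue. f x = g x)"
  using Quotient3_rel[OF Quotient3_l2, of f g] by auto

lemma rep_abs_l2: "square_integrable f \<Longrightarrow> AE x in lebesgue. rep_l2 (abs_l2 f) x = f x"
  using abs_l2_eq_iff[OF si_rep, of f "abs_l2 f"] by (simp add: abs_rep_l2)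

lemma abs_l2_ops:
  assumes "square_integrable f"
  shows "a *\<^sub>C abs_l2 f = abs_l2 (\<lambda>x. a * f x)"
    and "parity (abs_l2 f) = abs_l2 (\<lambda>x. f (- x))"
    and "pos_part (abs_l2 f) = abs_l2 (\<lambda>x. if x \<in> {0<..} then f x else 0)"
    and "neg_part (abs_l2 f) = abs_l2 (\<lambda>x. if x \<in> {..<0} then f x else 0)"
    and "square_integrable g \<Longrightarrow> abs_l2 f + abs_l2 g = abs_l2 (\<lambda>x. f x + g x)"
    and "square_integrable g \<Longrightarrow> cinner (abs_l2 f) (abs_l2 g) = (\<integral>x. f x * cnj (g x) \<partial>lebesgue)"
  using assms
  by (auto intro!: plus_l2.abs_eq scaleC_l2.abs_eq cinner_l2.abs_eq parity.abs_eq pos_part.abs_eq neg_part.abs_eq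
      simp del: greaterThan_iff lessThan_iff)

lemma square_integrable_diff:
  "square_integrable f \<Longrightarrow> square_integrable g \<Longrightarrow> square_integrable (\<lambda>x. f x - g x)"
  using square_integrable_add[OF _ square_integrable_cmult[of g "-1"], of f] by simp

lemma abs_l2_diff:
  assumes "square_integrable f" "square_integrable g"
  shows "abs_l2 f - abs_l2 g = abs_l2 (\<lambda>x. f x - g x)"
proof -
  have "abs_l2 f - abs_l2 g = abs_l2 f + (-1) *\<^sub>C abs_l2 g" by (simp only: scaleC_minus_one diff_conv_add_uminus)
  also have "\<dots> = abs_l2 (\<lambda>x. f x + - 1 * g x)"
    unfolding abs_l2_ops(1)[OF assms(2)] by (rule abs_l2_ops(5)[OF assms(1) square_integrable_cmult[OF assms(2)]])
  finally show ?thesis by simp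
qed

lemma norm_abs_l2:
  assumes "square_integrable f"
  shows "(norm (abs_l2 f))\<^sup>2 = (\<integral>x. (cmod (f x))\<^sup>2 \<partial>lebesgue)"
proof -
  have "complex_of_real ((norm (abs_l2 f))\<^sup>2) = (\<integral>x. complex_of_real ((cmod (f x))\<^sup>2) \<partial>lebesgue)"
    using abs_l2_ops(6)[OF assms assms] by (simp only: cinner_self complex_norm_square)
  then show ?thesis by (simp only: integral_complex_of_real of_real_eq_iff)
qed

lemma nn_integral_norm_abs_l2:
  assumes "square_integrable f"
  shows "(\<integral>\<^sup>+x. ennreal ((cmod (f x))\<^sup>2) \<partial>lebesgue) = ennreal ((norm (abs_l2 f))\<^sup>2)"
  unfolding norm_abs_l2[OF assms]
  by (rule nn_integral_eq_integral) (use square_integrable_integrable[OF assms] in auto)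

lemma square_integrableI_nn:
  assumes "f \<in> borel_measurable lebesgue" "(\<integral>\<^sup>+x. ennreal ((cmod (f x))\<^sup>2) \<partial>lebesgue) < \<infinity>"
  shows "square_integrable f"
  unfolding square_integrable_def
proof
  show "integrable lebesgue (\<lambda>x. (cmod (f x))\<^sup>2)"
  proof (rule integrableI_nonneg)
    show "(\<lambda>x. (cmod (f x))\<^sup>2) \<in> borel_measurable lebesgue"
      by (rule borel_measurable_power[OF measurable_compose[OF assms(1) borel_measurable_norm]])
  qed (use assms(2) in auto)
qed (rule assms(1))

text \<open>The squared norms are at most \<open>(1/4) ^ n\<close>, so with weight
  \<open>2 ^ n\<close> the integrals still have a finite sum. Hence
  \<open>2 ^ n * (cmod (f n x))\<^sup>2\<close> is bounded in \<open>n\<close> for almost every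
  \<open>x\<close>, and \<open>cmod (f n x)\<close> decays geometrically.\<close>

lemma summable_AE_l2:
  fixes f :: "nat \<Rightarrow> real \<Rightarrow> complex"
  assumes f: "\<And>n. square_integrable (f n)" and le: "\<And>n. norm (abs_l2 (f n)) \<le> (1/2) ^ n"
  shows "AE x in lebesgue. summable (\<lambda>n. cmod (f n x))"
proof -
  define D where "D n x = ennreal (2 ^ n * (cmod (f n x))\<^sup>2)" for n x
  have meas: "(\<lambda>x. (cmod (f n x))\<^sup>2) \<in> borel_measurable lebesgue" for n
    by (rule borel_measurable_power[OF measurable_compose[OF square_integrable_measurable[OF f] borel_measurable_norm]])
  then have Dm: "D n \<in> borel_measurable lebesgue" for n
    unfolding D_def by (intro measurable_compose[OF _ measurable_ennreal] borel_measurable_times borel_measurable_const)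
  have "(\<integral>\<^sup>+x. D n x \<partial>lebesgue) \<le> ennreal ((1/2) ^ n)" for n
  proof -
    have "(\<integral>\<^sup>+x. D n x \<partial>lebesgue) = ennreal (2 ^ n) * (\<integral>\<^sup>+x. ennreal ((cmod (f n x))\<^sup>2) \<partial>lebesgue)"
      unfolding D_def using meas[of n] by (subst nn_integral_cmult[symmetric]) (auto simp: ennreal_mult)
    also have "\<dots> = ennreal (2 ^ n * (norm (abs_l2 (f n)))\<^sup>2)"
      by (simp add: nn_integral_norm_abs_l2[OF f] ennreal_mult)
    also have "\<dots> \<le> ennreal ((1/2) ^ n)"
    proof (rule ennreal_leI)
      have "(norm (abs_l2 (f n)))\<^sup>2 \<le> ((1/2) ^ n)\<^sup>2" by (rule power_mono[OF le norm_ge_zero])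
      then have "2 ^ n * (norm (abs_l2 (f n)))\<^sup>2 \<le> 2 ^ n * ((1/2) ^ n)\<^sup>2" by (rule mult_left_mono) simp
      also have "\<dots> = (1/2::real) ^ n" by (simp only: power2_eq_square power_mult_distrib[symmetric]) simp
      finally show "2 ^ n * (norm (abs_l2 (f n)))\<^sup>2 \<le> (1/2) ^ n" .
    qed
    finally show ?thesis .
  qed
  then have "(\<Sum>n. \<integral>\<^sup>+x. D n x \<partial>lebesgue) \<le> (\<Sum>n. ennreal ((1/2) ^ n))"
    by (intro suminf_le) auto
  also have "\<dots> = ennreal (\<Sum>n. (1/2) ^ n)"
    by (intro suminf_ennreal2 summable_geometric) auto
  finally have "(\<Sum>n. \<integral>\<^sup>+x. D n x \<partial>lebesgue) < \<infinity>" by (simp add: le_less_trans)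
  then have "(\<integral>\<^sup>+x. (\<Sum>n. D n x) \<partial>lebesgue) \<noteq> \<infinity>"
    using nn_integral_suminf[of D lebesgue] Dm by simp
  then have "AE x in lebesgue. (\<Sum>n. D n x) \<noteq> \<infinity>"
    using Dm by (intro nn_integral_PInf_AE borel_measurable_suminf) auto
  then show ?thesis
  proof eventually_elim
    case (elim x)
    define C where "C = enn2real (\<Sum>n. D n x)"
    have C: "(\<Sum>n. D n x) = ennreal C" unfolding C_def using elim by (simp add: less_top)
    have "2 ^ n * (cmod (f n x))\<^sup>2 \<le> C" for n
    proof -
      have "D n x \<le> (\<Sum>n. D n x)" using sum_le_suminf[of "\<lambda>n. D n x" "{n}"] by simp
      then have "ennreal (2 ^ n * (cmod (f n x))\<^sup>2) \<le> ennreal C" unfolding C by (simp only: D_def)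
      moreover have "0 \<le> C" by (simp add: C_def)
      ultimately show ?thesis by (simp add: ennreal_le_iff)
    qed
    then have b: "cmod (f n x) \<le> sqrt C * (sqrt (1/2)) ^ n" for n
    proof -
      have "(cmod (f n x))\<^sup>2 \<le> C * (1/2) ^ n"
        using \<open>2 ^ n * (cmod (f n x))\<^sup>2 \<le> C\<close> by (simp add: field_simps)
      then have "cmod (f n x) \<le> sqrt (C * (1/2) ^ n)" by (rule real_le_rsqrt)
      then show ?thesis by (simp only: real_sqrt_mult real_sqrt_power)
    qed
    have "summable (\<lambda>n. sqrt C * (sqrt (1/2)) ^ n)"
      by (intro summable_mult summable_geometric) (simp add: real_sqrt_divide)
    then show ?case by (rule summable_comparison_test'[where N = 0]) (use b in auto)
  qed
qed

text \<open>Riesz-Fischer: a subsequence with geometrically small increments converges almost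
  everywhere, and Fatou's lemma turns the bounds on the increments into convergence in norm.\<close>

instance l2 :: complex_hilbert
proof
  fix u :: "nat \<Rightarrow> l2" assume "Cauchy u"
  then have "\<forall>j. \<exists>M. \<forall>m\<ge>M. \<forall>n\<ge>M. dist (u m) (u n) < (1/2) ^ j"
    by (intro allI metric_CauchyD) auto
  then obtain M where M: "\<And>j m n. m \<ge> M j \<Longrightarrow> n \<ge> M j \<Longrightarrow> dist (u m) (u n) < (1/2) ^ j" by metis
  \<comment> \<open>Partial sums of \<open>M\<close> provide indices that dominate every
    \<open>M i\<close> with \<open>i \<le> j\<close>.\<close>
  define r where "r j = (\<Sum>i\<le>j. M i)" for j :: nat
  have rM: "M j \<le> r l" if "j \<le> l" for j l
    unfolding r_def using that by (intro member_le_sum) auto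
  have rd: "norm (u (r l) - u (r j)) \<le> (1/2) ^ j" if "j \<le> l" for j l
    using M[of j "r l" "r j"] rM[OF that] rM[of j j] by (simp add: dist_norm)
  define f where "f n = rep_l2 (u (r n))" for n
  have f: "square_integrable (f n)" for n unfolding f_def by (rule si_rep)
  have af: "abs_l2 (f n) = u (r n)" for n unfolding f_def by (rule abs_rep_l2)
  have df: "abs_l2 (\<lambda>x. f l x - f j x) = u (r l) - u (r j)" for l j
    using abs_l2_diff[OF f f] by (simp add: af)
  have "AE x in lebesgue. summable (\<lambda>n. cmod (f (Suc n) x - f n x))"
    by (rule summable_AE_l2) (auto simp: df intro!: square_integrable_diff f rd)
  then have conv: "AE x in lebesgue. (\<lambda>n. f n x) \<longlonglongrightarrow> lim (\<lambda>n. f n x)"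
  proof eventually_elim
    case (elim x)
    then have "summable (\<lambda>n. f (Suc n) x - f n x)" by (rule summable_norm_cancel)
    then have "convergent (\<lambda>n. \<Sum>k<n. f (Suc k) x - f k x)" by (simp add: summable_iff_convergent)
    then have "convergent (\<lambda>n. f n x - f 0 x)" using sum_lessThan_telescope[of "\<lambda>n. f n x"] by simp
    then have "convergent (\<lambda>n. f 0 x + (f n x - f 0 x))"
      by (subst convergent_add_const_iff)
    then show ?case by (simp add: convergent_LIMSEQ_iff)
  qed
  define g where "g x = lim (\<lambda>n. f n x)" for x
  have gm: "g \<in> borel_measurable lebesgue"
    unfolding g_def by (rule borel_measurable_lim_metric[OF square_integrable_measurable[OF f]])
  have fatou: "(\<integral>\<^sup>+x. ennreal ((cmod (g x - f j x))\<^sup>2) \<partial>lebesgue) \<le> ennreal (((1/2) ^ j)\<^sup>2)" for j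
  proof -
    have m: "(\<lambda>x. ennreal ((cmod (f n x - f j x))\<^sup>2)) \<in> borel_measurable lebesgue" for n
      by (intro measurable_compose[OF _ measurable_ennreal] borel_measurable_power
          measurable_compose[OF _ borel_measurable_norm] borel_measurable_diff square_integrable_measurable f)
    have "(\<integral>\<^sup>+x. ennreal ((cmod (g x - f j x))\<^sup>2) \<partial>lebesgue)
       = (\<integral>\<^sup>+x. liminf (\<lambda>n. ennreal ((cmod (f n x - f j x))\<^sup>2)) \<partial>lebesgue)"
    proof (rule nn_integral_cong_AE)
      show "AE x in lebesgue. ennreal ((cmod (g x - f j x))\<^sup>2) = liminf (\<lambda>n. ennreal ((cmod (f n x - f j x))\<^sup>2))"
        using conv
      proof eventually_elim
        case (elim x)
        then have "(\<lambda>n. ennreal ((cmod (f n x - f j x))\<^sup>2)) \<longlonglongrightarrow> ennreal ((cmod (g x - f j x))\<^sup>2)"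
          unfolding g_def by (intro tendsto_intros tendsto_ennrealI)
        then show ?case by (intro lim_imp_Liminf[symmetric]) auto
      qed
    qed
    also have "\<dots> \<le> liminf (\<lambda>n. \<integral>\<^sup>+x. ennreal ((cmod (f n x - f j x))\<^sup>2) \<partial>lebesgue)"
      by (rule nn_integral_liminf[OF m])
    also have "\<dots> \<le> ennreal (((1/2) ^ j)\<^sup>2)"
    proof (rule Liminf_le)
      show "\<forall>\<^sub>F n in sequentially. (\<integral>\<^sup>+x. ennreal ((cmod (f n x - f j x))\<^sup>2) \<partial>lebesgue) \<le> ennreal (((1/2) ^ j)\<^sup>2)"
        using eventually_ge_at_top[of j]
      proof eventually_elim
        case (elim n)
        show ?case
          unfolding nn_integral_norm_abs_l2[OF square_integrable_diff[OF f f]] df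
          by (intro ennreal_leI power_mono rd elim norm_ge_zero)
      qed
    qed simp
    finally show ?thesis .
  qed
  have gf: "square_integrable (\<lambda>x. g x - f j x)" for j
    using fatou[of j] by (intro square_integrableI_nn borel_measurable_diff gm square_integrable_measurable[OF f])
      (simp add: le_less_trans)
  have g: "square_integrable g" using square_integrable_add[OF gf[of 0] f[of 0]] by simp
  have gd: "norm (abs_l2 g - u (r j)) \<le> (1/2) ^ j" for j
  proof -
    have "ennreal ((norm (abs_l2 g - u (r j)))\<^sup>2) \<le> ennreal (((1/2) ^ j)\<^sup>2)"
      using fatou[of j] unfolding nn_integral_norm_abs_l2[OF gf] abs_l2_diff[OF g f, symmetric] af .
    then have "(norm (abs_l2 g - u (r j)))\<^sup>2 \<le> ((1/2) ^ j)\<^sup>2" by (simp add: ennreal_le_iff)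
    then show ?thesis by (rule power2_le_imp_le) simp
  qed
  have "u \<longlonglongrightarrow> abs_l2 g"
  proof (rule metric_LIMSEQ_I)
    fix e :: real assume e: "e > 0"
    obtain j where j: "(1/2::real) ^ j < e / 2" using real_arch_pow_inv[of "e/2" "1/2"] e by auto
    have "dist (u n) (abs_l2 g) < e" if n: "n \<ge> r j" for n
    proof -
      have "dist (u n) (u (r j)) < (1/2) ^ j" using n rM[of j j] by (intro M) auto
      moreover have "dist (u (r j)) (abs_l2 g) \<le> (1/2) ^ j" using gd[of j] by (simp add: dist_norm norm_minus_commute)
      ultimately show ?thesis using dist_triangle[of "u n" "abs_l2 g" "u (r j)"] j by linarith
    qed
    then show "\<exists>N. \<forall>n\<ge>N. dist (u n) (abs_l2 g) < e" by blast
  qed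
  then show "convergent u" unfolding convergent_def by blast
qed

text \<open>If \<open>f\<close> is not integrable, neither is its reflection, and both integrals are
  0 by convention.\<close>

lemma integral_reflect_lebesgue: "(\<integral>x. f (- x) \<partial>lebesgue) = (\<integral>x. f x \<partial>(lebesgue::real measure))"
  for f :: "real \<Rightarrow> complex"
proof (cases "integrable lebesgue f")
  case True
  then have "has_bochner_integral lebesgue f (integral\<^sup>L lebesgue f)" by (simp add: has_bochner_integral_iff)
  then have "has_bochner_integral lebesgue (\<lambda>x. f (0 + (-1) * x)) (integral\<^sup>L lebesgue f /\<^sub>R \<bar>-1\<bar>)"
    by (subst has_bochner_integral_lebesgue_real_affine_iff[of "-1" _ _ 0, symmetric]) auto
  then show ?thesis by (simp add: has_bochner_integral_iff)
next
  case False
  moreover have "\<not> integrable lebesgue (\<lambda>x. f (- x))"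
  proof
    assume "integrable lebesgue (\<lambda>x. f (- x))"
    then have "has_bochner_integral lebesgue (\<lambda>x. f (- x)) (integral\<^sup>L lebesgue (\<lambda>x. f (- x)))" by (simp add: has_bochner_integral_iff)
    then have "has_bochner_integral lebesgue (\<lambda>x. f (- (0 + (-1) * x))) (integral\<^sup>L lebesgue (\<lambda>x. f (- x)) /\<^sub>R \<bar>-1\<bar>)"
      by (subst has_bochner_integral_lebesgue_real_affine_iff[of "-1" _ _ 0, symmetric]) auto
    then show False using False by (simp add: has_bochner_integral_iff)
  qed
  ultimately show ?thesis by (simp add: not_integrable_integral_eq)
qed

lemma parity_parity: "parity (parity u) = u"
  by transfer simp

lemma cinner_parity: "cinner (parity u) (parity v) = cinner u v"
  by transfer (rule integral_reflect_lebesgue)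

lemma parity_add: "parity (u + v) = parity u + parity v"
  by transfer (auto intro: square_integrable_reflect square_integrable_add)

lemma parity_scaleC: "parity (a *\<^sub>C u) = a *\<^sub>C parity u"
  by transfer (auto intro: square_integrable_reflect square_integrable_cmult)

lemma square_integrable_pos: "square_integrable f \<Longrightarrow> square_integrable (\<lambda>x. if 0 < x then f x else 0)"
  using square_integrable_indicator[of f "{0<..}"] by simp

lemma square_integrable_neg: "square_integrable f \<Longrightarrow> square_integrable (\<lambda>x. if x < 0 then f x else 0)"
  using square_integrable_indicator[of f "{..<0}"] by simp

lemma pos_part_add: "pos_part (u + v) = pos_part u + pos_part v"
  by transfer (auto intro!: square_integrable_add square_integrable_pos cong: if_cong)

lemma pos_part_scaleC: "pos_part (a *\<^sub>C u) = a *\<^sub>C pos_part u"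
  by transfer (auto intro!: square_integrable_cmult square_integrable_pos cong: if_cong)

lemma pos_part_pos_part: "pos_part (pos_part u) = pos_part u"
  by transfer (auto intro!: square_integrable_pos cong: if_cong)

lemma pos_part_parity: "pos_part (parity u) = parity (neg_part u)"
  by transfer (auto intro!: square_integrable_pos square_integrable_reflect cong: if_cong)

lemma l2_pos_iff: "u \<in> l2_pos \<longleftrightarrow> pos_part u = u"
  unfolding l2_pos_def using pos_part_pos_part by (metis rangeE rangeI)

lemma pos_part_in: "pos_part u \<in> l2_pos"
  by (simp add: l2_pos_def)

lemma pos_part_parity_pos_part: "pos_part (parity (pos_part u)) = 0"
  by transfer (auto intro!: square_integrable_pos square_integrable_reflect square_integrable_zero simp: cong: if_cong)

lemma l2_split: "u = pos_part u + parity (pos_part (parity u))"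
proof transfer
  fix f assume f: "square_integrable f \<and> square_integrable f \<and> (AE x in lebesgue. f x = (f x::complex))"
  have "AE x in lebesgue. f x = (if x \<in> {0<..} then f x else 0) + (if - x \<in> {0<..} then f (- (- x)) else 0)"
    using AE_not_eq_lebesgue[of 0] by eventually_elim auto
  moreover have "square_integrable (\<lambda>x. (if x \<in> {0<..} then f x else 0) + (if - x \<in> {0<..} then f (- (- x)) else 0))"
    using f by (intro square_integrable_add) (simp_all add: square_integrable_pos square_integrable_neg)
  ultimately show "square_integrable f \<and> square_integrable (\<lambda>x. (if x \<in> {0<..} then f x else 0) + (if - x \<in> {0<..} then f (- (- x)) else 0)) \<and>
    (AE x in lebesgue. f x = (if x \<in> {0<..} then f x else 0) + (if - x \<in> {0<..} then f (- (- x)) else 0))"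
    using f by blast
qed

lemma cinner_pos_part: "cinner (pos_part u) v = cinner (pos_part u) (pos_part v)"
  by transfer (auto intro!: Bochner_Integration.integral_cong)

text \<open>The decomposition into two half-lines, the negative one reflected onto the positive one.
  Through it objects on the line become pairs of objects in \<open>l2_pos\<close>.\<close>

lemma cinner_l2_split:
  "cinner u v = cinner (pos_part u) (pos_part v) + cinner (pos_part (parity u)) (pos_part (parity v))"
proof -
  have "cinner u v = cinner (pos_part u + parity (pos_part (parity u))) v" using l2_split[of u] by simp
  also have "\<dots> = cinner (pos_part u) v + cinner (parity (pos_part (parity u))) (parity (parity v))"
    by (simp add: cinner_add_left parity_parity)
  also have "\<dots> = cinner (pos_part u) (pos_part v) + cinner (pos_part (parity u)) (pos_part (parity v))"
    using cinner_pos_part[of u v] cinner_pos_part[of "parity u" "parity v"] by (simp add: cinner_parity)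
  finally show ?thesis .
qed

lemma norm_pos_part_le: "norm (pos_part u) \<le> norm u"
proof -
  have "complex_of_real ((norm u)\<^sup>2) = complex_of_real ((norm (pos_part u))\<^sup>2 + (norm (pos_part (parity u)))\<^sup>2)"
    using cinner_l2_split[of u u] by (simp add: cinner_self)
  then have "(norm u)\<^sup>2 = (norm (pos_part u))\<^sup>2 + (norm (pos_part (parity u)))\<^sup>2" by (simp only: of_real_eq_iff)
  then have "(norm (pos_part u))\<^sup>2 \<le> (norm u)\<^sup>2" by simp
  then show ?thesis by (rule power2_le_imp_le) simp
qed

lemma csubspace_l2_pos: "csubspace l2_pos"
  unfolding csubspace_def
proof (intro conjI ballI allI)
  show "0 \<in> l2_pos" using pos_part_scaleC[of 0 0] by (simp add: l2_pos_iff)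
qed (simp_all add: l2_pos_iff pos_part_add pos_part_scaleC)

lemma closed_l2_pos: "closed l2_pos"
proof -
  have "bounded_linear pos_part"
    by (rule bounded_linear_intro[where K = 1])
       (simp_all add: pos_part_add scaleR_scaleC pos_part_scaleC norm_pos_part_le)
  then have "continuous_on UNIV pos_part" by (rule linear_continuous_on)
  then have "closed {u. pos_part u = u}" by (intro closed_Collect_eq) auto
  moreover have "{u. pos_part u = u} = l2_pos" using l2_pos_iff by auto
  ultimately show ?thesis by simp
qed

section \<open>The indefinite form on boundary values\<close>

type_synonym quad = "complex \<times> complex \<times> complex \<times> complex"

text \<open>A boundary value is \<open>(\<Gamma>\<^sub>0 f\<^sub>+, \<Gamma>\<^sub>0 P f\<^sub>-, \<Gamma>\<^sub>1 f\<^sub>+, \<Gamma>\<^sub>1 P f\<^sub>-)\<close>. The two halves are interchanged in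
  the second argument because the form belongs to \<open>(f, g) \<mapsto> (L f, P g) - (f, P L g)\<close>.\<close>

fun bform :: "quad \<Rightarrow> quad \<Rightarrow> complex" where
  "bform (x1, x2, x3, x4) (y1, y2, y3, y4) = x3 * cnj y2 + x4 * cnj y1 - x1 * cnj y4 - x2 * cnj y3"

fun qscale :: "complex \<Rightarrow> quad \<Rightarrow> quad" where
  "qscale c (x1, x2, x3, x4) = (c * x1, c * x2, c * x3, c * x4)"

text \<open>Both the \<open>G0\<close>-pair \<open>(x1, x2)\<close> and the \<open>G1\<close>-pair
  \<open>(x3, x4)\<close> lie in the same complex line, the kernel of \<open>(\<i> * k, s)\<close>.
  Real \<open>s\<close> and \<open>k\<close> are what makes that line isotropic for
  \<open>x1 * cnj y2 + x2 * cnj y1\<close>.\<close>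

definition qline :: "real \<Rightarrow> real \<Rightarrow> quad set" where
  "qline s k = {(x1, x2, x3, x4). \<i> * k * x1 + s * x2 = 0 \<and> \<i> * k * x3 + s * x4 = 0}"

lemma qline_pair:
  assumes "\<not> (s = 0 \<and> k = 0)" "\<i> * complex_of_real k * x1 + complex_of_real s * x2 = 0"
    "\<i> * complex_of_real k * y1 + complex_of_real s * y2 = 0"
  shows "x1 * cnj y2 + x2 * cnj y1 = 0"
proof -
  have y: "- \<i> * complex_of_real k * cnj y1 + complex_of_real s * cnj y2 = 0"
    using arg_cong[OF assms(3), of cnj] by simp
  show ?thesis
  proof (cases "s = 0")
    case True
    then show ?thesis using assms y by simp
  next
    case False
    have "complex_of_real s * (x1 * cnj y2 + x2 * cnj y1) =
        x1 * (- \<i> * complex_of_real k * cnj y1 + complex_of_real s * cnj y2) +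
        cnj y1 * (\<i> * complex_of_real k * x1 + complex_of_real s * x2)"
      by (simp add: algebra_simps)
    also have "\<dots> = 0" by (simp only: y assms(2) mult_zero_right add_0_right)
    finally show ?thesis using False by simp
  qed
qed

lemma qline_lagrangian:
  assumes "\<not> (s = 0 \<and> k = 0)"
  shows "y \<in> qline s k \<longleftrightarrow> (\<forall>x\<in>qline s k. bform x y = 0)"
proof
  assume y: "y \<in> qline s k"
  show "\<forall>x\<in>qline s k. bform x y = 0"
  proof
    fix x assume x: "x \<in> qline s k"
    obtain x1 x2 x3 x4 y1 y2 y3 y4 where xy: "x = (x1, x2, x3, x4)" "y = (y1, y2, y3, y4)"
      by (metis prod_cases4)
    have "x3 * cnj y2 + x4 * cnj y1 = 0" "x1 * cnj y4 + x2 * cnj y3 = 0"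
      using x y unfolding xy qline_def by (auto intro!: qline_pair[OF assms])
    moreover have "bform x y = (x3 * cnj y2 + x4 * cnj y1) - (x1 * cnj y4 + x2 * cnj y3)" unfolding xy by simp
    ultimately show "bform x y = 0" by simp
  qed
next
  assume *: "\<forall>x\<in>qline s k. bform x y = 0"
  obtain y1 y2 y3 y4 where y: "y = (y1, y2, y3, y4)" by (metis prod_cases4)
  \<comment> \<open>These two vectors span \<open>qline s k\<close>; orthogonality to them gives the
    two defining equations, conjugated.\<close>
  have "bform (0, 0, complex_of_real s, - \<i> * k) y = 0" "bform (- complex_of_real s, \<i> * k, 0, 0) y = 0"
    by (rule bspec[OF *]; simp add: qline_def)+
  then have "complex_of_real s * cnj y2 - \<i> * k * cnj y1 = 0" "complex_of_real s * cnj y4 - \<i> * k * cnj y3 = 0"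
    unfolding y by simp_all
  from arg_cong[OF this(1), of cnj] arg_cong[OF this(2), of cnj]
  show "y \<in> qline s k" unfolding y qline_def by (simp add: algebra_simps eq_neg_iff_add_eq_0)
qed

text \<open>Isotropy, after cancelling \<open>m - cnj m\<close> and \<open>m - cnj n\<close>, places
  the conjugates of \<open>a\<close> and \<open>b\<close> in the kernel of one nonzero functional,
  so \<open>a\<close> and \<open>b\<close> are parallel. After rescaling, the two given vectors
  differ by a multiple of \<open>(0, 0, a1, a2)\<close>. So \<open>B\<close> contains the product of
  the line of \<open>a\<close> with itself, and this product is already Lagrangian.\<close>

lemma lagrangian_two_points:
  fixes B :: "quad set"
  assumes add: "\<And>x y. x \<in> B \<Longrightarrow> y \<in> B \<Longrightarrow> x + y \<in> B" and sc: "\<And>c x. x \<in> B \<Longrightarrow> qscale c x \<in> B"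
    and lag: "\<And>y. y \<in> B \<longleftrightarrow> (\<forall>x\<in>B. bform x y = 0)"
    and a: "(a1, a2, m * a1, m * a2) \<in> B" "a1 \<noteq> 0 \<or> a2 \<noteq> 0"
    and b: "(b1, b2, n * b1, n * b2) \<in> B" "b1 \<noteq> 0 \<or> b2 \<noteq> 0"
    and mn: "m \<noteq> cnj m" "m \<noteq> n" "m \<noteq> cnj n"
  obtains s k :: real where "\<not> (s = 0 \<and> k = 0)" "B = qline s k"
proof -
  have iso: "bform x y = 0" if "x \<in> B" "y \<in> B" for x y using lag[of y] that by blast
  have "(m - cnj m) * (a1 * cnj a2 + a2 * cnj a1) = 0" "(m - cnj n) * (a1 * cnj b2 + a2 * cnj b1) = 0"
    using iso[OF a(1) a(1)] iso[OF a(1) b(1)] by (simp_all add: algebra_simps)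
  then have aa: "a1 * cnj a2 + a2 * cnj a1 = 0" and ab: "a1 * cnj b2 + a2 * cnj b1 = 0"
    using mn by auto
  have "a1 * (cnj a1 * cnj b2 - cnj a2 * cnj b1) = cnj a1 * (a1 * cnj b2 + a2 * cnj b1) - cnj b1 * (a1 * cnj a2 + a2 * cnj a1)"
    "a2 * (cnj a1 * cnj b2 - cnj a2 * cnj b1) = cnj b2 * (a1 * cnj a2 + a2 * cnj a1) - cnj a2 * (a1 * cnj b2 + a2 * cnj b1)"
    by (simp_all add: algebra_simps)
  then have "cnj a1 * cnj b2 - cnj a2 * cnj b1 = 0" using aa ab a(2) by auto
  from arg_cong[OF this, of cnj] have par: "a1 * b2 = a2 * b1" by simp
  obtain t where t: "b1 = t * a1" "b2 = t * a2"
  proof (cases "a1 = 0")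
    case True
    then show ?thesis using that[of "b2 / a2"] a(2) par by auto
  next
    case False
    then show ?thesis using that[of "b1 / a1"] par by (auto simp: field_simps)
  qed
  have "t \<noteq> 0" using b(2) t by auto
  then have an: "(a1, a2, n * a1, n * a2) \<in> B"
    using sc[OF b(1), of "1 / t"] t by simp
  have "(0, 0, (m - n) * a1, (m - n) * a2) \<in> B"
    using add[OF a(1) sc[OF an, of "-1"]] by (simp add: algebra_simps)
  from sc[OF this, of "1 / (m - n)"] have p1: "(0, 0, a1, a2) \<in> B" using mn(2) by simp
  have p0: "(a1, a2, 0, 0) \<in> B" using add[OF a(1) sc[OF p1, of "- m"]] by simp
  \<comment> \<open>By \<open>aa\<close> the number \<open>a1 * cnj a2\<close> is purely imaginary.
    Multiplied by \<open>a1\<close>, the normal \<open>(cnj a2, cnj a1)\<close> of the line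
    therefore takes the form \<open>(\<i> * k, s)\<close> with real \<open>k\<close> and
    \<open>s\<close>; for \<open>a1 = 0\<close> the choice \<open>s = 0\<close>,
    \<open>k = 1\<close> works.\<close>
  obtain s k :: real and c where sk: "\<not> (s = 0 \<and> k = 0)" "c \<noteq> 0" "cnj a2 = c * (\<i> * k)" "cnj a1 = c * s"
  proof (cases "a1 = 0")
    case True
    show ?thesis
    proof (rule that[of 0 1 "- (\<i> * cnj a2)"])
      show "cnj a2 = - (\<i> * cnj a2) * (\<i> * complex_of_real 1)" by (simp add: complex_eq_iff)
    qed (use a(2) True in simp_all)
  next
    case False
    have "Re (a1 * cnj a2) = 0" using arg_cong[OF aa, of Re] by (simp add: mult.commute)
    then have "a1 * cnj a2 = \<i> * Im (a1 * cnj a2)" by (simp add: complex_eq_iff)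
    moreover have "a1 * cnj a1 = complex_of_real ((cmod a1)\<^sup>2)" by (rule complex_norm_square[symmetric])
    ultimately show ?thesis
      using that[of "(cmod a1)\<^sup>2" "Im (a1 * cnj a2)" "1 / a1"] False by (simp add: field_simps)
  qed
  have BK: "x \<in> qline s k" if x: "x \<in> B" for x
  proof -
    obtain x1 x2 x3 x4 where xx: "x = (x1, x2, x3, x4)" by (metis prod_cases4)
    have "x3 * cnj a2 + x4 * cnj a1 = 0" using iso[OF x p0] unfolding xx by simp
    moreover have "- (x1 * cnj a2) - x2 * cnj a1 = 0" using iso[OF x p1] unfolding xx by simp
    ultimately have "c * (\<i> * k * x3 + s * x4) = 0" "c * (\<i> * k * x1 + s * x2) = 0"
      unfolding sk by (simp_all add: algebra_simps) (metis add_eq_0_iff2)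
    then show ?thesis using sk(2) unfolding xx qline_def by simp
  qed
  have "x \<in> B" if x: "x \<in> qline s k" for x
    unfolding lag[of x]
  proof
    fix w assume "w \<in> B"
    then have "w \<in> qline s k" by (rule BK)
    then show "bform w x = 0" using qline_lagrangian[OF sk(1), of x] x by blast
  qed
  then have "B = qline s k" using BK by blast
  then show ?thesis using that sk(1) by blast
qed

text \<open>A vector orthogonal to the sum of \<open>B\<close> and the graph of \<open>m\<close>
  becomes, after a signed permutation of its entries, a point of \<open>B\<close> on the graph of
  \<open>cnj m\<close>; hence conditions at both \<open>m\<close> and \<open>cnj m\<close>. The
  bound holds because the image of the unit sphere in the graph is compact and disjoint from the
  closed set \<open>B\<close>.\<close>

lemma lagrangian_transversal:
  fixes B :: "quad set"
  assumes add: "\<And>x y. x \<in> B \<Longrightarrow> y \<in> B \<Longrightarrow> x + y \<in> B" and sc: "\<And>c x. x \<in> B \<Longrightarrow> qscale c x \<in> B"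
    and lag: "\<And>y. y \<in> B \<longleftrightarrow> (\<forall>x\<in>B. bform x y = 0)"
    and tr: "\<And>a1 a2. (a1, a2, m * a1, m * a2) \<in> B \<Longrightarrow> a1 = 0 \<and> a2 = 0"
    and tr': "\<And>a1 a2. (a1, a2, cnj m * a1, cnj m * a2) \<in> B \<Longrightarrow> a1 = 0 \<and> a2 = 0"
  shows "\<exists>a1 a2. (a1, a2, r1 + m * a1, r2 + m * a2) \<in> B"
    and "\<exists>C. \<forall>a1 a2 r1 r2. (a1, a2, r1 + m * a1, r2 + m * a2) \<in> B \<longrightarrow> norm (a1, a2) \<le> C * norm (r1, r2)"
proof -
  have Z: "0 \<in> B" unfolding lag[of 0] by (auto simp: zero_prod_def)
  have scR: "t *\<^sub>R x \<in> B" if "x \<in> B" for t x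
    using sc[OF that, of "complex_of_real t"] by (cases x) (simp add: scaleR_conv_of_real)
  have Bsub: "subspace B" unfolding subspace_def using Z add scR by blast
  define N where "N a = (fst a, snd a, m * fst a, m * snd a)" for a :: "complex \<times> complex"
  have N_lin: "bounded_linear N"
    unfolding N_def by (intro bounded_linear_Pair bounded_linear_fst bounded_linear_snd
        bounded_linear_const_mult)
  note N_add = linear_add[OF bounded_linear.linear[OF N_lin]] and N_scale = linear_scale[OF bounded_linear.linear[OF N_lin]]
  define W where "W = {b + N a | b a. b \<in> B}"
  have Wsub: "subspace W"
    unfolding subspace_def
  proof (intro conjI ballI allI)
    show "0 \<in> W" unfolding W_def using Z linear_0[OF bounded_linear.linear[OF N_lin]]
      by (intro CollectI exI[of _ 0]) simp
    fix x y assume "x \<in> W" "y \<in> W"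
    then obtain b a b' a' where "b \<in> B" "b' \<in> B" "x = b + N a" "y = b' + N a'" unfolding W_def by blast
    then have "b + b' \<in> B" "x + y = (b + b') + N (a + a')" using add by (auto simp: N_add algebra_simps)
    then show "x + y \<in> W" unfolding W_def by blast
  next
    fix t x assume "x \<in> W"
    then obtain b a where "b \<in> B" "x = b + N a" unfolding W_def by blast
    then have "t *\<^sub>R b \<in> B" "t *\<^sub>R x = t *\<^sub>R b + N (t *\<^sub>R a)" using scR by (auto simp: N_scale scaleR_add_right)
    then show "t *\<^sub>R x \<in> W" unfolding W_def by blast
  qed
  have Wsc: "qscale c x \<in> W" if xW: "x \<in> W" for c x
  proof -
    obtain b a where ba: "b \<in> B" "x = b + N a" using xW unfolding W_def by blast
    have "qscale c x = qscale c b + N (c * fst a, c * snd a)"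
      unfolding ba N_def by (cases b) (simp add: algebra_simps)
    then show ?thesis unfolding W_def using sc[OF ba(1)] by blast
  qed
  have BW: "b \<in> W" if "b \<in> B" for b
  proof -
    have "b = b + N 0" using linear_0[OF bounded_linear.linear[OF N_lin]] by simp
    then show ?thesis unfolding W_def using that by blast
  qed
  have NW: "N a \<in> W" for a
  proof -
    have "N a = 0 + N a" by simp
    then show ?thesis unfolding W_def using Z by blast
  qed
  have full: "x \<in> W" for x
  proof -
    obtain v where v: "v \<in> W" "\<And>w. w \<in> W \<Longrightarrow> inner (x - v) w = 0"
      using closed_subspace_projection[OF Wsub closed_subspace[OF Wsub]] by metis
    obtain d1 d2 d3 d4 where d: "x - v = (d1, d2, d3, d4)" by (metis prod_cases4)
    have orth: "w1 * cnj d1 + w2 * cnj d2 + w3 * cnj d3 + w4 * cnj d4 = 0" if w: "(w1, w2, w3, w4) \<in> W" for w1 w2 w3 w4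
    proof -
      have "inner (x - v) (w1, w2, w3, w4) = 0" "inner (x - v) (qscale \<i> (w1, w2, w3, w4)) = 0"
        using v(2) w Wsc by blast+
      then show ?thesis unfolding d by (simp add: inner_complex_def complex_eq_iff algebra_simps)
    qed
    have "cnj d1 + m * cnj d3 = 0" "cnj d2 + m * cnj d4 = 0"
      using orth[of 1 0 m 0] orth[of 0 1 0 m] NW[of "(1, 0)"] NW[of "(0, 1)"] by (simp_all add: N_def)
    from arg_cong[OF this(1), of cnj] arg_cong[OF this(2), of cnj]
    have dd: "d1 = - (cnj m * d3)" "d2 = - (cnj m * d4)" by (simp_all add: add_eq_0_iff2)
    \<comment> \<open>The signed permutation turns \<open>bform y\<close> of this vector into the
      Hermitian product of \<open>y\<close> with \<open>x - v\<close>.\<close>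
    have "(d4, d3, - d2, - d1) \<in> B"
      unfolding lag[of "(d4, d3, - d2, - d1)"]
    proof
      fix y assume y: "y \<in> B"
      obtain y1 y2 y3 y4 where yy: "y = (y1, y2, y3, y4)" by (metis prod_cases4)
      show "bform y (d4, d3, - d2, - d1) = 0"
        using orth[of y1 y2 y3 y4] BW[OF y] unfolding yy by (simp add: algebra_simps)
    qed
    then have "d4 = 0 \<and> d3 = 0" by (intro tr') (simp add: dd)
    then have "x - v = 0" unfolding d using dd by (simp add: zero_prod_def)
    then show ?thesis using v(1) by simp
  qed
  show "\<exists>a1 a2. (a1, a2, r1 + m * a1, r2 + m * a2) \<in> B"
  proof -
    obtain b a where ba: "b \<in> B" "(0, 0, r1, r2) = b + N a" using full[of "(0, 0, r1, r2)"] unfolding W_def by blast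
    then have "b = (0, 0, r1, r2) - N a" by (simp add: algebra_simps)
    also have "\<dots> = (- fst a, - snd a, r1 + m * (- fst a), r2 + m * (- snd a))" by (simp add: N_def)
    finally have "(- fst a, - snd a, r1 + m * (- fst a), r2 + m * (- snd a)) \<in> B" using ba(1) by simp
    then show ?thesis by blast
  qed
  have cK: "compact (N ` sphere 0 1)"
    by (intro compact_continuous_image linear_continuous_on N_lin compact_sphere)
  have disj: "N ` sphere 0 1 \<inter> B = {}"
  proof (rule ccontr)
    assume "\<not> ?thesis"
    then obtain a where a: "norm a = 1" "N a \<in> B" by auto
    then have "fst a = 0 \<and> snd a = 0" by (intro tr) (simp add: N_def)
    then have "a = 0" by (simp add: prod_eq_iff)
    then show False using a by simp
  qed
  obtain d where d: "d > 0" "\<And>x y. x \<in> N ` sphere 0 1 \<Longrightarrow> y \<in> B \<Longrightarrow> d \<le> dist x y"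
    using separate_compact_closed[OF cK closed_subspace[OF Bsub] disj] by blast
  show "\<exists>C. \<forall>a1 a2 r1 r2. (a1, a2, r1 + m * a1, r2 + m * a2) \<in> B \<longrightarrow> norm (a1, a2) \<le> C * norm (r1, r2)"
  proof (intro exI[of _ "1 / d"] allI impI)
    fix a1 a2 r1 r2 assume b: "(a1, a2, r1 + m * a1, r2 + m * a2) \<in> B"
    define s where "s = norm (a1, a2)"
    show "norm (a1, a2) \<le> 1 / d * norm (r1, r2)"
    proof (cases "s = 0")
      case False
      then have s: "s > 0" unfolding s_def by simp
      have "N ((1 / s) *\<^sub>R (a1, a2)) \<in> N ` sphere 0 1" using s by (intro imageI) (simp add: s_def[symmetric] del: scaleR_Pair)
      then have "d \<le> dist (N ((1 / s) *\<^sub>R (a1, a2))) ((1 / s) *\<^sub>R (a1, a2, r1 + m * a1, r2 + m * a2))"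
        by (intro d(2) scR b)
      also have "\<dots> = norm ((1 / s) *\<^sub>R ((a1, a2, r1 + m * a1, r2 + m * a2) - N (a1, a2)))"
        by (simp only: N_scale dist_norm scaleR_diff_right norm_minus_commute)
      also have "\<dots> = norm (r1, r2) / s" using s by (simp add: N_def norm_Pair del: scaleR_Pair)
      finally show ?thesis using s d(1) by (simp add: field_simps s_def[symmetric])
    qed (simp add: s_def[symmetric] d(1) less_imp_le)
  qed
qed

section \<open>Extensions of the doubled operator\<close>

locale line_triplet = half_triplet l2_pos T G0 G1
  for T :: "(l2 \<times> l2) set" and G0 G1 :: "l2 \<Rightarrow> complex"
begin

abbreviation "R1 \<equiv> pos_part"

definition R2 :: "l2 \<Rightarrow> l2" where "R2 u = pos_part (parity u)"

text \<open>The doubled adjoint. For \<open>T = min_op_pos q\<close> the final proof identifies it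
  with \<open>max_op q\<close>, and \<open>S\<close> with \<open>min_op q\<close>.\<close>

definition Lm where "Lm = {(f, g). (R1 f, R1 g) \<in> L \<and> (R2 f, R2 g) \<in> L}"

definition S where "S = {(u + parity v, u' + parity v') | u u' v v'. (u, u') \<in> T \<and> (v, v') \<in> T}"

definition bv :: "l2 \<Rightarrow> quad" where "bv f = (G0 (R1 f), G0 (R2 f), G1 (R1 f), G1 (R2 f))"

lemma R2_add: "R2 (u + v) = R2 u + R2 v"
  by (simp add: R2_def parity_add pos_part_add)

lemma R2_scaleC: "R2 (a *\<^sub>C u) = a *\<^sub>C R2 u"
  by (simp add: R2_def parity_scaleC pos_part_scaleC)

lemma R_in: "R1 u \<in> l2_pos" "R2 u \<in> l2_pos"
  by (simp_all add: R2_def pos_part_in)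

lemma R_parity: "R1 (parity u) = R2 u" "R2 (parity u) = R1 u"
  by (simp_all add: R2_def parity_parity)

lemma R_join:
  assumes "u \<in> l2_pos" "v \<in> l2_pos"
  shows "R1 (u + parity v) = u" "R2 (u + parity v) = v"
proof -
  have u: "pos_part u = u" and v: "pos_part v = v" using assms l2_pos_iff by auto
  have "pos_part (parity u) = 0" "pos_part (parity v) = 0"
    using pos_part_parity_pos_part[of u] pos_part_parity_pos_part[of v] u v by simp_all
  then show "R1 (u + parity v) = u" "R2 (u + parity v) = v"
    by (simp_all add: R2_def pos_part_add parity_add parity_parity u v)
qed

lemma R_split: "u = R1 u + parity (R2 u)"
  unfolding R2_def by (rule l2_split)

lemma R_eqI: "R1 u = R1 v \<Longrightarrow> R2 u = R2 v \<Longrightarrow> u = v"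
  using R_split[of u] R_split[of v] by simp

lemma cinner_R: "cinner u v = cinner (R1 u) (R1 v) + cinner (R2 u) (R2 v)"
  unfolding R2_def by (rule cinner_l2_split)

lemma norm_parity: "norm (parity u) = norm u"
proof -
  have "complex_of_real ((norm (parity u))\<^sup>2) = complex_of_real ((norm u)\<^sup>2)"
    unfolding cinner_self[symmetric] by (rule cinner_parity)
  then have "(norm (parity u))\<^sup>2 = (norm u)\<^sup>2" by (simp only: of_real_eq_iff)
  then show ?thesis by simp
qed

lemma norm_R: "norm u \<le> norm (R1 u) + norm (R2 u)" "norm (R1 u) \<le> norm u" "norm (R2 u) \<le> norm u"
proof -
  show "norm u \<le> norm (R1 u) + norm (R2 u)"
    by (subst R_split[of u]) (rule norm_triangle_le, simp add: norm_parity)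
  show "norm (R1 u) \<le> norm u" by (rule norm_pos_part_le)
  show "norm (R2 u) \<le> norm u" using norm_pos_part_le[of "parity u"] by (simp add: R2_def norm_parity)
qed

lemma Lm_iff: "(f, g) \<in> Lm \<longleftrightarrow> (R1 f, R1 g) \<in> L \<and> (R2 f, R2 g) \<in> L"
  by (simp add: Lm_def)

lemma Lm_add: "(f, g) \<in> Lm \<Longrightarrow> (f', g') \<in> Lm \<Longrightarrow> (f + f', g + g') \<in> Lm"
  unfolding Lm_iff by (simp add: pos_part_add R2_add L_add)

lemma Lm_scale: "(f, g) \<in> Lm \<Longrightarrow> (a *\<^sub>C f, a *\<^sub>C g) \<in> Lm"
  unfolding Lm_iff by (simp add: pos_part_scaleC R2_scaleC L_scale)

lemma Lm_parity: "(f, g) \<in> Lm \<Longrightarrow> (parity f, parity g) \<in> Lm"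
  unfolding Lm_iff R_parity by simp

lemma Lm_unique: "(f, g) \<in> Lm \<Longrightarrow> (f, g') \<in> Lm \<Longrightarrow> g = g'"
  unfolding Lm_iff using R_eqI L_unique[of "R1 f" "R1 g" "R1 g'"] L_unique[of "R2 f" "R2 g" "R2 g'"] by simp

lemma Lm_join:
  assumes "(u, u') \<in> L" "(v, v') \<in> L"
  shows "(u + parity v, u' + parity v') \<in> Lm"
    "bv (u + parity v) = (G0 u, G0 v, G1 u, G1 v)"
  using L_H[OF assms(1)] L_H[OF assms(2)] assms unfolding Lm_iff bv_def by (simp_all add: R_join)

text \<open>\<open>parity\<close> interchanges \<open>R1\<close> and \<open>R2\<close>, so the
  half-line Green identities are applied crosswise.\<close>

lemma Lm_green:
  assumes "(f, f') \<in> Lm" "(g, g') \<in> Lm"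
  shows "cinner f' (parity g) - cinner f (parity g') = bform (bv f) (bv g)"
proof -
  note F = assms(1)[unfolded Lm_iff] and G = assms(2)[unfolded Lm_iff]
  show ?thesis
    using green[OF conjunct1[OF F] conjunct2[OF G]] green[OF conjunct2[OF F] conjunct1[OF G]]
    by (simp add: bv_def cinner_R[of _ "parity _"] R_parity algebra_simps)
qed

lemma bv_add:
  assumes "(f, f') \<in> Lm" "(g, g') \<in> Lm"
  shows "bv (f + g) = bv f + bv g"
proof -
  note F = assms(1)[unfolded Lm_iff] and G = assms(2)[unfolded Lm_iff]
  show ?thesis
    unfolding bv_def pos_part_add R2_add G_add[OF conjunct1[OF F] conjunct1[OF G]]
      G_add[OF conjunct2[OF F] conjunct2[OF G]] by simp
qed

lemma bv_scale:
  assumes "(f, f') \<in> Lm"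
  shows "bv (a *\<^sub>C f) = qscale a (bv f)"
proof -
  note F = assms(1)[unfolded Lm_iff]
  show ?thesis
    unfolding bv_def pos_part_scaleC R2_scaleC G_scale[OF conjunct1[OF F]] G_scale[OF conjunct2[OF F]] by simp
qed

lemma Lm_surj:
  obtains f f' where "(f, f') \<in> Lm" "bv f = x"
proof -
  obtain x1 x2 x3 x4 where x: "x = (x1, x2, x3, x4)" by (metis prod_cases4)
  obtain u u' where u: "(u, u') \<in> L" "G0 u = x1" "G1 u = x3" by (rule G_surj)
  obtain v v' where v: "(v, v') \<in> L" "G0 v = x2" "G1 v = x4" by (rule G_surj)
  show ?thesis using that Lm_join[OF u(1) v(1)] u v x by simp
qed

lemma S_Lm: "(f, g) \<in> S \<Longrightarrow> (f, g) \<in> Lm \<and> bv f = 0"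
proof -
  assume "(f, g) \<in> S"
  then obtain u u' v v' where *: "f = u + parity v" "g = u' + parity v'" "(u, u') \<in> T" "(v, v') \<in> T"
    unfolding S_def by blast
  have "(u, u') \<in> L" "(v, v') \<in> L" using * sym by auto
  from Lm_join[OF this] show ?thesis using * T_G[OF *(3)] T_G[OF *(4)] by (simp add: zero_prod_def)
qed

lemma parity_zero: "parity 0 = 0"
  using parity_scaleC[of 0 0] by simp

text \<open>Elements of \<open>S\<close> with one summand equal to 0 test the two halves of
  \<open>(y, z)\<close> separately.\<close>

lemma adjoint_Lm:
  assumes "S \<subseteq> A" "(y, z) \<in> adjoint_in UNIV A"
  shows "(y, z) \<in> Lm"
proof -
  have *: "cinner x' y = cinner x z" if "(x, x') \<in> S" for x x'
    using assms that unfolding adjoint_in_def by auto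
  have "(R1 y, R1 z) \<in> L"
    unfolding L_iff
  proof (intro conjI allI impI R_in)
    fix u u' assume u: "(u, u') \<in> T"
    then have uH: "u \<in> l2_pos" "u' \<in> l2_pos" using sym L_H by blast+
    have "(u + parity 0, u' + parity 0) \<in> S" unfolding S_def using u T0 by blast
    from *[OF this] have "cinner u' y = cinner u z" by (simp add: parity_zero)
    then show "cinner u' (R1 y) = cinner u (R1 z)"
      using cinner_pos_part[of u y] cinner_pos_part[of u' y] cinner_pos_part[of u z] cinner_pos_part[of u' z] uH
      by (simp add: l2_pos_iff)
  qed
  moreover have "(R2 y, R2 z) \<in> L"
    unfolding L_iff
  proof (intro conjI allI impI R_in)
    fix u u' assume u: "(u, u') \<in> T"
    then have uH: "u \<in> l2_pos" "u' \<in> l2_pos" using sym L_H by blast+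
    have "(0 + parity u, 0 + parity u') \<in> S" unfolding S_def using u T0 by blast
    from *[OF this] have "cinner (parity u') y = cinner (parity u) z" by simp
    then have "cinner u' (parity y) = cinner u (parity z)"
      using cinner_parity[of u' "parity y"] cinner_parity[of u "parity z"] by (simp add: parity_parity)
    then show "cinner u' (R2 y) = cinner u (R2 z)"
      using cinner_pos_part[of u "parity z"] cinner_pos_part[of u' "parity y"] uH
      by (simp add: l2_pos_iff R2_def)
  qed
  ultimately show ?thesis unfolding Lm_iff by blast
qed

text \<open>\<open>parity\<close> is an involution, so the equation between compositions becomes a
  statement about pairs.\<close>

lemma self_adjoint_wrt_parity:
  "self_adjoint_wrt parity A \<longleftrightarrow> (\<forall>f g. (f, g) \<in> A \<longleftrightarrow> (parity f, parity g) \<in> adjoint_in UNIV A)"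
proof -
  have 1: "(x, y) \<in> adjoint_in UNIV A O graph_of parity \<longleftrightarrow> (x, parity y) \<in> adjoint_in UNIV A" for x y
    unfolding graph_of_def relcomp_unfold by (auto simp: parity_parity)
  have 2: "(x, y) \<in> graph_of parity O A \<longleftrightarrow> (parity x, y) \<in> A" for x y
    unfolding graph_of_def relcomp_unfold by auto
  have "self_adjoint_wrt parity A \<longleftrightarrow> (\<forall>x y. (x, parity y) \<in> adjoint_in UNIV A \<longleftrightarrow> (parity x, y) \<in> A)"
    unfolding self_adjoint_wrt_def set_eq_iff split_paired_All 1 2 ..
  also have "\<dots> \<longleftrightarrow> (\<forall>f g. (f, g) \<in> A \<longleftrightarrow> (parity f, parity g) \<in> adjoint_in UNIV A)"
    by (metis parity_parity)
  finally show ?thesis .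
qed

definition restr :: "quad set \<Rightarrow> (l2 \<times> l2) set" where
  "restr B = {(f, g). (f, g) \<in> Lm \<and> bv f \<in> B}"

lemma restr_iff: "(f, g) \<in> restr B \<longleftrightarrow> (f, g) \<in> Lm \<and> bv f \<in> B"
  by (simp add: restr_def)

lemma restr_linear:
  assumes add: "\<And>x y. x \<in> B \<Longrightarrow> y \<in> B \<Longrightarrow> x + y \<in> B" and sc: "\<And>c x. x \<in> B \<Longrightarrow> qscale c x \<in> B"
    and Z: "0 \<in> B"
  shows "linear_operator (restr B)" "S \<subseteq> restr B"
proof -
  show SB: "S \<subseteq> restr B"
  proof
    fix p assume "p \<in> S"
    then show "p \<in> restr B" using S_Lm[of "fst p" "snd p"] Z by (cases p) (simp add: restr_iff)
  qed
  have "(0 + parity 0, 0 + parity 0) \<in> S" unfolding S_def using T0 by blast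
  then have 0: "(0, 0) \<in> restr B" using SB by (auto simp: parity_zero)
  show "linear_operator (restr B)"
    unfolding linear_operator_def
  proof (intro conjI 0)
    show "single_valued (restr B)"
      unfolding single_valued_def using Lm_unique by (auto simp: restr_iff)
    show "\<forall>(x, x')\<in>restr B. \<forall>(y, y')\<in>restr B. (x + y, x' + y') \<in> restr B"
      by (auto simp: restr_iff Lm_add bv_add add)
    show "\<forall>a. \<forall>(x, x')\<in>restr B. (a *\<^sub>C x, a *\<^sub>C x') \<in> restr B"
      by (auto simp: restr_iff Lm_scale bv_scale sc)
  qed
qed

text \<open>By Green's identity the reflected pair lies in the adjoint exactly if
  \<open>bv f\<close> is \<open>bform\<close>-orthogonal to \<open>B\<close>; surjectivity of
  \<open>bv\<close> makes every element of \<open>B\<close> available for the test.\<close>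

lemma restr_self_adjoint:
  assumes S: "S \<subseteq> restr B" and lag: "\<And>y. y \<in> B \<longleftrightarrow> (\<forall>x\<in>B. bform x y = 0)"
  shows "self_adjoint_wrt parity (restr B)"
  unfolding self_adjoint_wrt_parity
proof (intro allI iffI)
  fix f g assume fg: "(f, g) \<in> restr B"
  show "(parity f, parity g) \<in> adjoint_in UNIV (restr B)"
    unfolding adjoint_in_def
  proof (clarsimp)
    fix x x' assume x: "(x, x') \<in> restr B"
    have "bform (bv x) (bv f) = 0" using lag[of "bv f"] x fg unfolding restr_iff by blast
    then show "cinner x' (parity f) = cinner x (parity g)"
      using Lm_green[of x x' f g] x fg unfolding restr_iff by simp
  qed
next
  fix f g assume a: "(parity f, parity g) \<in> adjoint_in UNIV (restr B)"
  then have "(parity f, parity g) \<in> Lm" by (rule adjoint_Lm[OF S])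
  from Lm_parity[OF this] have fg: "(f, g) \<in> Lm" by (simp add: parity_parity)
  have "bv f \<in> B"
    unfolding lag[of "bv f"]
  proof
    fix b assume b: "b \<in> B"
    obtain x x' where x: "(x, x') \<in> Lm" "bv x = b" by (rule Lm_surj)
    then have "(x, x') \<in> restr B" using b by (simp add: restr_iff)
    then have "cinner x' (parity f) = cinner x (parity g)" using a unfolding adjoint_in_def by auto
    then show "bform b (bv f) = 0" using Lm_green[OF x(1) fg] x(2) by simp
  qed
  then show "(f, g) \<in> restr B" using fg by (simp add: restr_iff)
qed

lemma qline_closed:
  "x \<in> qline s k \<Longrightarrow> y \<in> qline s k \<Longrightarrow> x + y \<in> qline s k" "x \<in> qline s k \<Longrightarrow> qscale c x \<in> qline s k" "0 \<in> qline s k"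
proof -
  assume xy: "x \<in> qline s k" "y \<in> qline s k"
  obtain x1 x2 x3 x4 y1 y2 y3 y4 where e: "x = (x1, x2, x3, x4)" "y = (y1, y2, y3, y4)" by (metis prod_cases4)
  have "\<i> * k * (x1 + y1) + s * (x2 + y2) = (\<i> * k * x1 + s * x2) + (\<i> * k * y1 + s * y2)"
    "\<i> * k * (x3 + y3) + s * (x4 + y4) = (\<i> * k * x3 + s * x4) + (\<i> * k * y3 + s * y4)"
    by (simp_all add: algebra_simps)
  then show "x + y \<in> qline s k" using xy unfolding e qline_def by simp
next
  assume x: "x \<in> qline s k"
  obtain x1 x2 x3 x4 where e: "x = (x1, x2, x3, x4)" by (metis prod_cases4)
  have "\<i> * k * (c * x1) + s * (c * x2) = c * (\<i> * k * x1 + s * x2)"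
    "\<i> * k * (c * x3) + s * (c * x4) = c * (\<i> * k * x3 + s * x4)"
    by (simp_all add: algebra_simps)
  then show "qscale c x \<in> qline s k" using x unfolding e qline_def by simp
qed (simp add: qline_def zero_prod_def)

text \<open>The halves of \<open>f\<close> are the multiples \<open>s\<close> and
  \<open>- \<i> * k\<close> of the same \<open>psi z\<close>. The \<open>G1\<close>-pair is then
  \<open>weyl z\<close> times the \<open>G0\<close>-pair, so both lie in the line whatever
  \<open>weyl z\<close> is.\<close>

lemma eigenvector_qline:
  assumes z: "Im z \<noteq> 0" and sk: "\<not> (s = 0 \<and> k = 0)"
  obtains f where "f \<noteq> 0" "(f, z *\<^sub>C f) \<in> restr (qline s k)"
proof -
  define f where "f = complex_of_real s *\<^sub>C psi z + parity ((- \<i> * complex_of_real k) *\<^sub>C psi z)"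
  note p = psi[OF z]
  have zf: "z *\<^sub>C f = complex_of_real s *\<^sub>C z *\<^sub>C psi z + parity ((- \<i> * complex_of_real k) *\<^sub>C z *\<^sub>C psi z)"
    by (simp add: f_def scaleC_add_right scaleC_scaleC parity_scaleC mult.commute)
  have b: "bv f = (complex_of_real s, - \<i> * complex_of_real k, complex_of_real s * weyl z, - \<i> * complex_of_real k * weyl z)"
    and L: "(f, z *\<^sub>C f) \<in> Lm"
    using Lm_join[OF L_scale[OF p(1), of "complex_of_real s"] L_scale[OF p(1), of "- \<i> * complex_of_real k"]]
      G_scale[OF p(1)] p(2) unfolding zf by (simp_all add: f_def weyl_def)
  have "f \<noteq> 0"
  proof
    assume "f = 0"
    then have "bv f = 0" using S_Lm[of 0 0] T0 unfolding S_def by (force simp: parity_zero)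
    then show False using b sk by (simp add: zero_prod_def)
  qed
  moreover have "bv f \<in> qline s k" unfolding b qline_def by (simp add: algebra_simps)
  ultimately show ?thesis using that L unfolding restr_iff by blast
qed

text \<open>Every non-real number is an eigenvalue, and a bounded inverse of the operator minus
  \<open>z\<close> would keep eigenvalues away from \<open>z\<close>; so real \<open>z\<close> are
  excluded as well.\<close>

lemma resolvent_set_qline:
  assumes sk: "\<not> (s = 0 \<and> k = 0)"
  shows "resolvent_set (restr (qline s k)) = {}"
proof (rule ccontr)
  assume "\<not> ?thesis"
  then obtain z where z: "z \<in> resolvent_set (restr (qline s k))" by blast
  then obtain C where C0: "\<forall>(x, x')\<in>restr (qline s k). norm x \<le> C * norm (x' - z *\<^sub>C x)"
    unfolding resolvent_set_def by blast
  have C: "norm x \<le> C * norm (x' - z *\<^sub>C x)" if "(x, x') \<in> restr (qline s k)" for x x'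
    using bspec[OF C0 that] by simp
  \<comment> \<open>A shift short enough to contradict the bound \<open>C\<close> that makes
    \<open>w\<close> non-real: if \<open>r\<close> happens to lead to the real axis,
    \<open>r / 2\<close> does not.\<close>
  obtain t :: real where t: "t > 0" "\<bar>C\<bar> * t < 1" "Im z + t \<noteq> 0"
  proof -
    define r where "r = 1 / (\<bar>C\<bar> + 1)"
    have r: "r > 0" "\<bar>C\<bar> * r < 1" by (simp_all add: r_def field_simps)
    have "\<bar>C\<bar> * (r / 2) < 1" using r by linarith
    then show ?thesis using that[of r] that[of "r / 2"] r by (cases "Im z + r = 0") auto
  qed
  define w where "w = z + \<i> * complex_of_real t"
  have "Im w \<noteq> 0" using t by (simp add: w_def)
  then obtain f where f: "f \<noteq> 0" "(f, w *\<^sub>C f) \<in> restr (qline s k)" using eigenvector_qline[OF _ sk] by blast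
  have "w *\<^sub>C f - z *\<^sub>C f = (\<i> * complex_of_real t) *\<^sub>C f" by (simp add: w_def scaleC_add_left)
  then have "norm f \<le> C * (t * norm f)" using C[OF f(2)] t(1) by (simp add: norm_scaleC norm_mult)
  also have "\<dots> \<le> (\<bar>C\<bar> * t) * norm f" using t(1) by (simp add: mult_right_mono mult.assoc)
  also have "\<dots> < 1 * norm f" using t(2) f(1) by (intro mult_strict_right_mono) auto
  finally show False by simp
qed

text \<open>Membership of \<open>(f, g)\<close> in \<open>A\<close> is membership of the reflected
  pair in the adjoint, and Green's identity makes the latter a condition on \<open>bv f\<close>
  alone. So \<open>A\<close> is cut out of \<open>Lm\<close> by its boundary values, and these form
  a Lagrangian space.\<close>

lemma self_adjoint_restr:
  assumes lin: "linear_operator A" and S: "S \<subseteq> A" and sa: "self_adjoint_wrt parity A"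
  defines "B \<equiv> bv ` Domain A"
  shows "A = restr B" "\<And>x y. x \<in> B \<Longrightarrow> y \<in> B \<Longrightarrow> x + y \<in> B" "\<And>c x. x \<in> B \<Longrightarrow> qscale c x \<in> B"
    "\<And>y. y \<in> B \<longleftrightarrow> (\<forall>x\<in>B. bform x y = 0)"
proof -
  note sa' = sa[unfolded self_adjoint_wrt_parity, rule_format]
  have AL: "(f, g) \<in> Lm" if "(f, g) \<in> A" for f g
    using Lm_parity[OF adjoint_Lm[OF S sa'[THEN iffD1, OF that]]] by (simp add: parity_parity)
  have char: "(f, g) \<in> A \<longleftrightarrow> (\<forall>x\<in>B. bform x (bv f) = 0)" if fg: "(f, g) \<in> Lm" for f g
  proof
    assume a: "(f, g) \<in> A"
    show "\<forall>x\<in>B. bform x (bv f) = 0"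
    proof
      fix b assume "b \<in> B"
      then obtain x x' where x: "(x, x') \<in> A" "b = bv x" unfolding B_def by auto
      have "cinner x' (parity f) = cinner x (parity g)"
        using sa'[THEN iffD1, OF a] x unfolding adjoint_in_def by auto
      then show "bform b (bv f) = 0" using Lm_green[OF AL[OF x(1)] fg] x(2) by simp
    qed
  next
    assume a: "\<forall>x\<in>B. bform x (bv f) = 0"
    have "(parity f, parity g) \<in> adjoint_in UNIV A"
      unfolding adjoint_in_def
    proof (clarsimp)
      fix x x' assume x: "(x, x') \<in> A"
      then have "bv x \<in> B" unfolding B_def by auto
      then show "cinner x' (parity f) = cinner x (parity g)"
        using Lm_green[OF AL[OF x] fg] a by simp
    qed
    then show "(f, g) \<in> A" by (rule sa'[THEN iffD2])
  qed
  show lag: "y \<in> B \<longleftrightarrow> (\<forall>x\<in>B. bform x y = 0)" for y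
  proof
    assume "y \<in> B"
    then obtain f g where "(f, g) \<in> A" "y = bv f" unfolding B_def by auto
    then show "\<forall>x\<in>B. bform x y = 0" using char[OF AL] by blast
  next
    assume a: "\<forall>x\<in>B. bform x y = 0"
    obtain f f' where f: "(f, f') \<in> Lm" "bv f = y" by (rule Lm_surj)
    then have "(f, f') \<in> A" using char a by blast
    then show "y \<in> B" unfolding B_def using f(2) by (intro image_eqI[OF _ DomainI]) auto
  qed
  show "A = restr B"
  proof (intro set_eqI iffI)
    fix p assume p: "p \<in> A"
    obtain f g where fg: "p = (f, g)" by (cases p)
    then have "f \<in> Domain A" using p by blast
    then show "p \<in> restr B" using AL[of f g] p unfolding fg restr_iff B_def by blast
  next
    fix p assume p: "p \<in> restr B"
    obtain f g where fg: "p = (f, g)" by (cases p)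
    then have "(f, g) \<in> Lm" "bv f \<in> B" using p unfolding fg restr_iff by blast+
    then show "p \<in> A" using char[of f g] lag[of "bv f"] unfolding fg by blast
  qed
  show "x + y \<in> B" if xy: "x \<in> B" "y \<in> B" for x y
  proof -
    obtain f f' g g' where *: "(f, f') \<in> A" "x = bv f" "(g, g') \<in> A" "y = bv g" using xy unfolding B_def by auto
    then have "(f + g, f' + g') \<in> A" using lin unfolding linear_operator_def by blast
    then have "f + g \<in> Domain A" by blast
    then show ?thesis using bv_add[OF AL[OF *(1)] AL[OF *(3)]] * unfolding B_def by (simp add: image_iff) metis
  qed
  show "qscale c x \<in> B" if x: "x \<in> B" for c x
  proof -
    obtain f f' where *: "(f, f') \<in> A" "x = bv f" using x unfolding B_def by auto
    then have "(c *\<^sub>C f, c *\<^sub>C f') \<in> A" using lin unfolding linear_operator_def by blast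
    then have "c *\<^sub>C f \<in> Domain A" by blast
    then show ?thesis using bv_scale[OF AL[OF *(1)]] * unfolding B_def by (simp add: image_iff) metis
  qed
qed

text \<open>Krein's resolvent formula: in each half the \<open>A0\<close>-solution is corrected by a
  multiple of \<open>psi z\<close>, with coefficients \<open>a1\<close>, \<open>a2\<close> chosen so
  that the boundary value falls into \<open>B\<close>. Transversality of \<open>B\<close> to the
  graph of \<open>weyl z\<close> makes them exist, unique and bounded.\<close>

lemma transversal_resolvent:
  assumes z: "Im z \<noteq> 0"
    and tr: "\<And>a1 a2. (a1, a2, weyl z * a1, weyl z * a2) \<in> B \<Longrightarrow> a1 = 0 \<and> a2 = 0"
    and sol: "\<And>r1 r2. \<exists>a1 a2. (a1, a2, r1 + weyl z * a1, r2 + weyl z * a2) \<in> B"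
    and bd: "\<And>a1 a2 r1 r2. (a1, a2, r1 + weyl z * a1, r2 + weyl z * a2) \<in> B \<Longrightarrow> norm (a1, a2) \<le> C * norm (r1, r2)"
    and diff: "\<And>x y. x \<in> B \<Longrightarrow> y \<in> B \<Longrightarrow> x - y \<in> B"
  shows "z \<in> resolvent_set (restr B)"
proof -
  note p = psi[OF z]
  \<comment> \<open>The 2 counts the \<open>A0\<close>-solutions of the two halves. The 4 is 2 for
    the halves times 2 from bounding \<open>norm (G1 x1, G1 x2)\<close> by the sum of its
    entries.\<close>
  have ex: "\<exists>x. (x, w + z *\<^sub>C x) \<in> restr B \<and> norm x \<le> (2 / \<bar>Im z\<bar> + 4 * \<bar>C\<bar> * norm (psi (cnj z)) * norm (psi z)) * norm w" for w
  proof -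
    obtain x1 x1' where x1: "(x1, x1') \<in> A0" "x1' - z *\<^sub>C x1 = R1 w" using A0_onto[OF z R_in(1)] by blast
    obtain x2 x2' where x2: "(x2, x2') \<in> A0" "x2' - z *\<^sub>C x2 = R2 w" using A0_onto[OF z R_in(2)] by blast
    obtain a1 a2 where a: "(a1, a2, G1 x1 + weyl z * a1, G1 x2 + weyl z * a2) \<in> B" using sol by blast
    define u where "u = x1 + a1 *\<^sub>C psi z"
    define v where "v = x2 + a2 *\<^sub>C psi z"
    have u: "(u, x1' + a1 *\<^sub>C z *\<^sub>C psi z) \<in> L" "G0 u = a1" "G1 u = G1 x1 + weyl z * a1"
      using L_add[OF _ L_scale[OF p(1), of a1], of x1 x1'] G_add[OF _ L_scale[OF p(1), of a1], of x1 x1'] G_scale[OF p(1)] p(2) x1(1)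
      unfolding A0_iff u_def weyl_def by (simp_all add: mult.commute)
    have v: "(v, x2' + a2 *\<^sub>C z *\<^sub>C psi z) \<in> L" "G0 v = a2" "G1 v = G1 x2 + weyl z * a2"
      using L_add[OF _ L_scale[OF p(1), of a2], of x2 x2'] G_add[OF _ L_scale[OF p(1), of a2], of x2 x2'] G_scale[OF p(1)] p(2) x2(1)
      unfolding A0_iff v_def weyl_def by (simp_all add: mult.commute)
    have e1: "x1' = R1 w + z *\<^sub>C x1" and e2: "x2' = R2 w + z *\<^sub>C x2" using x1(2) x2(2) by (simp_all add: algebra_simps)
    have "(x1' + a1 *\<^sub>C z *\<^sub>C psi z) + parity (x2' + a2 *\<^sub>C z *\<^sub>C psi z) = w + z *\<^sub>C (u + parity v)"
      unfolding e1 e2 u_def v_def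
      by (subst (3) R_split[of w]) (simp add: scaleC_add_right scaleC_scaleC parity_add parity_scaleC mult.commute algebra_simps)
    then have 1: "(u + parity v, w + z *\<^sub>C (u + parity v)) \<in> restr B"
      using Lm_join[OF u(1) v(1)] u v a unfolding restr_iff by simp
    have n1: "norm x1 \<le> norm w / \<bar>Im z\<bar>" and n2: "norm x2 \<le> norm w / \<bar>Im z\<bar>"
      using A0_lower[OF x1(1), of z] A0_lower[OF x2(1), of z] norm_R(2,3)[of w] z
      by (simp_all add: x1(2) x2(2) field_simps)
    have r: "cmod (G1 x1) \<le> norm w * norm (psi (cnj z))" "cmod (G1 x2) \<le> norm w * norm (psi (cnj z))"
      unfolding A0_G1[OF x1(1) z] A0_G1[OF x2(1) z] x1(2) x2(2)
      by (rule order_trans[OF cinner_norm_le mult_right_mono[OF _ norm_ge_zero]], rule norm_R)+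
    have "norm (a1, a2) \<le> C * norm (G1 x1, G1 x2)" by (rule bd[OF a])
    also have "\<dots> \<le> \<bar>C\<bar> * norm (G1 x1, G1 x2)" by (intro mult_right_mono) auto
    also have "\<dots> \<le> \<bar>C\<bar> * (2 * (norm w * norm (psi (cnj z))))"
      using norm_Pair_le[of "G1 x1" "G1 x2"] r by (intro mult_left_mono) auto
    finally have an: "norm (a1, a2) \<le> \<bar>C\<bar> * (2 * (norm w * norm (psi (cnj z))))" .
    have a12: "cmod a1 \<le> norm (a1, a2)" "cmod a2 \<le> norm (a1, a2)"
      using norm_fst_le[of a1 a2] norm_snd_le[of a2 a1] by simp_all
    have "norm (u + parity v) \<le> (norm x1 + cmod a1 * norm (psi z)) + (norm x2 + cmod a2 * norm (psi z))"
      unfolding u_def v_def by (intro norm_triangle_le add_mono) (simp_all add: norm_parity norm_triangle_le norm_scaleC)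
    also have "\<dots> \<le> (norm w / \<bar>Im z\<bar> + \<bar>C\<bar> * (2 * (norm w * norm (psi (cnj z)))) * norm (psi z)) +
        (norm w / \<bar>Im z\<bar> + \<bar>C\<bar> * (2 * (norm w * norm (psi (cnj z)))) * norm (psi z))"
      by (intro add_mono mult_right_mono n1 n2 order_trans[OF a12(1) an] order_trans[OF a12(2) an]) auto
    also have "\<dots> = (2 / \<bar>Im z\<bar> + 4 * \<bar>C\<bar> * norm (psi (cnj z)) * norm (psi z)) * norm w"
      by (simp add: algebra_simps)
    finally show ?thesis using 1 by blast
  qed
  have uniq: "x = y" if xy: "(x, w + z *\<^sub>C x) \<in> restr B" "(y, w + z *\<^sub>C y) \<in> restr B" for x y w
  proof -
    define d where "d = x + (-1) *\<^sub>C y"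
    have xyL: "(x, w + z *\<^sub>C x) \<in> Lm" "(y, w + z *\<^sub>C y) \<in> Lm" and xyB: "bv x \<in> B" "bv y \<in> B"
      using xy unfolding restr_iff by blast+
    have "w + z *\<^sub>C x + (-1) *\<^sub>C (w + z *\<^sub>C y) = z *\<^sub>C d"
      by (simp add: d_def scaleC_minus_one scaleC_add_right scaleC_minus_right scaleC_diff_right)
    then have dL: "(d, z *\<^sub>C d) \<in> Lm" using Lm_add[OF xyL(1) Lm_scale[OF xyL(2), of "-1"]] by (simp add: d_def)
    have "bv d = bv x + qscale (-1) (bv y)"
      unfolding d_def using bv_add[OF xyL(1) Lm_scale[OF xyL(2)]] bv_scale[OF xyL(2)] by simp
    also have "\<dots> = bv x - bv y" by (cases "bv x"; cases "bv y") simp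
    finally have dB: "bv d \<in> B" using diff xyB by simp
    have "(R1 d, z *\<^sub>C R1 d) \<in> L" "(R2 d, z *\<^sub>C R2 d) \<in> L"
      using dL unfolding Lm_iff pos_part_scaleC R2_scaleC by blast+
    from eigen_psi[OF z this(1)] eigen_psi[OF z this(2)]
    have e: "R1 d = G0 (R1 d) *\<^sub>C psi z" "R2 d = G0 (R2 d) *\<^sub>C psi z" .
    have "G1 (R1 d) = weyl z * G0 (R1 d)" "G1 (R2 d) = weyl z * G0 (R2 d)"
      by (subst e, simp add: G_scale[OF p(1)] weyl_def)+
    then have "(G0 (R1 d), G0 (R2 d), weyl z * G0 (R1 d), weyl z * G0 (R2 d)) \<in> B"
      using dB by (simp add: bv_def)
    then have "G0 (R1 d) = 0 \<and> G0 (R2 d) = 0" by (rule tr)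
    then have "R1 d = 0" "R2 d = 0" using e by simp_all
    then have "d = 0" using R_split[of d] by (simp add: parity_zero)
    then show "x = y" by (simp add: d_def scaleC_minus_one)
  qed
  show ?thesis
    unfolding resolvent_set_def
  proof (intro CollectI conjI allI)
    fix w
    obtain x where "(x, w + z *\<^sub>C x) \<in> restr B" using ex by blast
    then show "\<exists>!x. (x, w + z *\<^sub>C x) \<in> restr B" using uniq by blast
  next
    show "\<exists>C. \<forall>(x, x')\<in>restr B. norm x \<le> C * norm (x' - z *\<^sub>C x)"
    proof (intro exI ballI, clarify)
      fix x x' assume x: "(x, x') \<in> restr B"
      obtain y where y: "(y, (x' - z *\<^sub>C x) + z *\<^sub>C y) \<in> restr B"
        "norm y \<le> (2 / \<bar>Im z\<bar> + 4 * \<bar>C\<bar> * norm (psi (cnj z)) * norm (psi z)) * norm (x' - z *\<^sub>C x)"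
        using ex by blast
      have "x = y" by (rule uniq[OF _ y(1)]) (simp add: x)
      then show "norm x \<le> (2 / \<bar>Im z\<bar> + 4 * \<bar>C\<bar> * norm (psi (cnj z)) * norm (psi z)) * norm (x' - z *\<^sub>C x)"
        using y(2) by simp
    qed
  qed
qed

text \<open>At each of the two points \<open>B\<close> meets the graph of \<open>weyl\<close> or
  that of its conjugate; which of them is left open. Positivity of \<open>Im (weyl z)\<close> keeps
  all combinations distinct, so that \<open>lagrangian_two_points\<close> applies in every
  case.\<close>

theorem empty_resolvent_extensions:
  assumes z: "Im z > 0" "Im z' > 0" and ne: "weyl z \<noteq> weyl z'"
  shows "{A. linear_operator A \<and> S \<subseteq> A \<and> self_adjoint_wrt parity A \<and> resolvent_set A = {}} =
    {restr (qline s k) | s k. \<not> (s = 0 \<and> k = 0)}"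
proof (intro set_eqI iffI)
  fix A assume "A \<in> {restr (qline s k) | s k. \<not> (s = 0 \<and> k = 0)}"
  then obtain s k where A: "A = restr (qline s k)" and sk: "\<not> (s = 0 \<and> k = 0)" by blast
  have "linear_operator A" "S \<subseteq> A" unfolding A by (rule restr_linear; rule qline_closed; assumption)+
  moreover have "self_adjoint_wrt parity A"
    using restr_self_adjoint[OF \<open>S \<subseteq> A\<close>[unfolded A] qline_lagrangian[OF sk]] unfolding A .
  moreover have "resolvent_set A = {}" unfolding A by (rule resolvent_set_qline[OF sk])
  ultimately show "A \<in> {A. linear_operator A \<and> S \<subseteq> A \<and> self_adjoint_wrt parity A \<and> resolvent_set A = {}}" by blast
next
  fix A assume "A \<in> {A. linear_operator A \<and> S \<subseteq> A \<and> self_adjoint_wrt parity A \<and> resolvent_set A = {}}"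
  then have A: "linear_operator A" "S \<subseteq> A" "self_adjoint_wrt parity A" "resolvent_set A = {}" by auto
  define B where "B = bv ` Domain A"
  note B = self_adjoint_restr[OF A(1-3), folded B_def]
  have point: "\<exists>m a1 a2. (m = weyl w \<or> m = cnj (weyl w)) \<and> (a1, a2, m * a1, m * a2) \<in> B \<and> (a1 \<noteq> 0 \<or> a2 \<noteq> 0)"
    if w: "Im w > 0" for w
  proof (rule ccontr)
    assume no: "\<not> ?thesis"
    have w0: "Im w \<noteq> 0" using w by simp
    have tr: "a1 = 0 \<and> a2 = 0" if "(a1, a2, weyl w * a1, weyl w * a2) \<in> B" for a1 a2 using no that by blast
    have tr': "a1 = 0 \<and> a2 = 0" if "(a1, a2, cnj (weyl w) * a1, cnj (weyl w) * a2) \<in> B" for a1 a2 using no that by blast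
    note T = lagrangian_transversal[of B, OF B(2) B(3) B(4) tr tr']
    obtain C where C: "\<forall>a1 a2 r1 r2. (a1, a2, r1 + weyl w * a1, r2 + weyl w * a2) \<in> B \<longrightarrow> norm (a1, a2) \<le> C * norm (r1, r2)"
      using T(2) by blast
    have diff: "x - y \<in> B" if xy: "x \<in> B" "y \<in> B" for x y
    proof -
      have "x - y = x + qscale (-1) y" by (cases x; cases y) simp
      then show ?thesis using B(2)[OF xy(1) B(3)[OF xy(2), of "-1"]] by (simp only:)
    qed
    have "w \<in> resolvent_set (restr B)"
      by (rule transversal_resolvent[OF w0 tr T(1) C[rule_format] diff])
    then show False using A(4) B(1) by simp
  qed
  obtain m a1 a2 where m: "m = weyl z \<or> m = cnj (weyl z)" "(a1, a2, m * a1, m * a2) \<in> B" "a1 \<noteq> 0 \<or> a2 \<noteq> 0"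
    using point[OF z(1)] by blast
  obtain n b1 b2 where n: "n = weyl z' \<or> n = cnj (weyl z')" "(b1, b2, n * b1, n * b2) \<in> B" "b1 \<noteq> 0 \<or> b2 \<noteq> 0"
    using point[OF z(2)] by blast
  have "Im (weyl z) > 0" "Im (weyl z') > 0"
    using Im_weyl[of z] Im_weyl[of z'] z by simp_all
  then have "m \<noteq> cnj m" "m \<noteq> n" "m \<noteq> cnj n"
    using m(1) n(1) ne by (auto simp: complex_eq_iff)
  then obtain s k where "\<not> (s = 0 \<and> k = 0)" "B = qline s k"
    using lagrangian_two_points[of B, OF B(2) B(3) B(4) m(2,3) n(2,3)] by metis
  then show "A \<in> {restr (qline s k) | s k. \<not> (s = 0 \<and> k = 0)}" using B(1) by blast
qed

end

section \<open>Volterra equations with a degenerate kernel\<close>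

text \<open>The equation \<open>y = y0 + z * op y\<close> with a rank-two kernel, as variation of
  constants produces it. The weight \<open>S\<close> measures solutions and may be unbounded near
  \<open>c\<close>; \<open>kernel\<close> turns a bound \<open>S * B\<close> for \<open>f\<close>
  into \<open>S\<close> times the integral of \<open>\<kappa> * B\<close> for \<open>op f\<close>.
  As \<open>kernel\<close> concerns only the sum of the two terms, \<open>b_le\<close> supplies
  integrability of each.\<close>

locale volterra =
  fixes J :: "real set" and c :: real and a1 a2 b1 b2 y0 :: "real \<Rightarrow> complex" and S \<kappa> :: "real \<Rightarrow> real" and C :: real
  assumes J: "is_interval J" "c \<in> J" "J \<subseteq> {c..}"
    and meas: "\<And>x. x \<in> J \<Longrightarrow> a1 \<in> borel_measurable (lebesgue_on {c..x})" "\<And>x. x \<in> J \<Longrightarrow> a2 \<in> borel_measurable (lebesgue_on {c..x})"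
      "\<And>x. x \<in> J \<Longrightarrow> b1 \<in> borel_measurable (lebesgue_on {c..x})" "\<And>x. x \<in> J \<Longrightarrow> b2 \<in> borel_measurable (lebesgue_on {c..x})"
      "\<And>x. x \<in> J \<Longrightarrow> y0 \<in> borel_measurable (lebesgue_on {c..x})"
    and \<kappa>: "\<And>x. x \<in> J \<Longrightarrow> \<kappa> absolutely_integrable_on {c..x}"
    and S0: "\<And>x. x \<in> J \<Longrightarrow> 0 \<le> S x"
    and kernel: "\<And>x t. x \<in> J \<Longrightarrow> c \<le> t \<Longrightarrow> t \<le> x \<Longrightarrow> cmod (a1 x * b1 t + a2 x * b2 t) * S t \<le> S x * \<kappa> t"
    and b_le: "\<And>t. t \<in> J \<Longrightarrow> cmod (b1 t) * S t \<le> \<kappa> t" "\<And>t. t \<in> J \<Longrightarrow> cmod (b2 t) * S t \<le> \<kappa> t"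
    and y0: "\<And>x. x \<in> J \<Longrightarrow> cmod (y0 x) \<le> C * S x" and C0: "C \<ge> 0"
begin

definition K where "K x = integral {c..x} \<kappa>"

lemma sub: "x \<in> J \<Longrightarrow> {c..x} \<subseteq> J"
  using interval_sub[OF J(1,2)] .

lemma \<kappa>0: "t \<in> J \<Longrightarrow> 0 \<le> \<kappa> t"
  using b_le(1)[of t] S0[of t] by (meson mult_nonneg_nonneg norm_ge_zero order_trans)

lemma prim_K: "prim_on J K \<kappa>"
  unfolding K_def by (rule prim_on_integral[OF \<kappa> J(3)])

lemma K_c: "K c = 0"
  by (simp add: K_def)

lemma K_mono: "x \<in> J \<Longrightarrow> y \<in> J \<Longrightarrow> x \<le> y \<Longrightarrow> K x \<le> K y"
  using prim_onD(2)[OF prim_K, of x y] \<kappa>0 interval_sub[OF J(1), of x y]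
  by (metis diff_ge_0_iff_ge has_integral_nonneg subsetD)

lemma K0: "x \<in> J \<Longrightarrow> 0 \<le> K x"
  using K_mono[of c x] J K_c by auto

lemma K_power:
  assumes "x \<in> J"
  shows "((\<lambda>t. \<kappa> t * (K t ^ n / fact n)) has_integral K x ^ Suc n / fact (Suc n)) {c..x}"
  using prim_onD(2)[OF prim_on_power_fact[OF prim_K J(1)], of c x n] assms J K_c by auto

lemma b_integrable:
  assumes x: "x \<in> J" and f: "f \<in> borel_measurable (lebesgue_on {c..x})"
    and le: "\<forall>t\<in>{c..x}. cmod (f t) \<le> S t * B t" and B: "\<forall>t\<in>{c..x}. 0 \<le> B t"
    and int: "(\<lambda>t. \<kappa> t * B t) integrable_on {c..x}"
  shows "(\<lambda>t. b1 t * f t) absolutely_integrable_on {c..x}" "(\<lambda>t. b2 t * f t) absolutely_integrable_on {c..x}"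
    and "t \<in> {c..x} \<Longrightarrow> cmod (b1 t * f t) \<le> \<kappa> t * B t" "t \<in> {c..x} \<Longrightarrow> cmod (b2 t * f t) \<le> \<kappa> t * B t"
proof -
  have *: "cmod (b t * f t) \<le> \<kappa> t * B t"
    if "t \<in> {c..x}" "cmod (b t) * S t \<le> \<kappa> t" for t and b :: "real \<Rightarrow> complex"
  proof -
    have "cmod (b t * f t) \<le> cmod (b t) * (S t * B t)" unfolding norm_mult using le that by (intro mult_left_mono) auto
    also have "\<dots> \<le> \<kappa> t * B t" unfolding mult.assoc[symmetric] using that B by (intro mult_right_mono) auto
    finally show ?thesis .
  qed
  show 1: "t \<in> {c..x} \<Longrightarrow> cmod (b1 t * f t) \<le> \<kappa> t * B t" "t \<in> {c..x} \<Longrightarrow> cmod (b2 t * f t) \<le> \<kappa> t * B t" for t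
    using *[of t b1] *[of t b2] b_le sub[OF x] by blast+
  show "(\<lambda>t. b1 t * f t) absolutely_integrable_on {c..x}" "(\<lambda>t. b2 t * f t) absolutely_integrable_on {c..x}"
    by (rule measurable_bounded_by_integrable_imp_absolutely_integrable[OF _ _ int 1(1)],
        intro borel_measurable_times meas x f, simp, assumption)
       (rule measurable_bounded_by_integrable_imp_absolutely_integrable[OF _ _ int 1(2)],
        intro borel_measurable_times meas x f, simp, assumption)
qed

definition op :: "(real \<Rightarrow> complex) \<Rightarrow> real \<Rightarrow> complex" where
  "op f x = a1 x * integral {c..x} (\<lambda>t. b1 t * f t) + a2 x * integral {c..x} (\<lambda>t. b2 t * f t)"

lemma op_bound:
  assumes x: "x \<in> J" and f: "f \<in> borel_measurable (lebesgue_on {c..x})"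
    and le: "\<forall>t\<in>{c..x}. cmod (f t) \<le> S t * B t" and B: "\<forall>t\<in>{c..x}. 0 \<le> B t"
    and int: "((\<lambda>t. \<kappa> t * B t) has_integral I) {c..x}"
  shows "cmod (op f x) \<le> S x * I"
proof -
  have int': "(\<lambda>t. \<kappa> t * B t) integrable_on {c..x}" using int by blast
  note bi = b_integrable[OF x f le B int']
  have bi': "(\<lambda>t. b1 t * f t) integrable_on {c..x}" "(\<lambda>t. b2 t * f t) integrable_on {c..x}"
    using set_lebesgue_integral_eq_integral(1)[OF bi(1)] set_lebesgue_integral_eq_integral(1)[OF bi(2)] .
  \<comment> \<open>The two integrals are recombined before estimating, since \<open>kernel\<close>
    bounds only the combined kernel.\<close>
  have "((\<lambda>t. a1 x * (b1 t * f t) + a2 x * (b2 t * f t)) has_integral op f x) {c..x}"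
    unfolding op_def using bi' by (intro has_integral_add has_integral_mult_right integrable_integral)
  then have "norm (op f x) = norm (integral {c..x} (\<lambda>t. a1 x * (b1 t * f t) + a2 x * (b2 t * f t)))"
    by (simp add: integral_unique)
  also have "\<dots> \<le> integral {c..x} (\<lambda>t. S x * (\<kappa> t * B t))"
  proof (rule integral_norm_bound_integral)
    show "(\<lambda>t. a1 x * (b1 t * f t) + a2 x * (b2 t * f t)) integrable_on {c..x}"
      using bi' by (intro integrable_add integrable_on_mult_right)
    show "(\<lambda>t. S x * (\<kappa> t * B t)) integrable_on {c..x}" using int' by (intro integrable_on_mult_right)
    fix t assume t: "t \<in> {c..x}"
    have "cmod (a1 x * (b1 t * f t) + a2 x * (b2 t * f t)) = cmod (a1 x * b1 t + a2 x * b2 t) * cmod (f t)"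
      by (simp add: norm_mult[symmetric] algebra_simps)
    also have "\<dots> \<le> cmod (a1 x * b1 t + a2 x * b2 t) * (S t * B t)" using le t by (intro mult_left_mono) auto
    also have "\<dots> \<le> (S x * \<kappa> t) * B t"
      unfolding mult.assoc[symmetric] using kernel[OF x, of t] B t by (intro mult_right_mono) auto
    finally show "norm (a1 x * (b1 t * f t) + a2 x * (b2 t * f t)) \<le> S x * (\<kappa> t * B t)" by (simp add: mult.assoc)
  qed
  also have "\<dots> = S x * I" using int by (simp add: integral_unique)
  finally show ?thesis .
qed

primrec vit :: "nat \<Rightarrow> real \<Rightarrow> complex" where
  "vit 0 = y0"
| "vit (Suc n) = op (vit n)"

lemma op_measurable:
  assumes x: "x \<in> J" and int: "(\<lambda>t. b1 t * f t) integrable_on {c..x}" "(\<lambda>t. b2 t * f t) integrable_on {c..x}"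
  shows "op f \<in> borel_measurable (lebesgue_on {c..x})"
proof -
  have "(\<lambda>u. integral {c..u} (\<lambda>t. b1 t * f t)) \<in> borel_measurable (lebesgue_on {c..x})"
    "(\<lambda>u. integral {c..u} (\<lambda>t. b2 t * f t)) \<in> borel_measurable (lebesgue_on {c..x})"
    using int by (auto intro!: continuous_imp_measurable_on_sets_lebesgue indefinite_integral_continuous_1)
  then show ?thesis
    unfolding op_def[abs_def] by (intro borel_measurable_add borel_measurable_times meas x)
qed

lemma vit_bound:
  assumes x: "x \<in> J"
  shows "cmod (vit n x) \<le> S x * (C * (K x ^ n / fact n))" "vit n \<in> borel_measurable (lebesgue_on {c..x})"
proof -
  have "\<forall>x\<in>J. cmod (vit n x) \<le> S x * (C * (K x ^ n / fact n)) \<and> vit n \<in> borel_measurable (lebesgue_on {c..x})"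
  proof (induction n)
    case 0
    show ?case using y0 meas(5) by (simp add: mult.commute)
  next
    case (Suc n)
    show ?case
    proof
      fix x assume x: "x \<in> J"
      have m: "vit n \<in> borel_measurable (lebesgue_on {c..x})" using Suc x by blast
      have le: "\<forall>t\<in>{c..x}. cmod (vit n t) \<le> S t * (C * (K t ^ n / fact n))"
        using Suc sub[OF x] by blast
      have B: "\<forall>t\<in>{c..x}. 0 \<le> C * (K t ^ n / fact n)"
        using K0 sub[OF x] C0 by (auto simp: subset_eq)
      have int: "((\<lambda>t. \<kappa> t * (C * (K t ^ n / fact n))) has_integral C * (K x ^ Suc n / fact (Suc n))) {c..x}"
        using has_integral_mult_right[OF K_power[OF x, of n], of C] by (simp only: mult.left_commute)
      note bi = b_integrable(1,2)[OF x m le B has_integral_integrable[OF int]]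
      show "cmod (vit (Suc n) x) \<le> S x * (C * (K x ^ Suc n / fact (Suc n))) \<and> vit (Suc n) \<in> borel_measurable (lebesgue_on {c..x})"
        using op_bound[OF x m le B int]
          op_measurable[OF x set_lebesgue_integral_eq_integral(1)[OF bi(1)] set_lebesgue_integral_eq_integral(1)[OF bi(2)]]
        by simp
    qed
  qed
  then show "cmod (vit n x) \<le> S x * (C * (K x ^ n / fact n))" "vit n \<in> borel_measurable (lebesgue_on {c..x})"
    using x by blast+
qed

text \<open>The Neumann series. At each \<open>x\<close> it is a power series in \<open>z\<close>,
  which later makes integrals of the solution entire functions of \<open>z\<close>.\<close>

definition vsol :: "complex \<Rightarrow> real \<Rightarrow> complex" where
  "vsol z x = (\<Sum>n. z ^ n * vit n x)"

lemma vit_term_bound: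
  assumes "x \<in> J"
  shows "cmod (z ^ n * vit n x) \<le> C * S x * ((cmod z * K x) ^ n / fact n)"
proof -
  have "cmod (z ^ n * vit n x) \<le> cmod z ^ n * (S x * (C * (K x ^ n / fact n)))"
    unfolding norm_mult norm_power by (intro mult_left_mono vit_bound assms) auto
  then show ?thesis by (simp add: power_mult_distrib algebra_simps)
qed

lemma exp_sums: "(\<lambda>n. A * (r ^ n / fact n)) sums (A * exp r)" for A r :: real
  using sums_mult[OF exp_converges[of r], of A] by (simp add: divide_inverse mult.commute)

lemma vsol_summable: "x \<in> J \<Longrightarrow> summable (\<lambda>n. cmod (z ^ n * vit n x))"
  by (rule summable_comparison_test'[OF sums_summable[OF exp_sums], where N = 0]) (use vit_term_bound in force)

lemma vsol_sums: "x \<in> J \<Longrightarrow> (\<lambda>n. z ^ n * vit n x) sums vsol z x"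
  unfolding vsol_def by (intro summable_sums summable_norm_cancel[OF vsol_summable])

lemma vsol_bound:
  assumes x: "x \<in> J"
  shows "cmod (vsol z x) \<le> C * S x * exp (cmod z * K x)"
proof -
  have "cmod (vsol z x) \<le> (\<Sum>n. cmod (z ^ n * vit n x))"
    unfolding vsol_def by (rule summable_norm[OF vsol_summable[OF x]])
  also have "\<dots> \<le> (\<Sum>n. C * S x * ((cmod z * K x) ^ n / fact n))"
    by (intro suminf_le vit_term_bound x vsol_summable sums_summable[OF exp_sums])
  also have "\<dots> = C * S x * exp (cmod z * K x)" by (rule sums_unique[OF exp_sums, symmetric])
  finally show ?thesis .
qed

lemma vsol_measurable:
  assumes x: "x \<in> J"
  shows "vsol z \<in> borel_measurable (lebesgue_on {c..x})"
proof (rule borel_measurable_LIMSEQ_metric)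
  show "(\<lambda>t. \<Sum>n<N. z ^ n * vit n t) \<in> borel_measurable (lebesgue_on {c..x})" for N
    by (intro borel_measurable_sum borel_measurable_times borel_measurable_const vit_bound(2) x)
  show "(\<lambda>N. \<Sum>n<N. z ^ n * vit n t) \<longlonglongrightarrow> vsol z t" if "t \<in> space (lebesgue_on {c..x})" for t
    using vsol_sums[of t z] that sub[OF x] unfolding sums_def by auto
qed

lemma vsol_b_integrable:
  assumes x: "x \<in> J"
  shows "(\<lambda>t. b1 t * vsol z t) absolutely_integrable_on {c..x}" "(\<lambda>t. b2 t * vsol z t) absolutely_integrable_on {c..x}"
proof -
  define B where "B = C * exp (cmod z * K x)"
  have B0: "0 \<le> B" using C0 by (simp add: B_def)
  have le: "cmod (vsol z t) \<le> S t * B" if "c \<le> t" "t \<le> x" for t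
  proof -
    have t: "t \<in> J" using sub[OF x] that by auto
    have "exp (cmod z * K t) \<le> exp (cmod z * K x)" using K_mono[OF t x that(2)] by (simp add: mult_left_mono)
    then have "C * S t * exp (cmod z * K t) \<le> C * S t * exp (cmod z * K x)" using C0 S0[OF t] by (intro mult_left_mono) auto
    then show ?thesis using vsol_bound[OF t, of z] by (simp add: B_def algebra_simps)
  qed
  have "(\<lambda>t. \<kappa> t * B) integrable_on {c..x}"
    using set_lebesgue_integral_eq_integral(1)[OF \<kappa>[OF x]] by (rule integrable_on_mult_left)
  moreover have "\<forall>t\<in>{c..x}. cmod (vsol z t) \<le> S t * B" "\<forall>t\<in>{c..x}. 0 \<le> B" using le B0 by auto
  ultimately have "(\<lambda>t. \<kappa> t * B) integrable_on {c..x}" "\<forall>t\<in>{c..x}. cmod (vsol z t) \<le> S t * B" "\<forall>t\<in>{c..x}. 0 \<le> B" by blast+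
  from b_integrable(1,2)[OF x vsol_measurable[OF x] this(2,3,1)]
  show "(\<lambda>t. b1 t * vsol z t) absolutely_integrable_on {c..x}" "(\<lambda>t. b2 t * vsol z t) absolutely_integrable_on {c..x}" .
qed

text \<open>Termwise integration is justified by an exponential series that majorises the integrals
  of the norms. It yields the integral equation for \<open>vsol\<close> and also the power series of
  its integrals.\<close>

lemma vsol_integral_sums:
  assumes x: "x \<in> J" and b: "b = b1 \<or> b = b2"
  shows "(\<lambda>n. z ^ n * integral {c..x} (\<lambda>t. b t * vit n t)) sums integral {c..x} (\<lambda>t. b t * vsol z t)"
proof -
  have bd: "cmod (b t * vit n t) \<le> \<kappa> t * (C * (K t ^ n / fact n))" if t: "t \<in> {c..x}" for n t
  proof -
    have tJ: "t \<in> J" using sub[OF x] t by auto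
    have "cmod (b t * vit n t) \<le> cmod (b t) * (S t * (C * (K t ^ n / fact n)))"
      unfolding norm_mult by (intro mult_left_mono vit_bound(1)[OF tJ]) auto
    also have "\<dots> \<le> \<kappa> t * (C * (K t ^ n / fact n))"
      unfolding mult.assoc[symmetric, of "cmod (b t)"] using b b_le[OF tJ] K0[OF tJ] C0 by (intro mult_right_mono) auto
    finally show ?thesis .
  qed
  have hi: "((\<lambda>t. \<kappa> t * (C * (K t ^ n / fact n))) has_integral C * (K x ^ Suc n / fact (Suc n))) {c..x}" for n
    using has_integral_mult_right[OF K_power[OF x, of n], of C] by (simp only: mult.left_commute)
  have ai: "(\<lambda>t. b t * vit n t) absolutely_integrable_on {c..x}" for n
    by (rule measurable_bounded_by_integrable_imp_absolutely_integrable[OF _ _ has_integral_integrable[OF hi] bd])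
       (use b in \<open>auto intro!: borel_measurable_times meas x vit_bound(2)\<close>)
  define f where "f n t = indicator {c..x} t *\<^sub>R (z ^ n * (b t * vit n t))" for n t
  have fi: "integrable lebesgue (f n)" for n
    using set_integrable_mult_right[of "z ^ n", OF ai[of n]] unfolding f_def set_integrable_def by simp
  have If: "integral\<^sup>L lebesgue (f n) = z ^ n * integral {c..x} (\<lambda>t. b t * vit n t)" for n
  proof -
    have "integral\<^sup>L lebesgue (f n) = (LINT t:{c..x}|lebesgue. z ^ n * (b t * vit n t))"
      unfolding f_def[abs_def] set_lebesgue_integral_def ..
    also have "\<dots> = z ^ n * (LINT t:{c..x}|lebesgue. b t * vit n t)"
      by (rule set_integral_mult_right)
    also have "\<dots> = z ^ n * integral {c..x} (\<lambda>t. b t * vit n t)"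
      using set_lebesgue_integral_eq_integral(2)[OF ai[of n]] by simp
    finally show ?thesis .
  qed
  have nf: "(\<integral>t. norm (f n t) \<partial>lebesgue) \<le> C * K x * ((cmod z * K x) ^ n / fact n)" for n
  proof -
    have "(\<integral>t. norm (f n t) \<partial>lebesgue) = (LINT t:{c..x}|lebesgue. cmod (z ^ n * (b t * vit n t)))"
      unfolding f_def set_lebesgue_integral_def by (intro Bochner_Integration.integral_cong) (auto simp: indicator_def)
    also have "\<dots> = integral {c..x} (\<lambda>t. cmod (z ^ n * (b t * vit n t)))"
      by (rule set_lebesgue_integral_eq_integral(2)[OF absolutely_integrable_norm[OF set_integrable_mult_right[OF ai], unfolded o_def]])
    also have "\<dots> \<le> integral {c..x} (\<lambda>t. cmod z ^ n * (\<kappa> t * (C * (K t ^ n / fact n))))"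
    proof (rule integral_le)
      show "(\<lambda>t. cmod (z ^ n * (b t * vit n t))) integrable_on {c..x}"
        using set_lebesgue_integral_eq_integral(1)[OF absolutely_integrable_norm[OF set_integrable_mult_right[OF ai], unfolded o_def]] .
      show "(\<lambda>t. cmod z ^ n * (\<kappa> t * (C * (K t ^ n / fact n)))) integrable_on {c..x}"
        using hi by (intro integrable_on_mult_right) blast
      show "cmod (z ^ n * (b t * vit n t)) \<le> cmod z ^ n * (\<kappa> t * (C * (K t ^ n / fact n)))" if "t \<in> {c..x}" for t
        using mult_left_mono[OF bd[OF that, of n], of "cmod z ^ n"] by (simp only: norm_mult[of "z ^ n"] norm_power norm_ge_zero zero_le_power simp_thms)
    qed
    also have "\<dots> = cmod z ^ n * (C * (K x ^ Suc n / fact (Suc n)))"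
      by (rule integral_unique[OF has_integral_mult_right[OF hi]])
    also have "\<dots> = C * K x * ((cmod z * K x) ^ n / fact (Suc n))" by (simp add: power_mult_distrib field_simps)
    also have "\<dots> \<le> C * K x * ((cmod z * K x) ^ n / fact n)"
      using C0 K0[OF x] fact_mono[of n "Suc n", where ?'a = real] by (intro mult_left_mono divide_left_mono) auto
    finally show ?thesis .
  qed
  have s1: "AE t in lebesgue. summable (\<lambda>n. norm (f n t))"
  proof (rule AE_I2)
    fix t
    show "summable (\<lambda>n. norm (f n t))"
    proof (cases "t \<in> {c..x}")
      case True
      then have "t \<in> J" using sub[OF x] by auto
      from summable_mult[OF vsol_summable[OF this, of z], of "cmod (b t)"] show ?thesis
        using True by (simp add: f_def norm_mult algebra_simps)
    qed (simp add: f_def)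
  qed
  have s2: "summable (\<lambda>n. \<integral>t. norm (f n t) \<partial>lebesgue)"
    by (rule summable_comparison_test'[OF sums_summable[OF exp_sums], where N = 0])
       (use nf in \<open>auto simp: abs_of_nonneg Bochner_Integration.integral_nonneg\<close>)
  have "(\<lambda>n. integral\<^sup>L lebesgue (f n)) sums (\<integral>t. (\<Sum>n. f n t) \<partial>lebesgue)"
    by (rule sums_integral[OF fi s1 s2])
  moreover have "(\<Sum>n. f n t) = indicator {c..x} t *\<^sub>R (b t * vsol z t)" for t
  proof (cases "t \<in> {c..x}")
    case True
    then have "t \<in> J" using sub[OF x] by auto
    from sums_unique[OF sums_mult[OF vsol_sums[OF this, of z], of "b t"]] show ?thesis
      using True by (simp add: f_def algebra_simps)
  qed (simp add: f_def)
  moreover have "(\<integral>t. indicator {c..x} t *\<^sub>R (b t * vsol z t) \<partial>lebesgue) = integral {c..x} (\<lambda>t. b t * vsol z t)"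
    using set_lebesgue_integral_eq_integral(2)[of "{c..x}" "\<lambda>t. b t * vsol z t"] vsol_b_integrable[OF x, of z] b
    unfolding set_lebesgue_integral_def by auto
  ultimately show ?thesis by (simp add: If)
qed

lemma vsol_equation:
  assumes x: "x \<in> J"
  shows "vsol z x = y0 x + z * op (vsol z) x"
proof -
  have "(\<lambda>n. z * (a1 x * (z ^ n * integral {c..x} (\<lambda>t. b1 t * vit n t)) + a2 x * (z ^ n * integral {c..x} (\<lambda>t. b2 t * vit n t))))
     sums (z * op (vsol z) x)"
    unfolding op_def by (intro sums_mult sums_add vsol_integral_sums x) auto
  then have "(\<lambda>n. z ^ Suc n * vit (Suc n) x) sums (z * op (vsol z) x)"
    by (simp add: op_def algebra_simps)
  then have "(\<lambda>n. z ^ n * vit n x) sums (z * op (vsol z) x + z ^ 0 * vit 0 x)"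
    by (subst sums_Suc_iff[symmetric]) simp
  then show ?thesis using sums_unique2[OF vsol_sums[OF x, of z]] by simp
qed

text \<open>Inserting the bound into the homogeneous equation \<open>n\<close> times produces the
  factor \<open>(cmod z * K x) ^ n / fact n\<close>, which tends to 0.\<close>

lemma volterra_unique:
  assumes x: "x \<in> J" and f: "f \<in> borel_measurable (lebesgue_on {c..x})"
    and le: "\<And>t. c \<le> t \<Longrightarrow> t \<le> x \<Longrightarrow> cmod (f t) \<le> S t * M" and M: "M \<ge> 0"
    and eq: "\<And>t. c \<le> t \<Longrightarrow> t \<le> x \<Longrightarrow> f t = z * op f t"
  shows "f x = 0"
proof -
  have bd: "cmod (f t) \<le> S t * (M * cmod z ^ n * (K t ^ n / fact n))" if "c \<le> t" "t \<le> x" for t n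
    using that
  proof (induction n arbitrary: t)
    case 0
    then show ?case using le by simp
  next
    case (Suc n)
    have t: "t \<in> J" using sub[OF x] Suc.prems by auto
    have m: "f \<in> borel_measurable (lebesgue_on {c..t})"
      by (rule measurable_restrict_mono[OF f]) (use Suc.prems in auto)
    have "cmod (op f t) \<le> S t * (M * cmod z ^ n * (K t ^ Suc n / fact (Suc n)))"
    proof (rule op_bound[OF t m])
      show "\<forall>u\<in>{c..t}. cmod (f u) \<le> S u * (M * cmod z ^ n * (K u ^ n / fact n))"
        using Suc.IH Suc.prems by simp
      show "\<forall>u\<in>{c..t}. 0 \<le> M * cmod z ^ n * (K u ^ n / fact n)"
        using K0 sub[OF t] M by (auto simp: subset_eq)
      show "((\<lambda>u. \<kappa> u * (M * cmod z ^ n * (K u ^ n / fact n))) has_integral M * cmod z ^ n * (K t ^ Suc n / fact (Suc n))) {c..t}"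
        using has_integral_mult_right[OF K_power[OF t, of n], of "M * cmod z ^ n"] by (simp only: mult.left_commute mult.assoc)
    qed
    then have "cmod z * cmod (op f t) \<le> cmod z * (S t * (M * cmod z ^ n * (K t ^ Suc n / fact (Suc n))))"
      by (rule mult_left_mono) simp
    then show ?case using eq[OF Suc.prems] by (simp add: norm_mult algebra_simps)
  qed
  have "(\<lambda>n. (S x * M) * ((cmod z * K x) ^ n / fact n)) \<longlonglongrightarrow> 0"
    by (rule summable_LIMSEQ_zero[OF sums_summable[OF exp_sums]])
  moreover have "\<forall>n. cmod (f x) \<le> (S x * M) * ((cmod z * K x) ^ n / fact n)"
    using bd[of x] x J by (auto simp: power_mult_distrib algebra_simps)
  ultimately have "cmod (f x) \<le> 0" by (intro LIMSEQ_le_const[of _ 0]) auto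
  then show ?thesis by simp
qed

end

text \<open>The coefficient is merely integrable, so the inequality is iterated instead of
  differentiated: \<open>n\<close> rounds give a partial sum of the exponential series and a
  remainder carried by an upper bound \<open>M\<close> of \<open>V\<close>.\<close>

lemma gronwall:
  fixes V \<kappa> :: "real \<Rightarrow> real"
  assumes ab: "a \<le> b" and V: "continuous_on {a..b} V" "\<And>x. x \<in> {a..b} \<Longrightarrow> 0 \<le> V x"
    and \<kappa>: "\<kappa> absolutely_integrable_on {a..b}" "\<And>x. x \<in> {a..b} \<Longrightarrow> 0 \<le> \<kappa> x"
    and le: "\<And>x. x \<in> {a..b} \<Longrightarrow> V x \<le> A + integral {a..x} (\<lambda>t. \<kappa> t * V t)" and A: "A \<ge> 0"
  shows "V b \<le> A * exp (integral {a..b} \<kappa>)"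
proof -
  define K where "K x = integral {a..x} \<kappa>" for x
  have prK: "prim_on {a..b} K \<kappa>"
    unfolding K_def by (rule prim_on_integral) (auto intro: set_integrable_subset[OF \<kappa>(1)])
  have Kp: "((\<lambda>t. \<kappa> t * (K t ^ n / fact n)) has_integral K x ^ Suc n / fact (Suc n)) {a..x}" if "x \<in> {a..b}" for x n
    using prim_onD(2)[OF prim_on_power_fact[OF prK is_interval_cc], of a x n] that by (simp add: K_def)
  obtain M where M: "\<And>x. x \<in> {a..b} \<Longrightarrow> V x \<le> M"
    using continuous_attains_sup[OF compact_Icc _ V(1)] ab by (metis atLeastAtMost_iff empty_iff order_refl)
  have kV: "(\<lambda>t. \<kappa> t * V t) integrable_on {a..b}"
  proof -
    have "(\<lambda>t. V t * \<kappa> t) absolutely_integrable_on {a..b}"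
      by (rule absolutely_integrable_bounded_measurable_product_real[OF _ _ _ \<kappa>(1)])
         (auto intro!: continuous_imp_measurable_on_sets_lebesgue V compact_imp_bounded compact_continuous_image)
    then show ?thesis by (simp add: set_lebesgue_integral_eq_integral(1) mult.commute)
  qed
  have bd: "V x \<le> A * (\<Sum>j<n. K x ^ j / fact j) + M * (K x ^ n / fact n)" if "x \<in> {a..b}" for x n
    using that
  proof (induction n arbitrary: x)
    case 0 then show ?case using M by simp
  next
    case (Suc n)
    define W where "W t = A * (\<Sum>j<n. K t ^ j / fact j) + M * (K t ^ n / fact n)" for t
    have eqW: "\<kappa> t * W t = A * (\<Sum>j<n. \<kappa> t * (K t ^ j / fact j)) + M * (\<kappa> t * (K t ^ n / fact n))" for t
      by (simp add: W_def algebra_simps sum_distrib_left)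
    have hW: "((\<lambda>t. \<kappa> t * W t) has_integral (A * (\<Sum>j<n. K x ^ Suc j / fact (Suc j)) + M * (K x ^ Suc n / fact (Suc n)))) {a..x}"
      unfolding eqW by (intro has_integral_add has_integral_mult_right has_integral_sum Kp Suc.prems) auto
    have "integral {a..x} (\<lambda>t. \<kappa> t * V t) \<le> integral {a..x} (\<lambda>t. \<kappa> t * W t)"
    proof (rule integral_le)
      show "(\<lambda>t. \<kappa> t * V t) integrable_on {a..x}" by (rule integrable_on_subinterval[OF kV]) (use Suc.prems in auto)
      show "(\<lambda>t. \<kappa> t * W t) integrable_on {a..x}" using hW by blast
      show "\<kappa> t * V t \<le> \<kappa> t * W t" if "t \<in> {a..x}" for t
        using Suc.IH[of t] \<kappa>(2)[of t] that Suc.prems by (intro mult_left_mono) (auto simp: W_def)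
    qed
    also have "\<dots> = A * (\<Sum>j<n. K x ^ Suc j / fact (Suc j)) + M * (K x ^ Suc n / fact (Suc n))"
      using hW by (rule integral_unique)
    finally have "V x \<le> (A + A * (\<Sum>j<n. K x ^ Suc j / fact (Suc j))) + M * (K x ^ Suc n / fact (Suc n))"
      using le[OF Suc.prems] by linarith
    moreover have "A + A * (\<Sum>j<n. K x ^ Suc j / fact (Suc j)) = A * (\<Sum>j<Suc n. K x ^ j / fact j)"
      by (subst sum.lessThan_Suc_shift) (simp add: distrib_left del: fact_Suc power_Suc)
    ultimately show ?case by (simp only:)
  qed
  have es: "(\<lambda>n. K b ^ n / fact n) sums exp (K b)"
    using exp_converges[of "K b"] by (simp add: divide_inverse mult.commute)
  have "(\<lambda>n. A * (\<Sum>j<n. K b ^ j / fact j) + M * (K b ^ n / fact n)) \<longlonglongrightarrow> A * exp (K b) + M * 0"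
    using es by (intro tendsto_intros summable_LIMSEQ_zero[OF sums_summable[OF es]]) (simp add: sums_def)
  moreover have "\<forall>n. V b \<le> A * (\<Sum>j<n. K b ^ j / fact j) + M * (K b ^ n / fact n)" using bd[of b] ab by auto
  ultimately have "V b \<le> A * exp (K b) + M * 0" by (intro LIMSEQ_le_const) auto
  then show ?thesis by (simp add: K_def)
qed

section \<open>Second-order equations on intervals\<close>

lemma prim_on_ident: "prim_on I (\<lambda>x. complex_of_real (x - c)) (\<lambda>x. 1)"
  unfolding prim_on_def
proof (intro ballI impI conjI)
  fix a b :: real assume "a \<le> b"
  then show "((\<lambda>x. 1) has_integral complex_of_real (b - c) - complex_of_real (a - c)) {a..b}"
    using has_integral_const_real[of "1::complex" a b] by (simp add: scaleR_conv_of_real)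
  show "(\<lambda>x. 1::complex) absolutely_integrable_on {a..b}"
    by (rule absolutely_integrable_continuous_real) simp
qed

lemma prim_on_reflect:
  assumes P: "prim_on I F g"
  shows "prim_on (uminus ` I) (\<lambda>x. F (- x)) (\<lambda>x. - g (- x))"
  unfolding prim_on_def
proof (intro ballI impI conjI)
  fix a b assume ab: "a \<in> uminus ` I" "b \<in> uminus ` I" "a \<le> b"
  then have ab': "- b \<in> I" "- a \<in> I" "- b \<le> - a" by auto
  note * = prim_onD[OF P ab']
  have A: "(\<lambda>x. g (- x)) absolutely_integrable_on {a..b}"
    using *(1) absolutely_integrable_reflect_real[where f = g and a = "- b" and b = "- a"] by simp
  show "(\<lambda>x. - g (- x)) absolutely_integrable_on {a..b}"
    using absolutely_integrable_linear[OF A bounded_linear_minus[OF bounded_linear_ident]] by (simp add: o_def)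
  have B: "((\<lambda>x. g (- x)) has_integral F (- a) - F (- b)) {a..b}"
    using *(2) has_integral_reflect_real[where f = g and a = "- b" and b = "- a"] by simp
  show "((\<lambda>x. - g (- x)) has_integral F (- b) - F (- a)) {a..b}"
    using has_integral_neg[OF B] by simp
qed

lemma prim_on_glue:
  assumes 1: "prim_on {a<..m} F g" and 2: "prim_on {m..} F g" and am: "a < m"
  shows "prim_on {a<..} F g"
  unfolding prim_on_def
proof (intro ballI impI)
  fix x y assume xy: "x \<in> {a<..}" "y \<in> {a<..}" "x \<le> y"
  consider "y \<le> m" | "m \<le> x" | "x < m" "m < y" by linarith
  then show "g absolutely_integrable_on {x..y} \<and> (g has_integral F y - F x) {x..y}"
  proof cases
    case 1
    then show ?thesis using prim_onD(1,2)[OF assms(1), of x y] xy by auto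
  next
    case 2
    then show ?thesis using prim_onD(1,2)[OF assms(2), of x y] xy by auto
  next
    case 3
    have L: "g absolutely_integrable_on {x..m}" "(g has_integral F m - F x) {x..m}"
      using prim_onD(1,2)[OF assms(1), of x m] xy 3 by auto
    have R: "g absolutely_integrable_on {m..y}" "(g has_integral F y - F m) {m..y}"
      using prim_onD(1,2)[OF assms(2), of m y] xy 3 by auto
    have "{x..m} \<union> {m..y} = {x..y}" using 3 by auto
    then have "g absolutely_integrable_on {x..y}"
      using set_integrable_Un[OF L(1) R(1)] by simp
    moreover have "(g has_integral (F m - F x) + (F y - F m)) {x..y}"
      using has_integral_combine[OF _ _ L(2) R(2)] 3 by simp
    ultimately show ?thesis by simp
  qed
qed

text \<open>The equation \<open>u'' = q u\<close> with data at \<open>c\<close> becomes an integral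
  equation with free term \<open>\<alpha> + \<beta> * (x - c)\<close> and kernel
  \<open>(x - t) * q t\<close>. The potential sits in the kernel, so the Volterra scheme is used
  with parameter 1.\<close>

lemma exists_solution:
  fixes q :: "real \<Rightarrow> real" and \<alpha> \<beta> :: complex
  assumes J: "is_interval J" "c \<in> J" "J \<subseteq> {c..}" and q: "\<And>x. x \<in> J \<Longrightarrow> q absolutely_integrable_on {c..x}"
  obtains u p where "prim_on J u p" "prim_on J p (\<lambda>x. complex_of_real (q x) * u x)" "u c = \<alpha>" "p c = \<beta>"
proof -
  \<comment> \<open>The weight dominates the affine free term. Since
    \<open>x - t \<le> S x * S t\<close>, the kernel condition holds with
    \<open>S t * S t * \<bar>q t\<bar>\<close> as \<open>\<kappa>\<close>.\<close>
  define S where "S x = 1 + (x - c)" for x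
  have S1: "1 \<le> S x" if "c \<le> x" for x using that by (simp add: S_def)
  have mq: "(\<lambda>t. complex_of_real (q t)) \<in> borel_measurable (lebesgue_on {c..x})" if "x \<in> J" for x
    using integrable_imp_measurable[OF set_lebesgue_integral_eq_integral(1)[OF q[OF that]]] by simp
  interpret volterra J c "\<lambda>x. complex_of_real (x - c)" "\<lambda>x. -1" "\<lambda>t. complex_of_real (q t)"
    "\<lambda>t. complex_of_real (t - c) * complex_of_real (q t)" "\<lambda>x. \<alpha> + \<beta> * complex_of_real (x - c)" S "\<lambda>t. S t * S t * \<bar>q t\<bar>" "cmod \<alpha> + cmod \<beta>"
  proof unfold_locales
    show "(\<lambda>x. complex_of_real (x - c)) \<in> borel_measurable (lebesgue_on {c..x})"
      "(\<lambda>x. \<alpha> + \<beta> * complex_of_real (x - c)) \<in> borel_measurable (lebesgue_on {c..x})" for x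
      by (intro continuous_imp_measurable_on_sets_lebesgue continuous_intros; simp)+
    then show "(\<lambda>t. complex_of_real (t - c) * complex_of_real (q t)) \<in> borel_measurable (lebesgue_on {c..x})" if "x \<in> J" for x
      by (intro borel_measurable_times mq that)
    show "(\<lambda>t. S t * S t * \<bar>q t\<bar>) absolutely_integrable_on {c..x}" if x: "x \<in> J" for x
    proof (rule absolutely_integrable_bounded_measurable_product_real)
      have "continuous_on {c..x} (\<lambda>t. S t * S t)" unfolding S_def by (intro continuous_intros)
      then show "(\<lambda>t. S t * S t) \<in> borel_measurable (lebesgue_on {c..x})" "bounded ((\<lambda>t. S t * S t) ` {c..x})"
        by (auto intro!: continuous_imp_measurable_on_sets_lebesgue compact_imp_bounded compact_continuous_image)
      show "(\<lambda>t. \<bar>q t\<bar>) absolutely_integrable_on {c..x}"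
        using absolutely_integrable_norm[OF q[OF x]] by (simp add: o_def)
    qed simp
    show "0 \<le> S x" if "x \<in> J" for x using S1[of x] that J(3) by auto
    show "cmod (complex_of_real (x - c) * complex_of_real (q t) + - 1 * (complex_of_real (t - c) * complex_of_real (q t))) * S t
       \<le> S x * (S t * S t * \<bar>q t\<bar>)" if "x \<in> J" "c \<le> t" "t \<le> x" for x t
    proof -
      have "complex_of_real (x - c) * complex_of_real (q t) + - 1 * (complex_of_real (t - c) * complex_of_real (q t)) = complex_of_real ((x - t) * q t)"
        by (simp add: algebra_simps)
      then have e: "cmod (complex_of_real (x - c) * complex_of_real (q t) + - 1 * (complex_of_real (t - c) * complex_of_real (q t))) = (x - t) * \<bar>q t\<bar>"
        using that by (simp only: norm_of_real abs_mult)
      have "(x - t) * (\<bar>q t\<bar> * S t) \<le> (S x * S t) * (\<bar>q t\<bar> * S t)"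
      proof (rule mult_right_mono)
        have "x - t \<le> S x * 1" using that by (simp add: S_def)
        also have "\<dots> \<le> S x * S t" using S1[of t] S1[of x] that by (intro mult_left_mono) auto
        finally show "x - t \<le> S x * S t" .
      qed (use S1[of t] that in auto)
      then show ?thesis unfolding e by (simp only: ac_simps)
    qed
    show "cmod (complex_of_real (q t)) * S t \<le> S t * S t * \<bar>q t\<bar>" if "t \<in> J" for t
    proof -
      have "1 * (S t * \<bar>q t\<bar>) \<le> S t * (S t * \<bar>q t\<bar>)" using S1[of t] that J(3) by (intro mult_right_mono) auto
      then show ?thesis by (simp add: algebra_simps)
    qed
    show "cmod (complex_of_real (t - c) * complex_of_real (q t)) * S t \<le> S t * S t * \<bar>q t\<bar>" if "t \<in> J" for t
    proof -
      have tc: "c \<le> t" using that J(3) by auto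
      have "(t - c) * (S t * \<bar>q t\<bar>) \<le> S t * (S t * \<bar>q t\<bar>)" using S1[OF tc] by (intro mult_right_mono) (auto simp: S_def)
      moreover have e: "cmod (complex_of_real (t - c) * complex_of_real (q t)) = (t - c) * \<bar>q t\<bar>"
        using tc by (simp only: norm_mult norm_of_real)
      ultimately show ?thesis unfolding e by (simp only: ac_simps)
    qed
    show "cmod (\<alpha> + \<beta> * complex_of_real (x - c)) \<le> (cmod \<alpha> + cmod \<beta>) * S x" if "x \<in> J" for x
    proof -
      have xc: "c \<le> x" using that J(3) by auto
      have "cmod (\<alpha> + \<beta> * complex_of_real (x - c)) \<le> cmod \<alpha> * 1 + cmod \<beta> * (x - c)"
        using norm_triangle_ineq[of \<alpha> "\<beta> * complex_of_real (x - c)"] xc by (simp only: norm_mult norm_of_real)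
      also have "\<dots> \<le> cmod \<alpha> * S x + cmod \<beta> * S x" using S1[OF xc] by (intro add_mono mult_left_mono) (auto simp: S_def)
      finally show ?thesis by (simp add: distrib_right)
    qed
  qed (use J mq in auto)
  define u where "u = vsol 1"
  define Q1 where "Q1 x = integral {c..x} (\<lambda>t. complex_of_real (q t) * u t)" for x
  define Q2 where "Q2 x = integral {c..x} (\<lambda>t. complex_of_real (t - c) * complex_of_real (q t) * u t)" for x
  have pQ1: "prim_on J Q1 (\<lambda>t. complex_of_real (q t) * u t)"
    unfolding Q1_def u_def by (rule prim_on_integral[OF vsol_b_integrable(1) J(3)])
  have pQ2: "prim_on J Q2 (\<lambda>t. complex_of_real (t - c) * complex_of_real (q t) * u t)"
    unfolding Q2_def u_def by (rule prim_on_integral[OF vsol_b_integrable(2) J(3)])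
  have ux: "u x = \<alpha> + \<beta> * complex_of_real (x - c) + (complex_of_real (x - c) * Q1 x - Q2 x)" if "x \<in> J" for x
    using vsol_equation[OF that, of 1] unfolding op_def Q1_def Q2_def u_def by simp
  have "prim_on J (\<lambda>x. \<alpha> + \<beta> * complex_of_real (x - c) + (complex_of_real (x - c) * Q1 x - Q2 x))
     (\<lambda>x. 0 + \<beta> * 1 + ((1 * Q1 x + complex_of_real (x - c) * (complex_of_real (q x) * u x)) -
        complex_of_real (x - c) * complex_of_real (q x) * u x))"
    by (intro prim_on_add prim_on_diff prim_on_const prim_on_mult prim_on_ident pQ1 pQ2 J(1)
        prim_on_linear[OF bounded_linear_mult_right])
  then have "prim_on J u (\<lambda>x. \<beta> + Q1 x)"
    by (rule prim_on_cong_AE) (auto simp: ux J(1))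
  moreover have "prim_on J (\<lambda>x. \<beta> + Q1 x) (\<lambda>x. complex_of_real (q x) * u x)"
    using prim_on_add[OF prim_on_const pQ1] by simp
  moreover have "u c = \<alpha>" "\<beta> + Q1 c = \<beta>" using ux[OF J(2)] by (simp_all add: Q1_def Q2_def)
  ultimately show ?thesis using that by blast
qed

text \<open>The Volterra scheme integrates to the right only. For the part on \<open>{0<..1}\<close>
  the evenness of \<open>q\<close> allows solving on \<open>{-1..<0}\<close> from \<open>-1\<close>
  and reflecting; reflection changes the sign of the derivative, hence the initial value
  \<open>- \<beta>\<close>.\<close>

lemma half_line_solution:
  fixes q :: "real \<Rightarrow> real" and \<alpha> \<beta> :: complex
  assumes even: "\<And>x. q (- x) = q x" and q: "\<And>a b. 0 < a \<Longrightarrow> q absolutely_integrable_on {a..b}"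
  obtains u p where "prim_on {0<..} u p" "prim_on {0<..} p (\<lambda>x. complex_of_real (q x) * u x)" "u 1 = \<alpha>" "p 1 = \<beta>"
proof -
  obtain u1 p1 where 1: "prim_on {1..} u1 p1" "prim_on {1..} p1 (\<lambda>x. complex_of_real (q x) * u1 x)" "u1 1 = \<alpha>" "p1 1 = \<beta>"
    by (rule exists_solution[of "{1..}" 1 q \<alpha> \<beta>]) (auto simp: is_interval_ci intro: q)
  have qn: "q absolutely_integrable_on {- 1..x}" if "x \<in> {- 1..<0}" for x
  proof -
    have "q absolutely_integrable_on {- x..1}" using that by (intro q) auto
    then have "(\<lambda>t. q (- t)) absolutely_integrable_on {- 1.. - (- x)}"
      using absolutely_integrable_reflect_real[where f = q and a = "- x" and b = 1] by simp
    then show ?thesis by (simp add: even)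
  qed
  obtain u2 p2 where 2: "prim_on {-1..<0} u2 p2" "prim_on {-1..<0} p2 (\<lambda>x. complex_of_real (q x) * u2 x)" "u2 (-1) = \<alpha>" "p2 (-1) = - \<beta>"
    by (rule exists_solution[of "{-1..<0}" "-1" q \<alpha> "- \<beta>"]) (auto simp: is_interval_co intro: qn)
  have im: "uminus ` {-1..<0} = {0<..1::real}" by force
  define u where "u x = (if x < 1 then u2 (- x) else u1 x)" for x
  define p where "p x = (if x < 1 then - p2 (- x) else p1 x)" for x
  have r1: "prim_on {0<..1} (\<lambda>x. u2 (- x)) (\<lambda>x. - p2 (- x))" using prim_on_reflect[OF 2(1)] unfolding im .
  have "prim_on {0<..1} (\<lambda>x. - p2 (- x)) (\<lambda>x. - (- (complex_of_real (q (- x)) * u2 (- x))))"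
    using prim_on_linear[OF bounded_linear_minus[OF bounded_linear_ident] prim_on_reflect[OF 2(2)]] unfolding im .
  then have r2: "prim_on {0<..1} (\<lambda>x. - p2 (- x)) (\<lambda>x. complex_of_real (q x) * u2 (- x))"
    by (simp add: even)
  have "prim_on {0<..1} u p"
    by (rule prim_on_cong_AE[OF r1]) (use 1 2 in \<open>auto simp: u_def p_def is_interval_oc\<close>)
  moreover have "prim_on {1..} u p"
    by (rule prim_on_cong_AE[OF 1(1)]) (auto simp: u_def p_def is_interval_ci)
  ultimately have up: "prim_on {0<..} u p" by (rule prim_on_glue) simp
  have "prim_on {0<..1} p (\<lambda>x. complex_of_real (q x) * u x)"
    by (rule prim_on_cong_AE[OF r2]) (use 1 2 in \<open>auto simp: u_def p_def is_interval_oc\<close>)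
  moreover have "prim_on {1..} p (\<lambda>x. complex_of_real (q x) * u x)"
    by (rule prim_on_cong_AE[OF 1(2)]) (auto simp: u_def p_def is_interval_ci)
  ultimately have "prim_on {0<..} p (\<lambda>x. complex_of_real (q x) * u x)"
    by (intro prim_on_glue[of 0 1]) simp_all
  from up this show ?thesis by (rule that) (use 1(3,4) in \<open>simp_all add: u_def p_def\<close>)
qed

lemma prim_on_constant:
  assumes "prim_on I F (\<lambda>x. 0)" "a \<in> I" "b \<in> I"
  shows "F a = F b"
proof -
  have *: "F a = F b" if "a \<in> I" "b \<in> I" "a \<le> b" for a b
    using prim_onD(3)[OF assms(1) that] by simp
  consider "a \<le> b" | "b \<le> a" by linarith
  then show ?thesis
  proof cases
    case 1 then show ?thesis by (rule *[OF assms(2,3)])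
  next
    case 2 then show ?thesis by (rule *[OF assms(3,2), symmetric])
  qed
qed

text \<open>The coefficients are real, so real parts of complex solutions are solutions; the
  Wronskian is constant and equals 1 at the point 1.\<close>

lemma fundamental_system:
  fixes q :: "real \<Rightarrow> real"
  assumes even: "\<And>x. q (- x) = q x" and q: "\<And>a b. 0 < a \<Longrightarrow> q absolutely_integrable_on {a..b}"
  obtains s1 p1 s2 p2 :: "real \<Rightarrow> real" where "prim_on {0<..} s1 p1" "prim_on {0<..} p1 (\<lambda>x. q x * s1 x)"
    "prim_on {0<..} s2 p2" "prim_on {0<..} p2 (\<lambda>x. q x * s2 x)"
    "\<And>x. 0 < x \<Longrightarrow> s1 x * p2 x - p1 x * s2 x = 1"
proof -
  have *: "\<exists>s p. prim_on {0<..} s p \<and> prim_on {0<..} p (\<lambda>x. q x * s x) \<and> s 1 = \<alpha> \<and> p 1 = \<beta>" for \<alpha> \<beta> :: real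
  proof -
    obtain u p where up: "prim_on {0<..} u p" "prim_on {0<..} p (\<lambda>x. complex_of_real (q x) * u x)"
      "u 1 = complex_of_real \<alpha>" "p 1 = complex_of_real \<beta>"
      by (rule half_line_solution[OF even q])
    show ?thesis
      using prim_on_linear[OF bounded_linear_Re up(1)] prim_on_linear[OF bounded_linear_Re up(2)] up(3,4)
      by (intro exI[of _ "\<lambda>x. Re (u x)"] exI[of _ "\<lambda>x. Re (p x)"]) simp
  qed
  obtain s1 p1 where 1: "prim_on {0<..} s1 p1" "prim_on {0<..} p1 (\<lambda>x. q x * s1 x)" "s1 1 = 1" "p1 1 = 0"
    using *[of 1 0] by blast
  obtain s2 p2 where 2: "prim_on {0<..} s2 p2" "prim_on {0<..} p2 (\<lambda>x. q x * s2 x)" "s2 1 = 0" "p2 1 = 1"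
    using *[of 0 1] by blast
  have "prim_on {0<..} (\<lambda>x. s1 x * p2 x - p1 x * s2 x)
      (\<lambda>x. (p1 x * p2 x + s1 x * (q x * s2 x)) - ((q x * s1 x) * s2 x + p1 x * p2 x))"
    by (intro prim_on_diff prim_on_mult_real 1 2 is_interval_oi)
  then have W: "prim_on {0<..} (\<lambda>x. s1 x * p2 x - p1 x * s2 x) (\<lambda>x. 0)" by (simp add: algebra_simps)
  have "s1 x * p2 x - p1 x * s2 x = 1" if "0 < x" for x
    using prim_on_constant[OF W, of x 1] that 1 2 by simp
  then show ?thesis using that 1 2 by blast
qed

section \<open>Local absolute continuity in terms of primitives\<close>

text \<open>Rational intervals inside \<open>I\<close> cover it, so only countably many null sets
  are joined.\<close>

lemma AE_open_cover:
  fixes I :: "real set"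
  assumes I: "open I" and P: "\<And>a b. a \<le> b \<Longrightarrow> {a..b} \<subseteq> I \<Longrightarrow> AE x in lebesgue. x \<in> {a<..<b} \<longrightarrow> P x"
  shows "AE x in lebesgue. x \<in> I \<longrightarrow> P x"
proof -
  have "AE x in lebesgue. \<forall>r::rat \<times> rat. real_of_rat (fst r) \<le> real_of_rat (snd r) \<longrightarrow> {real_of_rat (fst r)..real_of_rat (snd r)} \<subseteq> I \<longrightarrow>
     x \<in> {real_of_rat (fst r)<..<real_of_rat (snd r)} \<longrightarrow> P x"
    unfolding AE_all_countable
  proof
    fix r :: "rat \<times> rat"
    show "AE x in lebesgue. real_of_rat (fst r) \<le> real_of_rat (snd r) \<longrightarrow> {real_of_rat (fst r)..real_of_rat (snd r)} \<subseteq> I \<longrightarrow>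
     x \<in> {real_of_rat (fst r)<..<real_of_rat (snd r)} \<longrightarrow> P x"
      using P[of "real_of_rat (fst r)" "real_of_rat (snd r)"]
      by (cases "real_of_rat (fst r) \<le> real_of_rat (snd r) \<and> {real_of_rat (fst r)..real_of_rat (snd r)} \<subseteq> I") auto
  qed
  then show ?thesis
  proof eventually_elim
    case (elim x)
    show ?case
    proof
      assume "x \<in> I"
      then obtain e where e: "e > 0" "ball x e \<subseteq> I" using I open_contains_ball by blast
      obtain a where a: "x - e < real_of_rat a" "real_of_rat a < x" using of_rat_dense[of "x - e" x] e by auto
      obtain b where b: "x < real_of_rat b" "real_of_rat b < x + e" using of_rat_dense[of x "x + e"] e by auto
      have "{real_of_rat a..real_of_rat b} \<subseteq> ball x e" using a b by (auto simp: dist_real_def)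
      then show "P x" using elim[rule_format, of "(a, b)"] a b e(2) by (simp add: order_trans[OF _ e(2)])
    qed
  qed
qed

lemma prim_on_AE_derivative:
  fixes F :: "real \<Rightarrow> 'a::euclidean_space"
  assumes "prim_on I F g" "open I"
  shows "AE x in lebesgue. x \<in> I \<longrightarrow> (F has_vector_derivative g x) (at x)"
  by (rule AE_open_cover[OF assms(2)]) (rule prim_on_vector_derivative_AE[OF prim_on_subset[OF assms(1)]])

lemma prim_on_zero_AE:
  fixes g :: "real \<Rightarrow> 'a::euclidean_space"
  assumes "prim_on I (\<lambda>x. c) g" "open I"
  shows "AE x in lebesgue. x \<in> I \<longrightarrow> g x = 0"
  using prim_on_AE_derivative[OF assms]
proof eventually_elim
  case (elim x)
  then show ?case using vector_derivative_unique_at[OF _ has_vector_derivative_const[of c]] by blast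
qed

lemma prim_pair_derivative:
  fixes f :: "real \<Rightarrow> 'a::euclidean_space"
  assumes "prim_on I f p" "prim_on I p r" "open I" "x \<in> I"
  shows "(f has_vector_derivative p x) (at x)"
proof -
  obtain e where e: "e > 0" "cball x e \<subseteq> I" using assms(3,4) open_contains_cball by blast
  then have sub: "{x - e..x + e} \<subseteq> I" by (auto simp: cball_eq_atLeastAtMost)
  show ?thesis
    by (rule prim_on_vector_derivative[OF prim_on_subset[OF assms(1) sub] prim_on_continuous[OF assms(2) sub]]) (use e in auto)
qed

lemma AC_cong:
  assumes "absolutely_continuous_on a b f" "\<And>x. x \<in> {a..b} \<Longrightarrow> f x = g x"
  shows "absolutely_continuous_on a b g"
  unfolding absolutely_continuous_on_def
proof (intro allI impI)
  fix e :: real assume "e > 0"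
  then obtain d where d: "d > 0" "\<And>n (u::nat\<Rightarrow>real) v. (\<forall>i<n. a \<le> u i \<and> u i \<le> v i \<and> v i \<le> b) \<and>
        (\<forall>i<n. \<forall>j<n. i \<noteq> j \<longrightarrow> {u i<..<v i} \<inter> {u j<..<v j} = {}) \<and>
        (\<Sum>i<n. v i - u i) < d \<Longrightarrow> (\<Sum>i<n. norm (f (v i) - f (u i))) < e"
    by (rule absolutely_continuous_onE[OF assms(1)]) (rule that)
  show "\<exists>\<delta>>0. \<forall>n (u :: nat \<Rightarrow> real) v. (\<forall>i<n. a \<le> u i \<and> u i \<le> v i \<and> v i \<le> b) \<and>
        (\<forall>i<n. \<forall>j<n. i \<noteq> j \<longrightarrow> {u i<..<v i} \<inter> {u j<..<v j} = {}) \<and>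
        (\<Sum>i<n. v i - u i) < \<delta> \<longrightarrow> (\<Sum>i<n. norm (g (v i) - g (u i))) < e"
  proof (intro exI[of _ d] conjI d(1) allI impI)
    fix n and u v :: "nat \<Rightarrow> real"
    assume A: "(\<forall>i<n. a \<le> u i \<and> u i \<le> v i \<and> v i \<le> b) \<and>
        (\<forall>i<n. \<forall>j<n. i \<noteq> j \<longrightarrow> {u i<..<v i} \<inter> {u j<..<v j} = {}) \<and> (\<Sum>i<n. v i - u i) < d"
    have "g (v i) = f (v i)" "g (u i) = f (u i)" if "i < n" for i
    proof -
      have "a \<le> u i" "u i \<le> v i" "v i \<le> b" using A that by blast+
      then have "u i \<in> {a..b}" "v i \<in> {a..b}" by auto
      then show "g (v i) = f (v i)" "g (u i) = f (u i)" by (simp_all add: assms(2))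
    qed
    then have "(\<Sum>i<n. norm (g (v i) - g (u i))) = (\<Sum>i<n. norm (f (v i) - f (u i)))" by (intro sum.cong) auto
    then show "(\<Sum>i<n. norm (g (v i) - g (u i))) < e" using d(2)[OF A] by simp
  qed
qed

text \<open>The passage from primitives to \<open>locally_AC1\<close>, with
  \<open>locally_AC1_prim\<close> as converse. That \<open>F\<close> need agree with
  \<open>f\<close> only on \<open>I\<close> permits functions pieced together from two
  half-lines.\<close>

lemma prim_pair_locally_AC1:
  assumes P: "prim_on I f p" "prim_on I p r" and I: "open I" and F: "\<And>x. x \<in> I \<Longrightarrow> F x = f x"
  shows "locally_AC1 I F" "\<And>x. x \<in> I \<Longrightarrow> deriv1 F x = p x"
    "AE x in lebesgue. x \<in> I \<longrightarrow> deriv1 (deriv1 F) x = r x"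
proof -
  have dF: "(F has_vector_derivative p x) (at x)" if x: "x \<in> I" for x
    by (rule has_vector_derivative_transform_within_open[OF prim_pair_derivative[OF P I x] I x]) (simp add: F)
  show d1: "deriv1 F x = p x" if "x \<in> I" for x
    unfolding deriv1_def by (rule vector_derivative_at[OF dF[OF that]])
  show "locally_AC1 I F"
    unfolding locally_AC1_def
  proof (intro conjI ballI allI impI)
    show "F differentiable at x" if "x \<in> I" for x using dF[OF that] by (rule differentiableI_vector)
    fix a b assume ab: "a \<le> b \<and> {a..b} \<subseteq> I"
    show "absolutely_continuous_on a b F"
      by (rule AC_cong[OF prim_on_AC[OF prim_on_subset[OF P(1)]]]) (use ab F in \<open>auto simp: subset_eq\<close>)
    show "absolutely_continuous_on a b (deriv1 F)"
      by (rule AC_cong[OF prim_on_AC[OF prim_on_subset[OF P(2)]]]) (use ab d1 in \<open>auto simp: subset_eq\<close>)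
  qed
  show "AE x in lebesgue. x \<in> I \<longrightarrow> deriv1 (deriv1 F) x = r x"
    using prim_on_AE_derivative[OF P(2) I]
  proof eventually_elim
    case (elim x)
    show ?case
    proof
      assume x: "x \<in> I"
      have "(deriv1 F has_vector_derivative r x) (at x)"
        by (rule has_vector_derivative_transform_within_open[of p _ _ I]) (use elim x I d1 in auto)
      then show "deriv1 (deriv1 F) x = r x" unfolding deriv1_def[of "deriv1 F"] by (rule vector_derivative_at)
    qed
  qed
qed

lemma locally_AC1_prim:
  assumes f: "locally_AC1 I f" and I: "is_interval J" "J \<subseteq> I"
  shows "prim_on J f (deriv1 f)" "prim_on J (deriv1 f) (deriv1 (deriv1 f))"
proof -
  have ab: "{a..b} \<subseteq> I" if "a \<in> J" "b \<in> J" for a b using interval_sub[OF I(1) that] I(2) by blast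
  have AC: "absolutely_continuous_on a b (deriv1 f)" if "a \<in> J" "b \<in> J" "a \<le> b" for a b
    using f ab[OF that(1,2)] that unfolding locally_AC1_def by blast
  show "prim_on J (deriv1 f) (deriv1 (deriv1 f))"
    unfolding prim_on_def
  proof (intro ballI impI)
    fix a b assume *: "a \<in> J" "b \<in> J" "a \<le> b"
    show "deriv1 (deriv1 f) absolutely_integrable_on {a..b} \<and> (deriv1 (deriv1 f) has_integral deriv1 f b - deriv1 f a) {a..b}"
      using prim_onD(1,2)[OF AC_deriv1[OF AC[OF *]], of a b] * by simp
  qed
  show "prim_on J f (deriv1 f)"
    unfolding prim_on_def
  proof (intro ballI impI conjI)
    fix a b assume *: "a \<in> J" "b \<in> J" "a \<le> b"
    show "deriv1 f absolutely_integrable_on {a..b}"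
      by (rule absolutely_integrable_continuous_real[OF AC_continuous[OF AC[OF *]]])
    show "(deriv1 f has_integral f b - f a) {a..b}"
    proof (rule fundamental_theorem_of_calculus[OF *(3)])
      fix x assume "x \<in> {a..b}"
      then have "f differentiable at x" using f ab[OF *(1,2)] unfolding locally_AC1_def by blast
      then have "(f has_vector_derivative deriv1 f x) (at x)"
        unfolding deriv1_def by (rule vector_derivative_works[THEN iffD1])
      then show "(f has_vector_derivative deriv1 f x) (at x within {a..b})" by (rule has_vector_derivative_at_within)
    qed
  qed
qed

section \<open>The maximal operator on the half-line\<close>

lemma square_integrable_cong_AE:
  assumes f: "square_integrable f" and eq: "AE x in lebesgue. f x = g x"
  shows "square_integrable g"
proof -
  have g: "g \<in> borel_measurable lebesgue"
    using borel_measurable_AE[OF square_integrable_measurable[OF f] eq] .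
  have "(\<lambda>x. (cmod (g x))\<^sup>2) \<in> borel_measurable lebesgue"
    by (rule borel_measurable_power[OF measurable_compose[OF g borel_measurable_norm]])
  then have "integrable lebesgue (\<lambda>x. (cmod (g x))\<^sup>2)"
    by (rule integrable_cong_AE_imp[OF square_integrable_integrable[OF f]]) (use eq in eventually_elim, simp)
  then show ?thesis using g unfolding square_integrable_def by simp
qed

lemma cinner_rep: "cinner u v = (\<integral>x. rep_l2 u x * cnj (rep_l2 v x) \<partial>lebesgue)"
  using abs_l2_ops(6)[OF si_rep si_rep, of u v] by (simp add: abs_rep_l2)

lemma l2_eqI: "AE x in lebesgue. rep_l2 u x = rep_l2 v x \<Longrightarrow> u = v"
  using abs_l2_eq_iff[OF si_rep si_rep, of u v] by (simp add: abs_rep_l2)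

lemma l2_AE: "square_integrable f \<Longrightarrow> AE x in lebesgue. rep_l2 u x = f x \<Longrightarrow> u = abs_l2 f"
  using abs_l2_eq_iff[OF si_rep, of f u] by (simp add: abs_rep_l2)

lemma rep_pos_part: "AE x in lebesgue. rep_l2 (pos_part u) x = (if 0 < x then rep_l2 u x else 0)"
  using abs_l2_ops(3)[OF si_rep, of u] rep_abs_l2[OF square_integrable_pos[OF si_rep, of u]]
  by (simp add: abs_rep_l2)

lemma rep_parity: "AE x in lebesgue. rep_l2 (parity u) x = rep_l2 u (- x)"
  using abs_l2_ops(2)[OF si_rep, of u] rep_abs_l2[OF square_integrable_reflect[OF si_rep, of u]]
  by (simp add: abs_rep_l2)

lemma l2_posI:
  assumes "AE x in lebesgue. x \<le> 0 \<longrightarrow> rep_l2 u x = 0"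
  shows "u \<in> l2_pos"
  unfolding l2_pos_iff
proof (rule l2_eqI)
  show "AE x in lebesgue. rep_l2 (pos_part u) x = rep_l2 u x"
    using rep_pos_part[of u] assms by eventually_elim auto
qed

lemma l2_pos_AE:
  assumes "u \<in> l2_pos"
  shows "AE x in lebesgue. x \<le> 0 \<longrightarrow> rep_l2 u x = 0"
  using rep_pos_part[of u] assms[unfolded l2_pos_iff] by (auto elim!: eventually_mono)

lemma locally_AC1_Un:
  assumes "locally_AC1 {0<..} f" "locally_AC1 {..<0} f"
  shows "locally_AC1 (- {0}) f"
  unfolding locally_AC1_def
proof (intro conjI ballI allI impI)
  fix x :: real assume "x \<in> - {0}"
  then have "x \<in> {0<..} \<or> x \<in> {..<0}" by auto
  then show "f differentiable at x" using assms unfolding locally_AC1_def by blast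
next
  fix a b :: real assume ab: "a \<le> b \<and> {a..b} \<subseteq> - {0}"
  then have "0 \<notin> {a..b}" by blast
  then have "{a..b} \<subseteq> {0<..} \<or> {a..b} \<subseteq> {..<0}" using ab by (auto simp: not_le)
  then show "absolutely_continuous_on a b f" "absolutely_continuous_on a b (deriv1 f)"
    using assms ab unfolding locally_AC1_def by blast+
qed

lemma set_lebesgue_eq_integral_of_AE:
  fixes f g :: "real \<Rightarrow> complex"
  assumes F: "integrable lebesgue f" and g: "AE x in lebesgue. f x = (if x \<in> {a..b} then g x else 0)"
    and gi: "g absolutely_integrable_on {a..b}"
  shows "(\<integral>x. f x \<partial>lebesgue) = integral {a..b} g"
proof -
  have "(\<integral>x. f x \<partial>lebesgue) = (\<integral>x. indicator {a..b} x *\<^sub>R g x \<partial>lebesgue)"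
  proof (rule integral_cong_AE)
    show "(\<lambda>x. indicat_real {a..b} x *\<^sub>R g x) \<in> borel_measurable lebesgue"
      using gi unfolding set_integrable_def by (rule borel_measurable_integrable)
    show "AE x in lebesgue. f x = indicat_real {a..b} x *\<^sub>R g x"
      using g by eventually_elim auto
  qed (rule borel_measurable_integrable[OF F])
  also have "\<dots> = integral {a..b} g"
    using set_lebesgue_integral_eq_integral(2)[OF gi] unfolding set_lebesgue_integral_def .
  finally show ?thesis .
qed

lemma square_integrable_continuous_compact:
  fixes f :: "real \<Rightarrow> complex"
  assumes f: "continuous_on {a..b} f" and z: "\<And>x. x \<notin> {a..b} \<Longrightarrow> f x = 0"
  shows "square_integrable f"
proof -
  have "f \<in> borel_measurable (lebesgue_on {a..b})"
    by (intro continuous_imp_measurable_on_sets_lebesgue f) simp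
  then have "(\<lambda>x. if x \<in> {a..b} then f x else 0) \<in> borel_measurable lebesgue"
    by (subst borel_measurable_if) auto
  moreover have "(\<lambda>x. if x \<in> {a..b} then f x else 0) = f" using z by auto
  ultimately have m: "f \<in> borel_measurable lebesgue" by simp
  have "bounded (f ` {a..b})" by (intro compact_imp_bounded compact_continuous_image f compact_Icc)
  then obtain M where M: "\<And>x. x \<in> {a..b} \<Longrightarrow> cmod (f x) \<le> M" unfolding bounded_iff by blast
  show ?thesis
  proof (rule square_integrable_bound[OF m])
    show "integrable lebesgue (\<lambda>x. M\<^sup>2 * indicat_real {a..b} x)"
      by (intro integrable_mult_right integrable_real_indicator) (auto simp: emeasure_lborel_Icc_eq)
    show "(cmod (f x))\<^sup>2 \<le> M\<^sup>2 * indicat_real {a..b} x" for x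
    proof (cases "x \<in> {a..b}")
      case True
      then show ?thesis using power_mono[OF M[OF True] norm_ge_zero, of 2] by simp
    qed (simp add: z)
  qed
qed

lemma square_integrable_local:
  fixes f :: "real \<Rightarrow> complex"
  assumes "square_integrable f"
  shows "f absolutely_integrable_on {a..b}"
proof -
  have fm: "f \<in> borel_measurable (lebesgue_on {a..b})"
    using square_integrable_measurable[OF assms] by (rule measurable_restrict_space1)
  have "(\<lambda>x. (cmod (f x))\<^sup>2) absolutely_integrable_on {a..b}"
    using set_integrable_subset[of lebesgue UNIV "\<lambda>x. (cmod (f x))\<^sup>2" "{a..b}"] square_integrable_integrable[OF assms]
    by (simp add: set_integrable_def)
  then have "(\<lambda>x. (cmod (f x))\<^sup>2) integrable_on {a..b}" by (rule set_lebesgue_integral_eq_integral(1))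
  then have "(\<lambda>x. 1 + (cmod (f x))\<^sup>2) integrable_on {a..b}" by (intro integrable_add) auto
  moreover have "norm (f x) \<le> 1 + (cmod (f x))\<^sup>2" for x
    using sum_squares_bound[of 1 "cmod (f x)"] norm_ge_zero[of "f x"] unfolding power2_eq_square by linarith
  ultimately show ?thesis
    by (intro measurable_bounded_by_integrable_imp_absolutely_integrable[OF fm]) auto
qed

lemma absolutely_integrable_continuous_mult:
  fixes f g :: "real \<Rightarrow> complex"
  assumes "continuous_on {a..b} f" "g absolutely_integrable_on {a..b}"
  shows "(\<lambda>x. f x * g x) absolutely_integrable_on {a..b}"
  by (rule absolutely_integrable_bounded_measurable_product[OF _ _ _ _ assms(2)])
     (auto simp: bilinear_conv_bounded_bilinear bounded_bilinear_mult intro!: continuous_imp_measurable_on_sets_lebesgue compact_imp_bounded compact_continuous_image assms(1))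

locale half_line =
  fixes q :: "real \<Rightarrow> real"
  assumes even: "\<And>x. q (- x) = q x" and q_int: "\<And>a b. 0 < a \<Longrightarrow> q absolutely_integrable_on {a..b}"
begin

text \<open>The differential equation on the positive half-line at the level of classes:
  \<open>f\<close> is the regular representative of \<open>u\<close> there, and \<open>p\<close> is
  its derivative.\<close>

definition hl :: "l2 \<Rightarrow> l2 \<Rightarrow> bool" where
  "hl u v \<longleftrightarrow> (\<exists>f p. prim_on {0<..} f p \<and> prim_on {0<..} p (\<lambda>x. complex_of_real (q x) * f x - rep_l2 v x) \<and>
     (AE x in lebesgue. 0 < x \<longrightarrow> rep_l2 u x = f x))"

lemma hlI:
  assumes "prim_on {0<..} f p" "prim_on {0<..} p r"
    "AE x in lebesgue. 0 < x \<longrightarrow> rep_l2 u x = f x" "AE x in lebesgue. 0 < x \<longrightarrow> r x = complex_of_real (q x) * f x - rep_l2 v x"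
  shows "hl u v"
proof -
  have "prim_on {0<..} p (\<lambda>x. complex_of_real (q x) * f x - rep_l2 v x)"
    by (rule prim_on_cong_AE[OF assms(2)]) (use assms(4) in \<open>simp_all add: is_interval_oi\<close>)
  then show ?thesis unfolding hl_def using assms(1,3) by blast
qed

lemma hl_pos_part: "hl (pos_part u) (pos_part v) \<longleftrightarrow> hl u v"
proof
  assume "hl u v"
  then obtain f p where *: "prim_on {0<..} f p" "prim_on {0<..} p (\<lambda>x. complex_of_real (q x) * f x - rep_l2 v x)"
     "AE x in lebesgue. 0 < x \<longrightarrow> rep_l2 u x = f x" unfolding hl_def by blast
  show "hl (pos_part u) (pos_part v)"
  proof (rule hlI[OF *(1,2)])
    show "AE x in lebesgue. 0 < x \<longrightarrow> rep_l2 (pos_part u) x = f x"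
      using *(3) rep_pos_part[of u] by eventually_elim auto
    show "AE x in lebesgue. 0 < x \<longrightarrow> complex_of_real (q x) * f x - rep_l2 v x = complex_of_real (q x) * f x - rep_l2 (pos_part v) x"
      using rep_pos_part[of v] by eventually_elim auto
  qed
next
  assume "hl (pos_part u) (pos_part v)"
  then obtain f p where *: "prim_on {0<..} f p" "prim_on {0<..} p (\<lambda>x. complex_of_real (q x) * f x - rep_l2 (pos_part v) x)"
     "AE x in lebesgue. 0 < x \<longrightarrow> rep_l2 (pos_part u) x = f x" unfolding hl_def by blast
  show "hl u v"
  proof (rule hlI[OF *(1,2)])
    show "AE x in lebesgue. 0 < x \<longrightarrow> rep_l2 u x = f x"
      using *(3) rep_pos_part[of u] by eventually_elim auto
    show "AE x in lebesgue. 0 < x \<longrightarrow> complex_of_real (q x) * f x - rep_l2 (pos_part v) x = complex_of_real (q x) * f x - rep_l2 v x"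
      using rep_pos_part[of v] by eventually_elim auto
  qed
qed

definition MP where "MP = {(u, v). u \<in> l2_pos \<and> v \<in> l2_pos \<and> hl u v}"

lemma two_sided:
  assumes 1: "prim_on {0<..} f1 p1" "prim_on {0<..} p1 r1" and 2: "prim_on {0<..} f2 p2" "prim_on {0<..} p2 r2"
    and f: "\<And>x. 0 < x \<Longrightarrow> f x = f1 x" "\<And>x. 0 < x \<Longrightarrow> f (- x) = f2 x"
  shows "locally_AC1 (- {0}) f"
    "AE x in lebesgue. 0 < x \<longrightarrow> deriv1 (deriv1 f) x = r1 x"
    "AE x in lebesgue. 0 < x \<longrightarrow> deriv1 (deriv1 f) (- x) = r2 x"
proof -
  have im: "uminus ` {0<..} = {..<0::real}" by force
  have n1: "prim_on {..<0} (\<lambda>x. f2 (- x)) (\<lambda>x. - p2 (- x))" using prim_on_reflect[OF 2(1)] unfolding im .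
  have n2: "prim_on {..<0} (\<lambda>x. - p2 (- x)) (\<lambda>x. r2 (- x))"
    using prim_on_linear[OF bounded_linear_minus[OF bounded_linear_ident] prim_on_reflect[OF 2(2)]] unfolding im by simp
  have fn: "f x = f2 (- x)" if "x \<in> {..<0}" for x using f(2)[of "- x"] that by simp
  have fp: "f x = f1 x" if "x \<in> {0<..}" for x using f(1) that by simp
  note P = prim_pair_locally_AC1[OF 1 open_greaterThan fp] and N = prim_pair_locally_AC1[OF n1 n2 open_lessThan fn]
  show "locally_AC1 (- {0}) f" by (rule locally_AC1_Un[OF P(1) N(1)])
  show "AE x in lebesgue. 0 < x \<longrightarrow> deriv1 (deriv1 f) x = r1 x" using P(3) by simp
  show "AE x in lebesgue. 0 < x \<longrightarrow> deriv1 (deriv1 f) (- x) = r2 x"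
    using AE_lebesgue_reflect[OF N(3)] by simp
qed

text \<open>The decomposition of the maximal operator into half-line operators; evenness of
  \<open>q\<close> makes the reflected negative half obey the same equation. For the converse the
  two representatives are joined with value 0 at the origin, a point that
  \<open>locally_AC1 (- {0})\<close> does not see.\<close>

lemma max_op_iff:
  "(u, v) \<in> max_op q \<longleftrightarrow> (pos_part u, pos_part v) \<in> MP \<and> (pos_part (parity u), pos_part (parity v)) \<in> MP"
proof -
  have "(u, v) \<in> max_op q \<longleftrightarrow> hl u v \<and> hl (parity u) (parity v)"
  proof
    assume "(u, v) \<in> max_op q"
    then obtain f where f: "f \<in> max_domain q" "u = abs_l2 f" "v = abs_l2 (schroedinger q f)"
      unfolding max_op_def by blast
    then have si: "square_integrable f" "square_integrable (schroedinger q f)" and AC: "locally_AC1 (- {0}) f"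
      unfolding max_domain_def by auto
    have ru: "AE x in lebesgue. rep_l2 u x = f x" and rv: "AE x in lebesgue. rep_l2 v x = schroedinger q f x"
      using rep_abs_l2[OF si(1)] rep_abs_l2[OF si(2)] f by simp_all
    have "hl u v"
    proof (rule hlI)
      show "prim_on {0<..} f (deriv1 f)" "prim_on {0<..} (deriv1 f) (deriv1 (deriv1 f))"
        by (rule locally_AC1_prim[OF AC]; auto simp: is_interval_oi)+
      show "AE x in lebesgue. 0 < x \<longrightarrow> rep_l2 u x = f x" using ru by eventually_elim simp
      show "AE x in lebesgue. 0 < x \<longrightarrow> deriv1 (deriv1 f) x = complex_of_real (q x) * f x - rep_l2 v x"
        using rv by eventually_elim (simp add: schroedinger_def)
    qed
    moreover have "hl (parity u) (parity v)"
    proof (rule hlI)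
      have im: "uminus ` {..<0} = {0::real<..}" by force
      have n: "prim_on {..<0} f (deriv1 f)" "prim_on {..<0} (deriv1 f) (deriv1 (deriv1 f))"
        by (rule locally_AC1_prim[OF AC]; auto simp: is_interval_io)+
      show "prim_on {0<..} (\<lambda>x. f (- x)) (\<lambda>x. - deriv1 f (- x))" using prim_on_reflect[OF n(1)] unfolding im .
      show "prim_on {0<..} (\<lambda>x. - deriv1 f (- x)) (\<lambda>x. deriv1 (deriv1 f) (- x))"
        using prim_on_linear[OF bounded_linear_minus[OF bounded_linear_ident] prim_on_reflect[OF n(2)]] unfolding im by simp
      show "AE x in lebesgue. 0 < x \<longrightarrow> rep_l2 (parity u) x = f (- x)"
        using AE_lebesgue_reflect[OF ru] rep_parity[of u] by eventually_elim simp
      show "AE x in lebesgue. 0 < x \<longrightarrow> deriv1 (deriv1 f) (- x) = complex_of_real (q x) * f (- x) - rep_l2 (parity v) x"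
        using AE_lebesgue_reflect[OF rv] rep_parity[of v] by eventually_elim (simp add: schroedinger_def even)
    qed
    ultimately show "hl u v \<and> hl (parity u) (parity v)" ..
  next
    assume "hl u v \<and> hl (parity u) (parity v)"
    then obtain f1 p1 f2 p2 where
      1: "prim_on {0<..} f1 p1" "prim_on {0<..} p1 (\<lambda>x. complex_of_real (q x) * f1 x - rep_l2 v x)"
         "AE x in lebesgue. 0 < x \<longrightarrow> rep_l2 u x = f1 x" and
      2: "prim_on {0<..} f2 p2" "prim_on {0<..} p2 (\<lambda>x. complex_of_real (q x) * f2 x - rep_l2 (parity v) x)"
         "AE x in lebesgue. 0 < x \<longrightarrow> rep_l2 (parity u) x = f2 x" unfolding hl_def by blast
    define f where "f x = (if 0 < x then f1 x else if x < 0 then f2 (- x) else 0)" for x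
    note T = two_sided[OF 1(1,2) 2(1,2), of f]
    have AC: "locally_AC1 (- {0}) f"
      and d1: "AE x in lebesgue. 0 < x \<longrightarrow> deriv1 (deriv1 f) x = complex_of_real (q x) * f1 x - rep_l2 v x"
      and d2: "AE x in lebesgue. 0 < x \<longrightarrow> deriv1 (deriv1 f) (- x) = complex_of_real (q x) * f2 x - rep_l2 (parity v) x"
      by (rule T; simp add: f_def)+
    have ru: "AE x in lebesgue. rep_l2 u x = f x"
      using 1(3) AE_lebesgue_reflect[OF 2(3)] AE_lebesgue_reflect[OF rep_parity[of u]] AE_not_eq_lebesgue[of 0]
      by eventually_elim (auto simp: f_def)
    have rv: "AE x in lebesgue. rep_l2 v x = schroedinger q f x"
      using d1 AE_lebesgue_reflect[OF d2] AE_lebesgue_reflect[OF rep_parity[of v]] AE_not_eq_lebesgue[of 0]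
    proof eventually_elim
      case (elim x)
      consider "0 < x" | "x < 0" using elim(4) by linarith
      then show ?case by cases (use elim even[of x] in \<open>simp_all add: schroedinger_def f_def\<close>)
    qed
    have si: "square_integrable f" "square_integrable (schroedinger q f)"
      using square_integrable_cong_AE[OF si_rep ru] square_integrable_cong_AE[OF si_rep rv] .
    have "f \<in> max_domain q" unfolding max_domain_def using si AC by simp
    moreover have "u = abs_l2 f" "v = abs_l2 (schroedinger q f)" using l2_AE[OF si(1) ru] l2_AE[OF si(2) rv] .
    ultimately show "(u, v) \<in> max_op q" unfolding max_op_def by blast
  qed
  then show ?thesis unfolding MP_def by (simp add: hl_pos_part pos_part_in)
qed

text \<open>Lagrange's identity: the terms with the real potential cancel, and so do the products of
  the derivatives.\<close>

lemma green_prim: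
  assumes "prim_on {0<..} f p" "prim_on {0<..} p (\<lambda>x. complex_of_real (q x) * f x - \<phi> x)"
    and "prim_on {0<..} g s" "prim_on {0<..} s (\<lambda>x. complex_of_real (q x) * g x - h x)"
  shows "prim_on {0<..} (\<lambda>x. f x * cnj (s x) - p x * cnj (g x)) (\<lambda>x. \<phi> x * cnj (g x) - f x * cnj (h x))"
proof -
  have "prim_on {0<..} (\<lambda>x. f x * cnj (s x) - p x * cnj (g x))
     (\<lambda>x. (p x * cnj (s x) + f x * cnj (complex_of_real (q x) * g x - h x)) -
        ((complex_of_real (q x) * f x - \<phi> x) * cnj (g x) + p x * cnj (s x)))"
    by (intro prim_on_diff prim_on_mult assms prim_on_linear[OF bounded_linear_cnj] is_interval_oi)
  then show ?thesis by (simp add: algebra_simps)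
qed

definition T0 :: "(l2 \<times> l2) set" where
  "T0 = {(abs_l2 f, abs_l2 (schroedinger q f)) | f.
     f \<in> max_domain q \<and> (\<exists>a b. 0 < a \<and> a \<le> b \<and> (\<forall>x. x \<notin> {a..b} \<longrightarrow> f x = 0))}"

lemma min_op_pos_closure: "min_op_pos q = closure T0"
  unfolding min_op_pos_def T0_def ..

lemma deriv1_zero:
  assumes "open U" "x \<in> U" "\<And>y. y \<in> U \<Longrightarrow> f y = 0"
  shows "deriv1 f x = 0"
  unfolding deriv1_def
  by (rule vector_derivative_at, rule has_vector_derivative_transform_within_open[OF has_vector_derivative_const[of 0] assms(1,2)])
     (simp add: assms(3))

lemma T0_pair:
  assumes "(u, v) \<in> T0"
  obtains f p a b where "0 < a" "a \<le> b" "prim_on {0<..} f p" "prim_on {0<..} p (\<lambda>x. complex_of_real (q x) * f x - rep_l2 v x)"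
    "\<And>x. x \<notin> {a..b} \<Longrightarrow> f x = 0 \<and> p x = 0" "AE x in lebesgue. rep_l2 u x = f x" "AE x in lebesgue. x \<notin> {a..b} \<longrightarrow> rep_l2 v x = 0"
proof -
  obtain f a b where f: "f \<in> max_domain q" "u = abs_l2 f" "v = abs_l2 (schroedinger q f)" and
    ab: "0 < a" "a \<le> b" and z: "\<And>x. x \<notin> {a..b} \<Longrightarrow> f x = 0"
    using assms unfolding T0_def by blast
  then have si: "square_integrable f" "square_integrable (schroedinger q f)" and AC: "locally_AC1 (- {0}) f"
    unfolding max_domain_def by auto
  have ru: "AE x in lebesgue. rep_l2 u x = f x" and rv: "AE x in lebesgue. rep_l2 v x = schroedinger q f x"
    using rep_abs_l2[OF si(1)] rep_abs_l2[OF si(2)] f by simp_all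
  have op: "open (- {a..b})" by (intro open_Compl closed_atLeastAtMost)
  have d1: "deriv1 f x = 0" if "x \<in> - {a..b}" for x by (rule deriv1_zero[OF op that]) (simp add: z)
  have d2: "deriv1 (deriv1 f) x = 0" if "x \<in> - {a..b}" for x by (rule deriv1_zero[OF op that d1])
  have p: "prim_on {0<..} f (deriv1 f)" "prim_on {0<..} (deriv1 f) (deriv1 (deriv1 f))"
    by (rule locally_AC1_prim[OF AC]; auto simp: is_interval_oi)+
  have p2: "prim_on {0<..} (deriv1 f) (\<lambda>x. complex_of_real (q x) * f x - rep_l2 v x)"
  proof (rule prim_on_cong_AE[OF p(2)])
    show "AE x in lebesgue. x \<in> {0<..} \<longrightarrow> deriv1 (deriv1 f) x = complex_of_real (q x) * f x - rep_l2 v x"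
      using rv by eventually_elim (simp add: schroedinger_def)
  qed (simp_all add: is_interval_oi)
  have "AE x in lebesgue. x \<notin> {a..b} \<longrightarrow> rep_l2 v x = 0"
    using rv by eventually_elim (use z d2 in \<open>auto simp: schroedinger_def\<close>)
  then show ?thesis using that[OF ab p(1) p2 _ ru] z d1 by simp
qed

lemma T0I:
  assumes P: "prim_on {0<..} f p" "prim_on {0<..} p (\<lambda>x. complex_of_real (q x) * f x - \<phi> x)"
    and si: "square_integrable \<phi>" and ab: "0 < a" "a \<le> b" and z: "\<And>x. x \<notin> {a..b} \<Longrightarrow> f x = 0 \<and> \<phi> x = 0"
  shows "(abs_l2 f, abs_l2 \<phi>) \<in> T0" "square_integrable f"
proof -
  have f0: "f (- x) = 0" "\<phi> (- x) = 0" if "0 < x" for x using z[of "- x"] that ab by auto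
  note T = two_sided[OF P prim_on_const[of _ 0] prim_on_const[of _ 0], of f]
  have AC: "locally_AC1 (- {0}) f"
    and d1: "AE x in lebesgue. 0 < x \<longrightarrow> deriv1 (deriv1 f) x = complex_of_real (q x) * f x - \<phi> x"
    and d2: "AE x in lebesgue. 0 < x \<longrightarrow> deriv1 (deriv1 f) (- x) = 0"
    by (rule T; simp add: f0)+
  have eq: "AE x in lebesgue. \<phi> x = schroedinger q f x"
    using d1 AE_lebesgue_reflect[OF d2] AE_not_eq_lebesgue[of 0]
  proof eventually_elim
    case (elim x)
    consider "0 < x" | "x < 0" using elim(3) by linarith
    then show ?case by cases (use elim f0[of "- x"] in \<open>simp_all add: schroedinger_def\<close>)
  qed
  have "continuous_on {a..b} f" by (rule prim_on_continuous[OF P(1)]) (use ab in auto)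
  then show sif: "square_integrable f" by (rule square_integrable_continuous_compact) (simp add: z)
  have sis: "square_integrable (schroedinger q f)" by (rule square_integrable_cong_AE[OF si eq])
  have "f \<in> max_domain q" unfolding max_domain_def using sif sis AC by simp
  moreover have "abs_l2 \<phi> = abs_l2 (schroedinger q f)" using abs_l2_eq_iff[OF si sis] eq by simp
  ultimately show "(abs_l2 f, abs_l2 \<phi>) \<in> T0" unfolding T0_def using ab z by blast
qed

lemma T0_green:
  assumes P: "prim_on {0<..} f p" "prim_on {0<..} p (\<lambda>x. complex_of_real (q x) * f x - \<phi> x)"
    and G: "prim_on {0<..} g s" "prim_on {0<..} s (\<lambda>x. complex_of_real (q x) * g x - h x)"
    and ab: "0 < a" "a \<le> b" and z: "\<And>x. 0 < x \<Longrightarrow> x \<notin> {a..b} \<Longrightarrow> f x = 0 \<and> p x = 0"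
  shows "(\<lambda>x. \<phi> x * cnj (g x) - f x * cnj (h x)) absolutely_integrable_on {a / 2..b + 1}"
    "integral {a / 2..b + 1} (\<lambda>x. \<phi> x * cnj (g x) - f x * cnj (h x)) = 0"
proof -
  \<comment> \<open>Endpoints strictly outside \<open>[a, b]\<close>, because \<open>z\<close> says
    nothing about \<open>a\<close> and \<open>b\<close> themselves.\<close>
  have ends: "f (a / 2) = 0 \<and> p (a / 2) = 0" "f (b + 1) = 0 \<and> p (b + 1) = 0"
    by (rule z; use ab in auto)+
  note D = prim_onD[OF green_prim[OF P G], of "a / 2" "b + 1"]
  show "(\<lambda>x. \<phi> x * cnj (g x) - f x * cnj (h x)) absolutely_integrable_on {a / 2..b + 1}"
    using D(1) ab by simp
  show "integral {a / 2..b + 1} (\<lambda>x. \<phi> x * cnj (g x) - f x * cnj (h x)) = 0"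
    using D(3) ab ends by simp
qed

lemma T0_MP:
  assumes "(u, v) \<in> T0"
  shows "(u, v) \<in> MP"
proof -
  obtain f p a b where *: "0 < a" "a \<le> b" "prim_on {0<..} f p" "prim_on {0<..} p (\<lambda>x. complex_of_real (q x) * f x - rep_l2 v x)"
    "\<And>x. x \<notin> {a..b} \<Longrightarrow> f x = 0 \<and> p x = 0" "AE x in lebesgue. rep_l2 u x = f x" "AE x in lebesgue. x \<notin> {a..b} \<longrightarrow> rep_l2 v x = 0"
    using assms by (rule T0_pair) (rule that)
  have "hl u v" unfolding hl_def using *(3,4,6) by (intro exI conjI) (auto elim: eventually_mono)
  moreover have "u \<in> l2_pos"
  proof (rule l2_posI)
    show "AE x in lebesgue. x \<le> 0 \<longrightarrow> rep_l2 u x = 0" using *(6) by eventually_elim (use *(1,5) in auto)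
  qed
  moreover have "v \<in> l2_pos"
  proof (rule l2_posI)
    show "AE x in lebesgue. x \<le> 0 \<longrightarrow> rep_l2 v x = 0" using *(7) by eventually_elim (use *(1) in auto)
  qed
  ultimately show ?thesis unfolding MP_def by simp
qed

lemma T0_MP_symmetric:
  assumes "(u, v) \<in> T0" "(y, w) \<in> MP"
  shows "cinner v y = cinner u w"
proof -
  obtain f p a b where *: "0 < a" "a \<le> b" "prim_on {0<..} f p" "prim_on {0<..} p (\<lambda>x. complex_of_real (q x) * f x - rep_l2 v x)"
    "\<And>x. x \<notin> {a..b} \<Longrightarrow> f x = 0 \<and> p x = 0" "AE x in lebesgue. rep_l2 u x = f x" "AE x in lebesgue. x \<notin> {a..b} \<longrightarrow> rep_l2 v x = 0"
    using assms(1) by (rule T0_pair) (rule that)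
  obtain g s where G: "prim_on {0<..} g s" "prim_on {0<..} s (\<lambda>x. complex_of_real (q x) * g x - rep_l2 w x)"
     "AE x in lebesgue. 0 < x \<longrightarrow> rep_l2 y x = g x" using assms(2) unfolding MP_def hl_def by blast
  have z: "f x = 0 \<and> p x = 0" if "0 < x" "x \<notin> {a..b}" for x using *(5) that by blast
  note D = T0_green[OF *(3,4) G(1,2) *(1,2) z]
  have int: "integrable lebesgue (\<lambda>x. rep_l2 v x * cnj (rep_l2 y x))" "integrable lebesgue (\<lambda>x. rep_l2 u x * cnj (rep_l2 w x))"
    by (intro integrable_mult_cnj si_rep)+
  have "cinner v y - cinner u w = (\<integral>x. rep_l2 v x * cnj (rep_l2 y x) - rep_l2 u x * cnj (rep_l2 w x) \<partial>lebesgue)"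
    unfolding cinner_rep using int by simp
  also have "\<dots> = integral {a / 2..b + 1} (\<lambda>x. rep_l2 v x * cnj (g x) - f x * cnj (rep_l2 w x))"
  proof (rule set_lebesgue_eq_integral_of_AE[OF _ _ D(1)])
    show "integrable lebesgue (\<lambda>x. rep_l2 v x * cnj (rep_l2 y x) - rep_l2 u x * cnj (rep_l2 w x))"
      using int by (rule Bochner_Integration.integrable_diff)
    show "AE x in lebesgue. rep_l2 v x * cnj (rep_l2 y x) - rep_l2 u x * cnj (rep_l2 w x) =
       (if x \<in> {a / 2..b + 1} then rep_l2 v x * cnj (g x) - f x * cnj (rep_l2 w x) else 0)"
      using *(6,7) G(3)
    proof eventually_elim
      case (elim x)
      show ?case
      proof (cases "x \<in> {a / 2..b + 1}")
        case True
        then have "0 < x" using *(1) by auto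
        then show ?thesis using True elim by simp
      next
        case False
        then have "x \<notin> {a..b}" using *(1) by auto
        then show ?thesis using False elim *(5)[of x] by simp
      qed
    qed
  qed
  also have "\<dots> = 0" by (rule D(2))
  finally show ?thesis by simp
qed

text \<open>Continuous representatives that agree almost everywhere agree everywhere; then so do
  their derivatives, and the second derivatives agree almost everywhere.\<close>

lemma MP_unique:
  assumes "(u, v) \<in> MP" "(u, v') \<in> MP"
  shows "v = v'"
proof -
  obtain f p where 1: "prim_on {0<..} f p" "prim_on {0<..} p (\<lambda>x. complex_of_real (q x) * f x - rep_l2 v x)"
     "AE x in lebesgue. 0 < x \<longrightarrow> rep_l2 u x = f x" using assms(1) unfolding MP_def hl_def by blast
  obtain g s where 2: "prim_on {0<..} g s" "prim_on {0<..} s (\<lambda>x. complex_of_real (q x) * g x - rep_l2 v' x)"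
     "AE x in lebesgue. 0 < x \<longrightarrow> rep_l2 u x = g x" using assms(2) unfolding MP_def hl_def by blast
  have eqAE: "AE x in lebesgue. 0 < x \<longrightarrow> f x = g x" using 1(3) 2(3) by eventually_elim auto
  note D = prim_on_diff[OF 1(1) 2(1)] prim_on_diff[OF 1(2) 2(2)]
  have fg: "f x - g x = 0" if x: "0 < x" for x
  proof (rule ccontr)
    assume ne: "f x - g x \<noteq> 0"
    have c: "continuous_on {x / 2..x + 1} (\<lambda>x. f x - g x)" by (rule prim_on_continuous[OF D(1)]) (use x in auto)
    have ci: "continuous_on (cbox (x / 2) (x + 1)) (\<lambda>x. cmod (f x - g x))"
      using continuous_on_norm[OF c] by simp
    obtain N where N: "N \<in> null_sets lebesgue" "{x \<in> space lebesgue. \<not> (0 < x \<longrightarrow> f x = g x)} \<subseteq> N"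
      using eqAE unfolding eventually_ae_filter by auto
    have neg: "negligible N" using N(1) by (simp add: negligible_iff_null_sets)
    have zero: "cmod (f t - g t) = 0" if t: "t \<in> cbox (x / 2) (x + 1) - N" for t
    proof (rule ccontr)
      assume "cmod (f t - g t) \<noteq> 0"
      then have "t \<in> {x \<in> space lebesgue. \<not> (0 < x \<longrightarrow> f x = g x)}" using t x by auto
      then show False using N(2) t by blast
    qed
    have "((\<lambda>x. cmod (f x - g x)) has_integral 0) (cbox (x / 2) (x + 1))"
      by (rule has_integral_spike[OF neg zero has_integral_0])
    from has_integral_0_cbox_imp_0[OF ci _ this, of x] x ne show False by auto
  qed
  have "prim_on {0<..} (\<lambda>x. 0) (\<lambda>x. p x - s x)"
    by (rule prim_on_cong_AE[OF D(1)]) (use fg in \<open>auto simp: is_interval_oi\<close>)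
  have ps: "p x - s x = 0" if x: "0 < x" for x
  proof -
    have "((\<lambda>x. f x - g x) has_vector_derivative p x - s x) (at x)"
      by (rule prim_pair_derivative[OF D open_greaterThan]) (use x in simp)
    then have "((\<lambda>x. 0) has_vector_derivative p x - s x) (at x)"
      by (rule has_vector_derivative_transform_within_open[of _ _ _ "{0<..}"]) (use x fg in auto)
    then show ?thesis using vector_derivative_unique_at[OF _ has_vector_derivative_const[of 0]] by blast
  qed
  have "prim_on {0<..} (\<lambda>x. 0) (\<lambda>x. (complex_of_real (q x) * f x - rep_l2 v x) - (complex_of_real (q x) * g x - rep_l2 v' x))"
    by (rule prim_on_cong_AE[OF D(2)]) (use ps in \<open>auto simp: is_interval_oi\<close>)
  from prim_on_zero_AE[OF this open_greaterThan]
  have pos: "AE x in lebesgue. 0 < x \<longrightarrow> rep_l2 v x = rep_l2 v' x"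
  proof eventually_elim
    case (elim x)
    then show ?case using fg[of x] by auto
  qed
  have "v \<in> l2_pos" "v' \<in> l2_pos" using assms unfolding MP_def by auto
  from l2_pos_AE[OF this(1)] l2_pos_AE[OF this(2)] pos
  have "AE x in lebesgue. rep_l2 v x = rep_l2 v' x"
  proof eventually_elim
    case (elim x)
    then show ?case by (cases "0 < x") auto
  qed
  then show ?thesis by (rule l2_eqI)
qed

end

section \<open>The adjoint of the preminimal operator\<close>

lemma exists_prim:
  fixes g :: "real \<Rightarrow> complex"
  assumes g: "\<And>a b. 0 < a \<Longrightarrow> g absolutely_integrable_on {a..b}"
  obtains F where "prim_on {0<..} F g"
proof -
  define F where "F x = (if 1 \<le> x then integral {1..x} g else - integral {x..1} g)" for x
  have gi: "g integrable_on {a..b}" if "0 < a" for a b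
    by (rule set_lebesgue_integral_eq_integral(1)[OF g[OF that]])
  have "prim_on {0<..} F g"
    unfolding prim_on_def
  proof (intro ballI impI conjI)
    fix a b :: real assume ab: "a \<in> {0<..}" "b \<in> {0<..}" "a \<le> b"
    show "g absolutely_integrable_on {a..b}" using g ab by simp
    consider "1 \<le> a" | "a < 1" "1 \<le> b" | "b < 1" by linarith
    then have "integral {a..b} g = F b - F a"
    proof cases
      case 1
      then show ?thesis using Henstock_Kurzweil_Integration.integral_combine[of 1 a b g] gi[of 1 b] ab by (simp add: F_def algebra_simps)
    next
      case 2
      then show ?thesis using Henstock_Kurzweil_Integration.integral_combine[of a 1 b g] gi[of a b] ab by (simp add: F_def algebra_simps)
    next
      case 3
      then show ?thesis using Henstock_Kurzweil_Integration.integral_combine[of a b 1 g] gi[of a 1] ab by (simp add: F_def algebra_simps)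
    qed
    then show "(g has_integral F b - F a) {a..b}" using integrable_integral[OF gi[of a b]] ab by simp
  qed
  then show ?thesis by (rule that)
qed

lemma continuous_zero_AE:
  fixes F :: "real \<Rightarrow> complex"
  assumes c: "continuous_on {a..b} F" and ae: "AE x in lebesgue. x \<in> {a..b} \<longrightarrow> F x = 0" and x: "x \<in> {a..b}" and ab: "a < b"
  shows "F x = 0"
proof -
  obtain N where N: "N \<in> null_sets lebesgue" "{x \<in> space lebesgue. \<not> (x \<in> {a..b} \<longrightarrow> F x = 0)} \<subseteq> N"
    using ae unfolding eventually_ae_filter by auto
  have neg: "negligible N" using N(1) by (simp add: negligible_iff_null_sets)
  have zero: "cmod (F t) = 0" if t: "t \<in> cbox a b - N" for t
  proof (rule ccontr)
    assume "cmod (F t) \<noteq> 0"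
    then have "t \<in> {x \<in> space lebesgue. \<not> (x \<in> {a..b} \<longrightarrow> F x = 0)}" using t by auto
    then show False using N(2) t by blast
  qed
  have "((\<lambda>x. cmod (F x)) has_integral 0) (cbox a b)"
    by (rule has_integral_spike[OF neg zero has_integral_0])
  moreover have "continuous_on (cbox a b) (\<lambda>x. cmod (F x))" using continuous_on_norm[OF c] by simp
  ultimately have "cmod (F x) = 0" using has_integral_0_cbox_imp_0[of a b "\<lambda>x. cmod (F x)" x] x ab by auto
  then show ?thesis by simp
qed

context half_line
begin

lemma q_prim_real: "prim_on {0<..} s p \<Longrightarrow> prim_on {0<..} (\<lambda>x. complex_of_real (s x)) (\<lambda>x. complex_of_real (p x))" for s p :: "real \<Rightarrow> real"
  by (rule prim_on_linear[OF bounded_linear_of_real])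

text \<open>Regularity of weak solutions. On a compact interval, \<open>y\<close> minus a particular
  solution is projected onto the span of \<open>s1\<close> and \<open>s2\<close>. The residual of
  this projection is an admissible right-hand side in \<open>T0\<close>, and testing
  \<open>y\<close> with it shows that the residual vanishes.\<close>

lemma adjoint_T0_hl:
  assumes adj: "(y, w) \<in> adjoint_in l2_pos T0"
  shows "hl y w"
proof -
  obtain s1r p1r s2r p2r :: "real \<Rightarrow> real" where fs: "prim_on {0<..} s1r p1r" "prim_on {0<..} p1r (\<lambda>x. q x * s1r x)"
    "prim_on {0<..} s2r p2r" "prim_on {0<..} p2r (\<lambda>x. q x * s2r x)"
    "\<And>x. 0 < x \<Longrightarrow> s1r x * p2r x - p1r x * s2r x = 1"
    by (rule fundamental_system[of q, OF even q_int]) (assumption | rule that)+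
  define s1 where "s1 x = complex_of_real (s1r x)" for x
  define s2 where "s2 x = complex_of_real (s2r x)" for x
  define p1 where "p1 x = complex_of_real (p1r x)" for x
  define p2 where "p2 x = complex_of_real (p2r x)" for x
  note defs = s1_def[abs_def] s2_def[abs_def] p1_def[abs_def] p2_def[abs_def]
  have S: "prim_on {0<..} s1 p1" "prim_on {0<..} p1 (\<lambda>x. complex_of_real (q x) * s1 x)"
    "prim_on {0<..} s2 p2" "prim_on {0<..} p2 (\<lambda>x. complex_of_real (q x) * s2 x)"
    using q_prim_real[OF fs(1)] q_prim_real[OF fs(2)] q_prim_real[OF fs(3)] q_prim_real[OF fs(4)]
    unfolding defs by simp_all
  have Wr: "s1 x * p2 x - p1 x * s2 x = 1" if "0 < x" for x
    using arg_cong[OF fs(5)[OF that], of complex_of_real] by (simp add: defs)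
  have cs: "cnj (s1 x) = s1 x" "cnj (s2 x) = s2 x" for x by (simp_all add: defs)
  have cont: "continuous_on {a..b} s1" "continuous_on {a..b} s2" if "0 < a" for a b
    by (rule prim_on_continuous[OF S(1)] prim_on_continuous[OF S(3)]; use that in auto)+
  define g where "g = rep_l2 y"
  define h where "h = rep_l2 w"
  have gh: "square_integrable g" "square_integrable h" unfolding g_def h_def by (rule si_rep)+
  have "(\<lambda>x. s1 x * h x) absolutely_integrable_on {a..b}" "(\<lambda>x. s2 x * h x) absolutely_integrable_on {a..b}" if "0 < a" for a b
    by (rule absolutely_integrable_continuous_mult[OF _ square_integrable_local[OF gh(2)]]; rule cont[OF that])+
  then obtain B1 B2 where B: "prim_on {0<..} B1 (\<lambda>x. s1 x * h x)" "prim_on {0<..} B2 (\<lambda>x. s2 x * h x)"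
    using exists_prim[of "\<lambda>x. s1 x * h x"] exists_prim[of "\<lambda>x. s2 x * h x"] by metis
  \<comment> \<open>Variation of constants: \<open>k\<close> is a particular solution of
    \<open>- k'' + q k = h\<close>.\<close>
  define k where "k x = s1 x * B2 x - s2 x * B1 x" for x
  define kp where "kp x = p1 x * B2 x - p2 x * B1 x" for x
  have "prim_on {0<..} k (\<lambda>x. (p1 x * B2 x + s1 x * (s2 x * h x)) - (p2 x * B1 x + s2 x * (s1 x * h x)))"
    unfolding k_def by (intro prim_on_diff prim_on_mult S B is_interval_oi)
  moreover have "(\<lambda>x. (p1 x * B2 x + s1 x * (s2 x * h x)) - (p2 x * B1 x + s2 x * (s1 x * h x))) = kp"
    by (auto simp: kp_def algebra_simps)
  ultimately have k1: "prim_on {0<..} k kp" by simp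
  have "prim_on {0<..} kp (\<lambda>x. (complex_of_real (q x) * s1 x * B2 x + p1 x * (s2 x * h x)) - (complex_of_real (q x) * s2 x * B1 x + p2 x * (s1 x * h x)))"
    unfolding kp_def by (intro prim_on_diff prim_on_mult S B is_interval_oi)
  then have k2: "prim_on {0<..} kp (\<lambda>x. complex_of_real (q x) * k x - h x)"
  proof (rule prim_on_cong_AE)
    show "AE x in lebesgue. x \<in> {0<..} \<longrightarrow> (complex_of_real (q x) * s1 x * B2 x + p1 x * (s2 x * h x)) - (complex_of_real (q x) * s2 x * B1 x + p2 x * (s1 x * h x)) = complex_of_real (q x) * k x - h x"
    proof (intro AE_I2 impI)
      fix x :: real assume "x \<in> {0<..}"
      then have W: "s1 x * p2 x - p1 x * s2 x = 1" using Wr by simp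
      have "(complex_of_real (q x) * s1 x * B2 x + p1 x * (s2 x * h x)) - (complex_of_real (q x) * s2 x * B1 x + p2 x * (s1 x * h x))
        = complex_of_real (q x) * k x - (s1 x * p2 x - p1 x * s2 x) * h x"
        by (simp add: k_def algebra_simps)
      then show "(complex_of_real (q x) * s1 x * B2 x + p1 x * (s2 x * h x)) - (complex_of_real (q x) * s2 x * B1 x + p2 x * (s1 x * h x)) = complex_of_real (q x) * k x - h x"
        unfolding W by simp
    qed
  qed (simp_all add: is_interval_oi)
  have span: "\<exists>\<alpha> \<beta>. AE x in lebesgue. x \<in> {a..b} \<longrightarrow> g x - k x = \<alpha> * s1 x + \<beta> * s2 x" if ab: "0 < a" "a \<le> b" for a b
  proof -
    define e1 where "e1 x = (if x \<in> {a..b} then s1 x else 0)" for x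
    define e2 where "e2 x = (if x \<in> {a..b} then s2 x else 0)" for x
    define wf where "wf x = (if x \<in> {a..b} then g x - k x else 0)" for x
    have ck: "continuous_on {a..b} k" by (rule prim_on_continuous[OF k1]) (use ab in auto)
    have sk: "square_integrable (\<lambda>x. if x \<in> {a..b} then k x else 0)"
      by (rule square_integrable_continuous_compact[of a b]) (auto intro: continuous_on_eq[OF ck])
    have "square_integrable (\<lambda>x. (if x \<in> {a..b} then g x else 0) - (if x \<in> {a..b} then k x else 0))"
      by (rule square_integrable_diff[OF square_integrable_indicator[OF gh(1)] sk]) simp
    moreover have "(\<lambda>x. (if x \<in> {a..b} then g x else 0) - (if x \<in> {a..b} then k x else 0)) = wf"
      by (auto simp: wf_def)
    ultimately have swf: "square_integrable wf" by simp
    have se: "square_integrable e1" "square_integrable e2"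
      unfolding e1_def e2_def
      by (rule square_integrable_continuous_compact[of a b]; auto intro: continuous_on_eq[OF cont(1)] continuous_on_eq[OF cont(2)] simp: ab(1))+
    obtain \<alpha> \<beta> where orth: "cinner (abs_l2 wf - \<alpha> *\<^sub>C abs_l2 e1 - \<beta> *\<^sub>C abs_l2 e2) (abs_l2 e1) = 0"
      "cinner (abs_l2 wf - \<alpha> *\<^sub>C abs_l2 e1 - \<beta> *\<^sub>C abs_l2 e2) (abs_l2 e2) = 0"
      by (rule two_vector_projection)
    define \<phi> where "\<phi> x = wf x - \<alpha> * e1 x - \<beta> * e2 x" for x
    have s\<phi>: "square_integrable \<phi>"
      unfolding \<phi>_def by (intro square_integrable_diff swf square_integrable_cmult se)
    have a\<phi>: "abs_l2 wf - \<alpha> *\<^sub>C abs_l2 e1 - \<beta> *\<^sub>C abs_l2 e2 = abs_l2 \<phi>"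
      unfolding \<phi>_def[abs_def] abs_l2_ops(1)[OF se(1)] abs_l2_ops(1)[OF se(2)]
        abs_l2_diff[OF swf square_integrable_cmult[OF se(1)]]
      by (rule abs_l2_diff) (intro square_integrable_diff swf square_integrable_cmult se)+
    have \<phi>0: "\<phi> x = 0" if "x \<notin> {a..b}" for x using that by (simp add: \<phi>_def wf_def e1_def e2_def del: atLeastAtMost_iff)
    have int: "integrable lebesgue (\<lambda>x. \<phi> x * e1 x)" "integrable lebesgue (\<lambda>x. \<phi> x * e2 x)"
      using integrable_mult_cnj[OF s\<phi> se(1)] integrable_mult_cnj[OF s\<phi> se(2)]
      by (simp_all add: e1_def e2_def if_distrib[of cnj] cs cong: if_cong)
    have zero: "(\<integral>x. \<phi> x * e1 x \<partial>lebesgue) = 0" "(\<integral>x. \<phi> x * e2 x \<partial>lebesgue) = 0"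
      using orth unfolding a\<phi> abs_l2_ops(6)[OF s\<phi> se(1)] abs_l2_ops(6)[OF s\<phi> se(2)]
      by (simp_all add: e1_def e2_def if_distrib[of cnj] cs cong: if_cong)
    have ai: "(\<lambda>x. \<phi> x * e1 x) absolutely_integrable_on A" "(\<lambda>x. \<phi> x * e2 x) absolutely_integrable_on A" if "A \<in> sets lebesgue" for A
      using set_integrable_subset[of lebesgue UNIV "\<lambda>x. \<phi> x * e1 x" A] set_integrable_subset[of lebesgue UNIV "\<lambda>x. \<phi> x * e2 x" A] int that
      by (simp_all add: set_integrable_def)
    \<comment> \<open>As \<open>\<phi>\<close> is orthogonal to \<open>s1\<close> and
      \<open>s2\<close>, these integrals vanish beyond \<open>b\<close> as well as before
      \<open>a\<close>. The solution \<open>f\<close> built from them below therefore has compact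
      support and supplies a test pair.\<close>
    define C1 where "C1 x = integral {0..x} (\<lambda>x. \<phi> x * e1 x)" for x
    define C2 where "C2 x = integral {0..x} (\<lambda>x. \<phi> x * e2 x)" for x
    have C: "prim_on {0<..} C1 (\<lambda>x. \<phi> x * e1 x)" "prim_on {0<..} C2 (\<lambda>x. \<phi> x * e2 x)"
      unfolding C1_def C2_def by (rule prim_on_integral[OF ai(1)] prim_on_integral[OF ai(2)]; auto)+
    have C0: "C1 x = 0" "C2 x = 0" if x: "0 < x" "x \<notin> {a..b}" for x
    proof -
      have "C1 x = 0 \<and> C2 x = 0"
      proof (cases "x < a")
        case True
        then have pz: "\<phi> t = 0" if "t \<in> {0..x}" for t using \<phi>0[of t] that by auto
        have "integral {0..x} (\<lambda>t. \<phi> t * e t) = integral {0..x} (\<lambda>t. 0)" for e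
          by (rule Henstock_Kurzweil_Integration.integral_cong) (simp only: pz mult_zero_left)
        then show ?thesis unfolding C1_def C2_def by simp
      next
        case False
        then have b: "b < x" using x by auto
        have eq: "(if t \<in> {0..x} then \<phi> t * e t else 0) = \<phi> t * e t" for t and e :: "real \<Rightarrow> complex"
          using \<phi>0[of t] b ab by auto
        have "C1 x = (\<integral>x. \<phi> x * e1 x \<partial>lebesgue)"
          unfolding C1_def by (rule set_lebesgue_eq_integral_of_AE[OF int(1) _ ai(1), symmetric]) (simp_all only: eq, simp_all)
        moreover have "C2 x = (\<integral>x. \<phi> x * e2 x \<partial>lebesgue)"
          unfolding C2_def by (rule set_lebesgue_eq_integral_of_AE[OF int(2) _ ai(2), symmetric]) (simp_all only: eq, simp_all)
        ultimately have "C1 x = (\<integral>x. \<phi> x * e1 x \<partial>lebesgue)" "C2 x = (\<integral>x. \<phi> x * e2 x \<partial>lebesgue)" .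
        then show ?thesis using zero by simp
      qed
      then show "C1 x = 0" "C2 x = 0" by auto
    qed
    define f where "f x = (if 0 < x then s2 x * C1 x - s1 x * C2 x else 0)" for x
    define fp where "fp x = p2 x * C1 x - p1 x * C2 x" for x
    have "prim_on {0<..} (\<lambda>x. s2 x * C1 x - s1 x * C2 x) (\<lambda>x. (p2 x * C1 x + s2 x * (\<phi> x * e1 x)) - (p1 x * C2 x + s1 x * (\<phi> x * e2 x)))"
      by (intro prim_on_diff prim_on_mult S C is_interval_oi)
    then have f1: "prim_on {0<..} f fp"
    proof (rule prim_on_cong_AE)
      show "AE x in lebesgue. x \<in> {0<..} \<longrightarrow> (p2 x * C1 x + s2 x * (\<phi> x * e1 x)) - (p1 x * C2 x + s1 x * (\<phi> x * e2 x)) = fp x"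
        by (rule AE_I2) (simp add: fp_def e1_def e2_def \<phi>0)
    qed (simp_all add: is_interval_oi f_def)
    have "prim_on {0<..} fp (\<lambda>x. (complex_of_real (q x) * s2 x * C1 x + p2 x * (\<phi> x * e1 x)) - (complex_of_real (q x) * s1 x * C2 x + p1 x * (\<phi> x * e2 x)))"
      unfolding fp_def by (intro prim_on_diff prim_on_mult S C is_interval_oi)
    then have "prim_on {0<..} fp (\<lambda>x. complex_of_real (q x) * f x - (- \<phi> x))"
    proof (rule prim_on_cong_AE)
      show "AE x in lebesgue. x \<in> {0<..} \<longrightarrow> (complex_of_real (q x) * s2 x * C1 x + p2 x * (\<phi> x * e1 x)) - (complex_of_real (q x) * s1 x * C2 x + p1 x * (\<phi> x * e2 x)) = complex_of_real (q x) * f x - (- \<phi> x)"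
      proof (intro AE_I2 impI)
        fix x :: real assume x: "x \<in> {0<..}"
        have "(s1 x * p2 x - p1 x * s2 x) * \<phi> x = p2 x * (\<phi> x * e1 x) - p1 x * (\<phi> x * e2 x)"
          by (cases "x \<in> {a..b}") (simp_all add: e1_def e2_def \<phi>0 algebra_simps)
        then have "p2 x * (\<phi> x * e1 x) - p1 x * (\<phi> x * e2 x) = \<phi> x" using Wr[of x] x by simp
        then show "(complex_of_real (q x) * s2 x * C1 x + p2 x * (\<phi> x * e1 x)) - (complex_of_real (q x) * s1 x * C2 x + p1 x * (\<phi> x * e2 x)) = complex_of_real (q x) * f x - (- \<phi> x)"
          using x by (simp add: f_def algebra_simps)
      qed
    qed (simp_all add: is_interval_oi)
    note f2 = this
    have sm: "square_integrable (\<lambda>x. - \<phi> x)" using square_integrable_cmult[OF s\<phi>, of "-1"] by simp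
    have fz: "f x = 0 \<and> - \<phi> x = 0" if "x \<notin> {a..b}" for x
      using C0[of x] \<phi>0[OF that] that by (simp add: f_def)
    have fz': "f x = 0 \<and> fp x = 0" if "0 < x" "x \<notin> {a..b}" for x
      using C0[OF that] by (simp add: f_def fp_def)
    have TT: "(abs_l2 f, abs_l2 (\<lambda>x. - \<phi> x)) \<in> T0" "square_integrable f"
      by (rule T0I[OF f1 f2 sm ab]; rule fz; assumption)+
    have "cinner (abs_l2 (\<lambda>x. - \<phi> x)) y = cinner (abs_l2 f) w"
      using adj TT(1) unfolding adjoint_in_def by auto
    then have adj': "(\<integral>x. - \<phi> x * cnj (g x) \<partial>lebesgue) = (\<integral>x. f x * cnj (h x) \<partial>lebesgue)"
      using abs_l2_ops(6)[OF sm gh(1)] abs_l2_ops(6)[OF TT(2) gh(2)] by (simp add: g_def h_def abs_rep_l2)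
    have GG: "(\<lambda>x. - \<phi> x * cnj (k x) - f x * cnj (h x)) absolutely_integrable_on {a / 2..b + 1}"
      "integral {a / 2..b + 1} (\<lambda>x. - \<phi> x * cnj (k x) - f x * cnj (h x)) = 0"
      by (rule T0_green[OF f1 f2 k1 k2 ab]; rule fz'; assumption)+
    have i1: "integrable lebesgue (\<lambda>x. - \<phi> x * cnj (g x))" "integrable lebesgue (\<lambda>x. f x * cnj (h x))" "integrable lebesgue (\<lambda>x. \<phi> x * cnj (wf x))"
      using integrable_mult_cnj[OF sm gh(1)] integrable_mult_cnj[OF TT(2) gh(2)] integrable_mult_cnj[OF s\<phi> swf] .
    have "(\<integral>x. (- \<phi> x * cnj (g x) - f x * cnj (h x)) + \<phi> x * cnj (wf x) \<partial>lebesgue)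
      = integral {a / 2..b + 1} (\<lambda>x. - \<phi> x * cnj (k x) - f x * cnj (h x))"
    proof (rule set_lebesgue_eq_integral_of_AE[OF _ _ GG(1)])
      show "integrable lebesgue (\<lambda>x. (- \<phi> x * cnj (g x) - f x * cnj (h x)) + \<phi> x * cnj (wf x))"
        by (rule Bochner_Integration.integrable_add[OF Bochner_Integration.integrable_diff[OF i1(1,2)] i1(3)])
      show "AE x in lebesgue. (- \<phi> x * cnj (g x) - f x * cnj (h x)) + \<phi> x * cnj (wf x) =
        (if x \<in> {a / 2..b + 1} then - \<phi> x * cnj (k x) - f x * cnj (h x) else 0)"
      proof (rule AE_I2)
        fix x
        show "(- \<phi> x * cnj (g x) - f x * cnj (h x)) + \<phi> x * cnj (wf x) =
          (if x \<in> {a / 2..b + 1} then - \<phi> x * cnj (k x) - f x * cnj (h x) else 0)"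
        proof (cases "x \<in> {a..b}")
          case True
          then have "x \<in> {a / 2..b + 1}" using ab by auto
          then show ?thesis using True by (simp add: wf_def algebra_simps)
        next
          case False
          then show ?thesis using fz[OF False] by simp
        qed
      qed
    qed
    then have "(\<integral>x. (- \<phi> x * cnj (g x) - f x * cnj (h x)) + \<phi> x * cnj (wf x) \<partial>lebesgue) = 0" using GG(2) by simp
    moreover have "(\<integral>x. (- \<phi> x * cnj (g x) - f x * cnj (h x)) + \<phi> x * cnj (wf x) \<partial>lebesgue)
      = ((\<integral>x. - \<phi> x * cnj (g x) \<partial>lebesgue) - (\<integral>x. f x * cnj (h x) \<partial>lebesgue)) + (\<integral>x. \<phi> x * cnj (wf x) \<partial>lebesgue)"
      using i1 by (subst Bochner_Integration.integral_add[OF Bochner_Integration.integrable_diff[OF i1(1,2)] i1(3)])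
        (simp add: Bochner_Integration.integral_diff[OF i1(1,2)])
    ultimately have "cinner (abs_l2 \<phi>) (abs_l2 wf) = 0"
      unfolding adj' abs_l2_ops(6)[OF s\<phi> swf] by simp
    then have "cinner (abs_l2 \<phi>) (abs_l2 wf - \<alpha> *\<^sub>C abs_l2 e1 - \<beta> *\<^sub>C abs_l2 e2) = 0"
      using orth[unfolded a\<phi>] by (simp add: cinner_diff_right cinner_scaleC_right)
    then have "abs_l2 \<phi> = 0" unfolding a\<phi> by (simp add: cinner_self)
    then have "AE x in lebesgue. \<phi> x = 0"
      using abs_l2_eq_iff[OF s\<phi> square_integrable_zero] by (simp add: zero_l2_def)
    then have "AE x in lebesgue. x \<in> {a..b} \<longrightarrow> g x - k x = \<alpha> * s1 x + \<beta> * s2 x"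
      by eventually_elim (auto simp: \<phi>_def wf_def e1_def e2_def algebra_simps)
    then show ?thesis by blast
  qed
  \<comment> \<open>The coefficients on \<open>[1, 2]\<close> serve as reference. On any larger
    interval they must be the same by linear independence, so one pair works on the whole
    half-line.\<close>
  obtain \<alpha> \<beta> where ab0: "AE x in lebesgue. x \<in> {1..2} \<longrightarrow> g x - k x = \<alpha> * s1 x + \<beta> * s2 x"
    using span[of 1 2] by auto
  have indep: "a = 0 \<and> b = 0" if z: "AE x in lebesgue. x \<in> {1..2} \<longrightarrow> a * s1 x + b * s2 x = 0" for a b
  proof -
    have P: "prim_on {0<..} (\<lambda>x. a * s1 x + b * s2 x) (\<lambda>x. a * p1 x + b * p2 x)"
      "prim_on {0<..} (\<lambda>x. a * p1 x + b * p2 x) (\<lambda>x. a * (complex_of_real (q x) * s1 x) + b * (complex_of_real (q x) * s2 x))"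
      by (intro prim_on_add prim_on_linear[OF bounded_linear_mult_right] S)+
    have Z: "a * s1 x + b * s2 x = 0" if "x \<in> {1..2}" for x
      by (rule continuous_zero_AE[OF prim_on_continuous[OF P(1)] z that]) auto
    have "((\<lambda>x. a * s1 x + b * s2 x) has_vector_derivative a * p1 (3/2) + b * p2 (3/2)) (at (3/2))"
      by (rule prim_pair_derivative[OF P open_greaterThan]) simp
    then have "((\<lambda>x. 0) has_vector_derivative a * p1 (3/2) + b * p2 (3/2)) (at (3/2))"
      by (rule has_vector_derivative_transform_within_open[of _ _ _ "{1<..<2}"]) (use Z in auto)
    then have 1: "a * p1 (3/2) + b * p2 (3/2) = 0"
      using vector_derivative_unique_at[OF _ has_vector_derivative_const[of 0]] by blast
    have 2: "a * s1 (3/2) + b * s2 (3/2) = 0" using Z by simp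
    have W: "s1 (3/2) * p2 (3/2) - p1 (3/2) * s2 (3/2) = 1" by (rule Wr) simp
    have "a * (s1 (3/2) * p2 (3/2) - p1 (3/2) * s2 (3/2)) =
       p2 (3/2) * (a * s1 (3/2) + b * s2 (3/2)) - s2 (3/2) * (a * p1 (3/2) + b * p2 (3/2))"
      "b * (s1 (3/2) * p2 (3/2) - p1 (3/2) * s2 (3/2)) =
       s1 (3/2) * (a * p1 (3/2) + b * p2 (3/2)) - p1 (3/2) * (a * s1 (3/2) + b * s2 (3/2))"
      by (simp_all add: algebra_simps)
    then show ?thesis unfolding 1 2 W by simp
  qed
  have fin1: "AE x in lebesgue. x \<in> {0<..} \<longrightarrow> g x = k x + \<alpha> * s1 x + \<beta> * s2 x"
  proof (rule AE_open_cover[OF open_greaterThan])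
    fix a b :: real assume ab: "a \<le> b" "{a..b} \<subseteq> {0<..}"
    then have m: "0 < min a 1" "min a 1 \<le> max b 2" by auto
    obtain \<alpha>' \<beta>' where n: "AE x in lebesgue. x \<in> {min a 1..max b 2} \<longrightarrow> g x - k x = \<alpha>' * s1 x + \<beta>' * s2 x"
      using span[OF m] by blast
    have "AE x in lebesgue. x \<in> {1..2} \<longrightarrow> (\<alpha>' - \<alpha>) * s1 x + (\<beta>' - \<beta>) * s2 x = 0"
      using n ab0 by eventually_elim (auto simp: algebra_simps)
    then have "\<alpha>' = \<alpha>" "\<beta>' = \<beta>" using indep[of "\<alpha>' - \<alpha>" "\<beta>' - \<beta>"] by auto
    with n show "AE x in lebesgue. x \<in> {a<..<b} \<longrightarrow> g x = k x + \<alpha> * s1 x + \<beta> * s2 x"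
      by (auto elim!: eventually_mono simp: algebra_simps)
  qed
  have fin2: "prim_on {0<..} (\<lambda>x. k x + \<alpha> * s1 x + \<beta> * s2 x) (\<lambda>x. kp x + \<alpha> * p1 x + \<beta> * p2 x)"
    by (intro prim_on_add prim_on_linear[OF bounded_linear_mult_right] S k1)
  have fin3: "prim_on {0<..} (\<lambda>x. kp x + \<alpha> * p1 x + \<beta> * p2 x)
     (\<lambda>x. (complex_of_real (q x) * k x - h x) + \<alpha> * (complex_of_real (q x) * s1 x) + \<beta> * (complex_of_real (q x) * s2 x))"
    by (intro prim_on_add prim_on_linear[OF bounded_linear_mult_right] S k2)
  show ?thesis
  proof (rule hlI[OF fin2 fin3])
    show "AE x in lebesgue. 0 < x \<longrightarrow> rep_l2 y x = k x + \<alpha> * s1 x + \<beta> * s2 x" using fin1 by (simp add: g_def)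
    show "AE x in lebesgue. 0 < x \<longrightarrow> (complex_of_real (q x) * k x - h x) + \<alpha> * (complex_of_real (q x) * s1 x) + \<beta> * (complex_of_real (q x) * s2 x)
      = complex_of_real (q x) * (k x + \<alpha> * s1 x + \<beta> * s2 x) - rep_l2 w x"
      by (rule AE_I2) (simp add: h_def algebra_simps)
  qed
qed

lemma adjoint_T0: "adjoint_in l2_pos T0 = MP"
proof (intro set_eqI iffI)
  fix p assume p: "p \<in> adjoint_in l2_pos T0"
  then have "(fst p, snd p) \<in> adjoint_in l2_pos T0" by simp
  from adjoint_T0_hl[OF this] p show "p \<in> MP" unfolding MP_def adjoint_in_def by auto
next
  fix p assume p: "p \<in> MP"
  then have "(fst p, snd p) \<in> MP" by simp
  from T0_MP_symmetric[OF _ this] p show "p \<in> adjoint_in l2_pos T0" unfolding MP_def adjoint_in_def by auto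
qed

lemma closed_adjoint_l2: "closed (adjoint_in l2_pos A)" for A :: "(l2 \<times> l2) set"
proof -
  have "adjoint_in l2_pos A = (l2_pos \<times> l2_pos) \<inter> (\<Inter>p\<in>A. {z. cinner (snd p) (fst z) = cinner (fst p) (snd z)})"
    unfolding adjoint_in_def by (auto simp: split_beta) fastforce
  moreover have "closed {z :: l2 \<times> l2. cinner (snd p) (fst z) = cinner (fst p) (snd z)}" for p
    by (intro closed_Collect_eq continuous_on_compose2[OF linear_continuous_on[OF bounded_linear_cinner_right], of UNIV] continuous_intros) auto
  ultimately show ?thesis by (auto intro!: closed_Int closed_Times closed_l2_pos closed_INT)
qed

text \<open>Passing to the closure does not change the adjoint, as the identities that define it are
  closed conditions.\<close>

lemma adjoint_min: "adjoint_in l2_pos (min_op_pos q) = MP"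
proof
  show "adjoint_in l2_pos (min_op_pos q) \<subseteq> MP"
    unfolding adjoint_T0[symmetric] min_op_pos_closure adjoint_in_def using closure_subset[of T0] by blast
  show "MP \<subseteq> adjoint_in l2_pos (min_op_pos q)"
  proof
    fix p assume p: "p \<in> MP"
    have "T0 \<subseteq> {z. cinner (snd z) (fst p) = cinner (fst z) (snd p)}"
    proof
      fix z assume "z \<in> T0"
      then show "z \<in> {z. cinner (snd z) (fst p) = cinner (fst z) (snd p)}"
        using T0_MP_symmetric[of "fst z" "snd z" "fst p" "snd p"] p by simp
    qed
    moreover have "closed {z :: l2 \<times> l2. cinner (snd z) (fst p) = cinner (fst z) (snd p)}"
      by (intro closed_Collect_eq continuous_on_compose2[OF linear_continuous_on[OF bounded_linear_cinner_left], of UNIV] continuous_intros) auto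
    ultimately have "closure T0 \<subseteq> {z. cinner (snd z) (fst p) = cinner (fst z) (snd p)}" by (rule closure_minimal)
    then show "p \<in> adjoint_in l2_pos (min_op_pos q)"
      using p unfolding adjoint_in_def min_op_pos_closure MP_def by auto
  qed
qed

lemma zero_T0: "(0, 0) \<in> T0"
proof -
  have "(abs_l2 (\<lambda>x. 0), abs_l2 (\<lambda>x. 0)) \<in> T0"
    by (rule T0I[of _ "\<lambda>x. 0" _ 1 1]) (auto simp: prim_on_const square_integrable_zero)
  then show ?thesis by (simp add: zero_l2_def)
qed

lemma half_triplet_min:
  assumes "boundary_triplet l2_pos (min_op_pos q) G0 G1"
  shows "line_triplet (min_op_pos q) G0 G1"
proof (intro line_triplet.intro half_triplet.intro csubspace_l2_pos closed_l2_pos assms)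
  show "min_op_pos q \<subseteq> adjoint_in l2_pos (min_op_pos q)"
    unfolding adjoint_min unfolding min_op_pos_closure
  proof (rule closure_minimal)
    show "T0 \<subseteq> MP" using T0_MP by auto
    show "closed MP" using closed_adjoint_l2[of T0] by (simp add: adjoint_T0)
  qed
  show "(0, 0) \<in> min_op_pos q" unfolding min_op_pos_closure using zero_T0 closure_subset by blast
  show "single_valued (adjoint_in l2_pos (min_op_pos q))"
    unfolding adjoint_min single_valued_def using MP_unique by blast
qed

end

section \<open>Entire functions of zero exponential type\<close>

definition zero_type :: "(complex \<Rightarrow> complex) \<Rightarrow> bool" where
  "zero_type F \<longleftrightarrow> (\<forall>\<epsilon>>0. \<exists>C. \<forall>z. cmod (F z) \<le> C * exp (\<epsilon> * cmod z))"

text \<open>The quadratic \<open>p\<close> has real part at least 1 on the upper semicircle of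
  radius \<open>R\<close> and a nonnegative one on the diameter, so the factor
  \<open>exp (- a * p)\<close> lowers the bound on the arc to \<open>M\<close> without spoiling the
  diameter. At a fixed \<open>w\<close> the cost \<open>a * Re (p w)\<close> tends to
  \<open>2 * \<epsilon> * Im w\<close> as \<open>R\<close> grows.\<close>

lemma phragmen_lindelof_half_disc:
  assumes F: "F holomorphic_on UNIV" and C: "\<And>z. cmod (F z) \<le> C * exp (\<epsilon> * cmod z)"
    and M: "\<And>x::real. cmod (F (complex_of_real x)) \<le> M" and M0: "M > 0" "C \<ge> M" "\<epsilon> > 0"
    and R: "cmod w \<le> R" "R > 0" and w: "Im w \<ge> 0"
  shows "cmod (F w) \<le> M * exp ((\<epsilon> * R + ln (C / M)) * (((Re w)\<^sup>2 - (Im w)\<^sup>2 + 2 * R * Im w) / R\<^sup>2))"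
proof -
  \<comment> \<open>The logarithm of \<open>C * exp (\<epsilon> * R) / M\<close>, by which the
    growth bound on the arc exceeds \<open>M\<close>.\<close>
  define a where "a = \<epsilon> * R + ln (C / M)"
  have a: "a \<ge> 0" using M0 R unfolding a_def by (intro add_nonneg_nonneg) auto
  define p where "p z = (z\<^sup>2 - 2 * \<i> * complex_of_real R * z) / complex_of_real (R\<^sup>2)" for z
  have Rep: "Re (p z) = ((Re z)\<^sup>2 - (Im z)\<^sup>2 + 2 * R * Im z) / R\<^sup>2" for z
    unfolding p_def by (simp add: Re_divide_of_real power2_eq_square)
  define f where "f z = F z * exp (- complex_of_real a * p z)" for z
  have fn: "cmod (f z) = cmod (F z) * exp (- a * Re (p z))" for z
    unfolding f_def by (simp add: norm_mult)
  define D where "D = cball 0 R \<inter> {z. 0 \<le> Im z}"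
  have "closed D" unfolding D_def by (intro closed_Int closed_cball closed_halfspace_Im_ge)
  have hol: "f holomorphic_on UNIV" unfolding f_def p_def by (intro holomorphic_intros F) (use R in auto)
  have "cmod (f w) \<le> M"
  proof (rule maximum_modulus_frontier[of f D])
    show "f holomorphic_on interior D" using hol by (rule holomorphic_on_subset) simp
    show "continuous_on (closure D) f" using holomorphic_on_imp_continuous_on[OF hol] by (rule continuous_on_subset) simp
    show "bounded D" unfolding D_def by (intro bounded_Int disjI1 bounded_cball)
    show "w \<in> D" using w R by (simp add: D_def)
    fix z assume "z \<in> frontier D"
    then have z: "z \<in> D" "z \<notin> interior D" using \<open>closed D\<close> by (simp_all add: frontier_def)
    have "open (ball 0 R \<inter> {z. 0 < Im z})" by (intro open_Int open_ball open_halfspace_Im_gt)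
    then have "ball 0 R \<inter> {z. 0 < Im z} \<subseteq> interior D" by (intro interior_maximal) (auto simp: D_def)
    then have "z \<notin> ball 0 R \<inter> {z. 0 < Im z}" using z(2) by blast
    then consider "Im z = 0" | "cmod z = R" using z(1) by (auto simp: D_def)
    then show "cmod (f z) \<le> M"
    proof cases
      case 1
      then have "z = complex_of_real (Re z)" by (simp add: complex_eq_iff)
      then have "cmod (F z) \<le> M" using M by metis
      moreover have "exp (- a * Re (p z)) \<le> 1" using a 1 by (simp add: Rep)
      ultimately show ?thesis unfolding fn using M0(1) by (metis exp_ge_zero mult_left_le mult_mono' norm_ge_zero mult.right_neutral)
    next
      case 2
      have y: "0 \<le> Im z" "Im z \<le> R" using z(1) 2 abs_Im_le_cmod[of z] by (auto simp: D_def)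
      have "(Re z)\<^sup>2 + (Im z)\<^sup>2 = R\<^sup>2" using 2 by (simp add: cmod_power2[symmetric])
      moreover have "Im z * Im z \<le> R * Im z" using y by (intro mult_right_mono) auto
      ultimately have "R\<^sup>2 \<le> (Re z)\<^sup>2 - (Im z)\<^sup>2 + 2 * R * Im z" by (simp add: power2_eq_square)
      then have "1 \<le> Re (p z)" unfolding Rep using R by simp
      then have "a * 1 \<le> a * Re (p z)" using a by (rule mult_left_mono)
      then have "exp (- a * Re (p z)) \<le> exp (- a)" by simp
      then have "cmod (f z) \<le> (C * exp (\<epsilon> * R)) * exp (- a)"
        unfolding fn using C[of z] 2 M0 by (intro mult_mono) (auto intro: order_trans[OF less_imp_le])
      also have "\<dots> = C * (exp (\<epsilon> * R) * exp (- (\<epsilon> * R))) * exp (- ln (C / M))"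
        unfolding a_def by (simp add: exp_diff exp_minus field_simps)
      also have "\<dots> = C * inverse (C / M)"
        using M0 by (subst exp_minus[of "ln (C / M)"]) (simp add: exp_minus)
      also have "\<dots> = M" using M0 by (simp add: field_simps)
      finally show ?thesis .
    qed
  qed
  then have "cmod (F w) * exp (- a * Re (p w)) * exp (a * Re (p w)) \<le> M * exp (a * Re (p w))"
    unfolding fn by (intro mult_right_mono) auto
  moreover have "exp (- a * Re (p w)) * exp (a * Re (p w)) = 1" by (simp add: exp_add[symmetric])
  ultimately have "cmod (F w) \<le> M * exp (a * Re (p w))" by (simp only: mult.assoc mult_1_right)
  then show ?thesis unfolding Rep a_def .
qed

text \<open>In the half-disc estimate \<open>R\<close> tends to infinity and then
  \<open>\<epsilon>\<close> to 0. \<open>M1 = M + e\<close> replaces \<open>M\<close>, which may be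
  0, because a logarithm of \<open>C / M1\<close> is taken.\<close>

lemma phragmen_lindelof_zero_type:
  assumes F: "F holomorphic_on UNIV" "zero_type F"
    and M: "\<And>x::real. cmod (F (complex_of_real x)) \<le> M" and w: "Im w \<ge> 0"
  shows "cmod (F w) \<le> M"
proof (rule field_le_epsilon)
  fix e :: real assume e: "e > 0"
  have M0: "M \<ge> 0" using M[of 0] norm_ge_zero[of "F (complex_of_real 0)"] by linarith
  define M1 where "M1 = M + e"
  have M1: "M1 > 0" "\<And>x::real. cmod (F (complex_of_real x)) \<le> M1"
    using M0 e M by (auto simp: M1_def intro: add_increasing2)
  have step: "cmod (F w) \<le> M1 * exp (2 * \<epsilon> * Im w)" if eps: "\<epsilon> > 0" for \<epsilon>
  proof -
    obtain C0 where C0: "\<And>z. cmod (F z) \<le> C0 * exp (\<epsilon> * cmod z)" using F(2) eps unfolding zero_type_def by blast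
    define C where "C = max C0 M1"
    have C: "cmod (F z) \<le> C * exp (\<epsilon> * cmod z)" for z
      using C0[of z] by (rule order_trans) (simp add: C_def)
    have "((\<lambda>R. M1 * exp ((\<epsilon> * R + ln (C / M1)) * (((Re w)\<^sup>2 - (Im w)\<^sup>2 + 2 * R * Im w) / R\<^sup>2))) \<longlongrightarrow> M1 * exp (2 * \<epsilon> * Im w)) at_top"
    proof -
      define u v c where "u = (Re w)\<^sup>2 - (Im w)\<^sup>2" and "v = Im w" and "c = ln (C / M1)"
      have "((\<lambda>R::real. (\<epsilon> * R + c) * ((u + 2 * R * v) / R\<^sup>2)) \<longlongrightarrow> 2 * \<epsilon> * v) at_top"
        by real_asymp
      then show ?thesis unfolding u_def v_def c_def by (rule tendsto_mult[OF tendsto_const tendsto_exp])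
    qed
    moreover have "\<forall>\<^sub>F R in at_top. cmod (F w) \<le> M1 * exp ((\<epsilon> * R + ln (C / M1)) * (((Re w)\<^sup>2 - (Im w)\<^sup>2 + 2 * R * Im w) / R\<^sup>2))"
      using eventually_ge_at_top[of "cmod w + 1"]
    proof eventually_elim
      case (elim R)
      show ?case
        by (rule phragmen_lindelof_half_disc[OF F(1) C M1(2) M1(1) _ eps _ _ w])
           (use elim norm_ge_zero[of w] in \<open>auto simp: C_def simp del: norm_ge_zero\<close>)
    qed
    ultimately show ?thesis by (intro tendsto_lowerbound[of _ _ at_top]) auto
  qed
  have "((\<lambda>\<epsilon>. M1 * exp (2 * \<epsilon> * Im w)) \<longlongrightarrow> M1 * exp (2 * 0 * Im w)) (at_right 0)"
    by (intro tendsto_intros)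
  moreover have "\<forall>\<^sub>F \<epsilon> in at_right 0. cmod (F w) \<le> M1 * exp (2 * \<epsilon> * Im w)"
    unfolding eventually_at_right_field using step by (intro exI[of _ 1]) auto
  ultimately have "cmod (F w) \<le> M1 * exp (2 * 0 * Im w)"
    by (intro tendsto_lowerbound[of _ _ "at_right (0::real)"]) auto
  then show "cmod (F w) \<le> M + e" by (simp add: M1_def)
qed

text \<open>The decay bounds \<open>F\<close> by \<open>K\<close> on the line
  \<open>Im z = 1\<close> and above it; Phragmen-Lindelof extends the bound below. By Liouville
  \<open>F\<close> is constant, and the decay leaves only the constant 0.\<close>

lemma zero_type_half_plane_decay:
  assumes F: "F holomorphic_on UNIV" "zero_type F"
    and K: "\<And>z. Im z > 0 \<Longrightarrow> cmod (F z) \<le> K / sqrt (Im z)"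
  shows "F z = 0"
proof -
  \<comment> \<open>A half-turn that carries the closed upper half-plane onto
    \<open>Im z \<le> 1\<close>.\<close>
  define G where "G w = F (\<i> - w)" for w
  have Gh: "G holomorphic_on UNIV"
    unfolding G_def using holomorphic_on_compose_gen[of "\<lambda>w. \<i> - w" UNIV F UNIV] F(1)
    by (simp add: o_def holomorphic_intros)
  have Gz: "zero_type G"
    unfolding zero_type_def
  proof (intro allI impI)
    fix e :: real assume e: "e > 0"
    then obtain C where C: "\<And>z. cmod (F z) \<le> C * exp (e * cmod z)" using F(2) unfolding zero_type_def by blast
    have C0: "C \<ge> 0" using C[of 0] norm_ge_zero[of "F 0"] by (simp del: norm_ge_zero)
    show "\<exists>C. \<forall>w. cmod (G w) \<le> C * exp (e * cmod w)"
    proof (intro exI allI)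
      fix w
      have "cmod (\<i> - w) \<le> 1 + cmod w" using norm_triangle_ineq4[of \<i> w] by simp
      then have "exp (e * cmod (\<i> - w)) \<le> exp (e * (1 + cmod w))" using e by simp
      then have "C * exp (e * cmod (\<i> - w)) \<le> C * exp (e * (1 + cmod w))" using C0 by (rule mult_left_mono)
      then show "cmod (G w) \<le> (C * exp e) * exp (e * cmod w)"
        using C[of "\<i> - w"] unfolding G_def by (simp add: distrib_left exp_add mult.assoc)
    qed
  qed
  have low: "cmod (F z) \<le> K" if "Im z \<le> 1" for z
  proof -
    have "cmod (G (\<i> - z)) \<le> K"
    proof (rule phragmen_lindelof_zero_type[OF Gh Gz])
      fix x :: real show "cmod (G (complex_of_real x)) \<le> K" using K[of "\<i> - complex_of_real x"] by (simp add: G_def)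
    qed (use that in simp)
    then show ?thesis by (simp add: G_def)
  qed
  have K0: "K \<ge> 0" using low[of 0] norm_ge_zero[of "F 0"] by (simp del: norm_ge_zero)
  have bd: "cmod (F z) \<le> K" for z
  proof (cases "Im z \<le> 1")
    case False
    then have "K / sqrt (Im z) \<le> K / 1" using K0 by (intro divide_left_mono) auto
    then show ?thesis using K[of z] False by simp
  qed (rule low)
  then have "bounded (range F)" unfolding bounded_iff by blast
  then obtain c where c: "\<And>z. F z = c" using Liouville_theorem[OF F(1)] unfolding constant_on_def by auto
  have "cmod c \<le> 0"
  proof (rule tendsto_lowerbound[of "\<lambda>y. K / sqrt y" 0 at_top])
    show "((\<lambda>y. K / sqrt y) \<longlongrightarrow> 0) at_top"
      by (intro tendsto_divide_0[OF tendsto_const] filterlim_at_top_imp_at_infinity sqrt_at_top)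
    show "\<forall>\<^sub>F y in at_top. cmod c \<le> K / sqrt y"
      using eventually_gt_at_top[of 0]
    proof eventually_elim
      case (elim y)
      then show ?case using K[of "Complex 0 y"] c by simp
    qed
  qed simp
  then show ?thesis using c by simp
qed

section \<open>Solutions near the limit-circle endpoint\<close>

text \<open>In the norm \<open>k * cmod (f x) + cmod (p x)\<close> the system \<open>f' = p\<close>,
  \<open>p' = (q - z) f\<close> has rate at most \<open>k + \<bar>q x\<bar>\<close>, so the exponent
  grows like the square root of \<open>cmod z\<close>. The 1 under the root gives
  \<open>k \<ge> 1\<close>, which absorbs the term with \<open>q\<close>.\<close>

lemma (in half_line) energy_bound:
  fixes f p :: "real \<Rightarrow> complex"
  assumes f: "prim_on {0<..} f p" and p: "prim_on {0<..} p (\<lambda>x. (complex_of_real (q x) - z) * f x)"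
    and ab: "0 < a" "a \<le> b"
  defines "k \<equiv> sqrt (1 + cmod z)"
  shows "k * cmod (f b) + cmod (p b) \<le> (k * cmod (f a) + cmod (p a)) * exp (k * (b - a) + integral {a..b} (\<lambda>t. \<bar>q t\<bar>))"
proof -
  have k: "k \<ge> 1" "k * k = 1 + cmod z" by (simp_all add: k_def)
  define V where "V x = k * cmod (f x) + cmod (p x)" for x
  define \<kappa> where "\<kappa> x = k + \<bar>q x\<bar>" for x
  have sub: "{a..b} \<subseteq> {0<..}" using ab by auto
  have cf: "continuous_on {a..b} f" and cp: "continuous_on {a..b} p"
    by (rule prim_on_continuous[OF f sub] prim_on_continuous[OF p sub])+
  have cV: "continuous_on {a..b} V" unfolding V_def by (intro continuous_intros cf cp)
  have ci: "(\<lambda>x. c) absolutely_integrable_on {a..b}" for c :: real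
    by (rule absolutely_integrable_continuous_real) simp
  have aq: "(\<lambda>x. \<bar>q x\<bar>) absolutely_integrable_on {a..b}"
    using absolutely_integrable_norm[OF q_int[OF ab(1), of b]] by (simp add: o_def)
  have a\<kappa>: "\<kappa> absolutely_integrable_on {a..b}" unfolding \<kappa>_def by (rule set_integral_add(1)[OF ci aq])
  have \<kappa>V: "(\<lambda>t. \<kappa> t * V t) integrable_on {a..b}"
  proof -
    have "(\<lambda>t. V t * \<kappa> t) absolutely_integrable_on {a..b}"
      by (rule absolutely_integrable_bounded_measurable_product_real[OF _ _ _ a\<kappa>])
         (auto intro!: continuous_imp_measurable_on_sets_lebesgue cV compact_imp_bounded compact_continuous_image)
    then show ?thesis by (simp add: set_lebesgue_integral_eq_integral(1) mult.commute)
  qed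
  have "V b \<le> V a * exp (integral {a..b} \<kappa>)"
  proof (rule gronwall[OF ab(2) cV _ a\<kappa>])
    show "V x \<le> V a + integral {a..x} (\<lambda>t. \<kappa> t * V t)" if x: "x \<in> {a..b}" for x
    proof -
      have ax: "a \<in> {0<..}" "x \<in> {0<..}" "a \<le> x" using x ab by auto
      define r where "r t = (complex_of_real (q t) - z) * f t" for t
      have np: "(\<lambda>t. cmod (p t)) integrable_on {a..x}" and nr: "(\<lambda>t. cmod (r t)) integrable_on {a..x}"
        using prim_onD(1)[OF f ax] prim_onD(1)[OF p ax] unfolding r_def
        by (simp_all add: absolutely_integrable_on_def)
      have "cmod (f x) \<le> cmod (f a) + integral {a..x} (\<lambda>t. cmod (p t))"
        using prim_on_norm_diff_le[OF f ax] norm_triangle_sub[of "f x" "f a"] by linarith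
      then have "k * cmod (f x) \<le> k * (cmod (f a) + integral {a..x} (\<lambda>t. cmod (p t)))"
        using k by (intro mult_left_mono) auto
      moreover have "cmod (p x) \<le> cmod (p a) + integral {a..x} (\<lambda>t. cmod (r t))"
        using prim_on_norm_diff_le[OF p ax] norm_triangle_sub[of "p x" "p a"] unfolding r_def by linarith
      ultimately have "V x \<le> V a + (k * integral {a..x} (\<lambda>t. cmod (p t)) + integral {a..x} (\<lambda>t. cmod (r t)))"
        unfolding V_def by (simp add: algebra_simps)
      also have "k * integral {a..x} (\<lambda>t. cmod (p t)) + integral {a..x} (\<lambda>t. cmod (r t)) = integral {a..x} (\<lambda>t. k * cmod (p t) + cmod (r t))"
        using np nr by (subst Henstock_Kurzweil_Integration.integral_add) (auto intro: integrable_on_mult_right)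
      also have "\<dots> \<le> integral {a..x} (\<lambda>t. \<kappa> t * V t)"
      proof (rule integral_le)
        show "(\<lambda>t. k * cmod (p t) + cmod (r t)) integrable_on {a..x}"
          by (intro integrable_add integrable_on_mult_right np nr)
        show "(\<lambda>t. \<kappa> t * V t) integrable_on {a..x}" by (rule integrable_on_subinterval[OF \<kappa>V]) (use x in auto)
        show "k * cmod (p t) + cmod (r t) \<le> \<kappa> t * V t" for t
        proof -
          have "cmod (r t) \<le> (\<bar>q t\<bar> + cmod z) * cmod (f t)"
            unfolding r_def norm_mult using norm_triangle_ineq4[of "complex_of_real (q t)" z] by (intro mult_right_mono) auto
          also have "\<dots> \<le> (k * \<bar>q t\<bar> + k * k) * cmod (f t)"
            using k mult_right_mono[of 1 k "\<bar>q t\<bar>"] by (intro mult_right_mono add_mono) auto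
          finally have "k * cmod (p t) + cmod (r t) \<le> k * cmod (p t) + (k * \<bar>q t\<bar> + k * k) * cmod (f t) + \<bar>q t\<bar> * cmod (p t)"
            by (simp add: add_increasing2)
          also have "\<dots> = \<kappa> t * V t" by (simp add: \<kappa>_def V_def algebra_simps)
          finally show ?thesis .
        qed
      qed
      finally show ?thesis by simp
    qed
  qed (use k in \<open>auto simp: V_def \<kappa>_def\<close>)
  moreover have "integral {a..b} \<kappa> = k * (b - a) + integral {a..b} (\<lambda>t. \<bar>q t\<bar>)"
    unfolding \<kappa>_def using ab set_lebesgue_integral_eq_integral(1)[OF aq] by (subst Henstock_Kurzweil_Integration.integral_add) auto
  ultimately show ?thesis unfolding V_def by simp
qed

text \<open>\<open>s_si\<close> is the form in which the limit-circle case at 0 is used. The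
  solutions are set to 0 at nonpositive arguments so that integrals may start at 0.\<close>

locale entrance = half_line +
  fixes s1 p1 s2 p2 :: "real \<Rightarrow> real"
  assumes S: "prim_on {0<..} s1 p1" "prim_on {0<..} p1 (\<lambda>x. q x * s1 x)"
    "prim_on {0<..} s2 p2" "prim_on {0<..} p2 (\<lambda>x. q x * s2 x)"
    and Wr: "\<And>x. 0 < x \<Longrightarrow> s1 x * p2 x - p1 x * s2 x = 1"
    and s_zero: "\<And>x. x \<le> 0 \<Longrightarrow> s1 x = 0 \<and> s2 x = 0"
    and s_si: "\<And>b. square_integrable (\<lambda>x. if x \<in> {0..b} then complex_of_real (s1 x) else 0)"
      "\<And>b. square_integrable (\<lambda>x. if x \<in> {0..b} then complex_of_real (s2 x) else 0)"
begin

definition \<sigma> where "\<sigma> x = sqrt ((s1 x)\<^sup>2 + (s2 x)\<^sup>2)"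

lemma \<sigma>: "0 \<le> \<sigma> x" "\<sigma> x * \<sigma> x = (s1 x)\<^sup>2 + (s2 x)\<^sup>2" "\<bar>s1 x\<bar> \<le> \<sigma> x" "\<bar>s2 x\<bar> \<le> \<sigma> x"
  unfolding \<sigma>_def by (simp_all add: real_le_rsqrt)

text \<open>Lagrange's identity for the vectors \<open>(s1, s2)\<close> at \<open>x\<close> and
  \<open>t\<close>. It admits \<open>\<sigma>\<close> as weight and
  \<open>\<sigma> * \<sigma>\<close>, integrable up to 0, as majorant in the Volterra
  scheme.\<close>

lemma cross_le: "\<bar>s1 x * s2 t - s2 x * s1 t\<bar> \<le> \<sigma> x * \<sigma> t"
proof -
  have "(\<sigma> x * \<sigma> t)\<^sup>2 = (\<sigma> x * \<sigma> x) * (\<sigma> t * \<sigma> t)" by (simp add: power2_eq_square)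
  also have "\<dots> = (s1 x * s2 t - s2 x * s1 t)\<^sup>2 + (s1 x * s1 t + s2 x * s2 t)\<^sup>2"
    unfolding \<sigma>(2) by (simp add: power2_eq_square algebra_simps)
  finally have "(s1 x * s2 t - s2 x * s1 t)\<^sup>2 \<le> (\<sigma> x * \<sigma> t)\<^sup>2" by simp
  then have "\<bar>s1 x * s2 t - s2 x * s1 t\<bar> \<le> \<bar>\<sigma> x * \<sigma> t\<bar>" by (simp only: abs_le_square_iff)
  then show ?thesis using \<sigma>(1)[of x] \<sigma>(1)[of t] by (simp add: abs_mult)
qed

lemma s_restrict_meas: "(\<lambda>x. complex_of_real (s1 x)) \<in> borel_measurable (lebesgue_on {0..b})"
  "(\<lambda>x. complex_of_real (s2 x)) \<in> borel_measurable (lebesgue_on {0..b})"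
  using square_integrable_measurable[OF s_si(1)[of b]] square_integrable_measurable[OF s_si(2)[of b]]
  by (simp_all add: borel_measurable_if[symmetric] del: atLeastAtMost_iff)

lemma s_sq_int: "(\<lambda>x. (s1 x)\<^sup>2) absolutely_integrable_on {0..b}" "(\<lambda>x. (s2 x)\<^sup>2) absolutely_integrable_on {0..b}"
proof -
  have eq: "(cmod (if x \<in> {0..b} then complex_of_real (s x) else 0))\<^sup>2 = indicator {0..b} x *\<^sub>R (s x)\<^sup>2" for s :: "real \<Rightarrow> real" and x
    by (simp add: indicator_def)
  show "(\<lambda>x. (s1 x)\<^sup>2) absolutely_integrable_on {0..b}" "(\<lambda>x. (s2 x)\<^sup>2) absolutely_integrable_on {0..b}"
    using square_integrable_integrable[OF s_si(1)[of b]] square_integrable_integrable[OF s_si(2)[of b]]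
    unfolding eq set_integrable_def .
qed

lemma \<sigma>_int: "(\<lambda>x. \<sigma> x * \<sigma> x) absolutely_integrable_on {0..b}"
  unfolding \<sigma>(2) by (rule set_integral_add(1)[OF s_sq_int])

end

text \<open>\<open>\<gamma>1\<close> and \<open>\<gamma>2\<close> prescribe the Wronskians of the
  solution with \<open>s1\<close> and \<open>s2\<close> at the endpoint 0. At a point
  \<open>x\<close> these Wronskians are \<open>\<gamma>1 + z * I1 z x\<close> and
  \<open>\<gamma>2 + z * I2 z x\<close>.\<close>

locale entrance_solution = entrance +
  fixes \<gamma>1 \<gamma>2 :: complex
begin

definition c1 where "c1 x = complex_of_real (s1 x)" for x
definition c2 where "c2 x = complex_of_real (s2 x)" for x

lemma volt: "volterra {0..} 0 c1 (\<lambda>x. - c2 x) c2 c1 (\<lambda>x. \<gamma>2 * c1 x - \<gamma>1 * c2 x) \<sigma> (\<lambda>x. \<sigma> x * \<sigma> x) (cmod \<gamma>1 + cmod \<gamma>2)"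
proof
  show m: "c1 \<in> borel_measurable (lebesgue_on {0..x})" "c2 \<in> borel_measurable (lebesgue_on {0..x})" for x
    using s_restrict_meas unfolding c1_def[abs_def] c2_def[abs_def] by blast+
  show "(\<lambda>x. - c2 x) \<in> borel_measurable (lebesgue_on {0..x})" for x
    by (intro borel_measurable_uminus m)
  show "(\<lambda>x. \<gamma>2 * c1 x - \<gamma>1 * c2 x) \<in> borel_measurable (lebesgue_on {0..x})" for x
    by (intro borel_measurable_diff borel_measurable_times borel_measurable_const m)
  show "cmod (c1 x * c2 t + - c2 x * c1 t) * \<sigma> t \<le> \<sigma> x * (\<sigma> t * \<sigma> t)" for x t
  proof -
    have "c1 x * c2 t + - c2 x * c1 t = complex_of_real (s1 x * s2 t - s2 x * s1 t)" by (simp add: c1_def c2_def)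
    then have "cmod (c1 x * c2 t + - c2 x * c1 t) \<le> \<sigma> x * \<sigma> t" using cross_le[of x t] by (simp only: norm_of_real)
    then have "cmod (c1 x * c2 t + - c2 x * c1 t) * \<sigma> t \<le> (\<sigma> x * \<sigma> t) * \<sigma> t" by (rule mult_right_mono) (rule \<sigma>)
    then show ?thesis by (simp only: mult.assoc)
  qed
  show "cmod (c2 t) * \<sigma> t \<le> \<sigma> t * \<sigma> t" "cmod (c1 t) * \<sigma> t \<le> \<sigma> t * \<sigma> t" for t
    using \<sigma>(1,3,4)[of t] by (auto simp: c1_def c2_def intro!: mult_right_mono)
  show "cmod (\<gamma>2 * c1 x - \<gamma>1 * c2 x) \<le> (cmod \<gamma>1 + cmod \<gamma>2) * \<sigma> x" for x
  proof -
    have "cmod (\<gamma>2 * c1 x - \<gamma>1 * c2 x) \<le> cmod \<gamma>2 * \<bar>s1 x\<bar> + cmod \<gamma>1 * \<bar>s2 x\<bar>"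
      using norm_triangle_ineq4[of "\<gamma>2 * c1 x" "\<gamma>1 * c2 x"] by (simp add: norm_mult c1_def c2_def)
    also have "\<dots> \<le> cmod \<gamma>2 * \<sigma> x + cmod \<gamma>1 * \<sigma> x" using \<sigma>[of x] by (intro add_mono mult_left_mono) auto
    finally show ?thesis by (simp add: algebra_simps)
  qed
qed (use \<sigma> \<sigma>_int in \<open>auto simp: is_interval_ci\<close>)

sublocale V: volterra "{0..}" 0 c1 "\<lambda>x. - c2 x" c2 c1 "\<lambda>x. \<gamma>2 * c1 x - \<gamma>1 * c2 x" \<sigma> "\<lambda>x. \<sigma> x * \<sigma> x" "cmod \<gamma>1 + cmod \<gamma>2"
  by (rule volt)

abbreviation "Psi \<equiv> V.vsol"

definition I1 where "I1 z x = integral {0..x} (\<lambda>t. c1 t * Psi z t)" for z x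
definition I2 where "I2 z x = integral {0..x} (\<lambda>t. c2 t * Psi z t)" for z x

lemma Psi_eq: "0 \<le> x \<Longrightarrow> Psi z x = (\<gamma>2 + z * I2 z x) * c1 x - (\<gamma>1 + z * I1 z x) * c2 x"
  using V.vsol_equation[of x z] unfolding V.op_def I1_def I2_def by (simp add: algebra_simps)

lemma prim_I: "prim_on {0..} (I1 z) (\<lambda>t. c1 t * Psi z t)" "prim_on {0..} (I2 z) (\<lambda>t. c2 t * Psi z t)"
  unfolding I1_def[abs_def] I2_def[abs_def]
  by (rule prim_on_integral; use V.vsol_b_integrable in auto)+

lemma I_bound:
  assumes x: "0 \<le> x"
  shows "cmod (I1 z x) \<le> (cmod \<gamma>1 + cmod \<gamma>2) * V.K x * exp (cmod z * V.K x)"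
    "cmod (I2 z x) \<le> (cmod \<gamma>1 + cmod \<gamma>2) * V.K x * exp (cmod z * V.K x)"
proof -
  define M where "M = (cmod \<gamma>1 + cmod \<gamma>2) * exp (cmod z * V.K x)"
  have M: "M \<ge> 0" by (simp add: M_def)
  have le: "cmod (b t * Psi z t) \<le> (\<sigma> t * \<sigma> t) * M" if t: "t \<in> {0..x}" "cmod (b t) \<le> \<sigma> t" for t and b :: "real \<Rightarrow> complex"
  proof -
    have "V.K t \<le> V.K x" using V.K_mono[of t x] t by auto
    then have "exp (cmod z * V.K t) \<le> exp (cmod z * V.K x)" by (simp add: mult_left_mono)
    then have "(cmod \<gamma>1 + cmod \<gamma>2) * \<sigma> t * exp (cmod z * V.K t) \<le> (cmod \<gamma>1 + cmod \<gamma>2) * \<sigma> t * exp (cmod z * V.K x)"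
      using \<sigma>(1)[of t] by (intro mult_left_mono) auto
    then have "cmod (Psi z t) \<le> \<sigma> t * M" using V.vsol_bound[of t z] t by (simp add: M_def algebra_simps)
    then have "cmod (b t) * cmod (Psi z t) \<le> \<sigma> t * (\<sigma> t * M)" using t \<sigma>(1)[of t] M by (intro mult_mono) auto
    then show ?thesis by (simp only: norm_mult mult.assoc)
  qed
  have int: "((\<lambda>t. (\<sigma> t * \<sigma> t) * M) has_integral V.K x * M) {0..x}"
    unfolding V.K_def by (intro has_integral_mult_left integrable_integral set_lebesgue_integral_eq_integral(1) \<sigma>_int)
  have bd: "cmod (integral {0..x} (\<lambda>t. b t * Psi z t)) \<le> V.K x * M"
    if "(\<lambda>t. b t * Psi z t) absolutely_integrable_on {0..x}" "\<And>t. cmod (b t) \<le> \<sigma> t" for b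
  proof -
    have "norm (integral {0..x} (\<lambda>t. b t * Psi z t)) \<le> integral {0..x} (\<lambda>t. (\<sigma> t * \<sigma> t) * M)"
      by (rule integral_norm_bound_integral[OF set_lebesgue_integral_eq_integral(1)[OF that(1)] has_integral_integrable[OF int]])
         (use le that(2) in auto)
    then show ?thesis unfolding integral_unique[OF int] .
  qed
  have "cmod (c1 t) \<le> \<sigma> t" "cmod (c2 t) \<le> \<sigma> t" for t using \<sigma>[of t] by (simp_all add: c1_def c2_def)
  then show "cmod (I1 z x) \<le> (cmod \<gamma>1 + cmod \<gamma>2) * V.K x * exp (cmod z * V.K x)"
    "cmod (I2 z x) \<le> (cmod \<gamma>1 + cmod \<gamma>2) * V.K x * exp (cmod z * V.K x)"
    using bd[of c1] bd[of c2] V.vsol_b_integrable[of x z] x unfolding I1_def I2_def M_def by (simp_all add: algebra_simps)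
qed

text \<open>The derivative of \<open>Psi z\<close>: in variation of constants the derivatives of the
  coefficients cancel, so only \<open>s1\<close> and \<open>s2\<close> are replaced by
  \<open>p1\<close> and \<open>p2\<close>.\<close>

definition Pp where "Pp z x = (\<gamma>2 + z * I2 z x) * complex_of_real (p1 x) - (\<gamma>1 + z * I1 z x) * complex_of_real (p2 x)" for z x

lemma Psi_prim: "prim_on {0<..} (Psi z) (Pp z)" "prim_on {0<..} (Pp z) (\<lambda>x. (complex_of_real (q x) - z) * Psi z x)"
proof -
  have C: "prim_on {0<..} c1 (\<lambda>x. complex_of_real (p1 x))" "prim_on {0<..} c2 (\<lambda>x. complex_of_real (p2 x))"
    "prim_on {0<..} (\<lambda>x. complex_of_real (p1 x)) (\<lambda>x. complex_of_real (q x) * c1 x)"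
    "prim_on {0<..} (\<lambda>x. complex_of_real (p2 x)) (\<lambda>x. complex_of_real (q x) * c2 x)"
    using prim_on_linear[OF bounded_linear_of_real S(1)] prim_on_linear[OF bounded_linear_of_real S(3)]
      prim_on_linear[OF bounded_linear_of_real S(2)] prim_on_linear[OF bounded_linear_of_real S(4)]
    unfolding c1_def[abs_def] c2_def[abs_def] by simp_all
  have J: "prim_on {0<..} (\<lambda>x. \<gamma>1 + z * I1 z x) (\<lambda>x. 0 + z * (c1 x * Psi z x))" "prim_on {0<..} (\<lambda>x. \<gamma>2 + z * I2 z x) (\<lambda>x. 0 + z * (c2 x * Psi z x))"
    by (intro prim_on_add prim_on_const prim_on_linear[OF bounded_linear_mult_right] prim_on_subset[OF prim_I(1)] prim_on_subset[OF prim_I(2)]; force)+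
  have "prim_on {0<..} (\<lambda>x. (\<gamma>2 + z * I2 z x) * c1 x - (\<gamma>1 + z * I1 z x) * c2 x)
    (\<lambda>x. ((0 + z * (c2 x * Psi z x)) * c1 x + (\<gamma>2 + z * I2 z x) * complex_of_real (p1 x)) -
      ((0 + z * (c1 x * Psi z x)) * c2 x + (\<gamma>1 + z * I1 z x) * complex_of_real (p2 x)))"
    by (intro prim_on_diff prim_on_mult J C is_interval_oi)
  then show "prim_on {0<..} (Psi z) (Pp z)"
    by (rule prim_on_cong_AE) (auto simp: is_interval_oi Pp_def Psi_eq algebra_simps)
  have "prim_on {0<..} (Pp z)
    (\<lambda>x. ((0 + z * (c2 x * Psi z x)) * complex_of_real (p1 x) + (\<gamma>2 + z * I2 z x) * (complex_of_real (q x) * c1 x)) -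
      ((0 + z * (c1 x * Psi z x)) * complex_of_real (p2 x) + (\<gamma>1 + z * I1 z x) * (complex_of_real (q x) * c2 x)))"
    unfolding Pp_def by (intro prim_on_diff prim_on_mult J C is_interval_oi)
  then show "prim_on {0<..} (Pp z) (\<lambda>x. (complex_of_real (q x) - z) * Psi z x)"
  proof (rule prim_on_cong_AE)
    show "AE x in lebesgue. x \<in> {0<..} \<longrightarrow> ((0 + z * (c2 x * Psi z x)) * complex_of_real (p1 x) + (\<gamma>2 + z * I2 z x) * (complex_of_real (q x) * c1 x)) -
      ((0 + z * (c1 x * Psi z x)) * complex_of_real (p2 x) + (\<gamma>1 + z * I1 z x) * (complex_of_real (q x) * c2 x)) = (complex_of_real (q x) - z) * Psi z x"
    proof (intro AE_I2 impI)
      fix x :: real assume "x \<in> {0<..}"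
      then have x: "0 < x" by simp
      have W: "c1 x * complex_of_real (p2 x) - complex_of_real (p1 x) * c2 x = 1"
        using arg_cong[OF Wr[OF x], of complex_of_real] by (simp add: c1_def c2_def)
      have "((0 + z * (c2 x * Psi z x)) * complex_of_real (p1 x) + (\<gamma>2 + z * I2 z x) * (complex_of_real (q x) * c1 x)) -
        ((0 + z * (c1 x * Psi z x)) * complex_of_real (p2 x) + (\<gamma>1 + z * I1 z x) * (complex_of_real (q x) * c2 x))
        = complex_of_real (q x) * ((\<gamma>2 + z * I2 z x) * c1 x - (\<gamma>1 + z * I1 z x) * c2 x) - z * Psi z x * (c1 x * complex_of_real (p2 x) - complex_of_real (p1 x) * c2 x)"
        by (simp add: algebra_simps)
      also have "\<dots> = (complex_of_real (q x) - z) * Psi z x"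
        unfolding W Psi_eq[OF less_imp_le[OF x], symmetric] by (simp add: algebra_simps)
      finally show "((0 + z * (c2 x * Psi z x)) * complex_of_real (p1 x) + (\<gamma>2 + z * I2 z x) * (complex_of_real (q x) * c1 x)) -
        ((0 + z * (c1 x * Psi z x)) * complex_of_real (p2 x) + (\<gamma>1 + z * I1 z x) * (complex_of_real (q x) * c2 x)) = (complex_of_real (q x) - z) * Psi z x" .
    qed
  qed (simp_all add: is_interval_oi)
qed

lemma I_series: "0 \<le> x \<Longrightarrow> (\<lambda>n. z ^ n * integral {0..x} (\<lambda>t. c1 t * V.vit n t)) sums I1 z x"
  "0 \<le> x \<Longrightarrow> (\<lambda>n. z ^ n * integral {0..x} (\<lambda>t. c2 t * V.vit n t)) sums I2 z x"
  unfolding I1_def I2_def using V.vsol_integral_sums[of x c1 z] V.vsol_integral_sums[of x c2 z] by auto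

lemma I_holomorphic:
  assumes "0 \<le> x"
  shows "(\<lambda>z. I1 z x) holomorphic_on UNIV" "(\<lambda>z. I2 z x) holomorphic_on UNIV"
proof -
  have *: "f holomorphic_on UNIV" if "\<And>z. (\<lambda>n. z ^ n * a n) sums f z" for f and a :: "nat \<Rightarrow> complex"
  proof -
    have "f holomorphic_on ball 0 r" for r
      by (rule power_series_holomorphic[of _ _ a]) (use that in \<open>simp add: mult.commute\<close>)
    then have "f field_differentiable at z" for z
      using holomorphic_on_imp_differentiable_at[of f "ball 0 (cmod z + 1)" z] by simp
    then show ?thesis unfolding holomorphic_on_def by (simp add: field_differentiable_at_within)
  qed
  show "(\<lambda>z. I1 z x) holomorphic_on UNIV" "(\<lambda>z. I2 z x) holomorphic_on UNIV"
    by (rule *[OF I_series(1)[OF assms]] *[OF I_series(2)[OF assms]])+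
qed

end

text \<open>\<open>k ^ 3 \<le> 27 * exp k\<close> comes from cubing
  \<open>k / 3 \<le> exp (k / 3)\<close>. Completing the square then trades
  \<open>k * (L + 1)\<close> for \<open>\<epsilon> * (k * k)\<close>, which is affine in
  \<open>r\<close>.\<close>

lemma sqrt_exp_bound:
  fixes \<epsilon> L r :: real
  assumes e: "\<epsilon> > 0" and L: "L \<ge> 0" and r: "r \<ge> 0"
  defines "k \<equiv> sqrt (1 + r)"
  shows "k ^ 3 * exp (k * L) \<le> 27 * exp (\<epsilon> + (L + 1)\<^sup>2 / (4 * \<epsilon>)) * exp (\<epsilon> * r)"
proof -
  have k: "k \<ge> 0" "k * k = 1 + r" using r by (simp_all add: k_def)
  have "(k / 3) ^ 3 \<le> exp (k / 3) ^ 3"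
    using k exp_ge_add_one_self[of "k / 3"] by (intro power_mono) linarith+
  then have "k ^ 3 \<le> 27 * exp k" by (simp add: power_divide exp_of_nat_mult[symmetric] divide_le_eq)
  then have "k ^ 3 * exp (k * L) \<le> 27 * exp k * exp (k * L)" by (rule mult_right_mono) simp
  also have "\<dots> = 27 * exp (k * (L + 1))" by (simp add: exp_add[symmetric] algebra_simps)
  also have "k * (L + 1) \<le> \<epsilon> * (k * k) + (L + 1)\<^sup>2 / (4 * \<epsilon>)"
  proof -
    have "0 \<le> \<epsilon> * (k - (L + 1) / (2 * \<epsilon>))\<^sup>2" using e by simp
    also have "\<dots> = \<epsilon> * (k * k) + (L + 1)\<^sup>2 / (4 * \<epsilon>) - k * (L + 1)"
      using e by (simp add: power2_eq_square field_simps)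
    finally show ?thesis by simp
  qed
  finally have "k ^ 3 * exp (k * L) \<le> 27 * exp (\<epsilon> * (k * k) + (L + 1)\<^sup>2 / (4 * \<epsilon>))" by simp
  also have "exp (\<epsilon> * (k * k) + (L + 1)\<^sup>2 / (4 * \<epsilon>)) = exp (\<epsilon> + (L + 1)\<^sup>2 / (4 * \<epsilon>)) * exp (\<epsilon> * r)"
    unfolding k exp_add[symmetric] by (simp add: algebra_simps)
  finally show ?thesis by simp
qed

context entrance_solution
begin

text \<open>Volterra bounds control the data at \<open>a\<close>, and the energy estimate carries
  them on. The cube is one factor \<open>k\<close> from the energy weight times
  \<open>k * k = 1 + cmod z\<close> from the Wronskians \<open>\<gamma>1 + z * I1 z a\<close> and
  \<open>\<gamma>2 + z * I2 z a\<close>.\<close>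

lemma Psi_growth:
  assumes a: "0 < a" "a \<le> x"
  obtains M where "M \<ge> 0" "\<And>z t. t \<in> {a..x} \<Longrightarrow>
    cmod (Psi z t) \<le> M * (sqrt (1 + cmod z)) ^ 3 * exp (sqrt (1 + cmod z) * (x - a)) * exp (cmod z * V.K a)"
proof -
  define G where "G = cmod \<gamma>1 + cmod \<gamma>2"
  define m where "m = 2 * \<sigma> a + (\<bar>p1 a\<bar> + \<bar>p2 a\<bar>)"
  define Q where "Q = integral {a..x} (\<lambda>t. \<bar>q t\<bar>)"
  have K: "0 \<le> V.K a" using V.K0[of a] a by simp
  have m0: "m \<ge> 0" "2 * \<sigma> a \<le> m" "\<bar>p1 a\<bar> + \<bar>p2 a\<bar> \<le> m" and G0: "G \<ge> 0" using \<sigma>(1)[of a] by (simp_all add: m_def G_def)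
  have aq: "(\<lambda>x. \<bar>q x\<bar>) absolutely_integrable_on {a..x}"
    using absolutely_integrable_norm[OF q_int[OF a(1), of x]] by (simp add: o_def)
  show thesis
  proof (rule that[of "2 * m * G * (1 + V.K a) * exp Q"])
    show "0 \<le> 2 * m * G * (1 + V.K a) * exp Q" using m0 G0 K by simp
    fix z t assume t: "t \<in> {a..x}"
    define k where "k = sqrt (1 + cmod z)"
    have k: "k \<ge> 1" "k * k = 1 + cmod z" by (simp_all add: k_def)
    define E where "E = exp (cmod z * V.K a)"
    have E: "E \<ge> 1" using K by (simp add: E_def)
    define N where "N = G * (1 + V.K a) * (k * k) * E"
    have N0: "N \<ge> 0" using G0 K k E by (simp add: N_def)
    have N: "cmod (g + z * I) \<le> N" if g: "cmod g \<le> G" and I: "cmod I \<le> G * V.K a * E" for g I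
    proof -
      have "cmod (g + z * I) \<le> G + cmod z * (G * V.K a * E)"
        using norm_triangle_ineq[of g "z * I"] mult_left_mono[OF I norm_ge_zero[of z]] g by (simp add: norm_mult)
      also have "\<dots> \<le> G * E + cmod z * (G * V.K a * E)" using E G0 by (simp add: mult_le_cancel_left1)
      also have "\<dots> \<le> G * E + cmod z * (G * V.K a * E) + (G * V.K a * E + G * cmod z * E)"
        using G0 K E by simp
      also have "\<dots> = N" unfolding N_def k by (simp add: algebra_simps)
      finally show ?thesis .
    qed
    have g: "cmod (\<gamma>1 + z * I1 z a) \<le> N" "cmod (\<gamma>2 + z * I2 z a) \<le> N"
      by (rule N; use I_bound[of a z] a in \<open>simp add: G_def E_def\<close>)+
    have cmb: "cmod ((\<gamma>2 + z * I2 z a) * complex_of_real u - (\<gamma>1 + z * I1 z a) * complex_of_real v) \<le> N * (\<bar>u\<bar> + \<bar>v\<bar>)" for u v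
    proof -
      have "cmod ((\<gamma>2 + z * I2 z a) * complex_of_real u - (\<gamma>1 + z * I1 z a) * complex_of_real v)
        \<le> cmod (\<gamma>2 + z * I2 z a) * \<bar>u\<bar> + cmod (\<gamma>1 + z * I1 z a) * \<bar>v\<bar>"
        using norm_triangle_ineq4[of "(\<gamma>2 + z * I2 z a) * complex_of_real u" "(\<gamma>1 + z * I1 z a) * complex_of_real v"] by (simp add: norm_mult)
      also have "\<dots> \<le> N * \<bar>u\<bar> + N * \<bar>v\<bar>" by (intro add_mono mult_right_mono g) auto
      finally show ?thesis by (simp add: algebra_simps)
    qed
    have "cmod (Psi z a) \<le> N * (\<bar>s1 a\<bar> + \<bar>s2 a\<bar>)" using cmb[of "s1 a" "s2 a"] Psi_eq[of a z] a by (simp add: c1_def c2_def)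
    also have "\<dots> \<le> N * m" using \<sigma>(3,4)[of a] m0(2) N0 by (intro mult_left_mono) auto
    finally have Pa: "cmod (Psi z a) \<le> N * m" .
    have "cmod (Pp z a) \<le> N * (\<bar>p1 a\<bar> + \<bar>p2 a\<bar>)" using cmb[of "p1 a" "p2 a"] by (simp add: Pp_def)
    also have "\<dots> \<le> N * m" using m0(3) N0 by (rule mult_left_mono)
    finally have Ppa: "cmod (Pp z a) \<le> N * m" .
    have "k * cmod (Psi z a) + cmod (Pp z a) \<le> k * (N * m) + N * m"
      using Pa Ppa k by (intro add_mono mult_left_mono) auto
    also have "\<dots> \<le> k * (N * m) + k * (N * m)" using mult_right_mono[OF k(1), of "N * m"] N0 m0(1) by (simp only: mult_1_left mult_nonneg_nonneg add_left_mono)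
    finally have D: "k * cmod (Psi z a) + cmod (Pp z a) \<le> 2 * k * N * m" by (simp add: mult_ac)
    have "integral {a..t} (\<lambda>t. \<bar>q t\<bar>) \<le> Q"
      unfolding Q_def using t by (intro integral_subset_le set_lebesgue_integral_eq_integral(1)[OF aq] integrable_on_subinterval[OF set_lebesgue_integral_eq_integral(1)[OF aq]]) auto
    moreover have "k * (t - a) \<le> k * (x - a)" using t k by (intro mult_left_mono) auto
    ultimately have ex: "exp (k * (t - a) + integral {a..t} (\<lambda>t. \<bar>q t\<bar>)) \<le> exp (k * (x - a) + Q)" by simp
    have "cmod (Psi z t) \<le> k * cmod (Psi z t) + cmod (Pp z t)" using k(1) by (simp add: add_increasing2 mult_le_cancel_right1)
    also have "\<dots> \<le> (k * cmod (Psi z a) + cmod (Pp z a)) * exp (k * (t - a) + integral {a..t} (\<lambda>t. \<bar>q t\<bar>))"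
      using energy_bound[OF Psi_prim a(1), of t z] t unfolding k_def by simp
    also have "\<dots> \<le> (2 * k * N * m) * exp (k * (x - a) + Q)"
      using D ex k N0 m0 by (intro mult_mono) auto
    also have "\<dots> = 2 * m * G * (1 + V.K a) * exp Q * k ^ 3 * exp (k * (x - a)) * E"
      unfolding N_def exp_add power3_eq_cube by (simp only: mult_ac)
    finally show "cmod (Psi z t) \<le> 2 * m * G * (1 + V.K a) * exp Q * (sqrt (1 + cmod z)) ^ 3 * exp (sqrt (1 + cmod z) * (x - a)) * exp (cmod z * V.K a)"
      unfolding k_def E_def .
  qed
qed

text \<open>Up to a small point \<open>a\<close> the Volterra series costs only \<open>exp (|z| K(a))\<close> with \<open>K(a) \<rightarrow> 0\<close>, and from \<open>a\<close>
  on, away from the singularity, the growth is of order \<open>1/2\<close> in \<open>z\<close>.\<close>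

lemma I_zero_type:
  assumes "0 \<le> x"
  shows "zero_type (\<lambda>z. I1 z x)" "zero_type (\<lambda>z. I2 z x)"
proof -
  have *: "zero_type (\<lambda>z. I z x)"
    if P: "\<And>z. prim_on {0..} (I z) (\<lambda>t. c t * Psi z t)" and bd: "\<And>y z. 0 \<le> y \<Longrightarrow> cmod (I z y) \<le> (cmod \<gamma>1 + cmod \<gamma>2) * V.K y * exp (cmod z * V.K y)"
      and c: "\<And>a b. 0 < a \<Longrightarrow> continuous_on {a..b} c" for I and c :: "real \<Rightarrow> complex"
    unfolding zero_type_def
  proof (intro allI impI)
    fix \<epsilon> :: real assume e: "\<epsilon> > 0"
    show "\<exists>C. \<forall>z. cmod (I z x) \<le> C * exp (\<epsilon> * cmod z)"
    proof (cases "x = 0")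
      case True
      then show ?thesis using bd[of 0] V.K_c by (intro exI[of _ 0]) simp
    next
      case False
      then have x: "0 < x" using assms by simp
      have "continuous_on {0..x} V.K" by (rule prim_on_continuous[OF V.prim_K]) auto
      then have "(V.K \<longlongrightarrow> V.K 0) (at 0 within {0..x})" unfolding continuous_on_def using x by auto
      then have "(V.K \<longlongrightarrow> 0) (at_right 0)" using x V.K_c by (simp add: at_within_Icc_at_right)
      then have "\<forall>\<^sub>F a in at_right 0. V.K a < \<epsilon> / 2" using e by (intro order_tendstoD) auto
      moreover have "\<forall>\<^sub>F a in at_right 0. a < x" unfolding eventually_at_right_field using x by auto
      moreover have "\<forall>\<^sub>F a::real in at_right 0. 0 < a" by (rule eventually_at_right_less)
      ultimately have "\<forall>\<^sub>F a in at_right 0. V.K a < \<epsilon> / 2 \<and> a < x \<and> 0 < a" by eventually_elim simp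
      then obtain a where a: "V.K a < \<epsilon> / 2" "a < x" "0 < a"
        using eventually_happens'[OF trivial_limit_at_right_real] by blast
      obtain M where M: "M \<ge> 0" "\<And>z t. t \<in> {a..x} \<Longrightarrow>
        cmod (Psi z t) \<le> M * (sqrt (1 + cmod z)) ^ 3 * exp (sqrt (1 + cmod z) * (x - a)) * exp (cmod z * V.K a)"
        using Psi_growth[of a x] a by auto
      have "compact (c ` {a..x})" using a by (intro compact_continuous_image c) auto
      then obtain W where W: "\<And>t. t \<in> {a..x} \<Longrightarrow> cmod (c t) \<le> W" "W > 0"
        using compact_imp_bounded[of "c ` {a..x}"] unfolding bounded_pos by (metis imageI)
      define A where "A = (cmod \<gamma>1 + cmod \<gamma>2) * V.K a"
      define R where "R = 27 * exp (\<epsilon> / 2 + (x - a + 1)\<^sup>2 / (4 * (\<epsilon> / 2)))"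
      have A: "A \<ge> 0" using V.K0[of a] a by (simp add: A_def)
      show ?thesis
      proof (intro exI[of _ "A + W * (M * R) * (x - a)"] allI)
        fix z
        define k where "k = sqrt (1 + cmod z)"
        \<comment> \<open>Half of \<open>\<epsilon>\<close> pays for
          \<open>exp (cmod z * V.K a)\<close>, the other half for the square-root growth.\<close>
        define h where "h = exp (\<epsilon> / 2 * cmod z)"
        have h: "h \<ge> 1" "h * h = exp (\<epsilon> * cmod z)" using e by (simp_all add: h_def exp_add[symmetric])
        have "cmod z * V.K a \<le> cmod z * (\<epsilon> / 2)" using a by (intro mult_left_mono) auto
        then have hK: "exp (cmod z * V.K a) \<le> h" by (simp add: h_def mult.commute)
        have "k ^ 3 * exp (k * (x - a)) \<le> R * h"
          using sqrt_exp_bound[of "\<epsilon> / 2" "x - a" "cmod z"] e a unfolding k_def R_def h_def by simp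
        then have "k ^ 3 * exp (k * (x - a)) * exp (cmod z * V.K a) \<le> R * h * h"
          by (rule mult_mono[OF _ hK]) (simp_all add: R_def h_def)
        then have kh: "M * (k ^ 3 * exp (k * (x - a)) * exp (cmod z * V.K a)) \<le> M * (R * (h * h))"
          using M by (intro mult_left_mono) (auto simp: mult.assoc)
        have P_le: "cmod (Psi z t) \<le> M * R * (h * h)" if "t \<in> {a..x}" for t
          using M(2)[OF that, of z] kh unfolding k_def[symmetric] by (simp add: mult.assoc)
        have "cmod (I z x - I z a) \<le> (W * (M * R * (h * h))) * measure lborel {a..x}"
        proof (rule has_integral_bound_real[where S = "{}"])
          show "((\<lambda>t. c t * Psi z t) has_integral I z x - I z a) {a..x}" using prim_onD(2)[OF P, of a x z] a by simp
          show "0 \<le> W * (M * R * (h * h))" using W M h by (simp add: R_def)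
          show "finite {}" by simp
          show "\<And>t. t \<in> {a..x} - {} \<Longrightarrow> cmod (c t * Psi z t) \<le> W * (M * R * (h * h))"
            unfolding norm_mult using W P_le by (intro mult_mono) auto
        qed
        then have 1: "cmod (I z x - I z a) \<le> W * (M * R * (h * h)) * (x - a)" using a by simp
        have "cmod (I z a) \<le> A * h" using bd[of a z] mult_left_mono[OF hK A] a by (simp add: A_def)
        also have "\<dots> \<le> A * (h * h)" using A h(1) by (intro mult_left_mono) (simp_all add: mult_le_cancel_right1)
        finally have "cmod (I z x) \<le> A * (h * h) + W * (M * R * (h * h)) * (x - a)"
          using 1 norm_triangle_sub[of "I z x" "I z a"] by simp
        then show "cmod (I z x) \<le> (A + W * (M * R) * (x - a)) * exp (\<epsilon> * cmod z)"
          unfolding h(2)[symmetric] by (simp add: algebra_simps)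
      qed
    qed
  qed
  have cc: "continuous_on {a..b} c1" "continuous_on {a..b} c2" if "0 < a" for a b
  proof -
    have sub: "{a..b} \<subseteq> {0<..}" using that by auto
    show "continuous_on {a..b} c1" "continuous_on {a..b} c2" unfolding c1_def[abs_def] c2_def[abs_def]
      by (intro continuous_on_of_real prim_on_continuous[OF S(1) sub] prim_on_continuous[OF S(3) sub])+
  qed
  show "zero_type (\<lambda>z. I1 z x)" by (rule *[OF prim_I(1) I_bound(1) cc(1)])
  show "zero_type (\<lambda>z. I2 z x)" by (rule *[OF prim_I(2) I_bound(2) cc(2)])
qed

end

section \<open>Pairing with cut-off solutions\<close>

lemma rep_scaleC: "AE x in lebesgue. rep_l2 (a *\<^sub>C u) x = a * rep_l2 u x"
  using rep_abs_l2[OF square_integrable_cmult[OF si_rep[of u], of a]] abs_l2_ops(1)[OF si_rep[of u], of a]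
  by (simp add: abs_rep_l2)

lemma set_integrable_of_AE:
  fixes f g :: "real \<Rightarrow> complex"
  assumes F: "integrable lebesgue f" and g: "AE x in lebesgue. f x = (if x \<in> {a..b} then g x else 0)"
  shows "g absolutely_integrable_on {a..b}"
proof -
  have eq: "AE x in lebesgue. f x = indicator {a..b} x *\<^sub>R g x" using g by eventually_elim auto
  have "(\<lambda>x. indicator {a..b} x *\<^sub>R g x) \<in> borel_measurable lebesgue"
    by (rule borel_measurable_AE[OF borel_measurable_integrable[OF F] eq])
  then show ?thesis unfolding set_integrable_def using integrable_cong_AE_imp[OF F _ ] eq by (metis (mono_tags, lifting) AE_mp AE_I2)
qed

definition ramp :: "real \<Rightarrow> complex" where "ramp x = complex_of_real (max 0 (min 1 (x - 1)))"

lemma ramp_simps: "x \<le> 1 \<Longrightarrow> ramp x = 0" "2 \<le> x \<Longrightarrow> ramp x = 1"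
  by (simp_all add: ramp_def max_def min_def)

lemma prim_ramp: "prim_on {0<..} ramp (\<lambda>x. if x \<in> {1..2} then 1 else 0)"
  unfolding prim_on_def
proof (intro ballI impI conjI)
  fix a b :: real assume ab: "a \<in> {0<..}" "b \<in> {0<..}" "a \<le> b"
  show "(\<lambda>x. if x \<in> {1..2} then 1 else 0 :: complex) absolutely_integrable_on {a..b}"
    by (rule square_integrable_local[OF square_integrable_continuous_compact[of 1 2]])
       (auto intro!: continuous_on_eq[OF continuous_on_const[of _ 1]])
  show "((\<lambda>x. if x \<in> {1..2} then 1 else 0) has_integral ramp b - ramp a) {a..b}"
  proof (rule fundamental_theorem_of_calculus_interior_strong[of "{1, 2}"])
    show "continuous_on {a..b} ramp" unfolding ramp_def[abs_def] by (intro continuous_intros)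
    fix x :: real assume x: "x \<in> {a<..<b} - {1, 2}"
    have d1: "((\<lambda>x. complex_of_real (x - 1)) has_vector_derivative 1) (at x)"
      using has_vector_derivative_of_real[of "\<lambda>x. x - 1" 1 "at x"] by (auto intro!: derivative_eq_intros)
    consider "x < 1" | "2 < x" | "1 < x" "x < 2" using x by fastforce
    then show "(ramp has_vector_derivative (if x \<in> {1..2} then 1 else 0)) (at x)"
    proof cases
      case 1
      then show ?thesis using ramp_simps
        by (auto intro!: has_vector_derivative_transform_within_open[OF has_vector_derivative_const[of 0], where S = "{..<1}"])
    next
      case 2
      then show ?thesis using ramp_simps
        by (auto intro!: has_vector_derivative_transform_within_open[OF has_vector_derivative_const[of 1], where S = "{2<..}"])
    next
      case 3
      then show ?thesis
        by (auto intro!: has_vector_derivative_transform_within_open[OF d1, where S = "{1<..<2}"] simp: ramp_def max_def min_def)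
    qed
  qed (use ab in auto)
qed

context entrance
begin

text \<open>A solution for \<open>z = 0\<close> need not be square-integrable at infinity. Cut off on \<open>[1, 2]\<close>, it belongs to
  the domain of the maximal operator, so the boundary maps can be applied to it.\<close>

lemma solution_cutoff:
  assumes P: "prim_on {0<..} s p" "prim_on {0<..} p (\<lambda>x. q x * s x)" and z: "\<And>x. x \<le> 0 \<Longrightarrow> s x = (0::real)"
    and si: "\<And>b. square_integrable (\<lambda>x. if x \<in> {0..b} then complex_of_real (s x) else 0)"
  obtains y y' h where "prim_on {0<..} y y'" "prim_on {0<..} y' (\<lambda>x. complex_of_real (q x) * y x - h x)"
    "square_integrable y" "square_integrable h" "\<And>x. x \<le> 1 \<Longrightarrow> y x = complex_of_real (s x)" "y' 1 = complex_of_real (p 1)"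
    "\<And>x. x < 1 \<Longrightarrow> h x = 0" "\<And>x. 2 < x \<Longrightarrow> h x = 0" "\<And>x. 2 \<le> x \<Longrightarrow> y x = 0" "y' 2 = 0"
proof -
  define I where "I x = (if x \<in> {1..2} then 1 else 0 :: complex)" for x :: real
  define f where "f x = complex_of_real (s x)" for x
  define g where "g x = complex_of_real (p x)" for x
  have C: "prim_on {0<..} f g" "prim_on {0<..} g (\<lambda>x. complex_of_real (q x) * f x)"
    using prim_on_linear[OF bounded_linear_of_real P(1)] prim_on_linear[OF bounded_linear_of_real P(2)]
    unfolding f_def[abs_def] g_def[abs_def] by simp_all
  define r where "r = ramp"
  have R: "prim_on {0<..} r I" using prim_ramp unfolding r_def I_def[abs_def] .
  \<comment> \<open>The cubic \<open>1 - 3 r^2 + 2 r^3\<close> falls from 1 to 0 with vanishing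
    derivative at both ends, so the product with a solution keeps an absolutely continuous
    derivative although \<open>r\<close> has corners.\<close>
  define \<omega> where "\<omega> x = 1 + r x * r x * (2 * r x - 3)" for x
  define \<delta> where "\<delta> x = 6 * (r x * r x - r x)" for x
  \<comment> \<open>\<open>r * r - r\<close> vanishes outside \<open>[1, 2]\<close>, so the
    indicator drops out and \<open>\<delta>\<close> is a polynomial in \<open>r\<close>, hence
    itself a primitive.\<close>
  have rI: "I x * (r x * r x - r x) = r x * r x - r x" for x
    using ramp_simps[of x] by (cases "x \<le> 1"; cases "2 \<le> x") (auto simp: I_def r_def)
  have "prim_on {0<..} \<omega> (\<lambda>x. 0 + ((I x * r x + r x * I x) * (2 * r x - 3) + (r x * r x) * (2 * I x - 0)))"
    unfolding \<omega>_def by (intro prim_on_add prim_on_diff prim_on_const prim_on_mult R is_interval_oi prim_on_linear[OF bounded_linear_mult_right])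
  moreover have "0 + ((I x * r x + r x * I x) * (2 * r x - 3) + (r x * r x) * (2 * I x - 0)) = \<delta> x" for x
  proof -
    have "0 + ((I x * r x + r x * I x) * (2 * r x - 3) + (r x * r x) * (2 * I x - 0)) = 6 * (I x * (r x * r x - r x))" by (simp add: algebra_simps)
    then show ?thesis unfolding rI \<delta>_def .
  qed
  ultimately have X: "prim_on {0<..} \<omega> \<delta>" by simp
  have D: "prim_on {0<..} \<delta> (\<lambda>x. 6 * ((I x * r x + r x * I x) - I x))"
    unfolding \<delta>_def by (intro prim_on_diff prim_on_mult R is_interval_oi prim_on_linear[OF bounded_linear_mult_right])
  define y where "y x = \<omega> x * f x" for x
  define y' where "y' x = \<delta> x * f x + \<omega> x * g x" for x
  define h where "h x = - (6 * ((I x * r x + r x * I x) - I x) * f x + 2 * \<delta> x * g x)" for x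
  have y1: "prim_on {0<..} y y'" unfolding y_def y'_def by (intro prim_on_mult X C is_interval_oi)
  have "prim_on {0<..} y' (\<lambda>x. (6 * ((I x * r x + r x * I x) - I x) * f x + \<delta> x * g x) + (\<delta> x * g x + \<omega> x * (complex_of_real (q x) * f x)))"
    unfolding y'_def by (intro prim_on_add prim_on_mult X D C is_interval_oi)
  moreover have "(6 * ((I x * r x + r x * I x) - I x) * f x + \<delta> x * g x) + (\<delta> x * g x + \<omega> x * (complex_of_real (q x) * f x)) = complex_of_real (q x) * y x - h x" for x
    by (simp add: y_def h_def algebra_simps)
  ultimately have y2: "prim_on {0<..} y' (\<lambda>x. complex_of_real (q x) * y x - h x)" by simp
  have r1: "r x = 0" if "x \<le> 1" for x using ramp_simps(1)[OF that] by (simp add: r_def)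
  have r2: "r x = 1" if "2 \<le> x" for x using ramp_simps(2)[OF that] by (simp add: r_def)
  have v: "\<And>x. x \<le> 1 \<Longrightarrow> y x = complex_of_real (s x)" "y' 1 = complex_of_real (p 1)"
    "\<And>x. x < 1 \<Longrightarrow> h x = 0" "\<And>x. 2 < x \<Longrightarrow> h x = 0" "\<And>x. 2 \<le> x \<Longrightarrow> y x = 0" "y' 2 = 0"
    by (simp_all add: y_def y'_def h_def \<omega>_def \<delta>_def r1 r2 f_def g_def I_def)
  have cont: "continuous_on {1..2} r" "continuous_on {1..2} f" "continuous_on {1..2} g"
    by (rule prim_on_continuous[OF R] prim_on_continuous[OF C(1)] prim_on_continuous[OF C(2)]; force)+
  have hs: "square_integrable h"
  proof (rule square_integrable_continuous_compact[of 1 2])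
    have "continuous_on {1..2} (\<lambda>x. - (6 * (2 * r x - 1) * f x + 2 * \<delta> x * g x))"
      unfolding \<delta>_def by (intro continuous_intros cont)
    then show "continuous_on {1..2} h"
      by (rule continuous_on_eq) (simp add: h_def I_def)
    show "h x = 0" if "x \<notin> {1..2}" for x using that v(3)[of x] v(4)[of x] by (cases "x < 1") auto
  qed
  have "square_integrable (\<lambda>x. if x \<in> {1..2} then y x else 0)"
  proof (rule square_integrable_continuous_compact[of 1 2])
    have "continuous_on {1..2} y" unfolding y_def \<omega>_def by (intro continuous_intros cont)
    then show "continuous_on {1..2} (\<lambda>x. if x \<in> {1..2} then y x else 0)" by (rule continuous_on_eq) simp
  qed auto
  then have "square_integrable (\<lambda>x. (if x \<in> {0..1} then complex_of_real (s x) else 0) + (if x \<in> {1..2} then y x else 0))"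
    by (rule square_integrable_add[OF si])
  then have ys: "square_integrable y"
  proof (rule square_integrable_cong_AE)
    show "AE x in lebesgue. (if x \<in> {0..1} then complex_of_real (s x) else 0) + (if x \<in> {1..2} then y x else 0) = y x"
      using AE_not_eq_lebesgue[of 1]
    proof eventually_elim
      case (elim x)
      consider "x \<le> 0" | "0 < x" "x < 1" | "1 < x" "x \<le> 2" | "2 < x" using elim by linarith
      then show ?case using v(1,5)[of x] z[of x] by cases (cases "x = 0"; auto)+
    qed
  qed
  show ?thesis by (rule that[OF y1 y2 ys hs]) (fact v)+
qed

lemma pair_MP:
  assumes "prim_on {0<..} y y'" "prim_on {0<..} y' (\<lambda>x. complex_of_real (q x) * y x - h x)"
    and si: "square_integrable y" "square_integrable h" and z: "\<And>x. x \<le> 0 \<Longrightarrow> y x = 0" "\<And>x. x \<le> 0 \<Longrightarrow> h x = 0"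
  shows "(abs_l2 y, abs_l2 h) \<in> MP"
proof -
  note r = rep_abs_l2[OF si(1)] rep_abs_l2[OF si(2)]
  have "abs_l2 y \<in> l2_pos" by (rule l2_posI) (use r(1) in eventually_elim, simp add: z)
  moreover have "abs_l2 h \<in> l2_pos" by (rule l2_posI) (use r(2) in eventually_elim, simp add: z)
  moreover have "hl (abs_l2 y) (abs_l2 h)"
    by (rule hlI[OF assms(1,2)]) (use r(1) in eventually_elim, simp, use r(2) in eventually_elim, simp)
  ultimately show ?thesis by (simp add: MP_def)
qed

lemma solution_pairing:
  assumes u: "AE x in lebesgue. rep_l2 u x = F x" and F0: "\<And>x. x \<le> 0 \<Longrightarrow> F x = 0"
    and si: "square_integrable (\<lambda>x. if x \<in> {0..b} then complex_of_real (s x) else 0)"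
  shows "(\<lambda>x. complex_of_real (s x) * F x) absolutely_integrable_on {0..b}"
    "cinner u (abs_l2 (\<lambda>x. if x \<in> {0..b} then complex_of_real (s x) else 0)) = integral {0..b} (\<lambda>x. complex_of_real (s x) * F x)"
proof -
  define S where "S x = (if x \<in> {0..b} then complex_of_real (s x) else 0)" for x
  have S: "square_integrable S" using si unfolding S_def[abs_def] .
  have i: "integrable lebesgue (\<lambda>x. rep_l2 u x * cnj (S x))" by (rule integrable_mult_cnj[OF si_rep S])
  have eq: "AE x in lebesgue. rep_l2 u x * cnj (S x) = (if x \<in> {0..b} then complex_of_real (s x) * F x else 0)"
    using u by eventually_elim (simp add: S_def)
  show I: "(\<lambda>x. complex_of_real (s x) * F x) absolutely_integrable_on {0..b}" by (rule set_integrable_of_AE[OF i eq])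
  have "cinner u (abs_l2 S) = (\<integral>x. rep_l2 u x * cnj (S x) \<partial>lebesgue)"
    using abs_l2_ops(6)[OF si_rep[of u] S] by (simp add: abs_rep_l2)
  also have "\<dots> = integral {0..b} (\<lambda>x. complex_of_real (s x) * F x)" by (rule set_lebesgue_eq_integral_of_AE[OF i eq I])
  finally show "cinner u (abs_l2 (\<lambda>x. if x \<in> {0..b} then complex_of_real (s x) else 0)) = integral {0..b} (\<lambda>x. complex_of_real (s x) * F x)"
    unfolding S_def[abs_def] .
qed

text \<open>Below 1 the cut-off is not felt: \<open>y = s\<close> and \<open>h = 0\<close>. On
  \<open>[1, 2]\<close> Lagrange's identity leaves only the Wronskian at 1, because \<open>y\<close>
  and \<open>y'\<close> vanish at 2. Together this is minus the limit at 0 of the Wronskian of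
  \<open>f\<close> with \<open>s\<close>.\<close>

lemma cutoff_pairing:
  assumes f: "prim_on {0<..} f p" "prim_on {0<..} p (\<lambda>x. complex_of_real (q x) * f x - z * f x)"
    and u: "AE x in lebesgue. rep_l2 u x = F x" and F: "\<And>x. x \<le> 0 \<Longrightarrow> F x = 0" "\<And>x. 0 < x \<Longrightarrow> F x = f x"
    and sz: "\<And>x. x \<le> 0 \<Longrightarrow> s x = 0"
    and y: "prim_on {0<..} y y'" "prim_on {0<..} y' (\<lambda>x. complex_of_real (q x) * y x - h x)"
    "square_integrable y" "square_integrable h" "\<And>x. x \<le> 1 \<Longrightarrow> y x = complex_of_real (s x)" "y' 1 = complex_of_real d"
    "\<And>x. x < 1 \<Longrightarrow> h x = 0" "\<And>x. 2 < x \<Longrightarrow> h x = 0" "\<And>x. 2 \<le> x \<Longrightarrow> y x = 0" "y' 2 = 0"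
  shows "cinner (z *\<^sub>C u) (abs_l2 y) - cinner u (abs_l2 h) =
    z * integral {0..1} (\<lambda>x. complex_of_real (s x) * F x) - (f 1 * complex_of_real d - p 1 * complex_of_real (s 1))"
proof -
  define G where "G x = z * F x * cnj (y x) - F x * cnj (h x)" for x
  define N where "N x = z * rep_l2 u x * cnj (y x) - rep_l2 u x * cnj (h x)" for x
  have i: "integrable lebesgue (\<lambda>x. z * rep_l2 u x * cnj (y x))" "integrable lebesgue (\<lambda>x. rep_l2 u x * cnj (h x))"
    by (rule integrable_mult_cnj[OF square_integrable_cmult[OF si_rep] y(3)] integrable_mult_cnj[OF si_rep y(4)])+
  then have N: "integrable lebesgue N" unfolding N_def[abs_def] by (rule Bochner_Integration.integrable_diff)
  have eq: "AE x in lebesgue. N x = (if x \<in> {0..2} then G x else 0)"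
    using u
  proof eventually_elim
    case (elim x)
    consider "x < 0" | "x \<in> {0..2}" | "2 < x" by fastforce
    then show ?case using elim F(1)[of x] y(8,9)[of x] by cases (auto simp: N_def G_def)
  qed
  have Gi: "G absolutely_integrable_on {0..2}" by (rule set_integrable_of_AE[OF N eq])
  have "cinner (z *\<^sub>C u) (abs_l2 y) = (\<integral>x. z * rep_l2 u x * cnj (y x) \<partial>lebesgue)"
    using abs_l2_ops(6)[OF square_integrable_cmult[OF si_rep[of u], of z] y(3)] abs_l2_ops(1)[OF si_rep[of u], of z]
    by (simp add: abs_rep_l2)
  moreover have "cinner u (abs_l2 h) = (\<integral>x. rep_l2 u x * cnj (h x) \<partial>lebesgue)"
    using abs_l2_ops(6)[OF si_rep[of u] y(4)] by (simp add: abs_rep_l2)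
  ultimately have "cinner (z *\<^sub>C u) (abs_l2 y) - cinner u (abs_l2 h) = (\<integral>x. N x \<partial>lebesgue)"
    unfolding N_def using Bochner_Integration.integral_diff[OF i] by simp
  also have "\<dots> = integral {0..2} G" by (rule set_lebesgue_eq_integral_of_AE[OF N eq Gi])
  also have "\<dots> = integral {0..1} G + integral {1..2} G"
    using Henstock_Kurzweil_Integration.integral_combine[of 0 1 2 G] set_lebesgue_integral_eq_integral(1)[OF Gi] by simp
  also have "integral {0..1} G = integral {0..1} (\<lambda>x. z * (complex_of_real (s x) * F x))"
  \<comment> \<open>\<open>h\<close> is known to vanish only strictly below 1.\<close>
  proof (rule integral_spike[of "{1}"])
    show "z * (complex_of_real (s x) * F x) = G x" if "x \<in> {0..1} - {1}" for x
      using that y(5,7)[of x] by (simp add: G_def)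
  qed simp
  also have "\<dots> = z * integral {0..1} (\<lambda>x. complex_of_real (s x) * F x)" by simp
  also have "integral {1..2} G = integral {1..2} (\<lambda>x. z * f x * cnj (y x) - f x * cnj (h x))"
    by (rule Henstock_Kurzweil_Integration.integral_cong) (simp add: G_def F)
  also have "\<dots> = (f 2 * cnj (y' 2) - p 2 * cnj (y 2)) - (f 1 * cnj (y' 1) - p 1 * cnj (y 1))"
    by (rule prim_onD(3)[OF green_prim[OF f y(1,2)]]) auto
  finally show ?thesis using y(5)[of 1] y(6,9,10) y(9)[of 2] by simp
qed

end

context entrance_solution
begin

text \<open>\<open>V.volterra_unique\<close> needs an a priori bound by a multiple of
  \<open>\<sigma>\<close>. The equation provides it: the integrals in it are continuous, so
  \<open>d\<close> is a combination of \<open>c1\<close> and \<open>c2\<close> with bounded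
  coefficients.\<close>

lemma Psi_unique:
  assumes int: "\<And>x. 0 \<le> x \<Longrightarrow> (\<lambda>t. c1 t * f t) absolutely_integrable_on {0..x}" "\<And>x. 0 \<le> x \<Longrightarrow> (\<lambda>t. c2 t * f t) absolutely_integrable_on {0..x}"
    and eq: "\<And>x. 0 \<le> x \<Longrightarrow> f x = (\<gamma>2 + z * integral {0..x} (\<lambda>t. c2 t * f t)) * c1 x - (\<gamma>1 + z * integral {0..x} (\<lambda>t. c1 t * f t)) * c2 x"
    and x: "0 \<le> x"
  shows "f x = Psi z x"
proof -
  define d where "d x = f x - Psi z x" for x
  have di: "(\<lambda>t. c1 t * d t) absolutely_integrable_on {0..y}" "(\<lambda>t. c2 t * d t) absolutely_integrable_on {0..y}" if y: "0 \<le> y" for y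
    using set_integral_diff(1)[OF int(1)[OF y] V.vsol_b_integrable(2)[of y z]] set_integral_diff(1)[OF int(2)[OF y] V.vsol_b_integrable(1)[of y z]] y
    unfolding d_def by (simp_all add: algebra_simps)
  have ii: "integral {0..y} (\<lambda>t. c1 t * d t) = integral {0..y} (\<lambda>t. c1 t * f t) - I1 z y"
    "integral {0..y} (\<lambda>t. c2 t * d t) = integral {0..y} (\<lambda>t. c2 t * f t) - I2 z y" if y: "0 \<le> y" for y
    unfolding I1_def I2_def d_def using y V.vsol_b_integrable[of y z] int[OF y]
    by (simp_all add: right_diff_distrib Henstock_Kurzweil_Integration.integral_diff set_lebesgue_integral_eq_integral(1))
  have op: "d y = z * V.op d y" if y: "0 \<le> y" for y
    unfolding V.op_def ii[OF y] unfolding d_def eq[OF y] Psi_eq[OF y] by (simp add: algebra_simps)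
  define D1 where "D1 y = integral {0..y} (\<lambda>t. c1 t * d t)" for y
  define D2 where "D2 y = integral {0..y} (\<lambda>t. c2 t * d t)" for y
  have D: "prim_on {0..} D1 (\<lambda>t. c1 t * d t)" "prim_on {0..} D2 (\<lambda>t. c2 t * d t)"
    unfolding D1_def[abs_def] D2_def[abs_def] by (rule prim_on_integral; use di in auto)+
  have "compact (D1 ` {0..x})" "compact (D2 ` {0..x})"
    by (intro compact_continuous_image prim_on_continuous[OF D(1)] prim_on_continuous[OF D(2)]; force)+
  then obtain B1 B2 where B: "B1 > 0" "B2 > 0" "\<And>y. y \<in> {0..x} \<Longrightarrow> cmod (D1 y) \<le> B1" "\<And>y. y \<in> {0..x} \<Longrightarrow> cmod (D2 y) \<le> B2"
    using compact_imp_bounded[of "D1 ` {0..x}"] compact_imp_bounded[of "D2 ` {0..x}"] unfolding bounded_pos by (metis imageI)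
  have "d x = 0"
  proof (rule V.volterra_unique[where M = "cmod z * (B1 + B2)"])
    show "x \<in> {0..}" using x by simp
    show "0 \<le> cmod z * (B1 + B2)" using B by simp
    show "d t = z * V.op d t" if "0 \<le> t" "t \<le> x" for t by (rule op[OF that(1)])
    show "cmod (d t) \<le> \<sigma> t * (cmod z * (B1 + B2))" if t: "0 \<le> t" "t \<le> x" for t
    proof -
      have dt: "d t = z * (D2 t * c1 t - D1 t * c2 t)"
        using op[OF t(1)] unfolding V.op_def D1_def D2_def by (simp add: algebra_simps)
      have "cmod (D2 t * c1 t - D1 t * c2 t) \<le> cmod (D2 t) * cmod (c1 t) + cmod (D1 t) * cmod (c2 t)"
        using norm_triangle_ineq4[of "D2 t * c1 t" "D1 t * c2 t"] by (simp add: norm_mult)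
      also have "\<dots> \<le> B2 * \<sigma> t + B1 * \<sigma> t"
        using B(3,4)[of t] t B(1,2) \<sigma>[of t] by (intro add_mono mult_mono) (auto simp: c1_def c2_def)
      finally have "cmod (D2 t * c1 t - D1 t * c2 t) \<le> \<sigma> t * (B1 + B2)" by (simp add: algebra_simps)
      then have "cmod z * cmod (D2 t * c1 t - D1 t * c2 t) \<le> cmod z * (\<sigma> t * (B1 + B2))" by (rule mult_left_mono) simp
      then show ?thesis unfolding dt norm_mult by (simp only: mult_ac)
    qed
    have "(\<lambda>y. z * V.op d y) \<in> borel_measurable (lebesgue_on {0..x})"
      by (intro borel_measurable_times borel_measurable_const V.op_measurable)
         (use x set_lebesgue_integral_eq_integral(1)[OF di(1)[OF x]] set_lebesgue_integral_eq_integral(1)[OF di(2)[OF x]] in auto)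
    moreover have "d \<in> borel_measurable (lebesgue_on {0..x}) \<longleftrightarrow> (\<lambda>y. z * V.op d y) \<in> borel_measurable (lebesgue_on {0..x})"
      by (rule measurable_cong) (use op in simp)
    ultimately show "d \<in> borel_measurable (lebesgue_on {0..x})" by simp
  qed
  then show ?thesis by (simp add: d_def)
qed

end

section \<open>Non-constancy of the Weyl function\<close>

context entrance
begin

text \<open>The Wronskian of \<open>f\<close> and \<open>s\<close> has derivative
  \<open>z * s * f\<close>, so subtracting \<open>z * J\<close> makes it constant.\<close>

lemma wronskian_formula:
  assumes f: "prim_on {0<..} f g" "prim_on {0<..} g (\<lambda>x. complex_of_real (q x) * f x - z * f x)"
    and u: "AE x in lebesgue. rep_l2 u x = F x" and F: "\<And>x. x \<le> 0 \<Longrightarrow> F x = 0" "\<And>x. 0 < x \<Longrightarrow> F x = f x"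
    and P: "prim_on {0<..} s p" "prim_on {0<..} p (\<lambda>x. q x * s x)"
    and si: "\<And>b. square_integrable (\<lambda>x. if x \<in> {0..b} then complex_of_real (s x) else 0)"
    and x: "0 < x"
  defines "J \<equiv> (\<lambda>x. integral {0..x} (\<lambda>t. complex_of_real (s t) * F t))"
  shows "f x * complex_of_real (p x) - g x * complex_of_real (s x) =
    f 1 * complex_of_real (p 1) - g 1 * complex_of_real (s 1) - z * J 1 + z * J x"
proof -
  have C: "prim_on {0<..} (\<lambda>x. complex_of_real (s x)) (\<lambda>x. complex_of_real (p x))"
    "prim_on {0<..} (\<lambda>x. complex_of_real (p x)) (\<lambda>x. complex_of_real (q x) * complex_of_real (s x) - 0)"
    using prim_on_linear[OF bounded_linear_of_real P(1)] prim_on_linear[OF bounded_linear_of_real P(2)] by simp_all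
  have "prim_on {0..} J (\<lambda>t. complex_of_real (s t) * F t)"
    unfolding J_def by (rule prim_on_integral) (auto intro: solution_pairing(1)[OF u F(1) si])
  then have J: "prim_on {0<..} J (\<lambda>t. complex_of_real (s t) * F t)" by (rule prim_on_subset) auto
  have "prim_on {0<..} (\<lambda>x. (f x * cnj (complex_of_real (p x)) - g x * cnj (complex_of_real (s x))) - z * J x)
     (\<lambda>x. (z * f x * cnj (complex_of_real (s x)) - f x * cnj 0) - z * (complex_of_real (s x) * F x))"
    by (intro prim_on_diff green_prim[OF f C] prim_on_linear[OF bounded_linear_mult_right J])
  then have "prim_on {0<..} (\<lambda>x. (f x * complex_of_real (p x) - g x * complex_of_real (s x)) - z * J x) (\<lambda>x. 0)"
    by (rule prim_on_cong_AE) (auto simp: is_interval_oi F)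
  from prim_on_constant[OF this, of x 1] x show ?thesis by (simp add: algebra_simps)
qed

lemma weyl_not_constant:
  assumes bt: "boundary_triplet l2_pos (min_op_pos q) G0 G1"
  defines "M \<equiv> half_triplet.weyl l2_pos (min_op_pos q) G0 G1"
  shows "\<exists>z z'. Im z > 0 \<and> Im z' > 0 \<and> M z \<noteq> M z'"
proof (rule ccontr)
  interpret T: line_triplet "min_op_pos q" G0 G1 by (rule half_triplet_min[OF bt])
  define \<mu> where "\<mu> = T.weyl \<i>"
  assume "\<not> ?thesis"
  then have neg: "\<nexists>z z'. Im z > 0 \<and> Im z' > 0 \<and> M z \<noteq> M z'" .
  have const: "T.weyl z = \<mu>" if "Im z > 0" for z
  proof (rule ccontr)
    assume "T.weyl z \<noteq> \<mu>"
    then have "Im z > 0 \<and> Im \<i> > 0 \<and> M z \<noteq> M \<i>" using that unfolding \<mu>_def M_def by simp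
    then show False using neg by (elim notE) (rule exI)+
  qed
  have L: "T.L = MP" by (simp add: T.L_def adjoint_min)
  have sz: "\<And>x. x \<le> 0 \<Longrightarrow> s1 x = 0" "\<And>x. x \<le> 0 \<Longrightarrow> s2 x = 0" using s_zero by auto
  obtain y1 y1' h1 where Y1: "prim_on {0<..} y1 y1'" "prim_on {0<..} y1' (\<lambda>x. complex_of_real (q x) * y1 x - h1 x)"
    "square_integrable y1" "square_integrable h1" "\<And>x. x \<le> 1 \<Longrightarrow> y1 x = complex_of_real (s1 x)" "y1' 1 = complex_of_real (p1 1)"
    "\<And>x. x < 1 \<Longrightarrow> h1 x = 0" "\<And>x. 2 < x \<Longrightarrow> h1 x = 0" "\<And>x. 2 \<le> x \<Longrightarrow> y1 x = 0" "y1' 2 = 0"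
    by (rule solution_cutoff[OF S(1,2) sz(1) s_si(1)]) (assumption | rule that)+
  obtain y2 y2' h2 where Y2: "prim_on {0<..} y2 y2'" "prim_on {0<..} y2' (\<lambda>x. complex_of_real (q x) * y2 x - h2 x)"
    "square_integrable y2" "square_integrable h2" "\<And>x. x \<le> 1 \<Longrightarrow> y2 x = complex_of_real (s2 x)" "y2' 1 = complex_of_real (p2 1)"
    "\<And>x. x < 1 \<Longrightarrow> h2 x = 0" "\<And>x. 2 < x \<Longrightarrow> h2 x = 0" "\<And>x. 2 \<le> x \<Longrightarrow> y2 x = 0" "y2' 2 = 0"
    by (rule solution_cutoff[OF S(3,4) sz(2) s_si(2)]) (assumption | rule that)+
  have YM: "(abs_l2 y1, abs_l2 h1) \<in> MP" "(abs_l2 y2, abs_l2 h2) \<in> MP"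
    by (rule pair_MP[OF Y1(1-4)] pair_MP[OF Y2(1-4)]; simp add: Y1(5,7) Y2(5,7) sz)+
  \<comment> \<open>The limit at 0 of the Wronskian of \<open>T.psi z\<close> with \<open>s1\<close>
    or \<open>s2\<close>. Green's identity with the cut-off solution expresses it through the
    boundary values 1 and \<open>\<mu>\<close> of \<open>T.psi z\<close>, so it is the same for all
    \<open>z\<close> in the upper half-plane.\<close>
  define \<gamma> where "\<gamma> y = cnj (G1 (abs_l2 y)) - \<mu> * cnj (G0 (abs_l2 y))" for y
  interpret X: entrance_solution q s1 p1 s2 p2 "\<gamma> y1" "\<gamma> y2" by unfold_locales
  have key: "\<exists>F. (AE x in lebesgue. rep_l2 (T.psi z) x = F x) \<and> (\<forall>x\<le>0. F x = 0) \<and> (\<forall>x\<ge>0. F x = X.Psi z x)" if z: "Im z > 0" for z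
  proof -
    have z0: "Im z \<noteq> 0" using z by simp
    note psi = T.psi[OF z0]
    have pm: "(T.psi z, z *\<^sub>C T.psi z) \<in> MP" using psi(1) unfolding L .
    then obtain f g where f: "prim_on {0<..} f g" "prim_on {0<..} g (\<lambda>x. complex_of_real (q x) * f x - rep_l2 (z *\<^sub>C T.psi z) x)"
      and uf: "AE x in lebesgue. 0 < x \<longrightarrow> rep_l2 (T.psi z) x = f x" unfolding MP_def hl_def by blast
    have g: "prim_on {0<..} g (\<lambda>x. complex_of_real (q x) * f x - z * f x)"
    proof (rule prim_on_cong_AE[OF f(2)])
      show "AE x in lebesgue. x \<in> {0<..} \<longrightarrow> complex_of_real (q x) * f x - rep_l2 (z *\<^sub>C T.psi z) x = complex_of_real (q x) * f x - z * f x"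
        using uf rep_scaleC[of z "T.psi z"] by eventually_elim simp
    qed (simp_all add: is_interval_oi)
    define F where "F x = (if 0 < x then f x else 0)" for x
    have F: "\<And>x. x \<le> 0 \<Longrightarrow> F x = 0" "\<And>x. 0 < x \<Longrightarrow> F x = f x" by (simp_all add: F_def)
    have u: "AE x in lebesgue. rep_l2 (T.psi z) x = F x"
      using uf l2_pos_AE[of "T.psi z"] pm unfolding MP_def by (auto simp: F_def elim!: eventually_elim2)
    have G: "z * integral {0..1} (\<lambda>x. complex_of_real (s x) * F x) - (f 1 * complex_of_real d - g 1 * complex_of_real (s 1)) = - \<gamma> y"
      if "cinner (z *\<^sub>C T.psi z) (abs_l2 y) - cinner (T.psi z) (abs_l2 h) = z * integral {0..1} (\<lambda>x. complex_of_real (s x) * F x) - (f 1 * complex_of_real d - g 1 * complex_of_real (s 1))"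
        "(abs_l2 y, abs_l2 h) \<in> MP" for s y h d
      using T.green[OF psi(1), unfolded L, OF that(2)] psi(2) const[OF z] that(1) by (simp add: \<gamma>_def T.weyl_def)
    have ar: "A = c + t" if "A = B - v + t" "v - B = - c" for A B c v t :: complex
      using that by algebra
    note W = wronskian_formula[OF f(1) g u F]
    have w: "f x * complex_of_real (p1 x) - g x * complex_of_real (s1 x) = \<gamma> y1 + z * integral {0..x} (\<lambda>t. complex_of_real (s1 t) * F t)"
      "f x * complex_of_real (p2 x) - g x * complex_of_real (s2 x) = \<gamma> y2 + z * integral {0..x} (\<lambda>t. complex_of_real (s2 t) * F t)" if "0 < x" for x
      by (rule ar[OF W[OF _ _ S(1,2) s_si(1) that] G[OF cutoff_pairing[OF f(1) g u F sz(1) Y1] YM(1)]]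
          ar[OF W[OF _ _ S(3,4) s_si(2) that] G[OF cutoff_pairing[OF f(1) g u F sz(2) Y2] YM(2)]]; assumption)+
    have eq: "F x = (\<gamma> y2 + z * integral {0..x} (\<lambda>t. X.c2 t * F t)) * X.c1 x - (\<gamma> y1 + z * integral {0..x} (\<lambda>t. X.c1 t * F t)) * X.c2 x"
      if x0: "0 \<le> x" for x
    proof (cases "x = 0")
      case True
      then show ?thesis by (simp add: F X.c1_def X.c2_def sz)
    next
      case False
      then have x: "0 < x" using x0 by simp
      have W1: "X.c1 x * complex_of_real (p2 x) - complex_of_real (p1 x) * X.c2 x = 1"
        using arg_cong[OF Wr[OF x], of complex_of_real] by (simp add: X.c1_def X.c2_def)
      have "F x = f x * (X.c1 x * complex_of_real (p2 x) - complex_of_real (p1 x) * X.c2 x)" using F(2)[OF x] W1 by simp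
      also have "\<dots> = (f x * complex_of_real (p2 x) - g x * X.c2 x) * X.c1 x - (f x * complex_of_real (p1 x) - g x * X.c1 x) * X.c2 x"
        by (simp add: algebra_simps)
      finally show ?thesis using w[OF x] unfolding X.c1_def X.c2_def by simp
    qed
    have "F x = X.Psi z x" if "0 \<le> x" for x
    proof (rule X.Psi_unique[OF _ _ eq that])
      show "(\<lambda>t. X.c1 t * F t) absolutely_integrable_on {0..y}" "(\<lambda>t. X.c2 t * F t) absolutely_integrable_on {0..y}" for y
        unfolding X.c1_def X.c2_def by (rule solution_pairing(1)[OF u F(1) s_si(1)] solution_pairing(1)[OF u F(1) s_si(2)]; assumption)+
    qed
    then show ?thesis using u F(1) by blast
  qed
  have vanish: "X.I1 z b = 0" "X.I2 z b = 0" if b: "0 \<le> b" for z b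
  proof -
    define S1 where "S1 = abs_l2 (\<lambda>x. if x \<in> {0..b} then complex_of_real (s1 x) else 0)"
    define S2 where "S2 = abs_l2 (\<lambda>x. if x \<in> {0..b} then complex_of_real (s2 x) else 0)"
    have bd: "cmod (X.I1 z b) \<le> sqrt (Im \<mu>) * norm S1 / sqrt (Im z)" "cmod (X.I2 z b) \<le> sqrt (Im \<mu>) * norm S2 / sqrt (Im z)" if z: "Im z > 0" for z
    proof -
      obtain F where F: "AE x in lebesgue. rep_l2 (T.psi z) x = F x" "\<And>x. x \<le> 0 \<Longrightarrow> F x = 0" "\<And>x. 0 \<le> x \<Longrightarrow> F x = X.Psi z x"
        using key[OF z] by blast
      have c: "X.c1 x * X.Psi z x = complex_of_real (s1 x) * F x" "X.c2 x * X.Psi z x = complex_of_real (s2 x) * F x" if "x \<in> {0..b}" for x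
        using F(3)[of x] that by (simp_all add: X.c1_def[of x] X.c2_def[of x])
      have "X.I1 z b = integral {0..b} (\<lambda>x. complex_of_real (s1 x) * F x)" "X.I2 z b = integral {0..b} (\<lambda>x. complex_of_real (s2 x) * F x)"
        unfolding X.I1_def X.I2_def
        by (rule Henstock_Kurzweil_Integration.integral_cong; rule c; assumption)+
      then have I: "X.I1 z b = cinner (T.psi z) S1" "X.I2 z b = cinner (T.psi z) S2"
        using solution_pairing(2)[OF F(1,2) s_si(1)] solution_pairing(2)[OF F(1,2) s_si(2)] unfolding S1_def S2_def by simp_all
      have "Im z * (norm (T.psi z))\<^sup>2 = Im \<mu>" using T.Im_weyl(1)[of z] const[OF z] z by simp
      then have "(norm (T.psi z))\<^sup>2 = Im \<mu> / Im z" using z by (simp add: field_simps)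
      then have n: "norm (T.psi z) = sqrt (Im \<mu>) / sqrt (Im z)"
        by (metis norm_ge_zero real_sqrt_divide real_sqrt_unique)
      show "cmod (X.I1 z b) \<le> sqrt (Im \<mu>) * norm S1 / sqrt (Im z)" "cmod (X.I2 z b) \<le> sqrt (Im \<mu>) * norm S2 / sqrt (Im z)"
        using cinner_norm_le[of "T.psi z" S1] cinner_norm_le[of "T.psi z" S2] unfolding I n by simp_all
    qed
    show "X.I1 z b = 0" by (rule zero_type_half_plane_decay[OF X.I_holomorphic(1)[OF b] X.I_zero_type(1)[OF b] bd(1)])
    show "X.I2 z b = 0" by (rule zero_type_half_plane_decay[OF X.I_holomorphic(2)[OF b] X.I_zero_type(2)[OF b] bd(2)])
  qed
  obtain F where F: "AE x in lebesgue. rep_l2 (T.psi \<i>) x = F x" "\<And>x. x \<le> 0 \<Longrightarrow> F x = 0" "\<And>x. 0 \<le> x \<Longrightarrow> F x = X.Psi \<i> x"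
    using key[of \<i>] by auto
  have sub: "{0<..} \<subseteq> {0::real..}" by auto
  have za: "prim_on {0<..} (\<lambda>x. 0) (\<lambda>t. X.c1 t * X.Psi \<i> t)"
    by (rule prim_on_cong_AE[OF prim_on_subset[OF X.prim_I(1) sub]]) (auto simp: vanish is_interval_oi)
  have zb: "prim_on {0<..} (\<lambda>x. 0) (\<lambda>t. X.c2 t * X.Psi \<i> t)"
    by (rule prim_on_cong_AE[OF prim_on_subset[OF X.prim_I(2) sub]]) (auto simp: vanish is_interval_oi)
  have z: "AE x in lebesgue. x \<in> {0<..} \<longrightarrow> X.c1 x * X.Psi \<i> x = 0" "AE x in lebesgue. x \<in> {0<..} \<longrightarrow> X.c2 x * X.Psi \<i> x = 0"
    by (rule prim_on_zero_AE[OF za open_greaterThan] prim_on_zero_AE[OF zb open_greaterThan])+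
  have "AE x in lebesgue. rep_l2 (T.psi \<i>) x = 0"
    using F(1) z
  proof eventually_elim
    case (elim x)
    show ?case
    proof (cases "0 < x")
      case True
      then have P: "X.Psi \<i> x = \<gamma> y2 * X.c1 x - \<gamma> y1 * X.c2 x" using X.Psi_eq[of x \<i>] by (simp add: vanish)
      \<comment> \<open>\<open>I1\<close> and \<open>I2\<close> vanish identically, hence so do
        their densities \<open>c1 * Psi\<close> and \<open>c2 * Psi\<close> almost everywhere. As
        \<open>Psi\<close> is now a constant combination of \<open>c1\<close> and \<open>c2\<close>,
        its square is 0.\<close>
      then have "X.Psi \<i> x * X.Psi \<i> x = \<gamma> y2 * (X.c1 x * X.Psi \<i> x) - \<gamma> y1 * (X.c2 x * X.Psi \<i> x)"
        using arg_cong[OF P, of "\<lambda>t. t * X.Psi \<i> x"] by (simp add: left_diff_distrib mult.assoc)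
      then show ?thesis using elim True F(3)[of x] by simp
    next
      case False
      then show ?thesis using elim F(2)[of x] by simp
    qed
  qed
  then have "T.psi \<i> = abs_l2 (\<lambda>x. 0)" by (rule l2_AE[OF square_integrable_zero])
  then have "T.psi \<i> = 0" by (simp add: zero_l2_def)
  then show False using T.Im_weyl(2)[of \<i>] by simp
qed

end

text \<open>The hypothesis at spectral parameter 0 gives square-integrability on some set that
  contains a right neighbourhood of 0; on the rest of \<open>[0, b]\<close> continuity
  suffices.\<close>

lemma limit_circle_solution:
  assumes lc: "limit_circle q {0<..} (at_right 0)"
    and P: "prim_on {0<..} s p" "prim_on {0<..} p (\<lambda>x. q x * s x)"
  shows "square_integrable (\<lambda>x. if x \<in> {0..b} then complex_of_real (if 0 < x then s x else 0) else 0)"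
proof -
  define f where "f x = complex_of_real (s x)" for x
  define g where "g x = complex_of_real (p x)" for x
  have C: "prim_on {0<..} f g" "prim_on {0<..} g (\<lambda>x. complex_of_real (q x) * f x)"
    using prim_on_linear[OF bounded_linear_of_real P(1)] prim_on_linear[OF bounded_linear_of_real P(2)]
    unfolding f_def[abs_def] g_def[abs_def] by simp_all
  have ac: "locally_AC1 {0<..} f" by (rule prim_pair_locally_AC1(1)[OF C]) auto
  have "AE x in lebesgue. x \<in> {0<..} \<longrightarrow> deriv1 (deriv1 f) x = complex_of_real (q x) * f x"
    by (rule prim_pair_locally_AC1(3)[OF C]) auto
  then have "AE x in lebesgue. x \<in> {0<..} \<longrightarrow> schroedinger q f x = 0 * f x"
    by eventually_elim (simp add: schroedinger_def)
  with ac have "solution_on q {0<..} 0 f" unfolding solution_on_def by blast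
  then have "square_integrable_near (at_right 0) f" using lc unfolding limit_circle_def by blast
  then obtain N where N: "N \<in> sets lebesgue" "\<forall>\<^sub>F x in at_right 0. x \<in> N" "square_integrable (\<lambda>x. if x \<in> N then f x else 0)"
    unfolding square_integrable_near_def by blast
  then obtain d :: real where d: "d > 0" "\<And>x. 0 < x \<Longrightarrow> x < d \<Longrightarrow> x \<in> N"
    unfolding eventually_at_right_field by auto
  define e where "e = d / 2"
  have e: "e > 0" "\<And>x. 0 < x \<Longrightarrow> x \<le> e \<Longrightarrow> x \<in> N" using d by (auto simp: e_def)
  have "square_integrable (\<lambda>x. if x \<in> {0..min b e} then (if x \<in> N then f x else 0) else 0)"
    by (rule square_integrable_indicator[OF N(3)]) simp
  moreover have "square_integrable (\<lambda>x. if x \<in> {e..b} then f x else 0)"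
  proof (rule square_integrable_continuous_compact[of e b])
    have "continuous_on {e..b} f" by (rule prim_on_continuous[OF C(1)]) (use e in auto)
    then show "continuous_on {e..b} (\<lambda>x. if x \<in> {e..b} then f x else 0)" by (rule continuous_on_eq) simp
  qed auto
  ultimately have "square_integrable (\<lambda>x. (if x \<in> {0..min b e} then (if x \<in> N then f x else 0) else 0) + (if x \<in> {e..b} then f x else 0))"
    by (rule square_integrable_add)
  then show ?thesis
  proof (rule square_integrable_cong_AE)
    show "AE x in lebesgue. (if x \<in> {0..min b e} then (if x \<in> N then f x else 0) else 0) + (if x \<in> {e..b} then f x else 0) =
       (if x \<in> {0..b} then complex_of_real (if 0 < x then s x else 0) else 0)"
      using AE_not_eq_lebesgue[of 0] AE_not_eq_lebesgue[of e]
    proof eventually_elim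
      case (elim x)
      consider "x < 0" | "0 < x" "x < e" | "e < x" using elim by linarith
      then show ?case
      proof cases
        case 2
        then show ?thesis using e(2)[of x] by (simp add: f_def)
      qed (use e in \<open>auto simp: f_def\<close>)
    qed
  qed
qed

text \<open>In half angles both matrices have rank one, every row being a multiple of
  \<open>(\<i> * cos (\<theta> / 2), sin (\<theta> / 2))\<close>. If \<open>U\<close> and
  \<open>V\<close> denote this functional on the \<open>G1\<close>- and the \<open>G0\<close>-pair,
  the equations read \<open>s * U = c * V\<close> and \<open>c * U = - (s * V)\<close>; the
  determinant \<open>s * s + c * c = 1\<close> forces \<open>U = V = 0\<close>.\<close>

lemma boundary_condition_iff:
  fixes \<theta> :: real and b1 b2 a1 a2 :: complex
  shows "(vector [vector [\<i> * sin (complex_of_real \<theta>), 1 - cos (complex_of_real \<theta>)], vector [1 + cos (complex_of_real \<theta>), - \<i> * sin (complex_of_real \<theta>)]] :: complex ^ 2 ^ 2) *v vector [b1, b2]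
      = \<i> *s ((vector [vector [1 + cos (complex_of_real \<theta>), - \<i> * sin (complex_of_real \<theta>)], vector [\<i> * sin (complex_of_real \<theta>), 1 - cos (complex_of_real \<theta>)]] :: complex ^ 2 ^ 2) *v vector [a1, a2])
    \<longleftrightarrow> (a1, a2, b1, b2) \<in> qline (sin (\<theta> / 2)) (cos (\<theta> / 2))"
proof -
  define s c where "s = complex_of_real (sin (\<theta> / 2))" and "c = complex_of_real (cos (\<theta> / 2))"
  have sc: "s * s + c * c = 1"
    using arg_cong[OF sin_cos_squared_add[of "\<theta> / 2"], of complex_of_real] by (simp add: s_def c_def power2_eq_square)
  have t: "sin (complex_of_real \<theta>) = 2 * s * c" "cos (complex_of_real \<theta>) = c * c - s * s"
    using sin_double[of "\<theta> / 2"] cos_double[of "\<theta> / 2"] by (simp_all add: s_def c_def power2_eq_square sin_of_real cos_of_real)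
  define U where "U = \<i> * c * b1 + s * b2"
  define V where "V = \<i> * c * a1 + s * a2"
  have m: "\<i> * sin (complex_of_real \<theta>) * b1 + (1 - cos (complex_of_real \<theta>)) * b2 = 2 * s * U"
    "(1 + cos (complex_of_real \<theta>)) * b1 + - \<i> * sin (complex_of_real \<theta>) * b2 = - 2 * \<i> * c * U"
    "\<i> * ((1 + cos (complex_of_real \<theta>)) * a1 + - \<i> * sin (complex_of_real \<theta>) * a2) = 2 * c * V"
    "\<i> * (\<i> * sin (complex_of_real \<theta>) * a1 + (1 - cos (complex_of_real \<theta>)) * a2) = 2 * \<i> * s * V"
    unfolding t sc[symmetric] U_def V_def by (simp_all add: algebra_simps)
  have "(2 * s * U = 2 * c * V \<and> - 2 * \<i> * c * U = 2 * \<i> * s * V) \<longleftrightarrow> U = 0 \<and> V = 0"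
  proof
    assume *: "2 * s * U = 2 * c * V \<and> - 2 * \<i> * c * U = 2 * \<i> * s * V"
    have "(2 * \<i>) * (c * U) = - (- 2 * \<i> * c * U)" by simp
    also have "\<dots> = - (2 * \<i> * s * V)" using * by (simp only:)
    also have "\<dots> = (2 * \<i>) * (- (s * V))" by simp
    finally have cU: "c * U = - (s * V)" by (simp only: mult_cancel_left) simp
    have sU: "s * U = c * V" using * by simp
    have "U = s * (s * U) + c * (c * U)" by (metis sc distrib_right mult.assoc mult_1)
    also have "\<dots> = 0" unfolding sU cU by simp
    finally have U: "U = 0" .
    have "V = s * (s * V) + c * (c * V)" by (metis sc distrib_right mult.assoc mult_1)
    also have "\<dots> = s * (- (c * U)) + c * (s * U)" unfolding sU cU by simp
    also have "\<dots> = 0" by simp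
    finally show "U = 0 \<and> V = 0" using U by simp
  qed simp
  moreover have "(a1, a2, b1, b2) \<in> qline (sin (\<theta> / 2)) (cos (\<theta> / 2)) \<longleftrightarrow> U = 0 \<and> V = 0"
    by (auto simp: qline_def U_def V_def s_def c_def)
  moreover have "(vector [vector [\<i> * sin (complex_of_real \<theta>), 1 - cos (complex_of_real \<theta>)], vector [1 + cos (complex_of_real \<theta>), - \<i> * sin (complex_of_real \<theta>)]] :: complex ^ 2 ^ 2) *v vector [b1, b2]
      = \<i> *s ((vector [vector [1 + cos (complex_of_real \<theta>), - \<i> * sin (complex_of_real \<theta>)], vector [\<i> * sin (complex_of_real \<theta>), 1 - cos (complex_of_real \<theta>)]] :: complex ^ 2 ^ 2) *v vector [a1, a2])
    \<longleftrightarrow> 2 * s * U = 2 * c * V \<and> - 2 * \<i> * c * U = 2 * \<i> * s * V"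
    unfolding m[symmetric] by (simp add: vec_eq_iff forall_2 matrix_vector_mult_def UNIV_2 sum_2 vector_2)
  ultimately show ?thesis by (simp only:)
qed

lemma qline_scale: "r \<noteq> 0 \<Longrightarrow> qline (r * s) (r * k) = qline s k"
proof -
  assume r: "r \<noteq> 0"
  have "(\<i> * complex_of_real (r * k) * x + complex_of_real (r * s) * y = 0) \<longleftrightarrow> \<i> * complex_of_real k * x + complex_of_real s * y = 0" for x y
  proof -
    have "\<i> * complex_of_real (r * k) * x + complex_of_real (r * s) * y = complex_of_real r * (\<i> * complex_of_real k * x + complex_of_real s * y)"
      by (simp add: algebra_simps)
    then show ?thesis using r by simp
  qed
  then show ?thesis unfolding qline_def by simp
qed

text \<open>Real scaling of \<open>(s, k)\<close> leaves the space unchanged, so only a point of the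
  real projective line matters, described by an angle \<open>\<theta> / 2\<close> from 0 up to, but
  excluding, \<open>pi\<close>.\<close>

lemma (in line_triplet) qline_angle:
  "{restr (qline s k) | s k. \<not> (s = 0 \<and> k = 0)} = (\<lambda>\<theta>. restr (qline (sin (\<theta> / 2)) (cos (\<theta> / 2)))) ` {0..<2 * pi}"
proof (intro set_eqI iffI)
  fix A assume "A \<in> {restr (qline s k) | s k. \<not> (s = 0 \<and> k = 0)}"
  then obtain s k where A: "A = restr (qline s k)" and sk: "\<not> (s = 0 \<and> k = 0)" by blast
  define r0 where "r0 = sqrt (s\<^sup>2 + k\<^sup>2)"
  have "r0 > 0" using sk by (simp add: r0_def sum_power2_gt_zero_iff)
  \<comment> \<open>The sign of \<open>r\<close> makes \<open>s / r \<ge> 0\<close>, and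
    \<open>k / r = 1\<close> in case \<open>s = 0\<close>; this rules out the angle
    \<open>pi\<close>.\<close>
  define r where "r = (if s < 0 \<or> (s = 0 \<and> k < 0) then - r0 else r0)"
  have r: "r \<noteq> 0" "r\<^sup>2 = s\<^sup>2 + k\<^sup>2" using \<open>r0 > 0\<close> by (auto simp: r_def r0_def)
  have "(k / r)\<^sup>2 + (s / r)\<^sup>2 = (s\<^sup>2 + k\<^sup>2) / r\<^sup>2" by (simp add: power_divide add_divide_distrib)
  then have "(k / r)\<^sup>2 + (s / r)\<^sup>2 = 1" using r(1) by (simp add: r(2)[symmetric])
  moreover have s0: "s / r \<ge> 0" using \<open>r0 > 0\<close> by (auto simp: r_def divide_le_0_iff)
  ultimately obtain t where t: "0 \<le> t" "t \<le> pi" "k / r = cos t" "s / r = sin t"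
    using sincos_total_pi[of "s / r" "k / r"] by blast
  have "t \<noteq> pi"
  proof
    assume "t = pi"
    then have "s / r = 0" "k / r = - 1" using t(3,4) by simp_all
    then have "s = 0" "k = - r" using r(1) by (simp_all add: divide_eq_eq)
    then show False using \<open>r0 > 0\<close> unfolding r_def by (cases "k < 0") simp_all
  qed
  then have "2 * t \<in> {0..<2 * pi}" using t by auto
  moreover have "A = restr (qline (sin (2 * t / 2)) (cos (2 * t / 2)))"
    using qline_scale[OF r(1), of "sin t" "cos t"] t(3,4)[symmetric] r(1) by (simp add: A)
  ultimately show "A \<in> (\<lambda>\<theta>. restr (qline (sin (\<theta> / 2)) (cos (\<theta> / 2)))) ` {0..<2 * pi}" by blast
next
  fix A assume "A \<in> (\<lambda>\<theta>. restr (qline (sin (\<theta> / 2)) (cos (\<theta> / 2)))) ` {0..<2 * pi}"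
  then obtain \<theta> where "A = restr (qline (sin (\<theta> / 2)) (cos (\<theta> / 2)))" by blast
  moreover have "\<not> (sin (\<theta> / 2) = 0 \<and> cos (\<theta> / 2) = 0)" using sin_zero_abs_cos_one[of "\<theta> / 2"] by fastforce
  ultimately show "A \<in> {restr (qline s k) | s k. \<not> (s = 0 \<and> k = 0)}" by blast
qed

theorem proposition3p6:
  fixes q :: "real \<Rightarrow> real" and G0 G1 :: "l2 \<Rightarrow> complex"
  assumes "singular_even_potential q"
    and "limit_point q {0<..} at_top" and "limit_point q {..<0} at_bot"
    and "limit_circle q {0<..} (at_right 0)" and "limit_circle q {..<0} (at_left 0)"
    and "boundary_triplet l2_pos (min_op_pos q) G0 G1"
  shows "{A. linear_operator A \<and> min_op q \<subseteq> A \<and> self_adjoint_wrt parity A \<and> resolvent_set A = {}} =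
    (\<lambda>\<theta>::real. {(f, g) \<in> max_op q.
        (vector [vector [\<i> * sin \<theta>, 1 - cos \<theta>],
                 vector [1 + cos \<theta>, - \<i> * sin \<theta>]] :: complex ^ 2 ^ 2) *v double_boundary_map G1 f
        = \<i> *s ((vector [vector [1 + cos \<theta>, - \<i> * sin \<theta>],
                 vector [\<i> * sin \<theta>, 1 - cos \<theta>]] :: complex ^ 2 ^ 2) *v double_boundary_map G0 f)})
      ` {0..<2 * pi}"
proof -
  have even: "\<And>x. q (- x) = q x" using assms(1) unfolding singular_even_potential_def by blast
  have qi: "q absolutely_integrable_on {a..b}" if "0 < a" for a b :: real
  proof (cases "a \<le> b")
    case True
    then show ?thesis using assms(1) that unfolding singular_even_potential_def by simp
  qed simp
  interpret half_line q by (rule half_line.intro[OF even qi])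
  interpret T: line_triplet "min_op_pos q" G0 G1 by (rule half_triplet_min[OF assms(6)])
  obtain s1 p1 s2 p2 :: "real \<Rightarrow> real" where s: "prim_on {0<..} s1 p1" "prim_on {0<..} p1 (\<lambda>x. q x * s1 x)"
    "prim_on {0<..} s2 p2" "prim_on {0<..} p2 (\<lambda>x. q x * s2 x)" and W: "\<And>x. 0 < x \<Longrightarrow> s1 x * p2 x - p1 x * s2 x = 1"
    by (rule fundamental_system[of q, OF even qi]) (assumption | rule that)+
  \<comment> \<open>Values at nonpositive arguments are set to 0, as \<open>entrance\<close>
    requires; on the positive half-line nothing changes.\<close>
  define ext where "ext s x = (if 0 < x then s x else (0::real))" for s :: "real \<Rightarrow> real" and x :: real
  have P: "prim_on {0<..} (ext s) p" "prim_on {0<..} p (\<lambda>x. q x * ext s x)"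
    if "prim_on {0<..} s p" "prim_on {0<..} p (\<lambda>x. q x * s x)" for s p
    by (rule prim_on_cong_AE[OF that(1)] prim_on_cong_AE[OF that(2)]; simp add: ext_def is_interval_oi)+
  \<comment> \<open>Here the limit-circle case at 0 enters the proof.\<close>
  have si: "square_integrable (\<lambda>x. if x \<in> {0..b} then complex_of_real (ext s x) else 0)"
    if "prim_on {0<..} s p" "prim_on {0<..} p (\<lambda>x. q x * s x)" for s p b
    unfolding ext_def by (rule limit_circle_solution[OF assms(4) that])
  interpret entrance q "ext s1" p1 "ext s2" p2
  proof unfold_locales
    show "ext s1 x * p2 x - p1 x * ext s2 x = 1" if "0 < x" for x using W[OF that] that by (simp add: ext_def)
    show "ext s1 x = 0 \<and> ext s2 x = 0" if "x \<le> 0" for x using that by (simp add: ext_def)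
  qed (rule P[OF s(1,2)] P[OF s(3,4)] si[OF s(1,2)] si[OF s(3,4)])+
  obtain z z' where z: "Im z > 0" "Im z' > 0" "T.weyl z \<noteq> T.weyl z'"
    using weyl_not_constant[OF assms(6)] by blast
  have S: "T.S = min_op q" unfolding T.S_def min_op_def ..
  have Lm: "T.Lm = max_op q"
    unfolding T.Lm_def T.R2_def T.L_def adjoint_min by (auto simp: max_op_iff)
  have dbm: "double_boundary_map G f = vector [G (pos_part f), G (T.R2 f)]" for G f
    by (simp add: double_boundary_map_def T.R2_def pos_part_parity)
  have R: "T.restr (qline (sin (\<theta> / 2)) (cos (\<theta> / 2))) = {(f, g) \<in> max_op q.
        (vector [vector [\<i> * sin (complex_of_real \<theta>), 1 - cos (complex_of_real \<theta>)],
                 vector [1 + cos (complex_of_real \<theta>), - \<i> * sin (complex_of_real \<theta>)]] :: complex ^ 2 ^ 2) *v double_boundary_map G1 f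
        = \<i> *s ((vector [vector [1 + cos (complex_of_real \<theta>), - \<i> * sin (complex_of_real \<theta>)],
                 vector [\<i> * sin (complex_of_real \<theta>), 1 - cos (complex_of_real \<theta>)]] :: complex ^ 2 ^ 2) *v double_boundary_map G0 f)}" for \<theta> :: real
    unfolding T.restr_def Lm dbm boundary_condition_iff T.bv_def ..
  show ?thesis using T.empty_resolvent_extensions[OF z] unfolding S T.qline_angle R .
qed

end
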